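(* Let $Y$ be an ICCSS$(p,q)$ process with $p>q>0$. Suppose $S\subseteq V=\{1,\dots,k\}$ and $a\in V$. Then, for $t\in\mathbb R$, $\mathbb P$-a.s., $$\begin{aligned} &\underset{h\downarrow0}{\mathrm{l.i.m.}}\;P_{\mathcal L_{Y_S}(t)}\Big(\frac{D^{(p-q-1)}Y_a(t+h)-D^{(p-q-1)}Y_a(t)}{h}\Big) \\ &\quad=\sum_{v\in S}\int_{-\infty}^te_a^\top\mathsf M'(0)e^{\mathbf\Lambda(t-u)}\mathbf\Theta e_vY_v(u)\,du+\sum_{v\in S}\sum_{m=0}^{p-q-1}e_a^\top\mathsf M_m'(0)\mathbf\Theta e_vD^{(m)}Y_v(t) \\ &\qquad+P_{\mathcal L_{Y_S}(t)}\Big(\sum_{v\in V\setminus S}\int_{-\infty}^te_a^\top\mathsf M'(0)e^{\mathbf\Lambda(t-u)}\mathbf\Theta e_vY_v(u)\,du\Big) \\ &\qquad+P_{\mathcal L_{Y_S}(t)}\Big(\sum_{v\in V\setminus S}\sum_{m=0}^{p-q-1}e_a^\top\mathsf M_m'(0)\mathbf\Theta e_vD^{(m)}Y_v(t)\Big),\end{aligned}$$ and for $h\ge0$, $$D^{(p-q-1)}Y_a(t+h)-P_{\mathcal L_Y(t)}D^{(p-q-1)}Y_a(t+h)=e_a^\top\eta(t,h)\qquad\mathbb P\text{-a.s.}$$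
   Context: Setting. Let $k\ge1$ and let $p>q>0$ be integers. $L=(L(t))_{t\in\mathbb R}$ is a two-sided $\mathbb R^k$-valued Lévy process with $\mathbb E L(1)=0$, $\mathbb E\|L(1)\|^2<\infty$. Let $P(z)=I_kz^p+A_1z^{p-1}+\dots+A_p$ and $Q(z)=C_0+C_1z+\dots+C_qz^q$ with $A_i,C_j\in M_k(\mathbb R)$ be right coprime (the stacked $2k\times k$ matrix $\begin{pmatrix} P(z) \\ Q(z) \end{pmatrix}$ has rank $k$ for all $z\in\mathbb C$), with $\operatorname{rank}(C_q)=k$ and such that all zeros of $\det P(z)$ and of $\det Q(z)$ have strictly negative real part. Put $$\mathbf A=\begin{pmatrix} 0_k & I_k & 0_k & \cdots & 0_k \\ \vdots & & \ddots & \ddots & \vdots \\ 0_k & \cdots & \cdots & 0_k & I_k \\ -A_p & -A_{p-1} & \cdots & \cdots & -A_1 \end{pmatrix}\in M_{kp}(\mathbb R),\quad \mathbf B=\begin{pmatrix} 0_k \\ \vdots \\ 0_k \\ I_k \end{pmatrix}\in M_{kp\times k}(\mathbb R),\quad \mathbf C=(C_0,\dots,C_q,0_k,\dots,0_k)\in M_{k\times kp}(\mathbb R).$$ The stationary processes $X(t)=\int_{-\infty}^te^{\mathbf A(t-u)}\mathbf B\,dL(u)$ and $Y(t)=\mathbf CX(t)$, $t\in\mathbb R$, are the input process and the ICCSS$(p,q)$ process, respectively. Matrices: $\mathsf C=(0_k,\dots,0_k,C_0,\dots,C_q)\in M_{k\times kp}(\mathbb R)$; $$\mathbf\Lambda=\begin{pmatrix}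 0_k & I_k & 0_k & \cdots & 0_k \\ \vdots & & \ddots & \ddots & \vdots \\ 0_k & \cdots & \cdots & 0_k & I_k \\ -C_q^{-1}C_0 & -C_q^{-1}C_1 & \cdots & \cdots & -C_q^{-1}C_{q-1} \end{pmatrix}\in M_{kq}(\mathbb R),\qquad \mathbf\Theta=\begin{pmatrix} 0_k \\ \vdots \\ 0_k \\ C_q^{-1} \end{pmatrix}\in M_{kq\times k}(\mathbb R);$$ $\mathbf E_j\in M_{kp\times k}(\mathbb R)$ ($j=1,\dots,p$) is the block column whose $j$-th $k\times k$ block is $I_k$ and whose other blocks are $0_k$; $\mathbf E^\top=(I_{kq},0_{kq\times k(p-q)})\in M_{kq\times kp}(\mathbb R)$; $\mathsf E^\top=(0_{k\times k(q-1)},I_k)\in M_{k\times kq}(\mathbb R)$; $$\mathsf M(h)=\mathsf Ce^{\mathbf Ah}\Big(\mathbf E+\sum_{j=1}^{p-q}\mathbf E_{q+j}\mathsf E^\top\mathbf\Lambda^j\Big),\quad \mathsf M_m(h)=\mathsf Ce^{\mathbf Ah}\sum_{j=m+1}^{p-q}\mathbf E_{q+j}\mathsf E^\top\mathbf\Lambda^{j-1-m},\quad \eta(t,h)=\mathsf C\int_t^{t+h}e^{\mathbf A(t+h-u)}\mathbf B\,dL(u);$$ $\mathsf M'(0),\mathsf M_m'(0)$ are derivatives in $h$ at $h=0$. $e_a\in\mathbb R^k$ is the $a$-th unit vector. $D^{(m)}Y_v$ is the $m$-th mean-square derivative of $Y_v$ ($D^{(0)}Y_v=Y_v$); $Y$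 is $(p-q-1)$ times mean-square differentiable. For $S\subseteq V$, $\mathcal L_{Y_S}(t)$ is the closure in $L^2$ (complex square-integrable random variables) of the set of finite complex linear combinations of $Y_s(r)$, $s\in S$, $r\le t$; $\mathcal L_Y(t)=\mathcal L_{Y_V}(t)$. $P_{\mathcal L}$ is the orthogonal projection in $L^2$ onto $\mathcal L$; l.i.m. is the mean-square limit. Integrals over $(-\infty,t]$ are limits (a.s. and in $L^2$) of integrals over $[s,t]$ as $s\to-\infty$. *)

theory Defs
  imports "HOL-Probability.Probability"
begin

section \<open>Mean-square calculus\<close>

definition L2 :: "'w measure \<Rightarrow> ('w \<Rightarrow> 'b::real_normed_vector) set" where
  "L2 M = {Z. Z \<in> borel_measurable M \<and> integrable M (\<lambda>\<omega>. (norm (Z \<omega>))\<^sup>2)}"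

definition ms_lim :: "'w measure \<Rightarrow> 'i filter \<Rightarrow> ('i \<Rightarrow> 'w \<Rightarrow> 'b::real_normed_vector) \<Rightarrow> ('w \<Rightarrow> 'b) \<Rightarrow> bool" where
  "ms_lim M F Z W \<longleftrightarrow>
     W \<in> L2 M \<and> (\<forall>\<^sub>F h in F. Z h \<in> L2 M) \<and>
     ((\<lambda>h. LINT \<omega>|M. (norm (Z h \<omega> - W \<omega>))\<^sup>2) \<longlongrightarrow> 0) F"

text \<open>Random variables that are determined only up to null sets (mean-square derivatives,
  projections, improper and stochastic integrals) are represented by a version chosen with
  \<open>SOME\<close>.\<close>

definition ms_deriv :: "'w measure \<Rightarrow> (real \<Rightarrow> 'w \<Rightarrow> 'b::real_normed_vector) \<Rightarrow> real \<Rightarrow> 'w \<Rightarrow> 'b" where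
  "ms_deriv M Z t = (SOME W. ms_lim M (at 0) (\<lambda>h \<omega>. (Z (t + h) \<omega> - Z t \<omega>) /\<^sub>R h) W)"

definition msD :: "'w measure \<Rightarrow> nat \<Rightarrow> (real \<Rightarrow> 'w \<Rightarrow> 'b::real_normed_vector) \<Rightarrow> real \<Rightarrow> 'w \<Rightarrow> 'b" where
  "msD M m Z = (ms_deriv M ^^ m) Z"

definition orth_proj :: "'w measure \<Rightarrow> ('w \<Rightarrow> complex) set \<Rightarrow> ('w \<Rightarrow> complex) \<Rightarrow> 'w \<Rightarrow> complex" where
  "orth_proj M \<L> Z = (SOME W. W \<in> \<L> \<and> (\<forall>U\<in>\<L>. (LINT \<omega>|M. (Z \<omega> - W \<omega>) * cnj (U \<omega>)) = 0))"

text \<open>The component \<open>Y\<^sub>v\<close> as an element of the complex \<open>L\<^sup>2\<close> space.\<close>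

definition component :: "(real \<Rightarrow> 'w \<Rightarrow> real^'k) \<Rightarrow> 'k \<Rightarrow> real \<Rightarrow> 'w \<Rightarrow> complex" where
  "component Y v t \<omega> = complex_of_real (Y t \<omega> $ v)"

definition past_lin :: "(real \<Rightarrow> 'w \<Rightarrow> real^'k) \<Rightarrow> 'k set \<Rightarrow> real \<Rightarrow> ('w \<Rightarrow> complex) set" where
  "past_lin Y S t =
     {(\<lambda>\<omega>. \<Sum>(s, r)\<in>F. c s r * component Y s r \<omega>) | F c. finite F \<and> F \<subseteq> S \<times> {..t}}"

definition past_space :: "'w measure \<Rightarrow> (real \<Rightarrow> 'w \<Rightarrow> real^'k) \<Rightarrow> 'k set \<Rightarrow> real \<Rightarrow> ('w \<Rightarrow> complex) set" where
  "past_space M Y S t =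
     {Z \<in> L2 M. \<forall>\<epsilon>>0. \<exists>W \<in> past_lin Y S t \<inter> L2 M. (LINT \<omega>|M. (norm (Z \<omega> - W \<omega>))\<^sup>2) < \<epsilon>}"

text \<open>The integral over \<open>(-\<infinity>, t]\<close> of a process \<open>F\<close>: a pathwise Lebesgue integral over
  \<open>[s, t]\<close>, followed by the limit \<open>s \<rightarrow> -\<infinity>\<close> both almost surely and in \<open>L\<^sup>2\<close>.\<close>

definition has_past_integral ::
  "'w measure \<Rightarrow> (real \<Rightarrow> 'w \<Rightarrow> 'b::{banach, second_countable_topology}) \<Rightarrow> real \<Rightarrow> ('w \<Rightarrow> 'b) \<Rightarrow> bool" where
  "has_past_integral M F t I \<longleftrightarrow>
     (AE \<omega> in M. \<forall>s. set_integrable lborel {s..t} (\<lambda>u. F u \<omega>)) \<and>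
     (AE \<omega> in M. ((\<lambda>s. LINT u:{s..t}|lborel. F u \<omega>) \<longlongrightarrow> I \<omega>) at_bot) \<and>
     ms_lim M at_bot (\<lambda>s \<omega>. LINT u:{s..t}|lborel. F u \<omega>) I"

definition past_integral ::
  "'w measure \<Rightarrow> (real \<Rightarrow> 'w \<Rightarrow> 'b::{banach, second_countable_topology}) \<Rightarrow> real \<Rightarrow> 'w \<Rightarrow> 'b" where
  "past_integral M F t = (SOME I. has_past_integral M F t I)"

section \<open>L\'evy processes and integrals of deterministic matrix functions\<close>

definition two_sided_levy :: "'w measure \<Rightarrow> (real \<Rightarrow> 'w \<Rightarrow> real^'k) \<Rightarrow> bool" where
  "two_sided_levy M L \<longleftrightarrow>
     prob_space M \<and>
     (\<forall>t. L t \<in> borel_measurable M) \<and>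
     (AE \<omega> in M. L 0 \<omega> = 0) \<and>
     (\<forall>(n::nat) x. (\<forall>i<n. x i < x (Suc i)) \<longrightarrow>
        prob_space.indep_vars M (\<lambda>_. borel) (\<lambda>i \<omega>. L (x (Suc i)) \<omega> - L (x i) \<omega>) {..<n}) \<and>
     (\<forall>s t. s \<le> t \<longrightarrow> distr M borel (\<lambda>\<omega>. L t \<omega> - L s \<omega>) = distr M borel (L (t - s))) \<and>
     (AE \<omega> in M. \<forall>t. ((\<lambda>s. L s \<omega>) \<longlongrightarrow> L t \<omega>) (at_right t) \<and>
                    (\<exists>l. ((\<lambda>s. L s \<omega>) \<longlongrightarrow> l) (at_left t)))"

text \<open>\<open>I = \<integral>\<^sub>s\<^sup>t G(u) dL(u)\<close>: the mean-square limit of the integrals of step functions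
  \<open>\<Sum>\<^sub>i c\<^sub>i 1\<^bsub>(x\<^sub>i, x\<^sub>i\<^sub>+\<^sub>1]\<^esub>\<close> that approximate \<open>G\<close> in \<open>L\<^sup>2([s, t])\<close>.\<close>

definition step_fun :: "nat \<Rightarrow> (nat \<Rightarrow> real) \<Rightarrow> (nat \<Rightarrow> real^'k^'k) \<Rightarrow> real \<Rightarrow> real^'k^'k" where
  "step_fun n x c u = (\<Sum>i<n. indicator {x i<..x (Suc i)} u *\<^sub>R c i)"

definition step_integral ::
  "(real \<Rightarrow> 'w \<Rightarrow> real^'k) \<Rightarrow> nat \<Rightarrow> (nat \<Rightarrow> real) \<Rightarrow> (nat \<Rightarrow> real^'k^'k) \<Rightarrow> 'w \<Rightarrow> real^'k" where
  "step_integral L n x c \<omega> = (\<Sum>i<n. c i *v (L (x (Suc i)) \<omega> - L (x i) \<omega>))"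

definition has_levy_integral ::
  "'w measure \<Rightarrow> (real \<Rightarrow> 'w \<Rightarrow> real^'k) \<Rightarrow> (real \<Rightarrow> real^'k^'k) \<Rightarrow> real \<Rightarrow> real \<Rightarrow> ('w \<Rightarrow> real^'k) \<Rightarrow> bool" where
  "has_levy_integral M L G s t I \<longleftrightarrow>
     set_borel_measurable lborel {s..t} G \<and>
     set_integrable lborel {s..t} (\<lambda>u. (norm (G u))\<^sup>2) \<and>
     (\<exists>(n :: nat \<Rightarrow> nat) x c.
        (\<forall>m. x m 0 = s \<and> x m (n m) = t \<and> (\<forall>i<n m. x m i \<le> x m (Suc i))) \<and>
        (\<lambda>m. LINT u:{s..t}|lborel. (norm (step_fun (n m) (x m) (c m) u - G u))\<^sup>2) \<longlonglongrightarrow> 0 \<and>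
        ms_lim M sequentially (\<lambda>m. step_integral L (n m) (x m) (c m)) I)"

definition levy_integral ::
  "'w measure \<Rightarrow> (real \<Rightarrow> 'w \<Rightarrow> real^'k) \<Rightarrow> (real \<Rightarrow> real^'k^'k) \<Rightarrow> real \<Rightarrow> real \<Rightarrow> 'w \<Rightarrow> real^'k" where
  "levy_integral M L G s t = (SOME I. has_levy_integral M L G s t I)"

text \<open>\<open>I = \<integral>\<^bsub>(-\<infinity>, t]\<^esub> G(u) dL(u)\<close>. Since \<open>\<integral>\<^sub>s\<^sup>t G dL\<close> is defined only up to a null set
  depending on \<open>s\<close>, the almost sure limit refers to a suitable version \<open>J\<close> of these integrals
  as a process in \<open>s\<close>.\<close>

definition has_past_levy_integral ::
  "'w measure \<Rightarrow> (real \<Rightarrow> 'w \<Rightarrow> real^'k) \<Rightarrow> (real \<Rightarrow> real^'k^'k) \<Rightarrow> real \<Rightarrow> ('w \<Rightarrow> real^'k) \<Rightarrow> bool" where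
  "has_past_levy_integral M L G t I \<longleftrightarrow>
     (\<exists>J. (\<forall>s\<le>t. has_levy_integral M L G s t (J s)) \<and>
          (AE \<omega> in M. ((\<lambda>s. J s \<omega>) \<longlongrightarrow> I \<omega>) at_bot) \<and>
          ms_lim M at_bot J I)"

section \<open>Block matrices\<close>

text \<open>A matrix in \<open>M\<^bsub>km\<times>kn\<^esub>(\<real>)\<close> is represented by its \<open>k \<times> k\<close> blocks, \<open>X i j\<close> being the block
  in block row \<open>i \<in> {1..m}\<close> and block column \<open>j \<in> {1..n}\<close>. Values outside these ranges are
  irrelevant: the inner dimension is an argument of the product.\<close>

type_synonym 'k bmat = "nat \<Rightarrow> nat \<Rightarrow> real^'k^'k"

definition bmul :: "nat \<Rightarrow> 'k::finite bmat \<Rightarrow> 'k bmat \<Rightarrow> 'k bmat" where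
  "bmul n X Z = (\<lambda>i j. \<Sum>l=1..n. X i l ** Z l j)"

definition badd :: "'k::finite bmat \<Rightarrow> 'k bmat \<Rightarrow> 'k bmat" where
  "badd X Z = (\<lambda>i j. X i j + Z i j)"

definition bsum :: "('i \<Rightarrow> 'k::finite bmat) \<Rightarrow> 'i set \<Rightarrow> 'k bmat" where
  "bsum X I = (\<lambda>i j. \<Sum>l\<in>I. X l i j)"

definition bscale :: "real \<Rightarrow> 'k::finite bmat \<Rightarrow> 'k bmat" where
  "bscale r X = (\<lambda>i j. r *\<^sub>R X i j)"

fun bpow :: "nat \<Rightarrow> 'k::finite bmat \<Rightarrow> nat \<Rightarrow> 'k bmat" where
  "bpow n X 0 = (\<lambda>i j. if i = j then mat 1 else 0)"
| "bpow n X (Suc m) = bmul n X (bpow n X m)"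

definition bexp :: "nat \<Rightarrow> 'k::finite bmat \<Rightarrow> 'k bmat" where
  "bexp n X = (\<lambda>i j. \<Sum>m. bpow n X m i j /\<^sub>R fact m)"

definition bderiv0 :: "(real \<Rightarrow> 'k::finite bmat) \<Rightarrow> 'k bmat" where
  "bderiv0 X = (\<lambda>i j. vector_derivative (\<lambda>h. X h i j) (at 0))"

section \<open>The ICCSS model\<close>

definition P_poly :: "nat \<Rightarrow> (nat \<Rightarrow> real^'k^'k) \<Rightarrow> complex \<Rightarrow> complex^'k^'k" where
  "P_poly p A z = (\<chi> a b. (if a = b then z ^ p else 0) +
                         (\<Sum>i=1..p. complex_of_real (A i $ a $ b) * z ^ (p - i)))"

definition Q_poly :: "nat \<Rightarrow> (nat \<Rightarrow> real^'k^'k) \<Rightarrow> complex \<Rightarrow> complex^'k^'k" where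
  "Q_poly q C z = (\<chi> a b. \<Sum>j=0..q. complex_of_real (C j $ a $ b) * z ^ j)"

definition stacked :: "complex^'k^'k \<Rightarrow> complex^'k^'k \<Rightarrow> complex^'k^('k + 'k)" where
  "stacked U W = (\<chi> r. case r of Inl a \<Rightarrow> U $ a | Inr a \<Rightarrow> W $ a)"

definition right_coprime :: "(complex \<Rightarrow> complex^'k^'k) \<Rightarrow> (complex \<Rightarrow> complex^'k^'k) \<Rightarrow> bool" where
  "right_coprime P Q \<longleftrightarrow> (\<forall>z. rank (stacked (P z) (Q z)) = CARD('k))"

definition matA :: "nat \<Rightarrow> (nat \<Rightarrow> real^'k^'k) \<Rightarrow> 'k::finite bmat" where
  "matA p A = (\<lambda>i j. if i < p then (if j = i + 1 then mat 1 else 0) else - A (p + 1 - j))"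

definition matB :: "nat \<Rightarrow> 'k::finite bmat" where
  "matB p = (\<lambda>i j. if i = p \<and> j = 1 then mat 1 else 0)"

definition matC :: "nat \<Rightarrow> (nat \<Rightarrow> real^'k^'k) \<Rightarrow> 'k::finite bmat" where
  "matC q C = (\<lambda>i j. if i = 1 \<and> 1 \<le> j \<and> j \<le> q + 1 then C (j - 1) else 0)"

text \<open>\<open>(0, \<dots>, 0, C\<^sub>0, \<dots>, C\<^sub>q)\<close>, which differs from \<open>matC\<close> in the position of the zero blocks.\<close>

definition sfC :: "nat \<Rightarrow> nat \<Rightarrow> (nat \<Rightarrow> real^'k^'k) \<Rightarrow> 'k::finite bmat" where
  "sfC p q C = (\<lambda>i j. if i = 1 \<and> p - q \<le> j \<and> j \<le> p then C (j - (p - q)) else 0)"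

definition matLambda :: "nat \<Rightarrow> (nat \<Rightarrow> real^'k^'k) \<Rightarrow> 'k::finite bmat" where
  "matLambda q C =
     (\<lambda>i j. if i < q then (if j = i + 1 then mat 1 else 0) else - (matrix_inv (C q) ** C (j - 1)))"

definition matTheta :: "nat \<Rightarrow> (nat \<Rightarrow> real^'k^'k) \<Rightarrow> 'k::finite bmat" where
  "matTheta q C = (\<lambda>i j. if i = q \<and> j = 1 then matrix_inv (C q) else 0)"

definition matEj :: "nat \<Rightarrow> 'k::finite bmat" where
  "matEj l = (\<lambda>i j. if i = l \<and> j = 1 then mat 1 else 0)"

definition matE :: "nat \<Rightarrow> 'k::finite bmat" where
  "matE q = (\<lambda>i j. if i = j \<and> i \<le> q then mat 1 else 0)"

definition sfET :: "nat \<Rightarrow> 'k::finite bmat" where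
  "sfET q = (\<lambda>i j. if i = 1 \<and> j = q then mat 1 else 0)"

definition sfM :: "nat \<Rightarrow> nat \<Rightarrow> (nat \<Rightarrow> real^'k^'k) \<Rightarrow> (nat \<Rightarrow> real^'k^'k) \<Rightarrow> real \<Rightarrow> 'k::finite bmat" where
  "sfM p q A C h =
     bmul p (bmul p (sfC p q C) (bexp p (bscale h (matA p A))))
       (badd (matE q)
         (bsum (\<lambda>j. bmul q (bmul 1 (matEj (q + j)) (sfET q)) (bpow q (matLambda q C) j)) {1..p - q}))"

definition sfMm ::
  "nat \<Rightarrow> nat \<Rightarrow> (nat \<Rightarrow> real^'k^'k) \<Rightarrow> (nat \<Rightarrow> real^'k^'k) \<Rightarrow> nat \<Rightarrow> real \<Rightarrow> 'k::finite bmat" where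
  "sfMm p q A C m h =
     bmul p (bmul p (sfC p q C) (bexp p (bscale h (matA p A))))
       (bsum (\<lambda>j. bmul q (bmul 1 (matEj (q + j)) (sfET q)) (bpow q (matLambda q C) (j - 1 - m)))
         {m + 1..p - q})"

text \<open>The \<open>k \<times> k\<close> matrices \<open>M'(0) e\<^bsup>\<Lambda> r\<^esup> \<Theta>\<close> and \<open>M'\<^sub>m(0) \<Theta>\<close>, whose \<open>(a, v)\<close> entries are
  \<open>e\<^sub>a\<^sup>T M'(0) e\<^bsup>\<Lambda> r\<^esup> \<Theta> e\<^sub>v\<close> and \<open>e\<^sub>a\<^sup>T M'\<^sub>m(0) \<Theta> e\<^sub>v\<close>.\<close>

definition kernel_coeff ::
  "nat \<Rightarrow> nat \<Rightarrow> (nat \<Rightarrow> real^'k^'k) \<Rightarrow> (nat \<Rightarrow> real^'k^'k) \<Rightarrow> real \<Rightarrow> real^'k^'k::finite" where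
  "kernel_coeff p q A C r =
     bmul q (bmul q (bderiv0 (sfM p q A C)) (bexp q (bscale r (matLambda q C)))) (matTheta q C) 1 1"

definition deriv_coeff ::
  "nat \<Rightarrow> nat \<Rightarrow> (nat \<Rightarrow> real^'k^'k) \<Rightarrow> (nat \<Rightarrow> real^'k^'k) \<Rightarrow> nat \<Rightarrow> real^'k^'k::finite" where
  "deriv_coeff p q A C m = bmul q (bderiv0 (sfMm p q A C m)) (matTheta q C) 1 1"

text \<open>The \<open>j\<close>-th block of \<open>e\<^bsup>\<A> r\<^esup> \<B>\<close>, with \<open>\<A> = matA p A\<close> and \<open>\<B> = matB p\<close>.\<close>

definition input_kernel :: "nat \<Rightarrow> (nat \<Rightarrow> real^'k^'k) \<Rightarrow> nat \<Rightarrow> real \<Rightarrow> real^'k^'k::finite" where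
  "input_kernel p A j r = bmul p (bexp p (bscale r (matA p A))) (matB p) j 1"

text \<open>\<open>X t j\<close> is the \<open>j\<close>-th \<open>\<real>\<^sup>k\<close>-valued block of the input process, \<open>1 \<le> j \<le> p\<close>. The integral
  determines \<open>X t j\<close> only almost surely for each \<open>t\<close>; joint measurability selects versions for
  which pathwise time integrals make sense (a cadlag version is one).\<close>

definition input_process ::
  "'w measure \<Rightarrow> (real \<Rightarrow> 'w \<Rightarrow> real^'k) \<Rightarrow> nat \<Rightarrow> (nat \<Rightarrow> real^'k^'k) \<Rightarrow> (real \<Rightarrow> nat \<Rightarrow> 'w \<Rightarrow> real^'k) \<Rightarrow> bool" where
  "input_process M L p A X \<longleftrightarrow>
     (\<forall>j\<in>{1..p}. (\<lambda>(t, \<omega>). X t j \<omega>) \<in> borel_measurable (borel \<Otimes>\<^sub>M M) \<and>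
        (\<forall>t. has_past_levy_integral M L (\<lambda>u. input_kernel p A j (t - u)) t (X t j)))"

definition output_process ::
  "nat \<Rightarrow> nat \<Rightarrow> (nat \<Rightarrow> real^'k^'k) \<Rightarrow> (real \<Rightarrow> nat \<Rightarrow> 'w \<Rightarrow> real^'k) \<Rightarrow> real \<Rightarrow> 'w \<Rightarrow> real^'k::finite" where
  "output_process p q C X t \<omega> = (\<Sum>j=1..p. matC q C 1 j *v X t j \<omega>)"

definition eta ::
  "'w measure \<Rightarrow> (real \<Rightarrow> 'w \<Rightarrow> real^'k) \<Rightarrow> nat \<Rightarrow> nat \<Rightarrow> (nat \<Rightarrow> real^'k^'k) \<Rightarrow> (nat \<Rightarrow> real^'k^'k) \<Rightarrow>
     real \<Rightarrow> real \<Rightarrow> 'w \<Rightarrow> real^'k::finite" where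
  "eta M L p q A C t h \<omega> =
     (\<Sum>j=1..p. sfC p q C 1 j *v levy_integral M L (\<lambda>u. input_kernel p A j (t + h - u)) t (t + h) \<omega>)"

end

theory Submission
  imports Defs
    "HOL-Computational_Algebra.Fundamental_Theorem_Algebra" "HOL-Real_Asymp.Real_Asymp"
begin

text \<open>Write \<open>X\<^sub>j\<close> for the blocks of the input process and \<open>n = p - q - 1\<close>. Since \<open>X\<^sub>j' = X\<^sub>j\<^sub>+\<^sub>1\<close> in mean
  square for \<open>j < p\<close>, the derivatives \<open>D\<^bsup>(m)\<^esup>Y\<close> with \<open>m \<le> n\<close> are obtained from \<open>Y = \<Sum>\<^sub>i C\<^sub>i X\<^sub>i\<^sub>+\<^sub>1\<close> by shifting
  the blocks, and the last of them is \<open>\<C> X\<close> with \<open>\<C> = (0, \<dots>, 0, C\<^sub>0, \<dots>, C\<^sub>q)\<close>. The transition formula for \<open>X\<close>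
  then reads \<open>D\<^bsup>(n)\<^esup>Y(t + h) = \<C> e\<^bsup>\<A>h\<^esup> X(t) + \<eta>(t, h)\<close>, where \<open>\<eta>(t, h)\<close> is orthogonal to the past of \<open>Y\<close> because
  increments of \<open>L\<close> over disjoint intervals are orthogonal.

  Conversely \<open>Y\<close> determines \<open>X\<close>: the first \<open>q\<close> blocks solve \<open>x' = \<Lambda> x + \<Theta> Y\<close>, and as \<open>\<Lambda>\<close> is stable they equal
  \<open>\<integral> e\<^bsup>\<Lambda>(t - u)\<^esup> \<Theta> Y(u) du\<close> over \<open>u \<le> t\<close>; the remaining blocks follow by solving recursively for the
  highest block in \<open>D\<^bsup>(m)\<^esup>Y\<close>. So \<open>X(t)\<close> lies in the past space of \<open>Y\<close>, which gives the prediction error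
  \<open>\<eta>(t, h)\<close>. For the limit, the difference quotient is \<open>\<C> \<A> X(t)\<close> up to a term of size \<open>o(1)\<close> and a term
  orthogonal to the past; projections are contractions, and inserting the representation of \<open>X(t)\<close>
  into \<open>\<C> \<A> X(t)\<close> yields the stated sums, of which those over \<open>v \<in> S\<close> are fixed by the projection.\<close>

section \<open>Exponentials of block matrices\<close>

text \<open>The noise collected over an interval of length h is of L2 size O(h^(1/2)) in general, so
  after division by h it need not become small; only its orthogonality to the past removes it. In
  the blocks j < p the kernel vanishes at 0, which gains a factor h and makes the derivatives up to
  order p - q - 1 exist. Derivatives, projections and integrals are versions picked by
  \<open>SOME\<close>, known up to null sets that depend on time. So existence is settled before
  such an object is used, and pathwise differentiation is avoided: the equation for the first q
  blocks is tested against an arbitrary square-integrable U, where it becomes an ordinary scalar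
  equation. The moment hypotheses concern L(1) alone; square integrability, zero mean and linear
  variance at other times have to be derived. Stability is a condition on the zeros of a
  determinant. It becomes exponential decay because this determinant, read as a scalar differential
  operator, annihilates the entries of the matrix exponential.\<close>

lemma bounded_bilinear_matrix_mult:
  "bounded_bilinear (\<lambda>(U::real^'m::finite^'k::finite) (W::real^'n::finite^'m). U ** W)"
  unfolding bilinear_conv_bounded_bilinear[symmetric] bilinear_def
  by (auto intro!: linearI simp: matrix_matrix_mult_def vec_eq_iff algebra_simps sum.distrib sum_distrib_left)

lemma bounded_bilinear_matrix_vector_mult:
  "bounded_bilinear (\<lambda>(U::real^'m::finite^'k::finite) (x::real^'m). U *v x)"
  unfolding bilinear_conv_bounded_bilinear[symmetric] bilinear_def
  by (auto intro!: linearI simp: matrix_vector_mult_def vec_eq_iff algebra_simps sum.distrib sum_distrib_left)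

lemmas matrix_mult_scaleR = bounded_bilinear.scaleR_right[OF bounded_bilinear_matrix_mult]
lemmas scaleR_matrix_mult = bounded_bilinear.scaleR_left[OF bounded_bilinear_matrix_mult]
lemmas minus_matrix_mult = bounded_bilinear.minus_left[OF bounded_bilinear_matrix_mult]
lemmas zero_matrix_mult = bounded_bilinear.zero_left[OF bounded_bilinear_matrix_mult]
lemmas matrix_mult_zero = bounded_bilinear.zero_right[OF bounded_bilinear_matrix_mult]
lemmas matrix_mult_sum_left = bounded_bilinear.sum_left[OF bounded_bilinear_matrix_mult]
lemmas matrix_mult_sum_right = bounded_bilinear.sum_right[OF bounded_bilinear_matrix_mult]
lemmas matrix_vector_sum_left = bounded_bilinear.sum_left[OF bounded_bilinear_matrix_vector_mult]
lemmas matrix_vector_sum_right = bounded_bilinear.sum_right[OF bounded_bilinear_matrix_vector_mult]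

lemma bmul_assoc: "bmul n (bmul m X Y) Z = bmul m X (bmul n Y Z)"
proof (intro ext)
  fix i j
  have "(\<Sum>l = 1..n. (\<Sum>u = 1..m. X i u ** Y u l) ** Z l j) = (\<Sum>l = 1..n. \<Sum>u = 1..m. X i u ** Y u l ** Z l j)"
    by (simp add: matrix_mult_sum_left)
  also have "\<dots> = (\<Sum>u = 1..m. \<Sum>l = 1..n. X i u ** Y u l ** Z l j)"
    by (rule sum.swap)
  also have "\<dots> = (\<Sum>u = 1..m. X i u ** (\<Sum>l = 1..n. Y u l ** Z l j))"
    by (simp add: matrix_mult_sum_right matrix_mul_assoc)
  finally show "bmul n (bmul m X Y) Z i j = bmul m X (bmul n Y Z) i j"
    by (simp add: bmul_def)
qed

text \<open>\<open>bpow n X 0\<close> serves as the identity matrix, whatever \<open>X\<close> is.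
  For \<open>i\<close> outside \<open>1..n\<close> the product would be 0 instead.\<close>

lemma bmul_one_left: "i \<in> {1..n} \<Longrightarrow> bmul n (bpow n X 0) Y i j = Y i j"
  by (simp add: bmul_def if_distrib[of "\<lambda>U. U ** _"] sum.delta cong: if_cong)

lemma bmul_one_right: "j \<in> {1..n} \<Longrightarrow> bmul n Y (bpow n X 0) i j = Y i j"
  by (simp add: bmul_def if_distrib[of "\<lambda>U. _ ** U"] sum.delta cong: if_cong)

text \<open>\<open>bpow\<close> multiplies from the left; associativity of \<open>bmul\<close> moves
  the factor to the right. The claim is confined to the index range because the identity acts as
  such only there.\<close>

lemma bpow_Suc_right:
  assumes "i \<in> {1..n}" "j \<in> {1..n}"
  shows "bpow n X (Suc m) i j = bmul n (bpow n X m) X i j"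
  using assms
proof (induction m arbitrary: i j)
  case 0
  then show ?case using bmul_one_left[of i n X X j] bmul_one_right[of j n X X i] by simp
next
  case (Suc m)
  have "bpow n X (Suc (Suc m)) i j = (\<Sum>l=1..n. X i l ** bpow n X (Suc m) l j)"
    by (simp add: bmul_def)
  also have "\<dots> = (\<Sum>l=1..n. X i l ** bmul n (bpow n X m) X l j)"
    using Suc by (intro sum.cong refl) simp
  also have "\<dots> = bmul n (bmul n X (bpow n X m)) X i j"
    by (simp only: bmul_assoc) (simp add: bmul_def)
  finally show ?case by simp
qed

text \<open>\<open>R\<close> contains the sum of all block norms, which dominates every row sum at
  once, times the constant \<open>k\<close> of the bilinear matrix product. The summand 1 in
  \<open>K\<close> and \<open>R\<close> keeps both positive.\<close>

lemma bpow_bound: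
  fixes X :: "'k::finite bmat"
  obtains K R where "\<And>m i j. i \<in> {1..n} \<Longrightarrow> j \<in> {1..n} \<Longrightarrow> norm (bpow n X m i j) \<le> K * R ^ m"
    "K > 0" "R > 0"
proof -
  obtain k where k: "k > 0" "\<And>U W. norm ((U::real^'k^'k) ** (W::real^'k^'k)) \<le> norm U * norm W * k"
    using bounded_bilinear.pos_bounded[OF bounded_bilinear_matrix_mult] by blast
  define K where "K = norm (mat 1 :: real^'k^'k) + 1"
  define R where "R = 1 + k * (\<Sum>i=1..n. \<Sum>l=1..n. norm (X i l))"
  have R: "R > 0" unfolding R_def using k by (intro add_pos_nonneg mult_nonneg_nonneg sum_nonneg) auto
  have K: "K > 0" unfolding K_def by (smt (verit) norm_ge_zero)
  have "norm (bpow n X m i j) \<le> K * R ^ m" if "i \<in> {1..n}" for m i j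
    using that
  proof (induction m arbitrary: i)
    case 0
    then show ?case using norm_ge_zero[of "mat 1 :: real^'k^'k"] by (simp add: K_def del: norm_ge_zero)
  next
    case (Suc m)
    have "norm (bpow n X (Suc m) i j) \<le> (\<Sum>l=1..n. norm (X i l ** bpow n X m l j))"
      by (simp add: bmul_def norm_sum)
    also have "\<dots> \<le> (\<Sum>l=1..n. norm (X i l) * (K * R ^ m) * k)"
      using Suc k by (intro sum_mono order.trans[OF k(2)] mult_right_mono mult_left_mono) auto
    also have "\<dots> = k * (\<Sum>l=1..n. norm (X i l)) * (K * R ^ m)"
      by (simp add: sum_distrib_left sum_distrib_right mult_ac)
    also have "\<dots> \<le> R * (K * R ^ m)"
    proof (intro mult_right_mono)
      have "(\<Sum>l=1..n. norm (X i l)) \<le> (\<Sum>i=1..n. \<Sum>l=1..n. norm (X i l))"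
        using Suc(2) by (intro member_le_sum[of i "{1..n}" "\<lambda>i. \<Sum>l=1..n. norm (X i l)"]) (auto intro: sum_nonneg)
      then show "k * (\<Sum>l=1..n. norm (X i l)) \<le> R"
        unfolding R_def using k(1) by (smt (verit) mult_left_mono)
    qed (use R K in auto)
    finally show ?case by (simp add: mult_ac)
  qed
  then show ?thesis using that K R by blast
qed

text \<open>\<open>bexpn n X k\<close> is the \<open>k\<close>-th derivative of \<open>r \<mapsto> e\<^bsup>X r\<^esup>\<close>.\<close>

definition bexpn :: "nat \<Rightarrow> 'k::finite bmat \<Rightarrow> nat \<Rightarrow> real \<Rightarrow> 'k bmat" where
  "bexpn n X k r = (\<lambda>i j. \<Sum>m. (r ^ m / fact m) *\<^sub>R bpow n X (m + k) i j)"

lemma bexpn_summable: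
  assumes "i \<in> {1..n}" "j \<in> {1..n}"
  shows "summable (\<lambda>m. (r ^ m / fact m) *\<^sub>R bpow n X (m + k) i j)"
proof -
  obtain K R where KR: "\<And>m i j. i \<in> {1..n} \<Longrightarrow> j \<in> {1..n} \<Longrightarrow> norm (bpow n X m i j) \<le> K * R ^ m"
    "K > 0" "R > 0" using bpow_bound by blast
  have "summable (\<lambda>m. K * R ^ k * (inverse (fact m) * (\<bar>r\<bar> * R) ^ m))"
    by (intro summable_mult summable_exp)
  then show ?thesis
  proof (rule summable_comparison_test'[of _ 0])
    fix m
    have "norm ((r ^ m / fact m) *\<^sub>R bpow n X (m + k) i j) \<le> (\<bar>r\<bar> ^ m / fact m) * (K * R ^ (m + k))"
      using KR(1)[OF assms, of "m + k"] by (simp add: power_abs mult_left_mono divide_right_mono)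
    then show "norm ((r ^ m / fact m) *\<^sub>R bpow n X (m + k) i j) \<le> K * R ^ k * (inverse (fact m) * (\<bar>r\<bar> * R) ^ m)"
      by (simp add: power_add power_mult_distrib field_simps)
  qed
qed

lemma bpow_bscale: "bpow n (bscale r X) m = (\<lambda>i j. r ^ m *\<^sub>R bpow n X m i j)"
proof (induction m)
  case 0 show ?case by (intro ext) simp
next
  case (Suc m)
  show ?case
    unfolding bpow.simps(2) Suc
    by (intro ext) (simp add: bmul_def bscale_def scaleR_matrix_mult matrix_mult_scaleR scaleR_sum_right mult.commute)
qed

lemma bexp_bscale: "bexp n (bscale r X) = bexpn n X 0 r"
  by (intro ext) (simp add: bexp_def bexpn_def bpow_bscale divide_inverse mult_ac)

text \<open>Each coordinate, taken as the inner product with \<open>b\<close>, is a real power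
  series converging everywhere. Termwise differentiation shifts its coefficients to those of the
  next derivative.\<close>

lemma has_vector_derivative_bexpn:
  fixes X :: "'k::finite bmat"
  assumes ij: "i \<in> {1..n}" "j \<in> {1..n}"
  shows "((\<lambda>r. bexpn n X k r i j) has_vector_derivative bexpn n X (Suc k) r i j) (at r within S)"
proof -
  have "((\<lambda>r. bexpn n X k r i j \<bullet> b) has_real_derivative (bexpn n X (Suc k) r i j \<bullet> b)) (at r)" for b :: "real^'k^'k"
  proof -
    define c where "c m = (bpow n X (m + k) i j \<bullet> b) / fact m" for m
    have inner_eq: "bexpn n X k r i j \<bullet> b = (\<Sum>m. (r ^ m / fact m) * (bpow n X (m + k) i j \<bullet> b))" for k r
      unfolding bexpn_def
      using bounded_linear.suminf[OF bounded_linear_inner_left[of b] bexpn_summable[OF ij, of r X k]]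
      by simp
    have "summable (\<lambda>m. c m * y ^ m)" for y
      using bounded_linear.summable[OF bounded_linear_inner_left[of b] bexpn_summable[OF ij, of y X k]]
      by (simp add: c_def mult_ac)
    then have "((\<lambda>x. \<Sum>m. c m * x ^ m) has_field_derivative (\<Sum>m. diffs c m * r ^ m)) (at r)"
      by (rule termdiffs_strong_converges_everywhere)
    moreover have "diffs c m * r ^ m = (r ^ m / fact m) * (bpow n X (m + Suc k) i j \<bullet> b)" for m
      by (simp add: diffs_def c_def fact_Suc field_simps del: of_nat_Suc)
    ultimately show ?thesis
      unfolding inner_eq c_def by (simp add: mult_ac)
  qed
  then have "((\<lambda>r. bexpn n X k r i j \<bullet> b) has_derivative (\<lambda>h. (h *\<^sub>R bexpn n X (Suc k) r i j) \<bullet> b)) (at r within S)"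
    for b :: "real^'k^'k"
    using has_derivative_at_withinI[of _ _ r S] unfolding has_field_derivative_def
    by (force simp: mult.commute[of _ "_ \<bullet> _"])
  then show ?thesis
    unfolding has_vector_derivative_def
    by (subst has_derivative_componentwise_within) blast
qed

lemma bexpn_left:
  assumes "i \<in> {1..n}" "j \<in> {1..n}"
  shows "(\<Sum>l=1..n. X i l ** bexpn n X k r l j) = bexpn n X (Suc k) r i j"
proof -
  have "(\<Sum>l=1..n. X i l ** bexpn n X k r l j)
      = (\<Sum>l=1..n. \<Sum>m. X i l ** ((r ^ m / fact m) *\<^sub>R bpow n X (m + k) l j))"
    unfolding bexpn_def using assms
    by (intro sum.cong refl bounded_linear.suminf[OF bounded_bilinear.bounded_linear_right[OF bounded_bilinear_matrix_mult]] bexpn_summable)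
  also have "\<dots> = (\<Sum>m. \<Sum>l=1..n. X i l ** ((r ^ m / fact m) *\<^sub>R bpow n X (m + k) l j))"
    using assms
    by (intro suminf_sum[symmetric] bounded_linear.summable[OF bounded_bilinear.bounded_linear_right[OF bounded_bilinear_matrix_mult]] bexpn_summable)
  finally show ?thesis
    by (simp add: bexpn_def bmul_def scaleR_sum_right matrix_mult_scaleR)
qed

lemma bexpn_right:
  assumes "i \<in> {1..n}" "j \<in> {1..n}"
  shows "(\<Sum>l=1..n. bexpn n X k r i l ** X l j) = bexpn n X (Suc k) r i j"
proof -
  have "(\<Sum>l=1..n. bexpn n X k r i l ** X l j)
      = (\<Sum>l=1..n. \<Sum>m. ((r ^ m / fact m) *\<^sub>R bpow n X (m + k) i l) ** X l j)"
    unfolding bexpn_def using assms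
    by (intro sum.cong refl bounded_linear.suminf[OF bounded_bilinear.bounded_linear_left[OF bounded_bilinear_matrix_mult]] bexpn_summable)
  also have "\<dots> = (\<Sum>m. \<Sum>l=1..n. ((r ^ m / fact m) *\<^sub>R bpow n X (m + k) i l) ** X l j)"
    using assms
    by (intro suminf_sum[symmetric] bounded_linear.summable[OF bounded_bilinear.bounded_linear_left[OF bounded_bilinear_matrix_mult]] bexpn_summable)
  also have "\<dots> = (\<Sum>m. (r ^ m / fact m) *\<^sub>R bmul n (bpow n X (m + k)) X i j)"
    by (simp add: bmul_def scaleR_sum_right scaleR_matrix_mult)
  finally show ?thesis
    using bpow_Suc_right[OF assms, of X, symmetric] by (simp add: bexpn_def del: bpow.simps)
qed

lemma bexpn_zero: "bexpn n X k 0 i j = bpow n X k i j"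
proof -
  have "(\<lambda>m. (0 ^ m / fact m) *\<^sub>R bpow n X (m + k) i j) = (\<lambda>m. if m = 0 then bpow n X k i j else 0)"
    by (auto simp: fun_eq_iff)
  then show ?thesis unfolding bexpn_def by (subst suminf_finite[of "{0}"]) auto
qed

text \<open>The function \<open>u \<mapsto> e\<^bsup>X (r - u)\<^esup> e\<^bsup>X u\<^esup>\<close> has derivative zero.\<close>

lemma bexpn_add:
  assumes ij: "i \<in> {1..n}" "j \<in> {1..n}"
  shows "bexpn n X 0 (r + s) i j = (\<Sum>l=1..n. bexpn n X 0 r i l ** bexpn n X 0 s l j)"
proof -
  define F where "F u = (\<Sum>l=1..n. bexpn n X 0 (r + s - u) i l ** bexpn n X 0 u l j)" for u
  have "(F has_vector_derivative 0) (at u)" for u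
  proof -
    have "(F has_vector_derivative (\<Sum>l=1..n. bexpn n X 0 (r + s - u) i l ** bexpn n X 1 u l j
        + (- bexpn n X 1 (r + s - u) i l) ** bexpn n X 0 u l j)) (at u)"
      unfolding F_def
    proof (intro has_vector_derivative_sum bounded_bilinear.has_vector_derivative[OF bounded_bilinear_matrix_mult])
      fix l assume l: "l \<in> {1..n}"
      show "((\<lambda>u. bexpn n X 0 u l j) has_vector_derivative bexpn n X 1 u l j) (at u)"
        using has_vector_derivative_bexpn[OF l ij(2), of X 0] by simp
      have "((\<lambda>u. r + s - u) has_vector_derivative -1) (at u)"
        by (auto intro!: derivative_eq_intros)
      from vector_diff_chain_at[OF this has_vector_derivative_bexpn[OF ij(1) l, of X 0]]
      show "((\<lambda>u. bexpn n X 0 (r + s - u) i l) has_vector_derivative - bexpn n X 1 (r + s - u) i l) (at u)"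
        by (simp add: o_def)
    qed
    \<comment> \<open>\<open>X\<close> can be moved from the left exponential to the right one, so
      the two halves of the product rule cancel.\<close>
    moreover have "(\<Sum>l=1..n. bexpn n X 1 (r + s - u) i l ** bexpn n X 0 u l j)
       = (\<Sum>l=1..n. bexpn n X 0 (r + s - u) i l ** bexpn n X 1 u l j)"
    proof -
      have "(\<Sum>l=1..n. bexpn n X 1 (r + s - u) i l ** bexpn n X 0 u l j)
        = (\<Sum>l=1..n. bmul n (bexpn n X 0 (r + s - u)) X i l ** bexpn n X 0 u l j)"
        using ij bexpn_right[OF ij(1), of _ X 0] by (intro sum.cong refl) (simp add: bmul_def)
      also have "\<dots> = bmul n (bexpn n X 0 (r + s - u)) (bmul n X (bexpn n X 0 u)) i j"
        by (simp only: bmul_assoc[symmetric]) (simp add: bmul_def)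
      also have "\<dots> = (\<Sum>l=1..n. bexpn n X 0 (r + s - u) i l ** bexpn n X 1 u l j)"
        using ij bexpn_left[OF _ ij(2), of _ X 0] by (simp add: bmul_def)
      finally show ?thesis .
    qed
    ultimately show ?thesis
      by (simp add: sum.distrib sum_subtractf minus_matrix_mult)
  qed
  \<comment> \<open>\<open>F 0\<close> is the exponential at \<open>r + s\<close>, and
    \<open>F s\<close> is the product of the exponentials at \<open>r\<close> and
    \<open>s\<close>.\<close>
  then have "F 0 = F s"
    using has_vector_derivative_zero_constant[of UNIV F] by (metis convex_UNIV UNIV_I)
  then show ?thesis
    using bmul_one_right[OF ij(2), of "bexpn n X 0 (r + s)" X i]
    by (simp add: F_def bexpn_zero bmul_def)
qed

section \<open>Exponential decay of stable companion matrices\<close>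

text \<open>A polynomial acts on sequences through the shift; on the sequence of derivatives of a
  function this is the differential operator with the given coefficients.\<close>

definition shift_act :: "complex poly \<Rightarrow> (nat \<Rightarrow> complex) \<Rightarrow> nat \<Rightarrow> complex" where
  "shift_act c f m = (\<Sum>n\<le>degree c. coeff c n * f (n + m))"

lemma shift_act_eq: "degree c \<le> N \<Longrightarrow> shift_act c f m = (\<Sum>n\<le>N. coeff c n * f (n + m))"
  unfolding shift_act_def by (intro sum.mono_neutral_left) (auto simp: coeff_eq_0)

lemma shift_act_0 [simp]: "shift_act 0 f m = 0"
  by (simp add: shift_act_def)

lemma shift_act_pCons: "shift_act (pCons a c) f m = a * f m + shift_act c f (Suc m)"
proof -
  have "shift_act (pCons a c) f m = (\<Sum>n\<le>Suc (degree c). coeff (pCons a c) n * f (n + m))"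
    by (rule shift_act_eq) (rule degree_pCons_le)
  then show ?thesis
    by (simp add: sum.atMost_Suc_shift shift_act_def del: sum.atMost_Suc)
qed

lemma shift_act_add: "shift_act (c + d) f m = shift_act c f m + shift_act d f m"
proof -
  let ?N = "max (degree c) (degree d)"
  have "shift_act e f m = (\<Sum>n\<le>?N. coeff e n * f (n + m))" if "e \<in> {c, d, c + d}" for e
    using that degree_add_le_max[of c d] by (intro shift_act_eq) auto
  then show ?thesis
    by (simp add: algebra_simps sum.distrib)
qed

lemma shift_act_sum: "shift_act (sum c I) f m = (\<Sum>i\<in>I. shift_act (c i) f m)"
  by (induction I rule: infinite_finite_induct) (simp_all add: shift_act_add)

lemma shift_act_smult: "shift_act (smult a c) f m = a * shift_act c f m"
proof -
  have "shift_act (smult a c) f m = (\<Sum>n\<le>degree c. coeff (smult a c) n * f (n + m))"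
    by (rule shift_act_eq) simp
  then show ?thesis by (simp add: shift_act_def sum_distrib_left mult.assoc)
qed

text \<open>Sequences become a module over the polynomials. This allows a factorisation of a
  polynomial, or an identity between polynomial determinants, to be applied to a differential
  equation.\<close>

lemma shift_act_mult: "shift_act (c * d) f m = shift_act c (shift_act d f) m"
proof (induction c arbitrary: m)
  case (pCons a c)
  then show ?case
    by (simp add: shift_act_add shift_act_smult shift_act_pCons mult_pCons_left)
qed simp

lemma shift_act_sum_right:
  "shift_act c (\<lambda>n. \<Sum>i\<in>I. f i n) m = (\<Sum>i\<in>I. shift_act c (f i) m)"
  unfolding shift_act_def by (simp add: sum_distrib_left sum.swap[of _ _ I])

lemma shift_act_monom: "shift_act (monom a k) f m = a * f (k + m)"
proof -
  have "shift_act (monom a k) f m = (\<Sum>n\<le>k. coeff (monom a k) n * f (n + m))"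
    by (rule shift_act_eq) (rule degree_monom_le)
  also have "\<dots> = (\<Sum>n\<le>k. if n = k then a * f (k + m) else 0)"
    by (intro sum.cong) auto
  finally show ?thesis by simp
qed

text \<open>The integrating factor e^(-\<mu>r) leaves H' = e^(-\<mu>r) G, bounded by K e^(\<beta>r)
  with \<beta> > 0 because \<mu> lies strictly to the left of -\<delta>. The mean value inequality
  compares H with (K/\<beta>) e^(\<beta>r), and undoing the factor returns exactly the rate \<delta>
  of the inhomogeneity.\<close>

lemma decay_first_order:
  fixes F G :: "real \<Rightarrow> complex"
  assumes der: "\<And>r. (F has_vector_derivative (\<mu> * F r + G r)) (at r)"
    and G: "\<And>r. r \<ge> 0 \<Longrightarrow> norm (G r) \<le> K * exp (- \<delta> * r)"
    and re: "Re \<mu> < - \<delta>"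
  shows "\<exists>K'. \<forall>r\<ge>0. norm (F r) \<le> K' * exp (- \<delta> * r)"
proof -
  define \<beta> where "\<beta> = - Re \<mu> - \<delta>"
  have \<beta>: "\<beta> > 0" using re by (simp add: \<beta>_def)
  have K: "K \<ge> 0" using order.trans[OF norm_ge_zero G[of 0]] by simp
  define H where "H r = exp (- \<mu> * of_real r) * F r" for r
  have H': "(H has_vector_derivative (exp (- \<mu> * of_real r) * G r)) (at r)" for r
  proof -
    have "((\<lambda>z. exp (- \<mu> * z)) has_field_derivative (- \<mu> * exp (- \<mu> * of_real r))) (at (of_real r))"
      by (auto intro!: derivative_eq_intros)
    then have "((\<lambda>r. exp (- \<mu> * of_real r)) has_vector_derivative (- \<mu> * exp (- \<mu> * of_real r))) (at r)"
      using field_vector_diff_chain_at[OF has_vector_derivative_of_real[OF DERIV_ident]]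
      by (simp add: o_def)
    from has_vector_derivative_mult[OF this der]
    show ?thesis unfolding H_def by (simp add: algebra_simps)
  qed
  have bnd: "norm (H r - H 0) \<le> K / \<beta> * exp (\<beta> * r) - K / \<beta> * exp (\<beta> * 0)" if "r \<ge> 0" for r
  proof (cases "r = 0")
    case False
    show ?thesis
    proof (rule differentiable_bound_general[where f' = "\<lambda>r. exp (- \<mu> * of_real r) * G r" and \<phi>' = "\<lambda>r. K * exp (\<beta> * r)"])
      show "continuous_on {0..r} H"
        using H' has_vector_derivative_continuous continuous_at_imp_continuous_on by blast
      show "continuous_on {0..r} (\<lambda>r. K / \<beta> * exp (\<beta> * r))"
        by (intro continuous_intros)
      show "((\<lambda>r. K / \<beta> * exp (\<beta> * r)) has_vector_derivative K * exp (\<beta> * x)) (at x)" for x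
        using \<beta> by (auto intro!: derivative_eq_intros simp flip: has_real_derivative_iff_has_vector_derivative)
      show "norm (exp (- \<mu> * of_real x) * G x) \<le> K * exp (\<beta> * x)" if "0 < x" for x
      proof -
        have "norm (exp (- \<mu> * of_real x) * G x) \<le> exp (- Re \<mu> * x) * (K * exp (- \<delta> * x))"
          using G[of x] that by (simp add: norm_mult mult_left_mono)
        also have "\<dots> = K * exp (\<beta> * x)"
          by (simp add: \<beta>_def left_diff_distrib flip: exp_add)
        finally show ?thesis .
      qed
    qed (use that False H' in auto)
  qed auto
  have "norm (F r) \<le> (norm (F 0) + K / \<beta>) * exp (- \<delta> * r)" if "r \<ge> 0" for r
  proof -
    have "norm (H r) \<le> norm (H 0) + K / \<beta> * exp (\<beta> * r)"
      using bnd[OF that] norm_triangle_ineq2[of "H r" "H 0"] K \<beta> by (smt (verit) divide_nonneg_pos mult_nonneg_nonneg exp_ge_zero)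
    also have "\<dots> \<le> (norm (F 0) + K / \<beta>) * exp (\<beta> * r)"
      using \<beta> that by (simp add: H_def distrib_right mult_le_cancel_left1)
    finally have 1: "norm (H r) \<le> (norm (F 0) + K / \<beta>) * exp (\<beta> * r)" .
    have "norm (F r) = exp (Re \<mu> * r) * norm (H r)"
      by (simp add: H_def norm_mult flip: mult.assoc exp_add)
    also have "\<dots> \<le> exp (Re \<mu> * r) * ((norm (F 0) + K / \<beta>) * exp (\<beta> * r))"
      using 1 by (intro mult_left_mono) auto
    also have "\<dots> = (norm (F 0) + K / \<beta>) * exp (- \<delta> * r)"
      by (simp add: \<beta>_def left_diff_distrib flip: exp_add)
    finally show ?thesis .
  qed
  then show ?thesis by blast
qed

text \<open>One root at a time: if c = (z - \<mu>) c1, then G = F' - \<mu>F is annihilated by c1 and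
  decays by induction, and F solves a first order equation with decaying right-hand side. The
  sequence \<open>F n\<close> carries all derivatives of \<open>F 0\<close> along.\<close>

lemma ode_solution_decay:
  fixes F :: "nat \<Rightarrow> real \<Rightarrow> complex" and c :: "complex poly"
  assumes "\<And>n r. (F n has_vector_derivative F (Suc n) r) (at r)"
    and "c \<noteq> 0" and "\<And>z. poly c z = 0 \<Longrightarrow> Re z < - \<delta>"
    and "\<And>r. shift_act c (\<lambda>n. F n r) 0 = 0"
  shows "\<exists>K. \<forall>r\<ge>0. norm (F 0 r) \<le> K * exp (- \<delta> * r)"
  using assms
proof (induction "degree c" arbitrary: c F)
  case 0
  then have "F 0 r = 0" for r
    by (auto simp: shift_act_def elim: degree_eq_zeroE)
  then show ?case by (intro exI[of _ 0]) auto
next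
  case (Suc d)
  then obtain \<mu> where root: "poly c \<mu> = 0"
    using fundamental_theorem_of_algebra[of c] by (auto simp: constant_degree)
  then obtain c1 where c1: "c = [:- \<mu>, 1:] * c1"
    by (auto simp: poly_eq_0_iff_dvd)
  have c1_nz: "c1 \<noteq> 0" using Suc.prems(2) c1 by auto
  have deg: "d = degree c1" using Suc.hyps(2) c1_nz unfolding c1 by (subst (asm) degree_mult_eq) auto
  define G where "G n r = F (Suc n) r - \<mu> * F n r" for n r
  have "\<exists>K. \<forall>r\<ge>0. norm (G 0 r) \<le> K * exp (- \<delta> * r)"
  proof (rule Suc.hyps(1)[OF deg])
    show "(G n has_vector_derivative G (Suc n) r) (at r)" for n r
      unfolding G_def by (intro has_vector_derivative_diff has_vector_derivative_mult_right Suc.prems(1))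
    show "Re z < - \<delta>" if "poly c1 z = 0" for z
      using Suc.prems(3)[of z] that by (simp add: c1)
    show "shift_act c1 (\<lambda>n. G n r) 0 = 0" for r
    proof -
      have "(\<lambda>n. G n r) = shift_act [:- \<mu>, 1:] (\<lambda>n. F n r)"
        by (simp add: fun_eq_iff G_def shift_act_pCons)
      then show ?thesis
        using Suc.prems(4)[of r] by (simp add: c1 mult.commute[of _ c1] shift_act_mult[symmetric] del: mult_pCons_left mult_pCons_right)
    qed
  qed (rule c1_nz)
  then obtain K where "\<And>r. r \<ge> 0 \<Longrightarrow> norm (G 0 r) \<le> K * exp (- \<delta> * r)" by blast
  then show ?case
    using Suc.prems(1)[of 0] Suc.prems(3)[OF root]
    by (intro decay_first_order[of "F 0" \<mu> "G 0" K]) (auto simp: G_def)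
qed

text \<open>The entry (i, l) is a cofactor, written as the determinant of the transpose with row i
  replaced by a unit vector. By linearity in row i the sum is the determinant with column j of
  \<open>T\<close> in that row, which has two equal rows unless i = j. The entries range over a
  commutative ring because polynomial entries are needed.\<close>

lemma adjugate_exists:
  fixes T :: "'a::comm_ring_1^'n::finite^'n"
  obtains U :: "'a^'n^'n" where "\<And>i j. (\<Sum>l\<in>UNIV. U $ i $ l * T $ l $ j) = (if i = j then det T else 0)"
proof -
  let ?T = "transpose T"
  define U :: "'a^'n^'n" where "U = (\<chi> i l. det (\<chi> r. if r = i then axis l 1 else ?T $ r))"
  have "(\<Sum>l\<in>UNIV. U $ i $ l * T $ l $ j) = (if i = j then det T else 0)" for i j
  proof -
    have "(\<Sum>l\<in>UNIV. U $ i $ l * T $ l $ j)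
        = (\<Sum>l\<in>UNIV. det (\<chi> r. if r = i then T $ l $ j *s axis l 1 else ?T $ r))"
      by (simp add: U_def det_row_mul mult.commute)
    also have "\<dots> = det (\<chi> r. if r = i then (\<Sum>l\<in>UNIV. T $ l $ j *s axis l 1) else ?T $ r)"
      by (subst det_linear_row_sum) auto
    also have "(\<Sum>l\<in>UNIV. T $ l $ j *s axis l 1) = ?T $ j"
      by (simp add: vec_eq_iff transpose_def axis_def if_distrib[of "\<lambda>x. _ * x"] cong: if_cong)
    also have "det (\<chi> r. if r = i then ?T $ j else ?T $ r) = (if i = j then det T else 0)"
    proof (cases "i = j")
      case True
      then have "(\<chi> r. if r = i then ?T $ j else ?T $ r) = ?T" by (simp add: vec_eq_iff)
      then show ?thesis using True by simp
    next
      case False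
      then show ?thesis by (auto intro!: det_identical_rows[of i j] simp: row_def)
    qed
    finally show ?thesis .
  qed
  then show ?thesis using that by blast
qed

text \<open>\<open>P_poly\<close> as a matrix of polynomials instead of a function of
  \<open>z\<close>, so that its determinant is a polynomial that can be factored and can act on
  sequences.\<close>

definition char_poly_mat :: "nat \<Rightarrow> (nat \<Rightarrow> real^'k^'k) \<Rightarrow> complex poly^'k^'k" where
  "char_poly_mat p A = (\<chi> a b. (if a = b then monom 1 p else 0) +
                         (\<Sum>i=1..p. monom (complex_of_real (A i $ a $ b)) (p - i)))"

lemma poly_det_char_poly_mat: "poly (det (char_poly_mat p A)) z = det (P_poly p A z)"
proof -
  have e: "poly (char_poly_mat p A $ a $ b) z = P_poly p A z $ a $ b" for a b
    by (simp add: char_poly_mat_def P_poly_def poly_sum poly_monom)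
  show ?thesis
    unfolding det_def by (simp add: poly_sum poly_prod e)
qed

text \<open>Cramer's rule for a system of differential equations: multiplication by the adjugate
  decouples it, and each unknown is annihilated by the scalar operator \<open>det T\<close>.\<close>

lemma shift_act_det_zero:
  fixes T :: "complex poly^'k::finite^'k"
  assumes "\<And>l m. (\<Sum>b\<in>UNIV. shift_act (T $ l $ b) (f b) m) = 0"
  shows "shift_act (det T) (f i) m = 0"
proof -
  obtain U :: "complex poly^'k^'k" where U: "\<And>i j. (\<Sum>l\<in>UNIV. U $ i $ l * T $ l $ j) = (if i = j then det T else 0)"
    using adjugate_exists by blast
  have "shift_act (det T) (f i) m = (\<Sum>j\<in>UNIV. if i = j then shift_act (det T) (f j) m else 0)"
    by simp
  also have "\<dots> = (\<Sum>j\<in>UNIV. shift_act (\<Sum>l\<in>UNIV. U $ i $ l * T $ l $ j) (f j) m)"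
    by (intro sum.cong refl) (auto simp: U)
  also have "\<dots> = (\<Sum>l\<in>UNIV. \<Sum>j\<in>UNIV. shift_act (U $ i $ l) (shift_act (T $ l $ j) (f j)) m)"
    by (subst sum.swap) (simp add: shift_act_sum shift_act_mult)
  also have "\<dots> = (\<Sum>l\<in>UNIV. shift_act (U $ i $ l) (\<lambda>m. \<Sum>j\<in>UNIV. shift_act (T $ l $ j) (f j) m) m)"
    by (simp add: shift_act_sum_right)
  also have "\<dots> = 0"
    by (simp only: assms) (simp add: shift_act_def)
  finally show ?thesis .
qed

text \<open>Finitely many roots leave a gap to the imaginary axis; half of the gap is taken to keep
  the inequality strict.\<close>

lemma roots_uniformly_stable:
  fixes c :: "complex poly"
  assumes "c \<noteq> 0" "\<And>z. poly c z = 0 \<Longrightarrow> Re z < 0"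
  obtains \<delta> where "\<delta> > 0" "\<And>z. poly c z = 0 \<Longrightarrow> Re z < - \<delta>"
proof (cases "{z. poly c z = 0} = {}")
  case True
  then show ?thesis using that[of 1] by auto
next
  case False
  define \<mu> where "\<mu> = Max (Re ` {z. poly c z = 0})"
  have fin: "finite (Re ` {z. poly c z = 0})"
    using poly_roots_finite[OF assms(1)] by blast
  have le: "Re z \<le> \<mu>" if "poly c z = 0" for z
    unfolding \<mu>_def using fin that by (intro Max_ge) auto
  have "\<mu> \<in> Re ` {z. poly c z = 0}"
    unfolding \<mu>_def using fin False by (intro Max_in) auto
  then have "\<mu> < 0" using assms(2) by auto
  then show ?thesis using that[of "- \<mu> / 2"] le by force
qed

lemma norm_matrix_le_sum: "norm (U :: real^'k::finite^'m::finite) \<le> (\<Sum>a\<in>UNIV. \<Sum>b\<in>UNIV. \<bar>U $ a $ b\<bar>)"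
proof -
  have "norm U \<le> (\<Sum>a\<in>UNIV. norm (U $ a))"
    unfolding norm_vec_def[of U] by (rule L2_set_le_sum) simp
  also have "\<dots> \<le> (\<Sum>a\<in>UNIV. \<Sum>b\<in>UNIV. \<bar>U $ a $ b\<bar>)"
    by (intro sum_mono norm_le_l1_cart)
  finally show ?thesis .
qed

text \<open>Serves to replace \<open>matLambda\<close> by a matrix of the form \<open>matA\<close>;
  the two are compared only inside the index range.\<close>

lemma bexpn_cong:
  assumes "\<And>i j. i \<in> {1..n} \<Longrightarrow> j \<in> {1..n} \<Longrightarrow> X i j = X' i j" "i \<in> {1..n}" "j \<in> {1..n}"
  shows "bexpn n X k r i j = bexpn n X' k r i j"
proof -
  have "bpow n X m i j = bpow n X' m i j" if "i \<in> {1..n}" for m i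
    using that
  proof (induction m arbitrary: i)
    case (Suc m)
    then show ?case using assms(1) by (auto simp: bmul_def intro!: sum.cong)
  qed simp
  then show ?thesis using assms(2) by (simp add: bexpn_def)
qed

section \<open>Exponentials of block companion matrices\<close>

lemma bexpn_companion_shift:
  assumes "i \<in> {1..<n}" "j \<in> {1..n}"
  shows "bexpn n (matA n A) (Suc k) r i j = bexpn n (matA n A) k r (Suc i) j"
proof -
  have "bexpn n (matA n A) (Suc k) r i j = (\<Sum>l=1..n. matA n A i l ** bexpn n (matA n A) k r l j)"
    using assms by (intro bexpn_left[symmetric]) auto
  also have "\<dots> = (\<Sum>l=1..n. if l = Suc i then bexpn n (matA n A) k r l j else 0)"
    using assms by (intro sum.cong refl) (auto simp: matA_def zero_matrix_mult)
  finally show ?thesis using assms by simp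
qed

text \<open>Multiplication by a companion matrix shifts the block rows, so row \<open>i\<close> of
  the exponential is the (i - 1)-st derivative of row 1. It is thus enough to control the
  derivatives of a single row.\<close>

lemma bexpn_companion_row:
  assumes "i \<in> {1..n}" "j \<in> {1..n}"
  shows "bexpn n (matA n A) k r i j = bexpn n (matA n A) (k + i - 1) r 1 j"
  using assms
proof (induction i arbitrary: k)
  case (Suc i)
  show ?case
  proof (cases "i = 0")
    case False
    then have "bexpn n (matA n A) k r (Suc i) j = bexpn n (matA n A) (Suc k) r i j"
      using Suc.prems by (intro bexpn_companion_shift[symmetric]) auto
    also have "\<dots> = bexpn n (matA n A) (Suc k + i - 1) r 1 j"
      using Suc False by (intro Suc.IH) auto
    finally show ?thesis by simp
  qed simp
qed simp

text \<open>The last block row of the companion matrix turns into the differential equation with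
  symbol P for the first row of the exponential; \<open>m\<close> counts further
  differentiations.\<close>

lemma bexpn_companion_recurrence:
  assumes "j \<in> {1..n}"
  shows "bexpn n (matA n A) (n + m) r 1 j + (\<Sum>i=1..n. A i ** bexpn n (matA n A) (n - i + m) r 1 j) = 0"
proof -
  let ?e = "bexpn n (matA n A)"
  have n: "n \<in> {1..n}" using assms by auto
  have "?e (n + m) r 1 j = ?e (Suc m + n - 1) r 1 j"
    by (simp add: add.commute)
  also have "\<dots> = ?e (Suc m) r n j"
    by (rule bexpn_companion_row[OF n assms, symmetric])
  also have "\<dots> = (\<Sum>l=1..n. matA n A n l ** ?e m r l j)"
    by (rule bexpn_left[OF n assms, symmetric])
  also have "\<dots> = (\<Sum>l=1..n. - (A (n + 1 - l) ** ?e (m + l - 1) r 1 j))"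
  proof (intro sum.cong refl)
    fix l assume "l \<in> {1..n}"
    from bexpn_companion_row[OF this assms, of A m r]
    show "matA n A n l ** ?e m r l j = - (A (n + 1 - l) ** ?e (m + l - 1) r 1 j)"
      by (simp add: matA_def minus_matrix_mult)
  qed
  also have "\<dots> = (\<Sum>i=1..n. - (A i ** ?e (n - i + m) r 1 j))"
    by (rule sum.reindex_bij_witness[of _ "\<lambda>i. n + 1 - i" "\<lambda>l. n + 1 - l"]) (auto simp: add.commute)
  finally show ?thesis by (simp add: sum_negf)
qed

text \<open>For a fixed column, the entries of the first block row solve the system with symbol P.
  Decoupled by the determinant, they solve scalar equations with characteristic polynomial det P,
  whose roots are stable. Block row \<open>i\<close> is reached by starting from the derivative of
  order i - 1.\<close>

lemma companion_exp_decay: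
  fixes A :: "nat \<Rightarrow> real^'k::finite^'k"
  assumes "\<And>z. det (P_poly n A z) = 0 \<Longrightarrow> Re z < 0"
  obtains K \<delta> where "\<delta> > 0" "K \<ge> 0"
    "\<And>i j r. i \<in> {1..n} \<Longrightarrow> j \<in> {1..n} \<Longrightarrow> r \<ge> 0 \<Longrightarrow> norm (bexpn n (matA n A) 0 r i j) \<le> K * exp (- \<delta> * r)"
proof -
  let ?e = "bexpn n (matA n A)"
  let ?c = "det (char_poly_mat n A)"
  \<comment> \<open>The zero polynomial would have the unstable root 1.\<close>
  have c0: "?c \<noteq> 0"
  proof
    assume "?c = 0"
    then have "det (P_poly n A 1) = 0"
      using poly_det_char_poly_mat[of n A 1] by simp
    from assms[OF this] show False by simp
  qed
  have "\<And>z. poly ?c z = 0 \<Longrightarrow> Re z < 0"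
    using assms by (simp add: poly_det_char_poly_mat)
  then obtain \<delta> where \<delta>: "\<delta> > 0" "\<And>z. poly ?c z = 0 \<Longrightarrow> Re z < - \<delta>"
    using roots_uniformly_stable[OF c0] by blast
  have "\<exists>K. \<forall>r\<ge>0. \<bar>?e 0 r i j $ b $ c\<bar> \<le> K * exp (- \<delta> * r)"
    if ij: "i \<in> {1..n}" "j \<in> {1..n}" for i j b c
  proof -
    have one: "1 \<in> {1..n}" using ij by auto
    define f where "f b m r = complex_of_real (?e m r 1 j $ b $ c)" for b m r
    have ann: "(\<Sum>b\<in>UNIV. shift_act (char_poly_mat n A $ a $ b) (\<lambda>m. f b m r) m) = 0" for a m r
    proof -
      have "(\<Sum>b\<in>UNIV. shift_act (char_poly_mat n A $ a $ b) (\<lambda>m. f b m r) m)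
          = (\<Sum>b\<in>UNIV. (if a = b then f b (n + m) r else 0)
              + (\<Sum>i=1..n. of_real (A i $ a $ b) * f b (n - i + m) r))"
        by (intro sum.cong refl) (auto simp: char_poly_mat_def shift_act_add shift_act_monom shift_act_sum)
      also have "\<dots> = f a (n + m) r + (\<Sum>i=1..n. \<Sum>b\<in>UNIV. of_real (A i $ a $ b) * f b (n - i + m) r)"
        by (simp add: sum.distrib sum.swap[of _ UNIV])
      also have "\<dots> = of_real ((?e (n + m) r 1 j + (\<Sum>i=1..n. A i ** ?e (n - i + m) r 1 j)) $ a $ c)"
        by (simp add: f_def matrix_matrix_mult_def)
      finally show ?thesis
        by (simp only: bexpn_companion_recurrence[OF ij(2)] zero_index of_real_0)
    qed
    have "\<exists>K. \<forall>r\<ge>0. norm (f b (i - 1) r) \<le> K * exp (- \<delta> * r)"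
    proof -
      have "\<exists>K. \<forall>r\<ge>0. norm ((\<lambda>m. f b (m + (i - 1))) 0 r) \<le> K * exp (- \<delta> * r)"
      proof (rule ode_solution_decay[OF _ c0 \<delta>(2)])
        fix m r
        have "((\<lambda>r. ?e (m + (i - 1)) r 1 j $ b $ c) has_vector_derivative ?e (Suc (m + (i - 1))) r 1 j $ b $ c) (at r)"
          by (intro bounded_linear.has_vector_derivative[OF bounded_linear_vec_nth] has_vector_derivative_bexpn one ij)
        then have "((\<lambda>r. ?e (m + (i - 1)) r 1 j $ b $ c) has_real_derivative ?e (Suc (m + (i - 1))) r 1 j $ b $ c) (at r)"
          by (simp add: has_real_derivative_iff_has_vector_derivative)
        from has_vector_derivative_of_real[OF this, where 'a = complex]
        show "(f b (m + (i - 1)) has_vector_derivative f b (Suc m + (i - 1)) r) (at r)"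
          by (simp add: f_def[abs_def] )
        have "shift_act ?c (\<lambda>m. f b m r) (i - 1) = 0"
          by (rule shift_act_det_zero[OF ann])
        then show "shift_act ?c (\<lambda>m. f b (m + (i - 1)) r) 0 = 0"
          by (simp add: shift_act_def)
      qed
      then show ?thesis by simp
    qed
    moreover have "?e 0 r i j = ?e (i - 1) r 1 j" for r
      using bexpn_companion_row[OF ij, of A 0 r] by simp
    ultimately show ?thesis by (simp add: f_def)
  qed
  then obtain K where K: "\<And>i j b c r. i \<in> {1..n} \<Longrightarrow> j \<in> {1..n} \<Longrightarrow> r \<ge> 0 \<Longrightarrow> \<bar>?e 0 r i j $ b $ c\<bar> \<le> K i j b c * exp (- \<delta> * r)"
    by metis
  \<comment> \<open>The individual constants may have any sign and depend on the entry; the sum of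
    their absolute values serves all entries.\<close>
  define K0 where "K0 = (\<Sum>i=1..n. \<Sum>j=1..n. \<Sum>b\<in>UNIV. \<Sum>c\<in>UNIV. \<bar>K i j b c\<bar>)"
  have "norm (?e 0 r i j) \<le> K0 * exp (- \<delta> * r)" if ij: "i \<in> {1..n}" "j \<in> {1..n}" and "r \<ge> 0" for i j r
  proof -
    have "norm (?e 0 r i j) \<le> (\<Sum>b\<in>UNIV. \<Sum>c\<in>UNIV. \<bar>?e 0 r i j $ b $ c\<bar>)"
      by (rule norm_matrix_le_sum)
    also have "\<dots> \<le> (\<Sum>b\<in>UNIV. \<Sum>c\<in>UNIV. \<bar>K i j b c\<bar> * exp (- \<delta> * r))"
      by (intro sum_mono order.trans[OF K[OF that]] mult_right_mono) auto
    also have "\<dots> = (\<Sum>b\<in>UNIV. \<Sum>c\<in>UNIV. \<bar>K i j b c\<bar>) * exp (- \<delta> * r)"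
      by (simp add: sum_distrib_right)
    also have "(\<Sum>b\<in>UNIV. \<Sum>c\<in>UNIV. \<bar>K i j b c\<bar>) \<le> (\<Sum>j=1..n. \<Sum>b\<in>UNIV. \<Sum>c\<in>UNIV. \<bar>K i j b c\<bar>)"
      using ij by (intro member_le_sum[of j _ "\<lambda>j. \<Sum>b\<in>UNIV. \<Sum>c\<in>UNIV. \<bar>K i j b c\<bar>"] sum_nonneg) auto
    also have "\<dots> \<le> K0"
      unfolding K0_def
      using ij by (intro member_le_sum[of i _ "\<lambda>i. \<Sum>j=1..n. \<Sum>b\<in>UNIV. \<Sum>c\<in>UNIV. \<bar>K i j b c\<bar>"] sum_nonneg) auto
    finally show ?thesis by simp
  qed
  moreover have "K0 \<ge> 0" unfolding K0_def by (intro sum_nonneg) auto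
  ultimately show ?thesis using that \<delta>(1) by blast
qed

lemma matrix_inv_full_rank:
  fixes U :: "real^'k::finite^'k"
  assumes "rank U = CARD('k)"
  shows "matrix_inv U ** U = mat 1"
proof -
  have "invertible U"
    using assms det_eq_0_rank[of U] by (simp add: invertible_det_nz)
  then show ?thesis unfolding invertible_def matrix_inv_def by (rule someI2_ex) simp
qed

text \<open>Multiplication by the inverse of \<open>C q\<close> makes Q monic. Its coefficients, in
  the reversed numbering of \<open>P_poly\<close>, are those in the last block row of
  \<open>matLambda\<close>.\<close>

lemma P_poly_normalised:
  fixes C :: "nat \<Rightarrow> real^'k::finite^'k"
  assumes "matrix_inv (C q) ** C q = mat 1"
  shows "P_poly q (\<lambda>i. matrix_inv (C q) ** C (q - i)) z
       = (\<chi> a b. complex_of_real (matrix_inv (C q) $ a $ b)) ** Q_poly q C z"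
proof -
  let ?D = "matrix_inv (C q)"
  have one: "(if a = b then z ^ q else 0) = complex_of_real ((?D ** C q) $ a $ b) * z ^ q" for a b
    by (simp add: assms mat_def)
  have "P_poly q (\<lambda>i. ?D ** C (q - i)) z $ a $ b = (\<Sum>j=0..q. complex_of_real ((?D ** C j) $ a $ b) * z ^ j)" for a b
  proof -
    have "(\<Sum>i=1..q. complex_of_real ((?D ** C (q - i)) $ a $ b) * z ^ (q - i))
        = (\<Sum>j<q. complex_of_real ((?D ** C j) $ a $ b) * z ^ j)"
      by (rule sum.reindex_bij_witness[of _ "\<lambda>j. q - j" "\<lambda>i. q - i"]) auto
    moreover have "{0..q} = insert q {..<q}" by auto
    ultimately show ?thesis unfolding P_poly_def by (simp add: one del: of_real_mult)
  qed
  also have "(\<Sum>j=0..q. complex_of_real ((?D ** C j) $ a $ b) * z ^ j)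
     = ((\<chi> a b. complex_of_real (?D $ a $ b)) ** Q_poly q C z) $ a $ b" for a b
    by (simp add: matrix_matrix_mult_def Q_poly_def sum_distrib_left sum_distrib_right sum.swap[of _ UNIV] mult_ac)
  finally show ?thesis by (simp add: vec_eq_iff)
qed

text \<open>\<open>matLambda\<close> is the companion matrix of the normalised Q. The determinant of
  the latter is det Q times a nonzero constant, so the stability of Q carries over.\<close>

lemma matLambda_exp_decay:
  fixes C :: "nat \<Rightarrow> real^'k::finite^'k"
  assumes rank: "rank (C q) = CARD('k)"
    and zeros: "\<And>z. det (Q_poly q C z) = 0 \<Longrightarrow> Re z < 0"
  obtains K \<delta> where "\<delta> > 0" "K \<ge> 0"
    "\<And>i j r. i \<in> {1..q} \<Longrightarrow> j \<in> {1..q} \<Longrightarrow> r \<ge> 0 \<Longrightarrow> norm (bexpn q (matLambda q C) 0 r i j) \<le> K * exp (- \<delta> * r)"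
proof -
  note inv = matrix_inv_full_rank[OF rank]
  let ?A = "\<lambda>i. matrix_inv (C q) ** C (q - i)"
  let ?D = "(\<chi> a b. complex_of_real (matrix_inv (C q) $ a $ b)) :: complex^'k^'k"
  have "?D ** (\<chi> a b. complex_of_real (C q $ a $ b)) = mat 1"
  proof -
    have "(?D ** (\<chi> a b. complex_of_real (C q $ a $ b))) $ a $ b = complex_of_real ((matrix_inv (C q) ** C q) $ a $ b)" for a b
      by (simp add: matrix_matrix_mult_def)
    then show ?thesis by (simp add: inv vec_eq_iff mat_def)
  qed
  then have "det ?D * det (\<chi> a b. complex_of_real (C q $ a $ b) :: complex^'k^'k) = 1"
    by (simp flip: det_mul)
  then have "det ?D \<noteq> 0" by auto
  moreover have "det (P_poly q ?A z) = det ?D * det (Q_poly q C z)" for z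
    unfolding P_poly_normalised[of C q, OF inv] by (rule det_mul)
  ultimately have neg: "Re z < 0" if "det (P_poly q ?A z) = 0" for z
    using that zeros[of z] by (metis mult_eq_0_iff)
  have eq: "bexpn q (matA q ?A) 0 r i j = bexpn q (matLambda q C) 0 r i j" if "i \<in> {1..q}" "j \<in> {1..q}" for i j r
    using that by (intro bexpn_cong) (auto simp: matLambda_def matA_def)
  show ?thesis
  proof (rule companion_exp_decay[of q ?A])
    fix K \<delta>
    assume K: "\<delta> > 0" "K \<ge> 0" and bound: "\<And>i j r. i \<in> {1..q} \<Longrightarrow> j \<in> {1..q} \<Longrightarrow> r \<ge> 0 \<Longrightarrow>
      norm (bexpn q (matA q ?A) 0 r i j) \<le> K * exp (- \<delta> * r)"
    show ?thesis
    proof (rule that[OF K])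
      show "norm (bexpn q (matLambda q C) 0 r i j) \<le> K * exp (- \<delta> * r)"
        if "i \<in> {1..q}" "j \<in> {1..q}" "r \<ge> 0" for i j r
        using bound[OF that] by (simp only: eq[OF that(1,2)])
    qed
  qed (rule neg)
qed

section \<open>Square-integrable functions\<close>

definition l2norm :: "'w measure \<Rightarrow> ('w \<Rightarrow> 'b::real_normed_vector) \<Rightarrow> real" where
  "l2norm M Z = sqrt (LINT \<omega>|M. (norm (Z \<omega>))\<^sup>2)"

text \<open>A real inner product also for complex-valued functions, namely the real part of the
  Hermitian one. Orthogonality to a complex subspace is the same for both, since the subspace
  contains \<i>U along with U.\<close>

definition l2inner :: "'w measure \<Rightarrow> ('w \<Rightarrow> 'b::real_inner) \<Rightarrow> ('w \<Rightarrow> 'b) \<Rightarrow> real" where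
  "l2inner M Z W = (LINT \<omega>|M. Z \<omega> \<bullet> W \<omega>)"

lemma L2_measurable [measurable_dest]: "Z \<in> L2 M \<Longrightarrow> Z \<in> borel_measurable M"
  and L2_integrable_power2: "Z \<in> L2 M \<Longrightarrow> integrable M (\<lambda>\<omega>. (norm (Z \<omega>))\<^sup>2)"
  by (auto simp: L2_def)

lemma l2norm_nonneg [simp]: "l2norm M Z \<ge> 0"
  by (simp add: l2norm_def)

lemma l2norm_power2: "(l2norm M Z)\<^sup>2 = (LINT \<omega>|M. (norm (Z \<omega>))\<^sup>2)"
  by (simp add: l2norm_def)

lemma l2norm_eq_inner: "(l2norm M Z)\<^sup>2 = l2inner M Z Z"
  by (simp add: l2norm_power2 l2inner_def power2_norm_eq_inner)

lemma L2_bounded_by: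
  fixes Z :: "'w \<Rightarrow> 'b::{second_countable_topology,real_normed_vector}" and W :: "'w \<Rightarrow> 'c::{second_countable_topology,real_normed_vector}"
  assumes "W \<in> L2 M" "Z \<in> borel_measurable M" "\<And>\<omega>. norm (Z \<omega>) \<le> c * norm (W \<omega>)"
  shows "Z \<in> L2 M"
proof -
  have "integrable M (\<lambda>\<omega>. (norm (Z \<omega>))\<^sup>2)"
  proof (rule Bochner_Integration.integrable_bound)
    show "integrable M (\<lambda>\<omega>. c\<^sup>2 * (norm (W \<omega>))\<^sup>2)"
      using assms(1) by (auto simp: L2_def)
    show "AE \<omega> in M. norm ((norm (Z \<omega>))\<^sup>2) \<le> norm (c\<^sup>2 * (norm (W \<omega>))\<^sup>2)"
    proof (intro AE_I2)
      fix \<omega>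
      have "(norm (Z \<omega>))\<^sup>2 \<le> (c * norm (W \<omega>))\<^sup>2"
        using assms(3) by (intro power_mono) auto
      then show "norm ((norm (Z \<omega>))\<^sup>2) \<le> norm (c\<^sup>2 * (norm (W \<omega>))\<^sup>2)"
        by (simp add: power_mult_distrib)
    qed
  qed (use assms in measurable)
  with assms(2) show ?thesis by (simp add: L2_def)
qed

lemma L2_bounded_linear:
  fixes Z :: "'w \<Rightarrow> 'b::{second_countable_topology,real_normed_vector}" and f :: "'b \<Rightarrow> 'c::{second_countable_topology,real_normed_vector}"
  assumes "bounded_linear f" "Z \<in> L2 M"
  shows "(\<lambda>\<omega>. f (Z \<omega>)) \<in> L2 M"
proof -
  obtain K where "\<And>x. norm (f x) \<le> norm x * K" using bounded_linear.bounded[OF assms(1)] by blast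
  moreover have "f \<in> borel_measurable borel"
    using assms(1) by (intro borel_measurable_continuous_onI linear_continuous_on)
  ultimately show ?thesis
    using assms(2) by (intro L2_bounded_by[OF assms(2), of _ K]) (auto simp: mult.commute)
qed

lemma L2_norm: "(Z :: _ \<Rightarrow> 'b::{second_countable_topology,real_normed_vector}) \<in> L2 M \<Longrightarrow> (\<lambda>\<omega>. norm (Z \<omega>)) \<in> L2 M"
  by (auto simp: L2_def)

lemma L2_0 [simp]: "(\<lambda>\<omega>. 0) \<in> L2 M"
  by (simp add: L2_def)

lemma L2_add:
  fixes Z W :: "'w \<Rightarrow> 'b::{second_countable_topology,real_normed_vector}"
  assumes "Z \<in> L2 M" "W \<in> L2 M"
  shows "(\<lambda>\<omega>. Z \<omega> + W \<omega>) \<in> L2 M"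
proof -
  have "integrable M (\<lambda>\<omega>. (norm (Z \<omega> + W \<omega>))\<^sup>2)"
  proof (rule Bochner_Integration.integrable_bound)
    show "integrable M (\<lambda>\<omega>. 2 * (norm (Z \<omega>))\<^sup>2 + 2 * (norm (W \<omega>))\<^sup>2)"
      using assms by (auto simp: L2_def)
    show "AE \<omega> in M. norm ((norm (Z \<omega> + W \<omega>))\<^sup>2) \<le> norm (2 * (norm (Z \<omega>))\<^sup>2 + 2 * (norm (W \<omega>))\<^sup>2)"
    proof (intro AE_I2)
      fix \<omega>
      have "(norm (Z \<omega> + W \<omega>))\<^sup>2 \<le> (norm (Z \<omega>) + norm (W \<omega>))\<^sup>2"
        by (intro power_mono norm_triangle_ineq norm_ge_zero)
      also have "\<dots> \<le> 2 * (norm (Z \<omega>))\<^sup>2 + 2 * (norm (W \<omega>))\<^sup>2"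
        using zero_le_power2[of "norm (Z \<omega>) - norm (W \<omega>)"] by (simp add: power2_sum power2_diff)
      finally show "norm ((norm (Z \<omega> + W \<omega>))\<^sup>2) \<le> norm (2 * (norm (Z \<omega>))\<^sup>2 + 2 * (norm (W \<omega>))\<^sup>2)"
        by simp
    qed
  qed (use assms in measurable)
  moreover have "(\<lambda>\<omega>. Z \<omega> + W \<omega>) \<in> borel_measurable M"
    using assms by measurable
  ultimately show ?thesis by (simp add: L2_def)
qed

lemma L2_scaleR:
  fixes Z :: "'w \<Rightarrow> 'b::{second_countable_topology,real_normed_vector}"
  shows "Z \<in> L2 M \<Longrightarrow> (\<lambda>\<omega>. c *\<^sub>R Z \<omega>) \<in> L2 M"
  by (rule L2_bounded_linear[OF bounded_linear_scaleR_right])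

lemma L2_mult_left:
  fixes Z :: "'w \<Rightarrow> 'b::{second_countable_topology,real_normed_algebra}"
  shows "Z \<in> L2 M \<Longrightarrow> (\<lambda>\<omega>. c * Z \<omega>) \<in> L2 M"
  by (rule L2_bounded_linear[OF bounded_linear_mult_right])

lemma L2_diff:
  fixes Z W :: "'w \<Rightarrow> 'b::{second_countable_topology,real_normed_vector}"
  assumes "Z \<in> L2 M" "W \<in> L2 M"
  shows "(\<lambda>\<omega>. Z \<omega> - W \<omega>) \<in> L2 M"
  using L2_add[OF assms(1) L2_scaleR[OF assms(2), of "-1"]] by simp

lemma L2_sum:
  fixes Z :: "'i \<Rightarrow> 'w \<Rightarrow> 'b::{second_countable_topology,real_normed_vector}"
  shows "(\<And>i. i \<in> I \<Longrightarrow> Z i \<in> L2 M) \<Longrightarrow> (\<lambda>\<omega>. \<Sum>i\<in>I. Z i \<omega>) \<in> L2 M"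
  by (induction I rule: infinite_finite_induct) (simp_all add: L2_add)

lemma L2_of_real: "Z \<in> L2 M \<Longrightarrow> (\<lambda>\<omega>. complex_of_real (Z \<omega>)) \<in> L2 M"
  by (auto simp: L2_def)

lemma L2_cong_AE:
  assumes "Z \<in> L2 M" "W \<in> borel_measurable M" "AE \<omega> in M. Z \<omega> = W \<omega>"
  shows "(W :: 'w \<Rightarrow> 'b::{second_countable_topology,real_normed_vector}) \<in> L2 M"
proof -
  have "integrable M (\<lambda>\<omega>. (norm (W \<omega>))\<^sup>2) = integrable M (\<lambda>\<omega>. (norm (Z \<omega>))\<^sup>2)"
    using assms by (intro integrable_cong_AE) (auto simp: L2_def)
  then show ?thesis using assms by (simp add: L2_def)
qed

lemma l2norm_cong_AE:
  fixes Z W :: "'w \<Rightarrow> 'b::{second_countable_topology,real_normed_vector}"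
  assumes "Z \<in> borel_measurable M" "W \<in> borel_measurable M" "AE \<omega> in M. Z \<omega> = W \<omega>"
  shows "l2norm M Z = l2norm M W"
  unfolding l2norm_def using assms by (intro arg_cong[of _ _ sqrt] integral_cong_AE) auto

lemma l2inner_cong_AE:
  fixes Z W :: "'w \<Rightarrow> 'b::euclidean_space"
  assumes "Z \<in> borel_measurable M" "W \<in> borel_measurable M" "U \<in> borel_measurable M" "AE \<omega> in M. Z \<omega> = W \<omega>"
  shows "l2inner M Z U = l2inner M W U"
  unfolding l2inner_def using assms by (intro integral_cong_AE) auto

lemma L2_inner_integrable:
  fixes Z W :: "'w \<Rightarrow> 'b::euclidean_space"
  assumes "Z \<in> L2 M" "W \<in> L2 M"
  shows "integrable M (\<lambda>\<omega>. Z \<omega> \<bullet> W \<omega>)"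
proof (rule Bochner_Integration.integrable_bound)
  show "integrable M (\<lambda>\<omega>. (norm (Z \<omega>))\<^sup>2 + (norm (W \<omega>))\<^sup>2)"
    using assms by (auto simp: L2_def)
  show "AE \<omega> in M. norm (Z \<omega> \<bullet> W \<omega>) \<le> norm ((norm (Z \<omega>))\<^sup>2 + (norm (W \<omega>))\<^sup>2)"
  proof (intro AE_I2)
    fix \<omega>
    have "norm (Z \<omega> \<bullet> W \<omega>) \<le> norm (Z \<omega>) * norm (W \<omega>)"
      using Cauchy_Schwarz_ineq2 by auto
    also have "\<dots> \<le> (norm (Z \<omega>))\<^sup>2 + (norm (W \<omega>))\<^sup>2"
      using zero_le_power2[of "norm (Z \<omega>) - norm (W \<omega>)"]
        mult_nonneg_nonneg[OF norm_ge_zero[of "Z \<omega>"] norm_ge_zero[of "W \<omega>"]]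
      unfolding power2_diff by linarith
    finally show "norm (Z \<omega> \<bullet> W \<omega>) \<le> norm ((norm (Z \<omega>))\<^sup>2 + (norm (W \<omega>))\<^sup>2)"
      by simp
  qed
qed (use assms in measurable)

lemma l2inner_commute: "l2inner M Z W = l2inner M W Z"
  by (simp add: l2inner_def inner_commute)

lemma l2inner_add_left:
  fixes Z W U :: "'w \<Rightarrow> 'b::euclidean_space"
  shows "Z \<in> L2 M \<Longrightarrow> W \<in> L2 M \<Longrightarrow> U \<in> L2 M \<Longrightarrow> l2inner M (\<lambda>\<omega>. Z \<omega> + W \<omega>) U = l2inner M Z U + l2inner M W U"
  by (simp add: l2inner_def inner_add_left L2_inner_integrable)

lemma l2inner_diff_left:
  fixes Z W U :: "'w \<Rightarrow> 'b::euclidean_space"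
  shows "Z \<in> L2 M \<Longrightarrow> W \<in> L2 M \<Longrightarrow> U \<in> L2 M \<Longrightarrow> l2inner M (\<lambda>\<omega>. Z \<omega> - W \<omega>) U = l2inner M Z U - l2inner M W U"
  by (simp add: l2inner_def inner_diff_left L2_inner_integrable)

lemma l2inner_scaleR_left: "l2inner M (\<lambda>\<omega>. c *\<^sub>R Z \<omega>) U = c * l2inner M Z U"
  by (simp add: l2inner_def)

lemma l2inner_sum_left:
  fixes Z :: "'i \<Rightarrow> 'w \<Rightarrow> 'b::euclidean_space"
  shows "(\<And>i. i \<in> I \<Longrightarrow> Z i \<in> L2 M) \<Longrightarrow> U \<in> L2 M \<Longrightarrow> l2inner M (\<lambda>\<omega>. \<Sum>i\<in>I. Z i \<omega>) U = (\<Sum>i\<in>I. l2inner M (Z i) U)"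
  by (simp add: l2inner_def inner_sum_left L2_inner_integrable)

text \<open>The quadratic function x -> ||xZ - W||^2 is nonnegative; its value at the minimum r/p
  gives the inequality.\<close>

lemma l2inner_Cauchy_Schwarz:
  fixes Z W :: "'w \<Rightarrow> 'b::euclidean_space"
  assumes Z: "Z \<in> L2 M" and W: "W \<in> L2 M"
  shows "\<bar>l2inner M Z W\<bar> \<le> l2norm M Z * l2norm M W"
proof -
  define p r s where "p = (l2norm M Z)\<^sup>2" and "r = l2inner M Z W" and "s = (l2norm M W)\<^sup>2"
  have q: "0 \<le> x\<^sup>2 * p - 2 * x * r + s" for x :: real
  proof -
    have xZ: "(\<lambda>\<omega>. x *\<^sub>R Z \<omega>) \<in> L2 M" by (rule L2_scaleR[OF Z])
    have d: "(\<lambda>\<omega>. x *\<^sub>R Z \<omega> - W \<omega>) \<in> L2 M" by (rule L2_diff[OF xZ W])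
    have "(l2norm M (\<lambda>\<omega>. x *\<^sub>R Z \<omega> - W \<omega>))\<^sup>2
      = l2inner M (\<lambda>\<omega>. x *\<^sub>R Z \<omega>) (\<lambda>\<omega>. x *\<^sub>R Z \<omega> - W \<omega>) - l2inner M W (\<lambda>\<omega>. x *\<^sub>R Z \<omega> - W \<omega>)"
      unfolding l2norm_eq_inner by (rule l2inner_diff_left[OF xZ W d])
    also have "l2inner M (\<lambda>\<omega>. x *\<^sub>R Z \<omega>) (\<lambda>\<omega>. x *\<^sub>R Z \<omega> - W \<omega>) = x * l2inner M (\<lambda>\<omega>. x *\<^sub>R Z \<omega> - W \<omega>) Z"
      by (simp only: l2inner_scaleR_left l2inner_commute[of M Z "\<lambda>\<omega>. x *\<^sub>R Z \<omega> - W \<omega>"])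
    also have "l2inner M (\<lambda>\<omega>. x *\<^sub>R Z \<omega> - W \<omega>) Z = x * p - r"
      by (simp only: l2inner_diff_left[OF xZ W Z] l2inner_scaleR_left p_def r_def l2norm_eq_inner l2inner_commute[of M W Z])
    also have "l2inner M W (\<lambda>\<omega>. x *\<^sub>R Z \<omega> - W \<omega>) = l2inner M (\<lambda>\<omega>. x *\<^sub>R Z \<omega> - W \<omega>) W"
      by (rule l2inner_commute)
    also have "\<dots> = x * r - s"
      by (simp only: l2inner_diff_left[OF xZ W W] l2inner_scaleR_left s_def r_def l2norm_eq_inner)
    finally have "x * (x * p - r) - (x * r - s) \<ge> 0" by (metis zero_le_power2)
    then show ?thesis by (simp add: algebra_simps power2_eq_square)
  qed
  have "r\<^sup>2 \<le> p * s"
  proof (cases "p = 0")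
    case True
    have "r = 0"
    proof (rule ccontr)
      assume "r \<noteq> 0"
      \<comment> \<open>For p = 0 the function is affine, and at this point its value is -1.\<close>
      with q[of "(s + 1) / (2 * r)"] True show False by (simp add: field_simps)
    qed
    then show ?thesis using True by simp
  next
    case False
    then have "p > 0" by (simp add: p_def)
    have "0 \<le> (r / p)\<^sup>2 * p - 2 * (r / p) * r + s" by (rule q)
    also have "\<dots> = s - r\<^sup>2 / p" using False by (simp add: field_simps power2_eq_square)
    finally show ?thesis using \<open>p > 0\<close> by (simp add: field_simps)
  qed
  then have "sqrt (r\<^sup>2) \<le> sqrt (p * s)" by (rule real_sqrt_le_mono)
  then show ?thesis by (simp add: real_sqrt_mult p_def s_def r_def)
qed

lemma l2norm_triangle:
  fixes Z W :: "'w \<Rightarrow> 'b::euclidean_space"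
  assumes Z: "Z \<in> L2 M" and W: "W \<in> L2 M"
  shows "l2norm M (\<lambda>\<omega>. Z \<omega> + W \<omega>) \<le> l2norm M Z + l2norm M W"
proof -
  have ZW: "(\<lambda>\<omega>. Z \<omega> + W \<omega>) \<in> L2 M" by (rule L2_add[OF Z W])
  have "(l2norm M (\<lambda>\<omega>. Z \<omega> + W \<omega>))\<^sup>2 = l2inner M Z (\<lambda>\<omega>. Z \<omega> + W \<omega>) + l2inner M W (\<lambda>\<omega>. Z \<omega> + W \<omega>)"
    unfolding l2norm_eq_inner by (rule l2inner_add_left[OF Z W ZW])
  also have "\<dots> \<le> (l2norm M Z + l2norm M W) * l2norm M (\<lambda>\<omega>. Z \<omega> + W \<omega>)"
    using l2inner_Cauchy_Schwarz[OF Z ZW] l2inner_Cauchy_Schwarz[OF W ZW] by (simp add: distrib_right)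
  finally have "l2norm M (\<lambda>\<omega>. Z \<omega> + W \<omega>) * l2norm M (\<lambda>\<omega>. Z \<omega> + W \<omega>) \<le> (l2norm M Z + l2norm M W) * l2norm M (\<lambda>\<omega>. Z \<omega> + W \<omega>)"
    by (simp add: power2_eq_square)
  then show ?thesis
    by (cases "l2norm M (\<lambda>\<omega>. Z \<omega> + W \<omega>) = 0") (auto simp: mult_le_cancel_right less_le)
qed

lemma l2norm_scaleR: "l2norm M (\<lambda>\<omega>. c *\<^sub>R Z \<omega>) = \<bar>c\<bar> * l2norm M Z"
  by (simp add: l2norm_def power_mult_distrib real_sqrt_mult)

lemma l2norm_mult_left: "l2norm M (\<lambda>\<omega>. c * (Z \<omega> :: 'b::real_normed_div_algebra)) = norm c * l2norm M Z"
  by (simp add: l2norm_def norm_mult power_mult_distrib real_sqrt_mult)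

lemma l2norm_0 [simp]: "l2norm M (\<lambda>\<omega>. 0) = 0"
  by (simp add: l2norm_def)

lemma l2norm_of_real [simp]: "l2norm M (\<lambda>\<omega>. complex_of_real (Z \<omega>)) = l2norm M Z"
  by (simp add: l2norm_def)

lemma l2norm_diff:
  fixes Z W :: "'w \<Rightarrow> 'b::euclidean_space"
  assumes "Z \<in> L2 M" "W \<in> L2 M"
  shows "l2norm M (\<lambda>\<omega>. Z \<omega> - W \<omega>) \<le> l2norm M Z + l2norm M W"
  using l2norm_triangle[OF assms(1) L2_scaleR[OF assms(2), of "-1"]] l2norm_scaleR[of M "-1" W] by simp

lemma l2norm_minus_commute: "l2norm M (\<lambda>\<omega>. Z \<omega> - W \<omega>) = l2norm M (\<lambda>\<omega>. W \<omega> - Z \<omega>)"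
  by (simp add: l2norm_def norm_minus_commute)

lemma l2norm_sum:
  fixes Z :: "'i \<Rightarrow> 'w \<Rightarrow> 'b::euclidean_space"
  assumes "\<And>i. i \<in> I \<Longrightarrow> Z i \<in> L2 M"
  shows "l2norm M (\<lambda>\<omega>. \<Sum>i\<in>I. Z i \<omega>) \<le> (\<Sum>i\<in>I. l2norm M (Z i))"
  using assms
proof (induction I rule: infinite_finite_induct)
  case (insert i I)
  then have "l2norm M (\<lambda>\<omega>. Z i \<omega> + (\<Sum>i\<in>I. Z i \<omega>)) \<le> l2norm M (Z i) + l2norm M (\<lambda>\<omega>. \<Sum>i\<in>I. Z i \<omega>)"
    by (intro l2norm_triangle L2_sum) auto
  with insert show ?case by simp
qed simp_all

lemma l2norm_le_norm:
  fixes Z :: "'w \<Rightarrow> 'b::euclidean_space" and W :: "'w \<Rightarrow> 'c::euclidean_space"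
  assumes "Z \<in> L2 M" "W \<in> L2 M" "\<And>\<omega>. norm (Z \<omega>) \<le> norm (W \<omega>)"
  shows "l2norm M Z \<le> l2norm M W"
  unfolding l2norm_def using assms
  by (intro real_sqrt_le_mono integral_mono power_mono L2_integrable_power2) auto

lemma l2norm_eq_0:
  fixes Z :: "'w \<Rightarrow> 'b::euclidean_space"
  assumes "Z \<in> L2 M" "l2norm M Z = 0"
  shows "AE \<omega> in M. Z \<omega> = 0"
proof -
  have "(LINT \<omega>|M. (norm (Z \<omega>))\<^sup>2) = 0"
    using assms(2) by (simp flip: l2norm_power2)
  then have "AE \<omega> in M. (norm (Z \<omega>))\<^sup>2 = 0"
    using integral_nonneg_eq_0_iff_AE[OF L2_integrable_power2[OF assms(1)]] by simp
  then show ?thesis by simp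
qed

text \<open>The test function Z - W suffices. The lemma identifies a random variable by scalar data,
  so that an identity between random integrals can be reduced to real calculus.\<close>

lemma AE_eq_if_l2inner_eq:
  fixes Z W :: "'w \<Rightarrow> 'b::euclidean_space"
  assumes "Z \<in> L2 M" "W \<in> L2 M" "\<And>U. U \<in> L2 M \<Longrightarrow> l2inner M Z U = l2inner M W U"
  shows "AE \<omega> in M. Z \<omega> = W \<omega>"
proof -
  have D: "(\<lambda>\<omega>. Z \<omega> - W \<omega>) \<in> L2 M" using assms by (intro L2_diff)
  have "(l2norm M (\<lambda>\<omega>. Z \<omega> - W \<omega>))\<^sup>2 = 0"
    unfolding l2norm_eq_inner using assms(3)[OF D] by (simp add: l2inner_diff_left assms D)
  then show ?thesis using l2norm_eq_0[OF D] by simp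
qed

lemma ms_lim_iff_l2norm:
  fixes Z :: "'i \<Rightarrow> 'w \<Rightarrow> 'b::euclidean_space"
  shows "ms_lim M F Z W \<longleftrightarrow> W \<in> L2 M \<and> (\<forall>\<^sub>F h in F. Z h \<in> L2 M) \<and>
     ((\<lambda>h. l2norm M (\<lambda>\<omega>. Z h \<omega> - W \<omega>)) \<longlongrightarrow> 0) F"
proof -
  have "((\<lambda>h. l2norm M (\<lambda>\<omega>. Z h \<omega> - W \<omega>)) \<longlongrightarrow> 0) F \<longleftrightarrow> ((\<lambda>h. (l2norm M (\<lambda>\<omega>. Z h \<omega> - W \<omega>))\<^sup>2) \<longlongrightarrow> 0) F"
    using tendsto_power[of "\<lambda>h. l2norm M (\<lambda>\<omega>. Z h \<omega> - W \<omega>)" 0 F 2]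
      tendsto_real_sqrt[of "\<lambda>h. (l2norm M (\<lambda>\<omega>. Z h \<omega> - W \<omega>))\<^sup>2" 0 F]
    by auto
  then show ?thesis unfolding ms_lim_def l2norm_power2 by auto
qed

lemma ms_lim_unique:
  fixes Z :: "'i \<Rightarrow> 'w \<Rightarrow> 'b::euclidean_space"
  assumes "ms_lim M F Z W" "ms_lim M F Z W'" "F \<noteq> bot"
  shows "AE \<omega> in M. W \<omega> = W' \<omega>"
proof -
  have W: "W \<in> L2 M" "W' \<in> L2 M" and Z: "\<forall>\<^sub>F h in F. Z h \<in> L2 M"
    using assms by (auto simp: ms_lim_iff_l2norm)
  have "((\<lambda>h. l2norm M (\<lambda>\<omega>. Z h \<omega> - W \<omega>) + l2norm M (\<lambda>\<omega>. Z h \<omega> - W' \<omega>)) \<longlongrightarrow> 0 + 0) F"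
    using assms by (intro tendsto_add) (auto simp: ms_lim_iff_l2norm)
  moreover have "\<forall>\<^sub>F h in F. l2norm M (\<lambda>\<omega>. W \<omega> - W' \<omega>) \<le> l2norm M (\<lambda>\<omega>. Z h \<omega> - W \<omega>) + l2norm M (\<lambda>\<omega>. Z h \<omega> - W' \<omega>)"
    using Z
  proof eventually_elim
    case (elim h)
    from l2norm_diff[OF L2_diff[OF elim W(2)] L2_diff[OF elim W(1)]] show ?case by simp
  qed
  ultimately have "l2norm M (\<lambda>\<omega>. W \<omega> - W' \<omega>) \<le> 0 + 0"
    using assms(3) by (intro tendsto_lowerbound)
  then show ?thesis using l2norm_eq_0[OF L2_diff[OF W]] by (simp add: antisym)
qed

lemma ms_lim_const: "W \<in> L2 M \<Longrightarrow> ms_lim M F (\<lambda>_. W) W"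
  by (simp add: ms_lim_def)

lemma ms_lim_add:
  fixes Z Z' :: "'i \<Rightarrow> 'w \<Rightarrow> 'b::euclidean_space"
  assumes "ms_lim M F Z W" "ms_lim M F Z' W'"
  shows "ms_lim M F (\<lambda>h \<omega>. Z h \<omega> + Z' h \<omega>) (\<lambda>\<omega>. W \<omega> + W' \<omega>)"
proof -
  have W: "W \<in> L2 M" "W' \<in> L2 M" and Z: "\<forall>\<^sub>F h in F. Z h \<in> L2 M" "\<forall>\<^sub>F h in F. Z' h \<in> L2 M"
    using assms by (auto simp: ms_lim_iff_l2norm)
  have "((\<lambda>h. l2norm M (\<lambda>\<omega>. Z h \<omega> - W \<omega>) + l2norm M (\<lambda>\<omega>. Z' h \<omega> - W' \<omega>)) \<longlongrightarrow> 0 + 0) F"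
    using assms by (intro tendsto_add) (auto simp: ms_lim_iff_l2norm)
  moreover have "\<forall>\<^sub>F h in F. norm (l2norm M (\<lambda>\<omega>. (Z h \<omega> + Z' h \<omega>) - (W \<omega> + W' \<omega>))) \<le> l2norm M (\<lambda>\<omega>. Z h \<omega> - W \<omega>) + l2norm M (\<lambda>\<omega>. Z' h \<omega> - W' \<omega>)"
    using Z
  proof eventually_elim
    case (elim h)
    from l2norm_triangle[OF L2_diff[OF elim(1) W(1)] L2_diff[OF elim(2) W(2)]] show ?case
      by (simp add: add_diff_add)
  qed
  ultimately have "((\<lambda>h. l2norm M (\<lambda>\<omega>. (Z h \<omega> + Z' h \<omega>) - (W \<omega> + W' \<omega>))) \<longlongrightarrow> 0) F"
    by (simp add: Lim_null_comparison)
  then show ?thesis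
    unfolding ms_lim_iff_l2norm using W eventually_conj[OF Z]
    by (auto intro: L2_add elim: eventually_mono)
qed

lemma l2norm_bounded_linear:
  fixes f :: "'b::euclidean_space \<Rightarrow> 'c::euclidean_space"
  assumes "bounded_linear f"
  obtains K where "K \<ge> 0" "\<And>(Z::'w \<Rightarrow> 'b) M. Z \<in> L2 M \<Longrightarrow> l2norm M (\<lambda>\<omega>. f (Z \<omega>)) \<le> K * l2norm M Z"
proof -
  obtain K where K: "K \<ge> 0" "\<And>x. norm (f x) \<le> norm x * K" using bounded_linear.nonneg_bounded[OF assms] by blast
  have "l2norm M (\<lambda>\<omega>. f (Z \<omega>)) \<le> K * l2norm M Z" if "Z \<in> L2 M" for Z :: "'w \<Rightarrow> 'b" and M
  proof -
    have "l2norm M (\<lambda>\<omega>. f (Z \<omega>)) \<le> l2norm M (\<lambda>\<omega>. K *\<^sub>R Z \<omega>)"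
      using that K by (intro l2norm_le_norm L2_scaleR L2_bounded_linear[OF assms]) (auto simp: mult.commute)
    then show ?thesis using K by (simp add: l2norm_scaleR)
  qed
  then show ?thesis using that K by blast
qed

lemma ms_lim_bounded_linear:
  fixes Z :: "'i \<Rightarrow> 'w \<Rightarrow> 'b::euclidean_space" and f :: "'b \<Rightarrow> 'c::euclidean_space"
  assumes "bounded_linear f" "ms_lim M F Z W"
  shows "ms_lim M F (\<lambda>h \<omega>. f (Z h \<omega>)) (\<lambda>\<omega>. f (W \<omega>))"
proof -
  obtain K where K: "K \<ge> 0" "\<And>(Z::'w \<Rightarrow> 'b) M. Z \<in> L2 M \<Longrightarrow> l2norm M (\<lambda>\<omega>. f (Z \<omega>)) \<le> K * l2norm M Z"
    using l2norm_bounded_linear[OF assms(1)] by blast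
  have W: "W \<in> L2 M" and Z: "\<forall>\<^sub>F h in F. Z h \<in> L2 M"
    using assms by (auto simp: ms_lim_iff_l2norm)
  have "((\<lambda>h. K * l2norm M (\<lambda>\<omega>. Z h \<omega> - W \<omega>)) \<longlongrightarrow> K * 0) F"
    using assms by (intro tendsto_mult tendsto_const) (auto simp: ms_lim_iff_l2norm)
  moreover have "\<forall>\<^sub>F h in F. norm (l2norm M (\<lambda>\<omega>. f (Z h \<omega>) - f (W \<omega>))) \<le> K * l2norm M (\<lambda>\<omega>. Z h \<omega> - W \<omega>)"
    using Z
  proof eventually_elim
    case (elim h)
    from K(2)[OF L2_diff[OF elim W]] show ?case
      by (simp add: linear_diff[OF bounded_linear.linear[OF assms(1)]])
  qed
  ultimately have "((\<lambda>h. l2norm M (\<lambda>\<omega>. f (Z h \<omega>) - f (W \<omega>))) \<longlongrightarrow> 0) F"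
    by (simp add: Lim_null_comparison)
  then show ?thesis
    unfolding ms_lim_iff_l2norm using W Z
    by (auto intro: L2_bounded_linear[OF assms(1)] elim: eventually_mono)
qed

lemma ms_lim_sum:
  fixes Z :: "'j \<Rightarrow> 'i \<Rightarrow> 'w \<Rightarrow> 'b::euclidean_space"
  assumes "\<And>j. j \<in> J \<Longrightarrow> ms_lim M F (Z j) (W j)"
  shows "ms_lim M F (\<lambda>h \<omega>. \<Sum>j\<in>J. Z j h \<omega>) (\<lambda>\<omega>. \<Sum>j\<in>J. W j \<omega>)"
  using assms by (induction J rule: infinite_finite_induct) (auto intro: ms_lim_const ms_lim_add)

text \<open>Moves a limit from explicit representatives to the versions chosen by
  \<open>SOME\<close>. The exceptional null set may depend on \<open>h\<close>.\<close>

lemma ms_lim_cong_AE: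
  fixes Z :: "'i \<Rightarrow> 'w \<Rightarrow> 'b::euclidean_space"
  assumes "ms_lim M F Z W" "\<forall>\<^sub>F h in F. Z' h \<in> borel_measurable M \<and> (AE \<omega> in M. Z h \<omega> = Z' h \<omega>)"
    "W' \<in> borel_measurable M" "AE \<omega> in M. W \<omega> = W' \<omega>"
  shows "ms_lim M F Z' W'"
proof -
  have W: "W \<in> L2 M" and Z: "\<forall>\<^sub>F h in F. Z h \<in> L2 M" and lim: "((\<lambda>h. l2norm M (\<lambda>\<omega>. Z h \<omega> - W \<omega>)) \<longlongrightarrow> 0) F"
    using assms by (auto simp: ms_lim_iff_l2norm)
  have W': "W' \<in> L2 M" using L2_cong_AE[OF W assms(3,4)] .
  have Z': "\<forall>\<^sub>F h in F. Z' h \<in> L2 M"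
    using Z assms(2) by eventually_elim (auto intro: L2_cong_AE)
  have "\<forall>\<^sub>F h in F. l2norm M (\<lambda>\<omega>. Z h \<omega> - W \<omega>) = l2norm M (\<lambda>\<omega>. Z' h \<omega> - W' \<omega>)"
    using Z assms(2)
  proof eventually_elim
    case (elim h)
    then have "AE \<omega> in M. Z h \<omega> = Z' h \<omega>" by blast
    then have "AE \<omega> in M. Z h \<omega> - W \<omega> = Z' h \<omega> - W' \<omega>" using assms(4) by eventually_elim simp
    then show ?case using elim W W' by (intro l2norm_cong_AE) (auto simp: L2_def)
  qed
  with lim have "((\<lambda>h. l2norm M (\<lambda>\<omega>. Z' h \<omega> - W' \<omega>)) \<longlongrightarrow> 0) F"
    by (rule Lim_transform_eventually)
  then show ?thesis using W' Z' by (simp add: ms_lim_iff_l2norm)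
qed

lemma tendsto_l2inner:
  fixes Z :: "'i \<Rightarrow> 'w \<Rightarrow> 'b::euclidean_space"
  assumes "ms_lim M F Z W" "U \<in> L2 M"
  shows "((\<lambda>h. l2inner M (Z h) U) \<longlongrightarrow> l2inner M W U) F"
proof -
  have W: "W \<in> L2 M" and Z: "\<forall>\<^sub>F h in F. Z h \<in> L2 M" and lim: "((\<lambda>h. l2norm M (\<lambda>\<omega>. Z h \<omega> - W \<omega>)) \<longlongrightarrow> 0) F"
    using assms by (auto simp: ms_lim_iff_l2norm)
  have "\<forall>\<^sub>F h in F. norm (l2inner M (Z h) U - l2inner M W U) \<le> l2norm M (\<lambda>\<omega>. Z h \<omega> - W \<omega>) * l2norm M U"
    using Z
  proof eventually_elim
    case (elim h)
    from l2inner_Cauchy_Schwarz[OF L2_diff[OF elim W] assms(2)] show ?case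
      by (simp add: l2inner_diff_left elim W assms)
  qed
  moreover have "((\<lambda>h. l2norm M (\<lambda>\<omega>. Z h \<omega> - W \<omega>) * l2norm M U) \<longlongrightarrow> 0 * l2norm M U) F"
    by (intro tendsto_mult lim tendsto_const)
  ultimately have "((\<lambda>h. l2inner M (Z h) U - l2inner M W U) \<longlongrightarrow> 0) F"
    by (simp add: Lim_null_comparison)
  then show ?thesis by (simp add: Lim_null[symmetric])
qed

lemma (in prob_space) nn_integral_norm_le_l2norm:
  fixes Z :: "'a \<Rightarrow> 'b::euclidean_space"
  assumes "Z \<in> L2 M"
  shows "(\<integral>\<^sup>+\<omega>. norm (Z \<omega>) \<partial>M) \<le> ennreal (l2norm M Z)"
proof -
  have n: "(\<lambda>\<omega>. norm (Z \<omega>)) \<in> L2 M" using assms by (rule L2_norm)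
  have one: "(\<lambda>\<omega>. 1::real) \<in> L2 M" by (simp add: L2_def)
  have i: "integrable M (\<lambda>\<omega>. norm (Z \<omega>))"
    using L2_inner_integrable[OF n one] by simp
  have "(\<integral>\<omega>. norm (Z \<omega>) \<partial>M) \<le> l2norm M (\<lambda>\<omega>. norm (Z \<omega>)) * l2norm M (\<lambda>\<omega>. 1::real)"
    using l2inner_Cauchy_Schwarz[OF n one] by (simp add: l2inner_def)
  also have "\<dots> = l2norm M Z" by (simp add: l2norm_def prob_space)
  finally show ?thesis
    by (subst nn_integral_eq_integral[OF i]) (auto intro: ennreal_leI)
qed

lemma (in prob_space) L2_integrable:
  fixes Z :: "'a \<Rightarrow> 'b::euclidean_space"
  assumes "Z \<in> L2 M"
  shows "integrable M Z"
proof (rule integrableI_bounded)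
  show "(\<integral>\<^sup>+\<omega>. norm (Z \<omega>) \<partial>M) < \<infinity>"
    using nn_integral_norm_le_l2norm[OF assms] by (simp add: le_less_trans ennreal_less_top)
qed (use assms in measurable)

lemma L2I_nn_integral:
  fixes Z :: "'a \<Rightarrow> 'b::euclidean_space"
  assumes [measurable]: "Z \<in> borel_measurable M" and "(\<integral>\<^sup>+\<omega>. ennreal ((norm (Z \<omega>))\<^sup>2) \<partial>M) \<le> ennreal c"
  shows "Z \<in> L2 M" "c \<ge> 0 \<Longrightarrow> l2norm M Z \<le> sqrt c"
proof -
  have i: "integrable M (\<lambda>\<omega>. (norm (Z \<omega>))\<^sup>2)"
    using assms(2) by (intro integrableI_bounded) (auto simp: le_less_trans ennreal_less_top)
  then show "Z \<in> L2 M" by (simp add: L2_def)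
  show "l2norm M Z \<le> sqrt c" if "c \<ge> 0"
    unfolding l2norm_def
    using nn_integral_eq_integral[OF i] assms(2) that by (simp add: ennreal_le_iff)
qed

lemma nn_integral_power2_l2norm:
  fixes Z :: "'a \<Rightarrow> 'b::euclidean_space"
  assumes "Z \<in> L2 M"
  shows "(\<integral>\<^sup>+\<omega>. ennreal ((norm (Z \<omega>))\<^sup>2) \<partial>M) = ennreal ((l2norm M Z)\<^sup>2)"
  unfolding l2norm_power2 using L2_integrable_power2[OF assms] by (intro nn_integral_eq_integral) auto

text \<open>Riesz-Fischer: along a fast subsequence the increments have L2 norms, hence L1 norms, at
  most 2^(-i), so they are almost surely summable and the subsequence converges. Fatou's lemma
  bounds the distance of the whole tail from that pointwise limit.\<close>

lemma (in prob_space) L2_complete: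
  fixes Z :: "nat \<Rightarrow> 'a \<Rightarrow> 'b::euclidean_space"
  assumes Z: "\<And>n. Z n \<in> L2 M"
    and Cauchy: "\<And>e. e > 0 \<Longrightarrow> \<exists>N. \<forall>m\<ge>N. \<forall>n\<ge>N. l2norm M (\<lambda>\<omega>. Z m \<omega> - Z n \<omega>) < e"
  obtains W where "W \<in> L2 M" "(\<lambda>n. l2norm M (\<lambda>\<omega>. Z n \<omega> - W \<omega>)) \<longlonglongrightarrow> 0"
proof -
  have [measurable]: "Z n \<in> borel_measurable M" for n using Z by measurable
  obtain N where N: "\<And>i m n. m \<ge> N i \<Longrightarrow> n \<ge> N i \<Longrightarrow> l2norm M (\<lambda>\<omega>. Z m \<omega> - Z n \<omega>) < (1/2) ^ i"
    using Cauchy[of "(1/2) ^ _"] by (metis zero_less_divide_1_iff zero_less_numeral zero_less_power)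
  \<comment> \<open>The partial sums make \<open>r\<close> monotone and at least \<open>N i\<close>;
    the summand \<open>i\<close> makes it unbounded.\<close>
  define r where "r i = (\<Sum>j\<le>i. N j) + i" for i
  have rN: "r i \<ge> N i" for i
    unfolding r_def using member_le_sum[of i "{..i}" N] by simp
  have r_mono: "r i \<le> r (Suc i)" for i by (simp add: r_def)
  have r_ge: "r i \<ge> i" for i by (simp add: r_def)
  define D where "D i \<omega> = Z (r (Suc i)) \<omega> - Z (r i) \<omega>" for i \<omega>
  have D: "D i \<in> L2 M" for i unfolding D_def by (intro L2_diff Z)
  have [measurable]: "D i \<in> borel_measurable M" for i using D by measurable
  have D_le: "l2norm M (D i) \<le> (1/2) ^ i" for i
    using N[of i "r (Suc i)" "r i"] rN[of i] r_mono[of i] by (simp add: D_def[abs_def])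
  have "(\<integral>\<^sup>+\<omega>. (\<Sum>i. ennreal (norm (D i \<omega>))) \<partial>M) = (\<Sum>i. \<integral>\<^sup>+\<omega>. ennreal (norm (D i \<omega>)) \<partial>M)"
    by (rule nn_integral_suminf) simp
  also have "\<dots> \<le> (\<Sum>i. ennreal ((1/2) ^ i))"
    by (intro suminf_le order.trans[OF nn_integral_norm_le_l2norm[OF D]] ennreal_leI D_le) simp_all
  also have "\<dots> = ennreal (\<Sum>i. (1/2) ^ i)"
    by (intro suminf_ennreal2) (auto simp: summable_geometric)
  also have "\<dots> < \<infinity>" by simp
  finally have "(\<integral>\<^sup>+\<omega>. (\<Sum>i. ennreal (norm (D i \<omega>))) \<partial>M) \<noteq> \<infinity>" by simp
  then have "AE \<omega> in M. (\<Sum>i. ennreal (norm (D i \<omega>))) \<noteq> \<infinity>"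
    by (intro nn_integral_PInf_AE) auto
  then have conv: "AE \<omega> in M. convergent (\<lambda>i. Z (r i) \<omega>)"
  proof eventually_elim
    case (elim \<omega>)
    then have "summable (\<lambda>i. norm (D i \<omega>))"
      by (intro summable_suminf_not_top) simp_all
    then have "summable (\<lambda>i. D i \<omega>)" by (rule summable_norm_cancel)
    then have "convergent (\<lambda>n. \<Sum>i<n. D i \<omega>)" by (simp add: summable_iff_convergent)
    moreover have "(\<Sum>i<n. D i \<omega>) = Z (r n) \<omega> - Z (r 0) \<omega>" for n
      unfolding D_def by (rule sum_lessThan_telescope)
    ultimately have "convergent (\<lambda>n. (Z (r n) \<omega> - Z (r 0) \<omega>) + Z (r 0) \<omega>)"
      by (intro convergent_add convergent_const) simp
    then show ?case by simp
  qed
  define W where "W \<omega> = lim (\<lambda>i. Z (r i) \<omega>)" for \<omega>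
  have [measurable]: "W \<in> borel_measurable M"
    unfolding W_def by measurable
  have lim: "AE \<omega> in M. (\<lambda>i. Z (r i) \<omega>) \<longlonglongrightarrow> W \<omega>"
    using conv by eventually_elim (simp add: W_def convergent_LIMSEQ_iff)
  have Fatou: "(\<integral>\<^sup>+\<omega>. ennreal ((norm (Z m \<omega> - W \<omega>))\<^sup>2) \<partial>M) \<le> ennreal (((1/2) ^ i)\<^sup>2)" if "m \<ge> N i" for m i
  proof -
    have "(\<integral>\<^sup>+\<omega>. ennreal ((norm (Z m \<omega> - W \<omega>))\<^sup>2) \<partial>M)
        = (\<integral>\<^sup>+\<omega>. liminf (\<lambda>n. ennreal ((norm (Z m \<omega> - Z (r n) \<omega>))\<^sup>2)) \<partial>M)"
      using lim
    proof (intro nn_integral_cong_AE, eventually_elim)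
      case (elim \<omega>)
      then have "(\<lambda>n. ennreal ((norm (Z m \<omega> - Z (r n) \<omega>))\<^sup>2)) \<longlonglongrightarrow> ennreal ((norm (Z m \<omega> - W \<omega>))\<^sup>2)"
        by (intro tendsto_intros)
      then show ?case by (rule lim_imp_Liminf[OF trivial_limit_sequentially, symmetric])
    qed
    also have "\<dots> \<le> liminf (\<lambda>n. \<integral>\<^sup>+\<omega>. ennreal ((norm (Z m \<omega> - Z (r n) \<omega>))\<^sup>2) \<partial>M)"
      by (rule nn_integral_liminf) simp
    also have "\<dots> \<le> ennreal (((1/2) ^ i)\<^sup>2)"
    proof (rule order.trans[OF Liminf_le_Limsup Limsup_bounded])
      show "\<forall>\<^sub>F n in sequentially. (\<integral>\<^sup>+\<omega>. ennreal ((norm (Z m \<omega> - Z (r n) \<omega>))\<^sup>2) \<partial>M) \<le> ennreal (((1/2) ^ i)\<^sup>2)"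
        using eventually_ge_at_top[of "N i"]
      proof eventually_elim
        case (elim n)
        have "l2norm M (\<lambda>\<omega>. Z m \<omega> - Z (r n) \<omega>) < (1/2) ^ i"
          using that elim r_ge[of n] by (intro N) auto
        then show ?case
          unfolding nn_integral_power2_l2norm[OF L2_diff[OF Z Z]]
          by (intro ennreal_leI power_mono) auto
      qed
    qed simp
    finally show ?thesis .
  qed
  have ZW: "(\<lambda>\<omega>. Z m \<omega> - W \<omega>) \<in> L2 M \<and> l2norm M (\<lambda>\<omega>. Z m \<omega> - W \<omega>) \<le> (1/2) ^ i" if "m \<ge> N i" for m i
    using L2I_nn_integral[OF _ Fatou[OF that]] by (simp add: real_sqrt_abs)
  have "W \<in> L2 M"
    using L2_diff[OF Z[of "N 0"], of "\<lambda>\<omega>. Z (N 0) \<omega> - W \<omega>"] ZW[of 0 "N 0"] by simp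
  moreover have "(\<lambda>n. l2norm M (\<lambda>\<omega>. Z n \<omega> - W \<omega>)) \<longlonglongrightarrow> 0"
  proof (rule LIMSEQ_I)
    fix e :: real assume "e > 0"
    then obtain i where "(1/2) ^ i < e" using real_arch_pow_inv[of e "1/2"] by auto
    then show "\<exists>n0. \<forall>n\<ge>n0. norm (l2norm M (\<lambda>\<omega>. Z n \<omega> - W \<omega>) - 0) < e"
      using ZW by (intro exI[of _ "N i"]) force
  qed
  ultimately show ?thesis using that by blast
qed

section \<open>Orthogonal projections\<close>

text \<open>The elements are functions, not equivalence classes. Closedness under
  \<open>l2norm\<close> includes closedness under modification on null sets, within measurable
  functions.\<close>

definition closed_subspace :: "'w measure \<Rightarrow> ('w \<Rightarrow> complex) set \<Rightarrow> bool" where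
  "closed_subspace M \<L> \<longleftrightarrow> \<L> \<subseteq> L2 M \<and> (\<lambda>_. 0) \<in> \<L> \<and>
     (\<forall>Z\<in>\<L>. \<forall>W\<in>\<L>. (\<lambda>\<omega>. Z \<omega> + W \<omega>) \<in> \<L>) \<and> (\<forall>Z\<in>\<L>. \<forall>c. (\<lambda>\<omega>. c * Z \<omega>) \<in> \<L>) \<and>
     (\<forall>Z\<in>L2 M. (\<forall>e>0. \<exists>W\<in>\<L>. l2norm M (\<lambda>\<omega>. Z \<omega> - W \<omega>) < e) \<longrightarrow> Z \<in> \<L>)"

lemma
  assumes "closed_subspace M \<L>"
  shows closed_subspace_L2: "Z \<in> \<L> \<Longrightarrow> Z \<in> L2 M"
    and closed_subspace_zero: "(\<lambda>_. 0) \<in> \<L>"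
    and closed_subspace_add: "Z \<in> \<L> \<Longrightarrow> W \<in> \<L> \<Longrightarrow> (\<lambda>\<omega>. Z \<omega> + W \<omega>) \<in> \<L>"
    and closed_subspace_mult: "Z \<in> \<L> \<Longrightarrow> (\<lambda>\<omega>. c * Z \<omega>) \<in> \<L>"
    and closed_subspace_closed: "Z \<in> L2 M \<Longrightarrow> (\<And>e. e > 0 \<Longrightarrow> \<exists>W\<in>\<L>. l2norm M (\<lambda>\<omega>. Z \<omega> - W \<omega>) < e) \<Longrightarrow> Z \<in> \<L>"
  using assms unfolding closed_subspace_def by blast+

lemma closed_subspace_sum:
  assumes "closed_subspace M \<L>" "\<And>i. i \<in> I \<Longrightarrow> Z i \<in> \<L>"
  shows "(\<lambda>\<omega>. \<Sum>i\<in>I. Z i \<omega>) \<in> \<L>"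
  using assms(2)
  by (induction I rule: infinite_finite_induct)
    (simp_all add: closed_subspace_zero[OF assms(1)] closed_subspace_add[OF assms(1)])

lemma closed_subspace_diff:
  assumes "closed_subspace M \<L>" "Z \<in> \<L>" "W \<in> \<L>"
  shows "(\<lambda>\<omega>. Z \<omega> - W \<omega>) \<in> \<L>"
  using closed_subspace_add[OF assms(1,2) closed_subspace_mult[OF assms(1,3), of "-1"]] by simp

lemma closed_subspace_ms_lim:
  assumes "closed_subspace M \<L>" "ms_lim M F Z W" "\<forall>\<^sub>F h in F. Z h \<in> \<L>" "F \<noteq> bot"
  shows "W \<in> \<L>"
proof -
  have W: "W \<in> L2 M" and lim: "((\<lambda>h. l2norm M (\<lambda>\<omega>. Z h \<omega> - W \<omega>)) \<longlongrightarrow> 0) F"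
    using assms by (auto simp: ms_lim_iff_l2norm)
  have "\<exists>V\<in>\<L>. l2norm M (\<lambda>\<omega>. W \<omega> - V \<omega>) < e" if "e > 0" for e
  proof -
    have "\<forall>\<^sub>F h in F. l2norm M (\<lambda>\<omega>. Z h \<omega> - W \<omega>) < e"
      using lim that by (rule order_tendstoD)
    with assms(3) have "\<forall>\<^sub>F h in F. Z h \<in> \<L> \<and> l2norm M (\<lambda>\<omega>. Z h \<omega> - W \<omega>) < e"
      by (rule eventually_conj)
    then obtain h where "Z h \<in> \<L>" "l2norm M (\<lambda>\<omega>. Z h \<omega> - W \<omega>) < e"
      using assms(4) eventually_happens' by blast
    then show ?thesis by (metis l2norm_minus_commute)
  qed
  then show ?thesis by (rule closed_subspace_closed[OF assms(1) W])
qed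

lemma closed_subspace_cong_AE:
  assumes "closed_subspace M \<L>" "Z \<in> \<L>" "W \<in> borel_measurable M" "AE \<omega> in M. Z \<omega> = W \<omega>"
  shows "W \<in> \<L>"
proof -
  have Z: "Z \<in> L2 M" by (rule closed_subspace_L2[OF assms(1,2)])
  have W: "W \<in> L2 M" using L2_cong_AE[OF Z assms(3,4)] .
  have "l2norm M (\<lambda>\<omega>. W \<omega> - Z \<omega>) = l2norm M (\<lambda>\<omega>. 0 :: complex)"
    using assms(4) Z W by (intro l2norm_cong_AE) (auto simp: L2_def)
  then show ?thesis
    using assms(2) by (intro closed_subspace_closed[OF assms(1) W] bexI[of _ Z]) simp_all
qed

text \<open>A minimising sequence is Cauchy by the parallelogram identity: midpoints stay in the
  subspace, so their squared distance from \<open>Z\<close> is at least the infimum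
  \<open>d\<close>.\<close>

lemma (in prob_space) nearest_point_exists:
  assumes L: "closed_subspace M \<L>" and Z: "Z \<in> L2 M"
  obtains W where "W \<in> \<L>" "\<And>V. V \<in> \<L> \<Longrightarrow> l2norm M (\<lambda>\<omega>. Z \<omega> - W \<omega>) \<le> l2norm M (\<lambda>\<omega>. Z \<omega> - V \<omega>)"
proof -
  have sub: "V \<in> L2 M" if "V \<in> \<L>" for V using closed_subspace_L2[OF L that] .
  note zero = closed_subspace_zero[OF L]
  define n2 where "n2 V = (l2norm M (\<lambda>\<omega>. Z \<omega> - V \<omega>))\<^sup>2" for V
  define d where "d = Inf (n2 ` \<L>)"
  have bdd: "bdd_below (n2 ` \<L>)" by (rule bdd_belowI[of _ 0]) (auto simp: n2_def)
  have d_le: "d \<le> n2 V" if "V \<in> \<L>" for V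
    unfolding d_def using that bdd by (intro cInf_lower) auto
  have "\<exists>V\<in>\<L>. n2 V < d + inverse (real (Suc n))" for n
  proof -
    have "Inf (n2 ` \<L>) < d + inverse (real (Suc n))" by (simp add: d_def)
    then show ?thesis using zero by (subst (asm) cInf_less_iff[OF _ bdd]) auto
  qed
  then obtain V where V: "\<And>n. V n \<in> \<L>" "\<And>n. n2 (V n) < d + inverse (real (Suc n))" by metis
  have par: "(l2norm M (\<lambda>\<omega>. V m \<omega> - V n \<omega>))\<^sup>2 \<le> 2 * n2 (V m) + 2 * n2 (V n) - 4 * d" for m n
  proof -
    have mid: "(\<lambda>\<omega>. (1/2) * (V m \<omega> + V n \<omega>)) \<in> \<L>"
      by (intro closed_subspace_mult[OF L] closed_subspace_add[OF L] V)
    have ident: "(norm (V m \<omega> - V n \<omega>))\<^sup>2 = 2 * (norm (Z \<omega> - V m \<omega>))\<^sup>2 + 2 * (norm (Z \<omega> - V n \<omega>))\<^sup>2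
        - 4 * (norm (Z \<omega> - (1/2) * (V m \<omega> + V n \<omega>)))\<^sup>2" for \<omega>
      unfolding cmod_power2 by (simp add: power2_eq_square algebra_simps)
    note int = L2_integrable_power2[OF L2_diff[OF Z sub]]
    have "(l2norm M (\<lambda>\<omega>. V m \<omega> - V n \<omega>))\<^sup>2 = 2 * n2 (V m) + 2 * n2 (V n) - 4 * n2 (\<lambda>\<omega>. (1/2) * (V m \<omega> + V n \<omega>))"
      unfolding n2_def l2norm_power2 ident
      using int[OF V(1)[of m]] int[OF V(1)[of n]] int[OF mid] by simp
    then show ?thesis using d_le[OF mid] by simp
  qed
  obtain W where W: "W \<in> L2 M" "(\<lambda>n. l2norm M (\<lambda>\<omega>. V n \<omega> - W \<omega>)) \<longlonglongrightarrow> 0"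
  proof (rule L2_complete[of V])
    show "\<exists>N. \<forall>m\<ge>N. \<forall>n\<ge>N. l2norm M (\<lambda>\<omega>. V m \<omega> - V n \<omega>) < e" if "e > 0" for e
    proof -
      \<comment> \<open>With both excesses over \<open>d\<close> below e^2/4, the bound
        \<open>par\<close> gives less than 2 e^2/4 + 2 e^2/4 = e^2.\<close>
      have "e\<^sup>2 / 4 > 0" using that by simp
      then obtain N where N: "inverse (real (Suc N)) < e\<^sup>2 / 4"
        using reals_Archimedean by blast
      have "l2norm M (\<lambda>\<omega>. V m \<omega> - V n \<omega>) < e" if mn: "m \<ge> N" "n \<ge> N" for m n
      proof -
        have "inverse (real (Suc m)) \<le> inverse (real (Suc N))" "inverse (real (Suc n)) \<le> inverse (real (Suc N))"
          using mn by (auto intro!: le_imp_inverse_le)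
        then have "(l2norm M (\<lambda>\<omega>. V m \<omega> - V n \<omega>))\<^sup>2 < e\<^sup>2"
          using par[of m n] V(2)[of m] V(2)[of n] N by linarith
        then show ?thesis by (rule power2_less_imp_less) (use \<open>e > 0\<close> in simp)
      qed
      then show ?thesis by blast
    qed
  qed (auto intro: sub V)
  have "ms_lim M sequentially V W" using W V sub by (auto simp: ms_lim_iff_l2norm)
  then have WL: "W \<in> \<L>" by (rule closed_subspace_ms_lim[OF L]) (auto simp: V)
  have "n2 W \<le> d"
  proof -
    have "l2norm M (\<lambda>\<omega>. Z \<omega> - W \<omega>) \<le> sqrt (d + inverse (real (Suc n))) + l2norm M (\<lambda>\<omega>. V n \<omega> - W \<omega>)" for n
    proof -
      have "l2norm M (\<lambda>\<omega>. Z \<omega> - W \<omega>) \<le> l2norm M (\<lambda>\<omega>. Z \<omega> - V n \<omega>) + l2norm M (\<lambda>\<omega>. V n \<omega> - W \<omega>)"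
        using l2norm_triangle[OF L2_diff[OF Z sub[OF V(1)[of n]]] L2_diff[OF sub[OF V(1)[of n]] W(1)]] by simp
      moreover have "l2norm M (\<lambda>\<omega>. Z \<omega> - V n \<omega>) \<le> sqrt (d + inverse (real (Suc n)))"
        using V(2)[of n] by (intro real_le_rsqrt) (simp add: n2_def)
      ultimately show ?thesis by simp
    qed
    moreover have "(\<lambda>n. sqrt (d + inverse (real (Suc n))) + l2norm M (\<lambda>\<omega>. V n \<omega> - W \<omega>)) \<longlonglongrightarrow> sqrt (d + 0) + 0"
      by (intro tendsto_intros W LIMSEQ_inverse_real_of_nat)
    ultimately have "l2norm M (\<lambda>\<omega>. Z \<omega> - W \<omega>) \<le> sqrt (d + 0) + 0"
      by (intro LIMSEQ_le_const) auto
    then have "n2 W \<le> (sqrt d)\<^sup>2"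
      unfolding n2_def by (intro power_mono) auto
    moreover have "d \<ge> 0" unfolding d_def using zero by (intro cInf_greatest) (auto simp: n2_def)
    ultimately show ?thesis by simp
  qed
  have "l2norm M (\<lambda>\<omega>. Z \<omega> - W \<omega>) \<le> l2norm M (\<lambda>\<omega>. Z \<omega> - U \<omega>)" if "U \<in> \<L>" for U
  proof -
    have "n2 W \<le> n2 U" using \<open>n2 W \<le> d\<close> d_le[OF that] by simp
    then show ?thesis unfolding n2_def by (rule power2_le_imp_le) simp
  qed
  with WL that show ?thesis by blast
qed

lemma integral_mult_cnj:
  assumes "Z \<in> L2 M" "U \<in> L2 M"
  shows "(LINT \<omega>|M. Z \<omega> * cnj (U \<omega>)) = Complex (l2inner M Z U) (l2inner M Z (\<lambda>\<omega>. \<i> * U \<omega>))"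
proof -
  have int: "integrable M (\<lambda>\<omega>. Z \<omega> * cnj (U \<omega>))"
  proof (rule Bochner_Integration.integrable_bound)
    show "integrable M (\<lambda>\<omega>. norm (Z \<omega>) \<bullet> norm (U \<omega>))"
      using assms by (intro L2_inner_integrable L2_norm)
    have [measurable]: "Z \<in> borel_measurable M" "U \<in> borel_measurable M" using assms by (auto simp: L2_def)
    show "(\<lambda>\<omega>. Z \<omega> * cnj (U \<omega>)) \<in> borel_measurable M"
      by (intro borel_measurable_times borel_measurable_continuous_on[of cnj] continuous_intros) auto
  qed (simp add: norm_mult)
  show ?thesis
    by (intro complex_eqI) (simp_all add: l2inner_def inner_complex_def algebra_simps flip: integral_Re[OF int] integral_Im[OF int])
qed

text \<open>The imaginary part of the Hermitian pairing with U is the real inner product with \<i>U,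
  which is again a member of the subspace.\<close>

lemma closed_subspace_orthogonal_complex:
  assumes "closed_subspace M \<L>" "D \<in> L2 M"
  shows "(\<forall>U\<in>\<L>. (LINT \<omega>|M. D \<omega> * cnj (U \<omega>)) = 0) \<longleftrightarrow> (\<forall>U\<in>\<L>. l2inner M D U = 0)"
  using integral_mult_cnj[OF assms(2) closed_subspace_L2[OF assms(1)]] closed_subspace_mult[OF assms(1)]
  by (auto simp: complex_eq_iff)

lemma (in prob_space) orth_proj_exists:
  assumes L: "closed_subspace M \<L>" and Z: "Z \<in> L2 M"
  shows "\<exists>W\<in>\<L>. \<forall>U\<in>\<L>. l2inner M (\<lambda>\<omega>. Z \<omega> - W \<omega>) U = 0"
proof -
  obtain W where W: "W \<in> \<L>" "\<And>V. V \<in> \<L> \<Longrightarrow> l2norm M (\<lambda>\<omega>. Z \<omega> - W \<omega>) \<le> l2norm M (\<lambda>\<omega>. Z \<omega> - V \<omega>)"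
    using nearest_point_exists[OF assms] by blast
  define D where "D \<omega> = Z \<omega> - W \<omega>" for \<omega>
  have D: "D \<in> L2 M" unfolding D_def by (intro L2_diff Z closed_subspace_L2[OF L] W)
  have "l2inner M D U = 0" if U: "U \<in> \<L>" for U
  proof -
    have UL: "U \<in> L2 M" by (rule closed_subspace_L2[OF L U])
    \<comment> \<open>The perturbation of \<open>W\<close> by x U would be optimal for x = r/u. The
      summand 1 avoids a case distinction for u = 0 and still leads to x^2 (u + 2) \<le> 0.\<close>
    define r u x where "r = l2inner M D U" and "u = (l2norm M U)\<^sup>2" and "x = r / (u + 1)"
    have u: "u \<ge> 0" by (simp add: u_def)
    have xU: "(\<lambda>\<omega>. x *\<^sub>R U \<omega>) \<in> L2 M" by (rule L2_scaleR[OF UL])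
    have "(\<lambda>\<omega>. W \<omega> + complex_of_real x * U \<omega>) \<in> \<L>"
      by (intro closed_subspace_add[OF L] closed_subspace_mult[OF L] W U)
    from W(2)[OF this] have "l2norm M D \<le> l2norm M (\<lambda>\<omega>. D \<omega> - x *\<^sub>R U \<omega>)"
      by (simp add: D_def[abs_def] algebra_simps scaleR_conv_of_real)
    then have "(l2norm M D)\<^sup>2 \<le> (l2norm M (\<lambda>\<omega>. D \<omega> - x *\<^sub>R U \<omega>))\<^sup>2"
      by (intro power_mono) auto
    also have "\<dots> = (l2norm M D)\<^sup>2 - 2 * x * r + x\<^sup>2 * u"
    proof -
      have d: "(\<lambda>\<omega>. D \<omega> - x *\<^sub>R U \<omega>) \<in> L2 M" by (rule L2_diff[OF D xU])
      have 1: "l2inner M D (\<lambda>\<omega>. D \<omega> - x *\<^sub>R U \<omega>) = (l2norm M D)\<^sup>2 - x * r"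
        by (simp only: l2inner_commute[of M D "\<lambda>\<omega>. D \<omega> - x *\<^sub>R U \<omega>"] l2inner_diff_left[OF D xU D]
            l2inner_scaleR_left l2norm_eq_inner r_def l2inner_commute[of M U D])
      have 2: "l2inner M U (\<lambda>\<omega>. D \<omega> - x *\<^sub>R U \<omega>) = r - x * u"
        by (simp only: l2inner_commute[of M U "\<lambda>\<omega>. D \<omega> - x *\<^sub>R U \<omega>"] l2inner_diff_left[OF D xU UL]
            l2inner_scaleR_left l2norm_eq_inner r_def u_def)
      show ?thesis
        unfolding l2norm_eq_inner[of M "\<lambda>\<omega>. D \<omega> - x *\<^sub>R U \<omega>"] l2inner_diff_left[OF D xU d] l2inner_scaleR_left 1 2
        by (simp add: algebra_simps power2_eq_square)
    qed
    finally have "2 * x * r \<le> x\<^sup>2 * u" by simp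
    moreover have "r = x * (u + 1)" using u by (simp add: x_def)
    ultimately have "x\<^sup>2 * (u + 2) \<le> 0" by (simp add: power2_eq_square algebra_simps)
    then have "x = 0" using u by (simp add: mult_le_0_iff not_le)
    then show ?thesis using \<open>r = x * (u + 1)\<close> by (simp add: r_def)
  qed
  then show ?thesis using W(1) unfolding D_def by blast
qed

lemma (in prob_space)
  assumes L: "closed_subspace M \<L>" and Z: "Z \<in> L2 M"
  shows orth_proj_in: "orth_proj M \<L> Z \<in> \<L>"
    and orth_proj_orthogonal: "U \<in> \<L> \<Longrightarrow> l2inner M (\<lambda>\<omega>. Z \<omega> - orth_proj M \<L> Z \<omega>) U = 0"
proof -
  have D: "(\<lambda>\<omega>. Z \<omega> - W \<omega>) \<in> L2 M" if "W \<in> \<L>" for W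
    by (intro L2_diff Z closed_subspace_L2[OF L] that)
  have "\<exists>W. W \<in> \<L> \<and> (\<forall>U\<in>\<L>. (LINT \<omega>|M. (Z \<omega> - W \<omega>) * cnj (U \<omega>)) = 0)"
    using orth_proj_exists[OF L Z] closed_subspace_orthogonal_complex[OF L D] by blast
  then have P: "orth_proj M \<L> Z \<in> \<L> \<and> (\<forall>U\<in>\<L>. (LINT \<omega>|M. (Z \<omega> - orth_proj M \<L> Z \<omega>) * cnj (U \<omega>)) = 0)"
    unfolding orth_proj_def by (rule someI_ex)
  then show "orth_proj M \<L> Z \<in> \<L>" by blast
  with P closed_subspace_orthogonal_complex[OF L D]
  show "U \<in> \<L> \<Longrightarrow> l2inner M (\<lambda>\<omega>. Z \<omega> - orth_proj M \<L> Z \<omega>) U = 0" by blast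
qed

text \<open>The difference Z - Z' has to agree with \<open>W\<close> only when tested against the
  subspace. A component of the difference orthogonal to the subspace thus does not enter the bound,
  however large it is.\<close>

lemma (in prob_space) orth_proj_contraction:
  assumes L: "closed_subspace M \<L>" and Z: "Z \<in> L2 M" "Z' \<in> L2 M" "W \<in> L2 M"
    and orth: "\<And>U. U \<in> \<L> \<Longrightarrow> l2inner M (\<lambda>\<omega>. Z \<omega> - Z' \<omega>) U = l2inner M W U"
  shows "l2norm M (\<lambda>\<omega>. orth_proj M \<L> Z \<omega> - orth_proj M \<L> Z' \<omega>) \<le> l2norm M W"
proof -
  define D where "D \<omega> = orth_proj M \<L> Z \<omega> - orth_proj M \<L> Z' \<omega>" for \<omega>
  note P = orth_proj_in[OF L Z(1)] orth_proj_in[OF L Z(2)]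
  note PL = P[THEN closed_subspace_L2[OF L]]
  have D: "D \<in> \<L>" unfolding D_def by (intro closed_subspace_diff[OF L] P)
  have DL: "D \<in> L2 M" by (rule closed_subspace_L2[OF L D])
  have "l2inner M Z D = l2inner M (orth_proj M \<L> Z) D" "l2inner M Z' D = l2inner M (orth_proj M \<L> Z') D"
    using orth_proj_orthogonal[OF L Z(1) D] orth_proj_orthogonal[OF L Z(2) D]
    by (simp_all add: l2inner_diff_left Z PL DL)
  then have "(l2norm M D)\<^sup>2 = l2inner M (\<lambda>\<omega>. Z \<omega> - Z' \<omega>) D"
    unfolding l2norm_eq_inner by (subst (1) D_def[abs_def]) (simp add: l2inner_diff_left Z PL DL)
  also have "\<dots> = l2inner M W D" by (rule orth[OF D])
  also have "\<dots> \<le> l2norm M W * l2norm M D" using l2inner_Cauchy_Schwarz[OF Z(3) DL] by simp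
  finally have le: "l2norm M D * l2norm M D \<le> l2norm M W * l2norm M D" by (simp add: power2_eq_square)
  have "l2norm M D \<le> l2norm M W"
  proof (cases "l2norm M D = 0")
    case False
    then have "l2norm M D > 0" using l2norm_nonneg[of M D] by linarith
    with le show ?thesis by (simp add: mult_le_cancel_right)
  qed simp
  then show ?thesis by (simp add: D_def[abs_def])
qed

text \<open>Inner products with the subspace determine the projection up to a null set, so an
  explicit candidate can be compared with the version chosen by \<open>SOME\<close>.\<close>

lemma (in prob_space) orth_proj_unique:
  assumes L: "closed_subspace M \<L>" and Z: "Z \<in> L2 M" and W: "W \<in> \<L>"
    and orth: "\<And>U. U \<in> \<L> \<Longrightarrow> l2inner M Z U = l2inner M W U"
  shows "AE \<omega> in M. orth_proj M \<L> Z \<omega> = W \<omega>"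
proof -
  define D where "D \<omega> = orth_proj M \<L> Z \<omega> - W \<omega>" for \<omega>
  note P = orth_proj_in[OF L Z]
  note PL = P[THEN closed_subspace_L2[OF L]] W[THEN closed_subspace_L2[OF L]]
  have D: "D \<in> \<L>" unfolding D_def by (intro closed_subspace_diff[OF L] P W)
  have DL: "D \<in> L2 M" by (rule closed_subspace_L2[OF L D])
  have "l2inner M Z D = l2inner M (orth_proj M \<L> Z) D"
    using orth_proj_orthogonal[OF L Z(1) D] by (simp add: l2inner_diff_left Z PL DL)
  then have "(l2norm M D)\<^sup>2 = 0"
    unfolding l2norm_eq_inner using orth[OF D]
    by (subst (1) D_def[abs_def]) (simp add: l2inner_diff_left Z PL DL)
  then have "AE \<omega> in M. D \<omega> = 0" using l2norm_eq_0[OF DL] by simp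
  then show ?thesis by (simp add: D_def)
qed

section \<open>The past of a process as a closed subspace\<close>

lemma past_lin_add:
  assumes "Z \<in> past_lin Y S t" "W \<in> past_lin Y S t"
  shows "(\<lambda>\<omega>. Z \<omega> + W \<omega>) \<in> past_lin Y S t"
proof -
  obtain F c F' c' where Z: "Z = (\<lambda>\<omega>. \<Sum>(s, r)\<in>F. c s r * component Y s r \<omega>)" "finite F" "F \<subseteq> S \<times> {..t}"
    and W: "W = (\<lambda>\<omega>. \<Sum>(s, r)\<in>F'. c' s r * component Y s r \<omega>)" "finite F'" "F' \<subseteq> S \<times> {..t}"
    using assms unfolding past_lin_def by blast
  \<comment> \<open>Both coefficient families are extended by zero to the union of the index sets;
    on the overlap they add up.\<close>
  define c'' where "c'' s r = (if (s, r) \<in> F then c s r else 0) + (if (s, r) \<in> F' then c' s r else 0)" for s r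
  have "Z \<omega> = (\<Sum>(s, r)\<in>F \<union> F'. (if (s, r) \<in> F then c s r else 0) * component Y s r \<omega>)" for \<omega>
    unfolding Z(1) using Z W by (intro sum.mono_neutral_cong_left) auto
  moreover have "W \<omega> = (\<Sum>(s, r)\<in>F \<union> F'. (if (s, r) \<in> F' then c' s r else 0) * component Y s r \<omega>)" for \<omega>
    unfolding W(1) using Z W by (intro sum.mono_neutral_cong_left) auto
  ultimately have "(\<lambda>\<omega>. Z \<omega> + W \<omega>) = (\<lambda>\<omega>. \<Sum>(s, r)\<in>F \<union> F'. c'' s r * component Y s r \<omega>)"
    by (simp add: c''_def distrib_right sum.distrib case_prod_unfold)
  moreover have "finite (F \<union> F')" "F \<union> F' \<subseteq> S \<times> {..t}" using Z W by auto
  ultimately show ?thesis unfolding past_lin_def by blast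
qed

lemma past_lin_mult:
  assumes "Z \<in> past_lin Y S t"
  shows "(\<lambda>\<omega>. d * Z \<omega>) \<in> past_lin Y S t"
proof -
  obtain F c where Z: "Z = (\<lambda>\<omega>. \<Sum>(s, r)\<in>F. c s r * component Y s r \<omega>)" "finite F" "F \<subseteq> S \<times> {..t}"
    using assms unfolding past_lin_def by blast
  have "(\<lambda>\<omega>. d * Z \<omega>) = (\<lambda>\<omega>. \<Sum>(s, r)\<in>F. (d * c s r) * component Y s r \<omega>)"
    unfolding Z(1) by (simp add: sum_distrib_left case_prod_unfold mult.assoc)
  with Z(2,3) show ?thesis unfolding past_lin_def by (intro CollectI exI[of _ F] exI[of _ "\<lambda>s r. d * c s r"]) simp
qed

lemma past_space_iff:
  "Z \<in> past_space M Y S t \<longleftrightarrow> Z \<in> L2 M \<and> (\<forall>e>0. \<exists>W \<in> past_lin Y S t \<inter> L2 M. l2norm M (\<lambda>\<omega>. Z \<omega> - W \<omega>) < e)"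
proof -
  have "(\<forall>\<epsilon>>0. \<exists>W \<in> past_lin Y S t \<inter> L2 M. (LINT \<omega>|M. (norm (Z \<omega> - W \<omega>))\<^sup>2) < \<epsilon>)
    \<longleftrightarrow> (\<forall>e>0. \<exists>W \<in> past_lin Y S t \<inter> L2 M. l2norm M (\<lambda>\<omega>. Z \<omega> - W \<omega>) < e)" (is "?l \<longleftrightarrow> ?r")
  proof
    assume l: ?l
    show ?r
    proof (intro allI impI)
      fix e :: real assume "e > 0"
      then obtain W where W: "W \<in> past_lin Y S t \<inter> L2 M" "(l2norm M (\<lambda>\<omega>. Z \<omega> - W \<omega>))\<^sup>2 < e\<^sup>2"
        using l[rule_format, of "e\<^sup>2"] by (auto simp: l2norm_power2)
      have "l2norm M (\<lambda>\<omega>. Z \<omega> - W \<omega>) < e"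
        using W(2) by (rule power2_less_imp_less) (use \<open>e > 0\<close> in simp)
      with W(1) show "\<exists>W \<in> past_lin Y S t \<inter> L2 M. l2norm M (\<lambda>\<omega>. Z \<omega> - W \<omega>) < e" by blast
    qed
  next
    assume r: ?r
    show ?l
    proof (intro allI impI)
      fix e :: real assume e: "e > 0"
      then have "sqrt e > 0" by simp
      then obtain W where W: "W \<in> past_lin Y S t \<inter> L2 M" "l2norm M (\<lambda>\<omega>. Z \<omega> - W \<omega>) < sqrt e"
        using r by blast
      have "(l2norm M (\<lambda>\<omega>. Z \<omega> - W \<omega>))\<^sup>2 < (sqrt e)\<^sup>2"
        using W(2) by (intro power_strict_mono) auto
      then have "(LINT \<omega>|M. (norm (Z \<omega> - W \<omega>))\<^sup>2) < e" using e by (simp add: l2norm_power2)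
      with W(1) show "\<exists>W \<in> past_lin Y S t \<inter> L2 M. (LINT \<omega>|M. (norm (Z \<omega> - W \<omega>))\<^sup>2) < e" by blast
    qed
  qed
  then show ?thesis by (simp add: past_space_def)
qed

lemma past_lin_subset_past_space: "W \<in> past_lin Y S t \<Longrightarrow> W \<in> L2 M \<Longrightarrow> W \<in> past_space M Y S t"
  unfolding past_space_iff by (auto intro!: bexI[of _ W])

lemma past_space_add:
  assumes "Z \<in> past_space M Y S t" "W \<in> past_space M Y S t"
  shows "(\<lambda>\<omega>. Z \<omega> + W \<omega>) \<in> past_space M Y S t"
  unfolding past_space_iff
proof (intro conjI allI impI)
  have Z: "Z \<in> L2 M" and W: "W \<in> L2 M" using assms by (auto simp: past_space_iff)
  show "(\<lambda>\<omega>. Z \<omega> + W \<omega>) \<in> L2 M" using Z W by (rule L2_add)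
  fix e :: real assume "e > 0"
  then have "e / 2 > 0" by simp
  then obtain Z' W' where 1: "Z' \<in> past_lin Y S t \<inter> L2 M" "l2norm M (\<lambda>\<omega>. Z \<omega> - Z' \<omega>) < e / 2"
    and 2: "W' \<in> past_lin Y S t \<inter> L2 M" "l2norm M (\<lambda>\<omega>. W \<omega> - W' \<omega>) < e / 2"
    using assms unfolding past_space_iff by blast
  have "l2norm M (\<lambda>\<omega>. (Z \<omega> - Z' \<omega>) + (W \<omega> - W' \<omega>)) \<le> l2norm M (\<lambda>\<omega>. Z \<omega> - Z' \<omega>) + l2norm M (\<lambda>\<omega>. W \<omega> - W' \<omega>)"
    using Z W 1 2 by (intro l2norm_triangle L2_diff) auto
  then have "l2norm M (\<lambda>\<omega>. (Z \<omega> + W \<omega>) - (Z' \<omega> + W' \<omega>)) < e"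
    using 1 2 by (simp add: add_diff_add)
  moreover have "(\<lambda>\<omega>. Z' \<omega> + W' \<omega>) \<in> past_lin Y S t \<inter> L2 M"
    using 1 2 by (auto intro: past_lin_add L2_add)
  ultimately show "\<exists>V \<in> past_lin Y S t \<inter> L2 M. l2norm M (\<lambda>\<omega>. Z \<omega> + W \<omega> - V \<omega>) < e"
    by (intro bexI[of _ "\<lambda>\<omega>. Z' \<omega> + W' \<omega>"])
qed

lemma past_space_mult:
  assumes "Z \<in> past_space M Y S t"
  shows "(\<lambda>\<omega>. d * Z \<omega>) \<in> past_space M Y S t"
  unfolding past_space_iff
proof (intro conjI allI impI)
  have Z: "Z \<in> L2 M" using assms by (auto simp: past_space_iff)
  show "(\<lambda>\<omega>. d * Z \<omega>) \<in> L2 M" using Z by (rule L2_mult_left)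
  fix e :: real assume e: "e > 0"
  have pos: "norm d + 1 > 0" by (smt (verit) norm_ge_zero)
  then have "e / (norm d + 1) > 0" using e by simp
  then obtain Z' where 1: "Z' \<in> past_lin Y S t \<inter> L2 M" "l2norm M (\<lambda>\<omega>. Z \<omega> - Z' \<omega>) < e / (norm d + 1)"
    using assms unfolding past_space_iff by blast
  have "l2norm M (\<lambda>\<omega>. d * Z \<omega> - d * Z' \<omega>) = norm d * l2norm M (\<lambda>\<omega>. Z \<omega> - Z' \<omega>)"
    by (simp add: l2norm_mult_left flip: right_diff_distrib)
  also have "\<dots> \<le> (norm d + 1) * l2norm M (\<lambda>\<omega>. Z \<omega> - Z' \<omega>)"
    by (simp add: mult_right_mono)
  also have "\<dots> < e" using 1(2) pos by (simp add: field_simps)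
  finally show "\<exists>V \<in> past_lin Y S t \<inter> L2 M. l2norm M (\<lambda>\<omega>. d * Z \<omega> - V \<omega>) < e"
    using 1 by (intro bexI[of _ "\<lambda>\<omega>. d * Z' \<omega>"]) (auto intro: past_lin_mult L2_mult_left)
qed

lemma closed_subspace_past_space: "closed_subspace M (past_space M Y S t)"
  unfolding closed_subspace_def
proof (intro conjI ballI allI impI)
  show "past_space M Y S t \<subseteq> L2 M" by (auto simp: past_space_iff)
  have "(\<lambda>_. 0) \<in> past_lin Y S t" unfolding past_lin_def by (intro CollectI exI[of _ "{}"]) simp
  then show "(\<lambda>_. 0) \<in> past_space M Y S t" by (intro past_lin_subset_past_space) simp_all
  fix Z assume Z: "Z \<in> L2 M" and approx: "\<forall>e>0. \<exists>W\<in>past_space M Y S t. l2norm M (\<lambda>\<omega>. Z \<omega> - W \<omega>) < e"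
  show "Z \<in> past_space M Y S t"
    unfolding past_space_iff
  proof (intro conjI allI impI Z)
    fix e :: real assume "e > 0"
    then have e: "e / 2 > 0" by simp
    then obtain W where W: "W \<in> past_space M Y S t" "l2norm M (\<lambda>\<omega>. Z \<omega> - W \<omega>) < e / 2"
      using approx by blast
    then obtain V where V: "V \<in> past_lin Y S t \<inter> L2 M" "l2norm M (\<lambda>\<omega>. W \<omega> - V \<omega>) < e / 2"
      using e unfolding past_space_iff by blast
    have WL: "W \<in> L2 M" using W by (simp add: past_space_iff)
    have "l2norm M (\<lambda>\<omega>. (Z \<omega> - W \<omega>) + (W \<omega> - V \<omega>)) \<le> l2norm M (\<lambda>\<omega>. Z \<omega> - W \<omega>) + l2norm M (\<lambda>\<omega>. W \<omega> - V \<omega>)"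
      using Z WL V by (intro l2norm_triangle L2_diff) auto
    then have "l2norm M (\<lambda>\<omega>. Z \<omega> - V \<omega>) < e" using W V by simp
    with V show "\<exists>V \<in> past_lin Y S t \<inter> L2 M. l2norm M (\<lambda>\<omega>. Z \<omega> - V \<omega>) < e" by blast
  qed
qed (rule past_space_add past_space_mult; assumption)+

lemma component_in_past_space:
  assumes "component Y s r \<in> L2 M" "s \<in> S" "r \<le> t"
  shows "component Y s r \<in> past_space M Y S t"
proof (rule past_lin_subset_past_space)
  show "component Y s r \<in> past_lin Y S t"
    unfolding past_lin_def using assms
    by (intro CollectI exI[of _ "{(s, r)}"] exI[of _ "\<lambda>_ _. 1"]) auto
qed (rule assms)

lemma past_space_mono:
  assumes "t \<le> t'" "S \<subseteq> S'"
  shows "past_space M Y S t \<subseteq> past_space M Y S' t'"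
proof -
  have "past_lin Y S t \<subseteq> past_lin Y S' t'"
  proof
    fix Z assume "Z \<in> past_lin Y S t"
    then obtain F c where Z: "Z = (\<lambda>\<omega>. \<Sum>(s, r)\<in>F. c s r * component Y s r \<omega>)" "finite F" "F \<subseteq> S \<times> {..t}"
      unfolding past_lin_def by blast
    have "F \<subseteq> S' \<times> {..t'}" using Z(3) assms by fastforce
    with Z(1,2) show "Z \<in> past_lin Y S' t'"
      unfolding past_lin_def by (intro CollectI exI[of _ F] exI[of _ c]) simp
  qed
  then show ?thesis unfolding past_space_def by blast
qed

text \<open>By independence the joint law is a product, so Tonelli's theorem yields a fixed vector v
  with E|U + v|^2 finite. Subtracting the constant v preserves square integrability.\<close>

lemma (in prob_space) L2_of_indep_sum:
  fixes U V :: "'a \<Rightarrow> 'b::euclidean_space"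
  assumes indep: "indep_var borel U borel V" and L2: "(\<lambda>\<omega>. U \<omega> + V \<omega>) \<in> L2 M"
  shows "U \<in> L2 M"
proof -
  have [measurable]: "U \<in> borel_measurable M" "V \<in> borel_measurable M"
    using indep indep_var_rv1 indep_var_rv2 by blast+
  have joint: "distr M borel U \<Otimes>\<^sub>M distr M borel V = distr M (borel \<Otimes>\<^sub>M borel) (\<lambda>x. (U x, V x))"
    using indep by (simp add: indep_var_distribution_eq)
  have L2fin: "(\<integral>\<^sup>+\<omega>. ennreal ((norm (U \<omega> + V \<omega>))\<^sup>2) \<partial>M) < \<infinity>"
    using nn_integral_power2_l2norm[OF L2] by simp
  note space_1 = emeasure_space_1
  interpret \<mu>: prob_space "distr M borel U" by (rule prob_space_distr) simp
  interpret \<nu>: prob_space "distr M borel V" by (rule prob_space_distr) simp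
  interpret pair_prob_space "distr M borel V" "distr M borel U" ..
  have "(\<integral>\<^sup>+v. \<integral>\<^sup>+u. ennreal ((norm (u + v))\<^sup>2) \<partial>distr M borel U \<partial>distr M borel V)
      = (\<integral>\<^sup>+u. \<integral>\<^sup>+v. ennreal ((norm (u + v))\<^sup>2) \<partial>distr M borel V \<partial>distr M borel U)"
    by (rule Fubini'[symmetric]) measurable
  also have "\<dots> = (\<integral>\<^sup>+x. ennreal ((norm (fst x + snd x))\<^sup>2) \<partial>(distr M borel U \<Otimes>\<^sub>M distr M borel V))"
    by (subst \<nu>.nn_integral_fst[symmetric]) simp_all
  also have "\<dots> = (\<integral>\<^sup>+\<omega>. ennreal ((norm (U \<omega> + V \<omega>))\<^sup>2) \<partial>M)"
    unfolding joint by (subst nn_integral_distr) simp_all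
  also note L2fin
  finally have fin: "(\<integral>\<^sup>+v. \<integral>\<^sup>+u. ennreal ((norm (u + v))\<^sup>2) \<partial>distr M borel U \<partial>distr M borel V) \<noteq> \<infinity>" by simp
  have "AE v in distr M borel V. (\<integral>\<^sup>+u. ennreal ((norm (u + v))\<^sup>2) \<partial>distr M borel U) \<noteq> \<infinity>"
    by (rule nn_integral_PInf_AE[OF _ fin]) measurable
  then obtain v where v: "(\<integral>\<^sup>+u. ennreal ((norm (u + v))\<^sup>2) \<partial>distr M borel U) \<noteq> \<infinity>"
    using eventually_happens'[OF \<nu>.ae_filter_bot] by blast
  have "(\<integral>\<^sup>+\<omega>. ennreal ((norm (U \<omega>))\<^sup>2) \<partial>M) \<le> (\<integral>\<^sup>+\<omega>. 2 * ennreal ((norm (U \<omega> + v))\<^sup>2) + ennreal (2 * (norm v)\<^sup>2) \<partial>M)"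
  proof (rule nn_integral_mono)
    fix \<omega>
    have "(norm (U \<omega>))\<^sup>2 = (norm ((U \<omega> + v) - v))\<^sup>2" by simp
    also have "\<dots> \<le> (norm (U \<omega> + v) + norm v)\<^sup>2"
      by (intro power_mono norm_triangle_ineq4) auto
    also have "\<dots> \<le> 2 * (norm (U \<omega> + v))\<^sup>2 + 2 * (norm v)\<^sup>2"
      using zero_le_power2[of "norm (U \<omega> + v) - norm v"] by (simp add: power2_sum power2_diff)
    finally have "ennreal ((norm (U \<omega>))\<^sup>2) \<le> ennreal (2 * (norm (U \<omega> + v))\<^sup>2 + 2 * (norm v)\<^sup>2)"
      by (rule ennreal_leI)
    also have "\<dots> = 2 * ennreal ((norm (U \<omega> + v))\<^sup>2) + ennreal (2 * (norm v)\<^sup>2)"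
      by (simp add: ennreal_mult' ennreal_plus)
    finally show "ennreal ((norm (U \<omega>))\<^sup>2) \<le> 2 * ennreal ((norm (U \<omega> + v))\<^sup>2) + ennreal (2 * (norm v)\<^sup>2)" .
  qed
  also have "\<dots> = 2 * (\<integral>\<^sup>+\<omega>. ennreal ((norm (U \<omega> + v))\<^sup>2) \<partial>M) + ennreal (2 * (norm v)\<^sup>2)"
    by (subst nn_integral_add) (simp_all add: nn_integral_cmult space_1)
  also have "(\<integral>\<^sup>+\<omega>. ennreal ((norm (U \<omega> + v))\<^sup>2) \<partial>M) = (\<integral>\<^sup>+u. ennreal ((norm (u + v))\<^sup>2) \<partial>distr M borel U)"
    by (subst nn_integral_distr) simp_all
  finally have "(\<integral>\<^sup>+\<omega>. ennreal ((norm (U \<omega>))\<^sup>2) \<partial>M) < \<infinity>"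
    using v by (auto simp: ennreal_mult_less_top top.not_eq_extremum elim!: le_less_trans)
  then have "integrable M (\<lambda>\<omega>. (norm (U \<omega>))\<^sup>2)"
    by (intro integrableI_bounded) simp_all
  then show ?thesis by (simp add: L2_def)
qed

lemma (in prob_space) indep_vars_pair:
  assumes "indep_vars N X I" "i \<in> I" "j \<in> I" "i \<noteq> j"
  shows "indep_var (N i) (X i) (N j) (X j)"
proof -
  have "indep_var (N i) ((\<lambda>f. f i) \<circ> (\<lambda>\<omega>. restrict (\<lambda>i. X i \<omega>) {i})) (N j) ((\<lambda>f. f j) \<circ> (\<lambda>\<omega>. restrict (\<lambda>i. X i \<omega>) {j}))"
    using assms by (intro indep_var_compose[OF indep_var_restrict[OF assms(1)]]) auto
  then show ?thesis by (simp add: o_def)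
qed

text \<open>Cauchy's functional equation for a monotone function. Enclosing n t between consecutive
  integers bounds n |f t - t f(1)| by f(1) for every n, which forces the difference to
  vanish.\<close>

lemma additive_nonneg_linear:
  fixes f :: "real \<Rightarrow> real"
  assumes add: "\<And>s t. 0 \<le> s \<Longrightarrow> 0 \<le> t \<Longrightarrow> f (s + t) = f s + f t" and nonneg: "\<And>t. 0 \<le> t \<Longrightarrow> 0 \<le> f t"
    and "0 \<le> t"
  shows "f t = t * f 1"
proof -
  have f0: "f 0 = 0" using add[of 0 0] by simp
  have mult: "f (real n * t) = real n * f t" if "0 \<le> t" for n t
  proof (induction n)
    case (Suc n)
    then show ?case using add[of "real n * t" t] that by (simp add: algebra_simps)
  qed (simp add: f0)
  have mono: "f s \<le> f t" if "0 \<le> s" "s \<le> t" for s t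
    using add[of s "t - s"] nonneg[of "t - s"] that by simp
  have *: "real n * \<bar>f t - t * f 1\<bar> \<le> f 1" for n
  proof -
    define m where "m = nat \<lfloor>real n * t\<rfloor>"
    have m: "real m \<le> real n * t" "real n * t \<le> real (Suc m)"
    proof -
      have "real m = of_int \<lfloor>real n * t\<rfloor>" using \<open>0 \<le> t\<close> by (simp add: m_def of_nat_nat)
      then show "real m \<le> real n * t" "real n * t \<le> real (Suc m)"
        using of_int_floor_le[of "real n * t"] real_of_int_floor_add_one_ge[of "real n * t"] by linarith+
    qed
    have "real m * f 1 \<le> real n * f t" "real n * f t \<le> real (Suc m) * f 1"
      using mono[OF _ m(1)] mono[OF _ m(2)] mult[of 1 m] mult[of 1 "Suc m"] mult[OF \<open>0 \<le> t\<close>, of n] \<open>0 \<le> t\<close> by simp_all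
    moreover have "real m * f 1 \<le> (real n * t) * f 1" "(real n * t) * f 1 \<le> real (Suc m) * f 1"
      using m nonneg[of 1] by (auto intro: mult_right_mono)
    ultimately have "\<bar>real n * f t - real n * t * f 1\<bar> \<le> f 1" by (simp add: algebra_simps abs_le_iff)
    moreover have "real n * \<bar>f t - t * f 1\<bar> = \<bar>real n * (f t - t * f 1)\<bar>" by (simp add: abs_mult)
    ultimately show ?thesis by (simp add: right_diff_distrib mult.assoc)
  qed
  show ?thesis
  proof (rule ccontr)
    assume "f t \<noteq> t * f 1"
    then have "\<bar>f t - t * f 1\<bar> > 0" by simp
    then obtain n where "f 1 < real n * \<bar>f t - t * f 1\<bar>"
      using reals_Archimedean3 by blast
    with *[of n] show False by simp
  qed
qed

section \<open>Square-integrable L\'evy processes\<close>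

locale square_levy = prob_space M for M :: "'w measure" +
  fixes L :: "real \<Rightarrow> 'w \<Rightarrow> real^'k::finite"
  assumes levy: "two_sided_levy M L"
    and L1_square: "integrable M (\<lambda>\<omega>. (norm (L 1 \<omega>))\<^sup>2)"
    and L1_mean: "(LINT \<omega>|M. L 1 \<omega>) = 0"
begin

lemma L_measurable [measurable]: "L t \<in> borel_measurable M"
  using levy by (simp add: two_sided_levy_def)

lemma L_zero: "AE \<omega> in M. L 0 \<omega> = 0"
  using levy by (simp add: two_sided_levy_def)

lemma L_stationary: "s \<le> t \<Longrightarrow> distr M borel (\<lambda>\<omega>. L t \<omega> - L s \<omega>) = distr M borel (L (t - s))"
  using levy by (simp add: two_sided_levy_def)

lemma L_indep:
  assumes "x < y" "y \<le> x'" "x' < y'"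
  shows "indep_var borel (\<lambda>\<omega>. L y \<omega> - L x \<omega>) borel (\<lambda>\<omega>. L y' \<omega> - L x' \<omega>)"
proof -
  \<comment> \<open>The definition speaks of consecutive increments along a strictly increasing
    partition. Adjacent intervals form a partition with two steps; separated ones need a third step
    in the gap, whose increment is then ignored.\<close>
  define n where "n = (if y = x' then 2 else 3 :: nat)"
  define p where "p i = (if i = 0 then x else if i = 1 then y else if i = n - 1 then x' else y')" for i :: nat
  have "\<forall>i<n. p i < p (Suc i)"
    using assms by (auto simp: p_def n_def less_Suc_eq numeral_2_eq_2 numeral_3_eq_3)
  then have "indep_vars (\<lambda>_. borel) (\<lambda>i \<omega>. L (p (Suc i)) \<omega> - L (p i) \<omega>) {..<n}"
    using levy by (simp add: two_sided_levy_def)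
  from indep_vars_pair[OF this, of 0 "n - 1"] show ?thesis
    using assms by (cases "y = x'") (simp_all add: p_def n_def numeral_2_eq_2 numeral_3_eq_3)
qed

lemma L2_increment_iff: "s \<le> t \<Longrightarrow> (\<lambda>\<omega>. L t \<omega> - L s \<omega>) \<in> L2 M \<longleftrightarrow> L (t - s) \<in> L2 M"
proof -
  assume "s \<le> t"
  have "integrable M (\<lambda>\<omega>. (norm (Z \<omega>))\<^sup>2) \<longleftrightarrow> integrable (distr M borel Z) (\<lambda>x. (norm x)\<^sup>2)"
    if [measurable]: "Z \<in> borel_measurable M" for Z :: "'w \<Rightarrow> real^'k"
    by (subst integrable_distr_eq) simp_all
  then show ?thesis
    using L_stationary[OF \<open>s \<le> t\<close>] by (simp add: L2_def)
qed

text \<open>Only L(1) is known to be square integrable. For 0 < t < 1 the increment up to 1 is the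
  sum of two independent increments, each of which inherits the property; stationarity extends it to
  longer times by unit steps.\<close>

lemma L2_L: "0 \<le> t \<Longrightarrow> L t \<in> L2 M"
proof -
  have one: "L 1 \<in> L2 M" using L1_square by (simp add: L2_def)
  have zero: "L 0 \<in> L2 M"
    by (rule L2_cong_AE[OF L2_0]) (use L_zero in auto)
  have small: "L t \<in> L2 M" if "0 < t" "t < 1" for t
  proof -
    have "(\<lambda>\<omega>. L t \<omega> - L 0 \<omega>) \<in> L2 M"
    proof (rule L2_of_indep_sum)
      show "indep_var borel (\<lambda>\<omega>. L t \<omega> - L 0 \<omega>) borel (\<lambda>\<omega>. L 1 \<omega> - L t \<omega>)"
        using that by (intro L_indep) auto
      show "(\<lambda>\<omega>. L t \<omega> - L 0 \<omega> + (L 1 \<omega> - L t \<omega>)) \<in> L2 M"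
        using L2_diff[OF one zero] by simp
    qed
    then show ?thesis using L2_increment_iff[of 0 t] that by simp
  qed
  have add: "L (s + t) \<in> L2 M" if "L s \<in> L2 M" "L t \<in> L2 M" "0 \<le> t" for s t
    using L2_add[of "\<lambda>\<omega>. L (s + t) \<omega> - L s \<omega>" M "L s"] L2_increment_iff[of s "s + t"] that by simp
  have "L t \<in> L2 M" if "0 \<le> t" "t \<le> real n" for n
    using that
  proof (induction n arbitrary: t)
    case (Suc n)
    show ?case
    proof (cases "t \<le> real n")
      case False
      have "L (t - real n) \<in> L2 M"
        using small[of "t - real n"] one zero Suc.prems False by (cases "t - real n = 1") auto
      moreover have "L (real n) \<in> L2 M" using Suc.IH by simp
      ultimately show ?thesis using add[of "real n" "t - real n"] False by simp
    qed (use Suc in auto)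
  qed (use zero in auto)
  moreover assume "0 \<le> t"
  ultimately show ?thesis using real_arch_simple[of t] by blast
qed

lemma L2_increment: "(\<lambda>\<omega>. L t \<omega> - L s \<omega>) \<in> L2 M"
proof (cases "s \<le> t")
  case True
  then show ?thesis by (simp add: L2_increment_iff L2_L)
next
  case False
  then have "(\<lambda>\<omega>. L s \<omega> - L t \<omega>) \<in> L2 M" by (simp add: L2_increment_iff L2_L)
  from L2_scaleR[OF this, of "-1"] show ?thesis by simp
qed

lemma L2_increment_nth: "(\<lambda>\<omega>. L t \<omega> $ a - L s \<omega> $ a) \<in> L2 M"
  using L2_bounded_linear[OF bounded_linear_vec_nth[of a] L2_increment[of t s]] by simp

lemma L2_L_nth: "0 \<le> t \<Longrightarrow> (\<lambda>\<omega>. L t \<omega> $ a) \<in> L2 M"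
  by (rule L2_bounded_linear[OF bounded_linear_vec_nth L2_L])

lemma increment_moments:
  fixes a :: 'k
  assumes "s \<le> t"
  shows "expectation (\<lambda>\<omega>. L t \<omega> $ a - L s \<omega> $ a) = expectation (\<lambda>\<omega>. L (t - s) \<omega> $ a)"
    and "expectation (\<lambda>\<omega>. (L t \<omega> $ a - L s \<omega> $ a)\<^sup>2) = expectation (\<lambda>\<omega>. (L (t - s) \<omega> $ a)\<^sup>2)"
proof -
  have 1: "expectation (\<lambda>\<omega>. f (L t \<omega> - L s \<omega>)) = expectation (\<lambda>\<omega>. f (L (t - s) \<omega>))"
    if [measurable]: "f \<in> borel_measurable borel" for f :: "_ \<Rightarrow> real"
  proof -
    have "expectation (\<lambda>\<omega>. f (L t \<omega> - L s \<omega>)) = (\<integral>x. f x \<partial>distr M borel (\<lambda>\<omega>. L t \<omega> - L s \<omega>))"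
      by (subst integral_distr) simp_all
    also have "\<dots> = expectation (\<lambda>\<omega>. f (L (t - s) \<omega>))"
      unfolding L_stationary[OF assms] by (subst integral_distr) simp_all
    finally show ?thesis .
  qed
  show "expectation (\<lambda>\<omega>. L t \<omega> $ a - L s \<omega> $ a) = expectation (\<lambda>\<omega>. L (t - s) \<omega> $ a)"
    using 1[of "\<lambda>x. x $ a"] by simp
  show "expectation (\<lambda>\<omega>. (L t \<omega> $ a - L s \<omega> $ a)\<^sup>2) = expectation (\<lambda>\<omega>. (L (t - s) \<omega> $ a)\<^sup>2)"
    using 1[of "\<lambda>x. (x $ a)\<^sup>2"] by simp
qed

lemma increment_product_mean:
  assumes "x < y" "y \<le> x'" "x' < y'"
  shows "expectation (\<lambda>\<omega>. (L y \<omega> $ a - L x \<omega> $ a) * (L y' \<omega> $ b - L x' \<omega> $ b))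
       = expectation (\<lambda>\<omega>. L (y - x) \<omega> $ a) * expectation (\<lambda>\<omega>. L (y' - x') \<omega> $ b)"
proof -
  have "indep_var borel ((\<lambda>v. v $ a) \<circ> (\<lambda>\<omega>. L y \<omega> - L x \<omega>)) borel ((\<lambda>v. v $ b) \<circ> (\<lambda>\<omega>. L y' \<omega> - L x' \<omega>))"
    by (rule indep_var_compose[OF L_indep[OF assms]]) simp_all
  then have "indep_var borel (\<lambda>\<omega>. L y \<omega> $ a - L x \<omega> $ a) borel (\<lambda>\<omega>. L y' \<omega> $ b - L x' \<omega> $ b)"
    by (simp add: o_def)
  from indep_var_lebesgue_integral[OF this L2_integrable[OF L2_increment_nth] L2_integrable[OF L2_increment_nth]]
  show ?thesis using increment_moments(1)[of x y a] increment_moments(1)[of x' y' b] assms by simp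
qed

lemma expectation_L_add:
  assumes "0 \<le> s" "0 \<le> t"
  shows "expectation (\<lambda>\<omega>. L (s + t) \<omega> $ a) = expectation (\<lambda>\<omega>. L s \<omega> $ a) + expectation (\<lambda>\<omega>. L t \<omega> $ a)"
  using increment_moments(1)[of s "s + t" a] assms
  by (simp add: Bochner_Integration.integral_diff L2_integrable[OF L2_L_nth])

lemma L_zero_moments:
  "expectation (\<lambda>\<omega>. L 0 \<omega> $ a) = 0" "expectation (\<lambda>\<omega>. (L 0 \<omega> $ a)\<^sup>2) = 0"
proof -
  have [measurable]: "(\<lambda>\<omega>. L 0 \<omega> $ a) \<in> borel_measurable M"
    by (rule L2_measurable[OF L2_L_nth]) simp
  have "expectation (\<lambda>\<omega>. L 0 \<omega> $ a) = expectation (\<lambda>\<omega>. 0)"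
    by (rule integral_cong_AE) (use L_zero in auto)
  then show "expectation (\<lambda>\<omega>. L 0 \<omega> $ a) = 0" by simp
  have "expectation (\<lambda>\<omega>. (L 0 \<omega> $ a)\<^sup>2) = expectation (\<lambda>\<omega>. 0)"
    by (rule integral_cong_AE) (use L_zero in auto)
  then show "expectation (\<lambda>\<omega>. (L 0 \<omega> $ a)\<^sup>2) = 0" by simp
qed

text \<open>Independence and stationarity make the variance additive in time, and a nonnegative
  additive function is linear. The mean is subtracted because it is shown to vanish only afterwards,
  with the help of this formula.\<close>

lemma variance_L:
  assumes "0 \<le> t"
  shows "expectation (\<lambda>\<omega>. (L t \<omega> $ a - expectation (\<lambda>\<omega>. L t \<omega> $ a))\<^sup>2)
       = t * expectation (\<lambda>\<omega>. (L 1 \<omega> $ a - expectation (\<lambda>\<omega>. L 1 \<omega> $ a))\<^sup>2)"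
proof (rule additive_nonneg_linear[of "\<lambda>t. expectation (\<lambda>\<omega>. (L t \<omega> $ a - expectation (\<lambda>\<omega>. L t \<omega> $ a))\<^sup>2)"])
  define \<mu> where "\<mu> t = expectation (\<lambda>\<omega>. L t \<omega> $ a)" for t
  define w where "w t = expectation (\<lambda>\<omega>. (L t \<omega> $ a)\<^sup>2)" for t
  have sq: "integrable M (\<lambda>\<omega>. (L t \<omega> $ a)\<^sup>2)" if "0 \<le> t" for t
    using L2_integrable_power2[OF L2_L_nth[OF that, of a]] by simp
  have var: "expectation (\<lambda>\<omega>. (L t \<omega> $ a - \<mu> t)\<^sup>2) = w t - (\<mu> t)\<^sup>2" if "0 \<le> t" for t
    unfolding \<mu>_def w_def using variance_eq[OF L2_integrable[OF L2_L_nth[OF that]] sq[OF that]] .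
  have w_add: "w (s + t) = w s + w t + 2 * \<mu> s * \<mu> t" if "0 < s" "0 < t" for s t
  proof -
    have "w (s + t) = expectation (\<lambda>\<omega>. (L (s + t) \<omega> $ a - L 0 \<omega> $ a)\<^sup>2)"
      using increment_moments(2)[of 0 "s + t" a] that by (simp add: w_def)
    also have "\<dots> = expectation (\<lambda>\<omega>. (L s \<omega> $ a - L 0 \<omega> $ a)\<^sup>2 + (L (s + t) \<omega> $ a - L s \<omega> $ a)\<^sup>2
        + 2 * ((L s \<omega> $ a - L 0 \<omega> $ a) * (L (s + t) \<omega> $ a - L s \<omega> $ a)))"
      by (intro Bochner_Integration.integral_cong refl) (simp add: power2_eq_square algebra_simps)
    also have "\<dots> = expectation (\<lambda>\<omega>. (L s \<omega> $ a - L 0 \<omega> $ a)\<^sup>2) + expectation (\<lambda>\<omega>. (L (s + t) \<omega> $ a - L s \<omega> $ a)\<^sup>2)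
        + 2 * expectation (\<lambda>\<omega>. (L s \<omega> $ a - L 0 \<omega> $ a) * (L (s + t) \<omega> $ a - L s \<omega> $ a))"
      using L2_integrable_power2[OF L2_increment_nth] L2_inner_integrable[OF L2_increment_nth L2_increment_nth]
      by simp
    also have "\<dots> = w s + w t + 2 * \<mu> s * \<mu> t"
      using increment_moments(2)[of 0 s a] increment_moments(2)[of s "s + t" a]
        increment_product_mean[of 0 s s "s + t" a a] that by (simp add: w_def \<mu>_def)
    finally show ?thesis .
  qed
  have \<mu>_add: "\<mu> (s + t) = \<mu> s + \<mu> t" if "0 \<le> s" "0 \<le> t" for s t
    using expectation_L_add[OF that] by (simp add: \<mu>_def)
  have zero: "\<mu> 0 = 0" "w 0 = 0" by (simp_all add: \<mu>_def w_def L_zero_moments)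
  fix s t :: real assume st: "0 \<le> s" "0 \<le> t"
  have "w (s + t) - (\<mu> (s + t))\<^sup>2 = (w s - (\<mu> s)\<^sup>2) + (w t - (\<mu> t)\<^sup>2)"
  \<comment> \<open>The product formula for means is available for nondegenerate intervals
    only.\<close>
  proof (cases "s = 0 \<or> t = 0")
    case False
    then show ?thesis using w_add[of s t] st by (simp add: \<mu>_add power2_eq_square algebra_simps)
  qed (auto simp: zero)
  then show "expectation (\<lambda>\<omega>. (L (s + t) \<omega> $ a - expectation (\<lambda>\<omega>. L (s + t) \<omega> $ a))\<^sup>2)
     = expectation (\<lambda>\<omega>. (L s \<omega> $ a - expectation (\<lambda>\<omega>. L s \<omega> $ a))\<^sup>2)
     + expectation (\<lambda>\<omega>. (L t \<omega> $ a - expectation (\<lambda>\<omega>. L t \<omega> $ a))\<^sup>2)"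
    using var[of s] var[of t] var[of "s + t"] st by (simp add: \<mu>_def)
qed (auto intro: assms)

text \<open>The mean is additive in \<open>t\<close> and vanishes at \<open>t = 1\<close>, hence at rational times; right-continuity
  of the paths and Fatou's lemma give the other times.\<close>

lemma expectation_L:
  assumes t: "0 \<le> t"
  shows "expectation (\<lambda>\<omega>. L t \<omega> $ a) = 0"
proof -
  define \<mu> where "\<mu> t = expectation (\<lambda>\<omega>. L t \<omega> $ a)" for t
  define \<sigma> where "\<sigma> = expectation (\<lambda>\<omega>. (L 1 \<omega> $ a - \<mu> 1)\<^sup>2)"
  have L1: "integrable M (L 1)" by (rule L2_integrable) (rule L2_L, simp)
  have one: "\<mu> 1 = 0"
    unfolding \<mu>_def using integral_bounded_linear[OF bounded_linear_vec_nth L1, of a] L1_mean by simp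
  have add: "\<mu> (s + t) = \<mu> s + \<mu> t" if "0 \<le> s" "0 \<le> t" for s t
    unfolding \<mu>_def by (rule expectation_L_add[OF that])
  have mult: "\<mu> (real n * s) = real n * \<mu> s" if "0 \<le> s" for n s
  proof (induction n)
    case (Suc n)
    then show ?case using add[of "real n * s" s] that by (simp add: algebra_simps)
  qed (simp add: \<mu>_def L_zero_moments)
  have rat: "\<mu> (real m / real n) = 0" if "n > 0" for m n
  proof -
    have "real n * \<mu> (real m / real n) = \<mu> (real m * 1)"
      using mult[of "real m / real n" n] that by simp
    also have "\<dots> = 0" using mult[of 1 m] one by simp
    finally show ?thesis using that by simp
  qed
  \<comment> \<open>Rational times, strictly above \<open>t\<close> and within 1/(n + 1) of it, so
    that right-continuity applies along them.\<close>
  define r where "r n = real (Suc (nat \<lfloor>real (Suc n) * t\<rfloor>)) / real (Suc n)" for n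
  have r_gt: "r n > t" for n
  proof -
    have "real (Suc n) * t < real (Suc (nat \<lfloor>real (Suc n) * t\<rfloor>))"
      using t by linarith
    then show ?thesis unfolding r_def by (subst pos_less_divide_eq) (simp_all add: mult.commute del: of_nat_Suc)
  qed
  have r_le: "r n \<le> t + inverse (real (Suc n))" for n
  proof -
    have "real (nat \<lfloor>real (Suc n) * t\<rfloor>) \<le> real (Suc n) * t"
      using t by (subst of_nat_nat) auto
    moreover have "(t + inverse (real (Suc n))) * real (Suc n) = real (Suc n) * t + 1"
      by (simp add: distrib_right mult.commute[of t] del: of_nat_Suc)
    ultimately have "real (Suc (nat \<lfloor>real (Suc n) * t\<rfloor>)) \<le> (t + inverse (real (Suc n))) * real (Suc n)"
      by linarith
    then show ?thesis unfolding r_def by (subst pos_divide_le_eq) simp_all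
  qed
  have r_lim: "r \<longlonglongrightarrow> t"
  proof (rule tendsto_sandwich[of "\<lambda>_. t" r sequentially "\<lambda>n. t + inverse (real (Suc n))"])
    show "(\<lambda>n. t + inverse (real (Suc n))) \<longlonglongrightarrow> t"
      using tendsto_add[OF tendsto_const LIMSEQ_inverse_real_of_nat, of t] by simp
  qed (simp_all only: r_le less_imp_le[OF r_gt] eventually_True tendsto_const)
  have \<mu>r: "\<mu> (r n) = 0" for n unfolding r_def by (rule rat) simp
  have diff: "\<mu> (r n - t) = - \<mu> t" for n
    using add[of t "r n - t"] \<mu>r[of n] r_gt[of n] t by simp
  \<comment> \<open>The increment from t to r n has mean -\<mu>(t), so this is its centred version.
    Its second moment (r n - t)\<sigma> tends to 0, while its paths tend to \<mu>(t); Fatou's lemma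
    leaves only \<mu>(t) = 0.\<close>
  define D where "D n \<omega> = L (r n) \<omega> $ a - L t \<omega> $ a + \<mu> t" for n \<omega>
  have "AE \<omega> in M. \<forall>t. ((\<lambda>s. L s \<omega>) \<longlongrightarrow> L t \<omega>) (at_right t)"
    using levy unfolding two_sided_levy_def by auto
  then have lim: "AE \<omega> in M. (\<lambda>n. D n \<omega>) \<longlonglongrightarrow> \<mu> t"
  proof eventually_elim
    case (elim \<omega>)
    have "filterlim r (at_right t) sequentially"
      using r_lim r_gt by (auto simp: filterlim_at eventually_sequentially)
    from filterlim_compose[OF elim[rule_format] this]
    have "(\<lambda>n. L (r n) \<omega>) \<longlonglongrightarrow> L t \<omega>" .
    then have "(\<lambda>n. L (r n) \<omega> $ a - L t \<omega> $ a + \<mu> t) \<longlonglongrightarrow> L t \<omega> $ a - L t \<omega> $ a + \<mu> t"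
      by (intro tendsto_intros)
    then show ?case by (simp add: D_def)
  qed
  have Dn: "D n \<in> L2 M" for n
    unfolding D_def by (intro L2_add L2_increment_nth) (simp add: L2_def)
  have [measurable]: "D n \<in> borel_measurable M" for n by (rule L2_measurable[OF Dn])
  have var: "(\<integral>\<^sup>+\<omega>. ennreal ((D n \<omega>)\<^sup>2) \<partial>M) = ennreal ((r n - t) * \<sigma>)" for n
  proof -
    have "(LINT \<omega>|M. (D n \<omega>)\<^sup>2) = expectation (\<lambda>\<omega>. (L (r n - t) \<omega> $ a - \<mu> (r n - t))\<^sup>2)"
    proof -
      have "(LINT \<omega>|M. (D n \<omega>)\<^sup>2) = expectation (\<lambda>\<omega>. (L (r n) \<omega> $ a - L t \<omega> $ a)\<^sup>2
         + 2 * \<mu> t * (L (r n) \<omega> $ a - L t \<omega> $ a) + (\<mu> t)\<^sup>2)"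
        by (intro Bochner_Integration.integral_cong refl) (simp add: D_def power2_eq_square algebra_simps)
      also have "\<dots> = expectation (\<lambda>\<omega>. (L (r n) \<omega> $ a - L t \<omega> $ a)\<^sup>2)
         + 2 * \<mu> t * expectation (\<lambda>\<omega>. L (r n) \<omega> $ a - L t \<omega> $ a) + (\<mu> t)\<^sup>2"
        using L2_integrable_power2[OF L2_increment_nth[of "r n" a t]] L2_integrable[OF L2_increment_nth[of "r n" a t]]
        by (simp add: prob_space)
      also have "\<dots> = expectation (\<lambda>\<omega>. (L (r n - t) \<omega> $ a)\<^sup>2) + 2 * \<mu> t * \<mu> (r n - t) + (\<mu> t)\<^sup>2"
        using increment_moments[of t "r n" a] r_gt[of n] by (simp add: \<mu>_def)
      also have "\<dots> = expectation (\<lambda>\<omega>. (L (r n - t) \<omega> $ a)\<^sup>2) - (\<mu> (r n - t))\<^sup>2"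
        by (simp add: diff power2_eq_square)
      also have "\<dots> = expectation (\<lambda>\<omega>. (L (r n - t) \<omega> $ a - \<mu> (r n - t))\<^sup>2)"
        unfolding \<mu>_def using r_gt[of n] L2_integrable_power2[OF L2_L_nth[of "r n - t" a]]
        by (intro variance_eq[OF L2_integrable[OF L2_L_nth], symmetric]) simp_all
      finally show ?thesis .
    qed
    also have "\<dots> = (r n - t) * \<sigma>"
      unfolding \<mu>_def \<sigma>_def using r_gt[of n] by (intro variance_L) simp
    finally show ?thesis
      using nn_integral_power2_l2norm[OF Dn] by (simp add: l2norm_power2)
  qed
  have "ennreal ((\<mu> t)\<^sup>2) = (\<integral>\<^sup>+\<omega>. ennreal ((\<mu> t)\<^sup>2) \<partial>M)"
    by (simp add: emeasure_space_1)
  also have "\<dots> = (\<integral>\<^sup>+\<omega>. liminf (\<lambda>n. ennreal ((D n \<omega>)\<^sup>2)) \<partial>M)"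
    using lim
  proof (intro nn_integral_cong_AE, eventually_elim)
    case (elim \<omega>)
    then have "(\<lambda>n. ennreal ((D n \<omega>)\<^sup>2)) \<longlonglongrightarrow> ennreal ((\<mu> t)\<^sup>2)" by (intro tendsto_intros)
    then show ?case by (rule lim_imp_Liminf[OF trivial_limit_sequentially, symmetric])
  qed
  also have "\<dots> \<le> liminf (\<lambda>n. \<integral>\<^sup>+\<omega>. ennreal ((D n \<omega>)\<^sup>2) \<partial>M)"
    by (rule nn_integral_liminf) measurable
  also have "\<dots> = liminf (\<lambda>n. ennreal ((r n - t) * \<sigma>))" by (simp add: var)
  also have "\<dots> = ennreal ((t - t) * \<sigma>)"
    by (intro lim_imp_Liminf tendsto_intros r_lim) simp
  finally show ?thesis by (simp add: \<mu>_def)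
qed

definition sigma :: "'k \<Rightarrow> real" where
  "sigma a = l2norm M (\<lambda>\<omega>. L 1 \<omega> $ a)"

lemma increment_variance: "expectation (\<lambda>\<omega>. (L y \<omega> $ a - L x \<omega> $ a)\<^sup>2) = (sigma a)\<^sup>2 * \<bar>y - x\<bar>"
proof -
  have le: "expectation (\<lambda>\<omega>. (L y \<omega> $ a - L x \<omega> $ a)\<^sup>2) = (sigma a)\<^sup>2 * (y - x)" if "x \<le> y" for x y
    using variance_L[of "y - x" a] increment_moments(2)[OF that, of a] that
    by (simp add: expectation_L sigma_def l2norm_power2)
  show ?thesis
    using le[of x y] le[of y x] by (cases "x \<le> y") (auto simp: power2_commute)
qed

lemma increment_orthogonal:
  assumes "x \<le> y" "y \<le> x'" "x' \<le> y'"
  shows "l2inner M (\<lambda>\<omega>. L y \<omega> $ a - L x \<omega> $ a) (\<lambda>\<omega>. L y' \<omega> $ b - L x' \<omega> $ b) = 0"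
proof (cases "x < y \<and> x' < y'")
  case True
  then show ?thesis
    using increment_product_mean[of x y x' y' a b] assms by (simp add: l2inner_def expectation_L)
next
  case False
  then have "x = y \<or> x' = y'" using assms by auto
  then show ?thesis by (auto simp: l2inner_def)
qed

text \<open>Polarisation of the variance of the increments.\<close>

lemma increment_covariance:
  assumes "x \<le> y" "x' \<le> y'"
  shows "l2inner M (\<lambda>\<omega>. L y \<omega> $ a - L x \<omega> $ a) (\<lambda>\<omega>. L y' \<omega> $ a - L x' \<omega> $ a)
       = (sigma a)\<^sup>2 * measure lborel ({x<..y} \<inter> {x'<..y'})"
proof -
  note int = L2_integrable_power2[OF L2_increment_nth, simplified]
  have "l2inner M (\<lambda>\<omega>. L y \<omega> $ a - L x \<omega> $ a) (\<lambda>\<omega>. L y' \<omega> $ a - L x' \<omega> $ a)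
      = expectation (\<lambda>\<omega>. ((L y' \<omega> $ a - L x \<omega> $ a)\<^sup>2 + (L y \<omega> $ a - L x' \<omega> $ a)\<^sup>2
          - (L y \<omega> $ a - L y' \<omega> $ a)\<^sup>2 - (L x \<omega> $ a - L x' \<omega> $ a)\<^sup>2) / 2)"
    unfolding l2inner_def by (intro Bochner_Integration.integral_cong refl) (simp add: power2_eq_square algebra_simps)
  also have "\<dots> = (sigma a)\<^sup>2 * ((\<bar>y' - x\<bar> + \<bar>y - x'\<bar> - \<bar>y - y'\<bar> - \<bar>x - x'\<bar>) / 2)"
    using int by (simp add: increment_variance algebra_simps)
  also have "(\<bar>y' - x\<bar> + \<bar>y - x'\<bar> - \<bar>y - y'\<bar> - \<bar>x - x'\<bar>) / 2 = measure lborel {max x x'<..min y y'}"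
  proof -
    have "measure lborel {l<..u} = max 0 (u - l)" for l u :: real
      by (cases "l \<le> u") auto
    then show ?thesis using assms by (simp add: max_def min_def abs_if)
  qed
  also have "{max x x'<..min y y'} = {x<..y} \<inter> {x'<..y'}" by auto
  finally show ?thesis .
qed

end

section \<open>Integrals of deterministic step functions\<close>

text \<open>Step functions with values in \<open>\<real>\<^sup>k\<close> are lists of terms \<open>c 1\<^bsub>(x, y]\<^esub>\<close>; the intervals may
  overlap.\<close>

type_synonym 'k lstep = "((real^'k) \<times> real \<times> real) list"

definition lstep_fun :: "'k::finite lstep \<Rightarrow> real \<Rightarrow> real^'k" where
  "lstep_fun xs u = (\<Sum>(c, x, y)\<leftarrow>xs. indicator {x<..y} u *\<^sub>R c)"

text \<open>The coefficient acts as a row vector on the increment, so a matrix-valued integral is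
  treated one row at a time and its integrals are real random variables.\<close>

definition lstep_int :: "(real \<Rightarrow> 'w \<Rightarrow> real^'k::finite) \<Rightarrow> 'k lstep \<Rightarrow> 'w \<Rightarrow> real" where
  "lstep_int L xs \<omega> = (\<Sum>(c, x, y)\<leftarrow>xs. c \<bullet> (L y \<omega> - L x \<omega>))"

text \<open>Records the time window whose noise an integral uses; orthogonality of integrals is read
  off from the position of their windows. The order of the end points is what the covariance formula
  asks for.\<close>

definition lstep_within :: "real \<Rightarrow> real \<Rightarrow> 'k::finite lstep \<Rightarrow> bool" where
  "lstep_within lo hi xs \<longleftrightarrow> (\<forall>(c, x, y)\<in>set xs. lo \<le> x \<and> x \<le> y \<and> y \<le> hi)"

lemma lstep_Nil [simp]: "lstep_fun [] u = 0" "lstep_int L [] \<omega> = 0" "lstep_within lo hi []"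
  by (auto simp: lstep_fun_def lstep_int_def lstep_within_def)

lemma lstep_Cons [simp]:
  "lstep_fun ((c, x, y) # xs) u = indicator {x<..y} u *\<^sub>R c + lstep_fun xs u"
  "lstep_int L ((c, x, y) # xs) \<omega> = c \<bullet> (L y \<omega> - L x \<omega>) + lstep_int L xs \<omega>"
  "lstep_within lo hi ((c, x, y) # xs) \<longleftrightarrow> lo \<le> x \<and> x \<le> y \<and> y \<le> hi \<and> lstep_within lo hi xs"
  by (auto simp: lstep_fun_def lstep_int_def lstep_within_def)

lemma lstep_append:
  "lstep_fun (xs @ ys) u = lstep_fun xs u + lstep_fun ys u"
  "lstep_int L (xs @ ys) \<omega> = lstep_int L xs \<omega> + lstep_int L ys \<omega>"
  "lstep_within lo hi (xs @ ys) \<longleftrightarrow> lstep_within lo hi xs \<and> lstep_within lo hi ys"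
  by (simp_all add: lstep_fun_def lstep_int_def lstep_within_def ball_Un)

definition lstep_scale :: "real \<Rightarrow> 'k::finite lstep \<Rightarrow> 'k lstep" where
  "lstep_scale d xs = map (\<lambda>(c, x, y). (d *\<^sub>R c, x, y)) xs"

lemma lstep_scale:
  "lstep_fun (lstep_scale d xs) u = d *\<^sub>R lstep_fun xs u"
  "lstep_int L (lstep_scale d xs) \<omega> = d * lstep_int L xs \<omega>"
  "lstep_within lo hi (lstep_scale d xs) \<longleftrightarrow> lstep_within lo hi xs"
  by (induction xs) (auto simp: lstep_scale_def algebra_simps)

lemma L2_indicator_Ioc: "(\<lambda>u. indicator {x<..y::real} u *\<^sub>R (c :: 'b::{real_normed_vector,second_countable_topology})) \<in> L2 lborel"
proof -
  have "(\<lambda>u. (norm (indicator {x<..y} u *\<^sub>R c))\<^sup>2) = (\<lambda>u. indicator {x<..y} u *\<^sub>R (norm c)\<^sup>2)"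
    by (auto simp: fun_eq_iff indicator_def)
  moreover have "integrable lborel (\<lambda>u. indicator {x<..y} u *\<^sub>R (norm c)\<^sup>2)"
    by (intro integrable_scaleR_left integrable_real_indicator) (cases "x \<le> y"; simp)+
  ultimately show ?thesis by (simp add: L2_def)
qed

lemma L2_lstep_fun: "lstep_fun xs \<in> L2 lborel"
proof (induction xs)
  case Nil
  have "lstep_fun [] = (\<lambda>_. 0)" by (simp add: fun_eq_iff)
  then show ?case by simp
next
  case (Cons z xs)
  obtain c x y where z: "z = (c, x, y)" by (cases z) auto
  have "lstep_fun (z # xs) = (\<lambda>u. indicator {x<..y} u *\<^sub>R c + lstep_fun xs u)" by (simp add: fun_eq_iff z)
  then show ?case using L2_add[OF L2_indicator_Ioc Cons] by simp
qed

context square_levy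
begin

text \<open>The contribution of one coordinate of L. The isometry is stated for single coordinates,
  because the covariance between different coordinates of the same increment is unknown.\<close>

definition lstep_int1 :: "'k \<Rightarrow> 'k lstep \<Rightarrow> 'w \<Rightarrow> real" where
  "lstep_int1 a xs \<omega> = (\<Sum>(c, x, y)\<leftarrow>xs. c $ a * (L y \<omega> $ a - L x \<omega> $ a))"

lemma lstep_int1_Cons:
  "lstep_int1 a ((c, x, y) # xs) \<omega> = c $ a * (L y \<omega> $ a - L x \<omega> $ a) + lstep_int1 a xs \<omega>"
  by (simp add: lstep_int1_def)

lemma lstep_int_eq_sum: "lstep_int L xs \<omega> = (\<Sum>a\<in>UNIV. lstep_int1 a xs \<omega>)"
proof (induction xs)
  case (Cons z xs)
  then show ?case by (cases z) (simp add: lstep_int1_Cons sum.distrib inner_vec_def)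
qed (simp add: lstep_int1_def)

lemma L2_lstep_int1: "lstep_int1 a xs \<in> L2 M"
proof (induction xs)
  case Nil
  have "lstep_int1 a [] = (\<lambda>_. 0)" by (simp add: fun_eq_iff lstep_int1_def)
  then show ?case by simp
next
  case (Cons z xs)
  obtain c x y where z: "z = (c, x, y)" by (cases z) auto
  have "lstep_int1 a (z # xs) = (\<lambda>\<omega>. c $ a * (L y \<omega> $ a - L x \<omega> $ a) + lstep_int1 a xs \<omega>)"
    by (simp add: fun_eq_iff z lstep_int1_Cons)
  then show ?case using L2_add[OF L2_mult_left[OF L2_increment_nth] Cons] by simp
qed

lemma L2_lstep_int: "lstep_int L xs \<in> L2 M"
proof -
  have "lstep_int L xs = (\<lambda>\<omega>. \<Sum>a\<in>UNIV. lstep_int1 a xs \<omega>)" by (simp add: fun_eq_iff lstep_int_eq_sum)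
  then show ?thesis using L2_sum[of UNIV "\<lambda>a. lstep_int1 a xs" M] L2_lstep_int1 by simp
qed

lemma L2_lstep_fun_nth: "(\<lambda>u. lstep_fun xs u $ a) \<in> L2 lborel"
  by (rule L2_bounded_linear[OF bounded_linear_vec_nth L2_lstep_fun])

lemma lstep_isometry_single:
  assumes "lstep_within lo hi xs" "x' \<le> y'"
  shows "l2inner M (lstep_int1 a xs) (\<lambda>\<omega>. L y' \<omega> $ a - L x' \<omega> $ a)
       = (sigma a)\<^sup>2 * l2inner lborel (\<lambda>u. lstep_fun xs u $ a) (indicator {x'<..y'})"
  using assms(1)
proof (induction xs)
  case Nil
  then show ?case by (simp add: l2inner_def lstep_int1_def)
next
  case (Cons z xs)
  obtain c x y where z: "z = (c, x, y)" by (cases z) auto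
  note inc = L2_increment_nth[of y' a x']
  have ind: "(indicator {x<..y} :: real \<Rightarrow> real) \<in> L2 lborel" for x y :: real
    using L2_indicator_Ioc[of x y "1::real"] by simp
  have "l2inner M (lstep_int1 a (z # xs)) (\<lambda>\<omega>. L y' \<omega> $ a - L x' \<omega> $ a)
      = c $ a * l2inner M (\<lambda>\<omega>. L y \<omega> $ a - L x \<omega> $ a) (\<lambda>\<omega>. L y' \<omega> $ a - L x' \<omega> $ a)
        + l2inner M (lstep_int1 a xs) (\<lambda>\<omega>. L y' \<omega> $ a - L x' \<omega> $ a)"
  proof -
    have "lstep_int1 a (z # xs) = (\<lambda>\<omega>. c $ a *\<^sub>R (L y \<omega> $ a - L x \<omega> $ a) + lstep_int1 a xs \<omega>)"
      by (simp add: fun_eq_iff z lstep_int1_Cons)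
    then show ?thesis
      using l2inner_add_left[OF L2_scaleR[OF L2_increment_nth] L2_lstep_int1 inc]
      by (simp only: l2inner_scaleR_left)
  qed
  also have "\<dots> = c $ a * ((sigma a)\<^sup>2 * measure lborel ({x<..y} \<inter> {x'<..y'}))
     + (sigma a)\<^sup>2 * l2inner lborel (\<lambda>u. lstep_fun xs u $ a) (indicator {x'<..y'})"
    using Cons z assms(2) by (simp add: increment_covariance)
  also have "measure lborel ({x<..y} \<inter> {x'<..y'}) = l2inner lborel (indicator {x<..y} :: real \<Rightarrow> real) (indicator {x'<..y'})"
  proof -
    have "measure lborel K = (LINT u|lborel. indicator K u)" if "K \<in> sets lborel" for K :: "real set"
      using that by simp
    moreover have "(\<lambda>u. (indicator {x<..y} u :: real) \<bullet> (indicator {x'<..y'} u :: real)) = indicator ({x<..y} \<inter> {x'<..y'})"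
      by (auto simp: fun_eq_iff indicator_def)
    ultimately show ?thesis by (simp only: l2inner_def) simp
  qed
  also have "c $ a * ((sigma a)\<^sup>2 * l2inner lborel (indicator {x<..y} :: real \<Rightarrow> real) (indicator {x'<..y'}))
     + (sigma a)\<^sup>2 * l2inner lborel (\<lambda>u. lstep_fun xs u $ a) (indicator {x'<..y'})
     = (sigma a)\<^sup>2 * l2inner lborel (\<lambda>u. lstep_fun (z # xs) u $ a) (indicator {x'<..y'})"
  proof -
    have "(\<lambda>u. lstep_fun (z # xs) u $ a) = (\<lambda>u. c $ a *\<^sub>R indicator {x<..y} u + lstep_fun xs u $ a)"
      by (simp add: fun_eq_iff z)
    moreover have "l2inner lborel (\<lambda>u. c $ a *\<^sub>R indicator {x<..y} u + lstep_fun xs u $ a) (indicator {x'<..y'})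
        = c $ a * l2inner lborel (indicator {x<..y} :: real \<Rightarrow> real) (indicator {x'<..y'})
          + l2inner lborel (\<lambda>u. lstep_fun xs u $ a) (indicator {x'<..y'})"
      by (subst l2inner_add_left[OF L2_scaleR[OF ind] L2_lstep_fun_nth ind]) (simp only: l2inner_scaleR_left)
    ultimately show ?thesis by (simp only: distrib_left mult.left_commute)
  qed
  finally show ?case .
qed

text \<open>The isometry for one coordinate is the bilinear extension of the covariance of two
  increments. Since that formula holds for arbitrary pairs of intervals, overlaps within a list do
  no harm.\<close>

lemma lstep_isometry:
  assumes "lstep_within lo hi xs" "lstep_within lo' hi' ys"
  shows "l2inner M (lstep_int1 a xs) (lstep_int1 a ys)
       = (sigma a)\<^sup>2 * l2inner lborel (\<lambda>u. lstep_fun xs u $ a) (\<lambda>u. lstep_fun ys u $ a)"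
  using assms(2)
proof (induction ys)
  case Nil
  then show ?case by (simp add: l2inner_def lstep_int1_def)
next
  case (Cons z ys)
  obtain c x y where z: "z = (c, x, y)" by (cases z) auto
  have ind: "(indicator {x<..y} :: real \<Rightarrow> real) \<in> L2 lborel" for x y :: real
    using L2_indicator_Ioc[of x y "1::real"] by simp
  have e1: "lstep_int1 a (z # ys) = (\<lambda>\<omega>. c $ a *\<^sub>R (L y \<omega> $ a - L x \<omega> $ a) + lstep_int1 a ys \<omega>)"
    by (simp add: fun_eq_iff z lstep_int1_Cons)
  have e2: "(\<lambda>u. lstep_fun (z # ys) u $ a) = (\<lambda>u. c $ a *\<^sub>R indicator {x<..y} u + lstep_fun ys u $ a)"
    by (simp add: fun_eq_iff z)
  have "l2inner M (lstep_int1 a xs) (lstep_int1 a (z # ys)) = l2inner M (lstep_int1 a (z # ys)) (lstep_int1 a xs)"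
    by (rule l2inner_commute)
  also have "\<dots> = c $ a * l2inner M (\<lambda>\<omega>. L y \<omega> $ a - L x \<omega> $ a) (lstep_int1 a xs) + l2inner M (lstep_int1 a ys) (lstep_int1 a xs)"
    unfolding e1 using l2inner_add_left[OF L2_scaleR[OF L2_increment_nth] L2_lstep_int1 L2_lstep_int1]
    by (simp only: l2inner_scaleR_left)
  also have "\<dots> = c $ a * l2inner M (lstep_int1 a xs) (\<lambda>\<omega>. L y \<omega> $ a - L x \<omega> $ a) + l2inner M (lstep_int1 a xs) (lstep_int1 a ys)"
    by (simp only: l2inner_commute)
  also have "\<dots> = c $ a * ((sigma a)\<^sup>2 * l2inner lborel (\<lambda>u. lstep_fun xs u $ a) (indicator {x<..y}))
      + (sigma a)\<^sup>2 * l2inner lborel (\<lambda>u. lstep_fun xs u $ a) (\<lambda>u. lstep_fun ys u $ a)"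
    using Cons z lstep_isometry_single[OF assms(1), of x y] by simp
  also have "\<dots> = (sigma a)\<^sup>2 * (c $ a * l2inner lborel (indicator {x<..y}) (\<lambda>u. lstep_fun xs u $ a)
      + l2inner lborel (\<lambda>u. lstep_fun ys u $ a) (\<lambda>u. lstep_fun xs u $ a))"
    by (simp only: l2inner_commute) (simp add: algebra_simps)
  also have "\<dots> = (sigma a)\<^sup>2 * l2inner lborel (\<lambda>u. lstep_fun (z # ys) u $ a) (\<lambda>u. lstep_fun xs u $ a)"
    unfolding e2 by (subst l2inner_add_left[OF L2_scaleR[OF ind] L2_lstep_fun_nth L2_lstep_fun_nth])
      (simp only: l2inner_scaleR_left)
  also have "\<dots> = (sigma a)\<^sup>2 * l2inner lborel (\<lambda>u. lstep_fun xs u $ a) (\<lambda>u. lstep_fun (z # ys) u $ a)"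
    by (simp only: l2inner_commute)
  finally show ?case .
qed

definition sigma_sum :: real where "sigma_sum = (\<Sum>a\<in>UNIV. sigma a)"

lemma sigma_nonneg: "sigma a \<ge> 0"
  by (simp add: sigma_def)

lemma sigma_sum_nonneg: "sigma_sum \<ge> 0"
  unfolding sigma_sum_def by (intro sum_nonneg sigma_nonneg)

text \<open>The coordinates are combined by the triangle inequality, which replaces their
  covariances by the sum of the standard deviations; hence an estimate and not an isometry.\<close>

lemma l2norm_lstep_int:
  assumes "lstep_within lo hi xs"
  shows "l2norm M (lstep_int L xs) \<le> sigma_sum * l2norm lborel (lstep_fun xs)"
proof -
  have "l2norm M (lstep_int L xs) = l2norm M (\<lambda>\<omega>. \<Sum>a\<in>UNIV. lstep_int1 a xs \<omega>)"
    by (intro arg_cong[of _ _ "l2norm M"]) (simp add: fun_eq_iff lstep_int_eq_sum)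
  also have "\<dots> \<le> (\<Sum>a\<in>UNIV. l2norm M (lstep_int1 a xs))"
    by (intro l2norm_sum L2_lstep_int1)
  also have "\<dots> \<le> (\<Sum>a\<in>UNIV. sigma a * l2norm lborel (lstep_fun xs))"
  proof (rule sum_mono)
    fix a
    have "(l2norm M (lstep_int1 a xs))\<^sup>2 = (sigma a * l2norm lborel (\<lambda>u. lstep_fun xs u $ a))\<^sup>2"
      unfolding power_mult_distrib l2norm_eq_inner using assms assms by (rule lstep_isometry)
    then have "l2norm M (lstep_int1 a xs) = sigma a * l2norm lborel (\<lambda>u. lstep_fun xs u $ a)"
      by (rule power2_eq_imp_eq) (simp_all add: sigma_nonneg)
    also have "l2norm lborel (\<lambda>u. lstep_fun xs u $ a) \<le> l2norm lborel (lstep_fun xs)"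
      by (intro l2norm_le_norm L2_lstep_fun L2_lstep_fun_nth) (simp add: component_le_norm_cart)
    finally show "l2norm M (lstep_int1 a xs) \<le> sigma a * l2norm lborel (lstep_fun xs)"
      using sigma_nonneg by (simp add: mult_left_mono)
  qed
  finally show ?thesis by (simp add: sigma_sum_def sum_distrib_right)
qed

text \<open>Here different coordinates do meet, but over intervals that do not overlap increments
  are orthogonal for every pair of coordinates.\<close>

lemma lstep_int_increment_orthogonal:
  assumes "lstep_within lo hi xs" "hi \<le> x" "x \<le> y"
  shows "l2inner M (lstep_int L xs) (\<lambda>\<omega>. c \<bullet> (L y \<omega> - L x \<omega>)) = 0"
proof -
  have inc: "(\<lambda>\<omega>. c \<bullet> (L y \<omega> - L x \<omega>)) \<in> L2 M" for c x y
    by (rule L2_bounded_linear[OF bounded_linear_inner_right L2_increment])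
  have single: "l2inner M (\<lambda>\<omega>. d \<bullet> (L y' \<omega> - L x' \<omega>)) (\<lambda>\<omega>. c \<bullet> (L y \<omega> - L x \<omega>)) = 0" if "x' \<le> y'" "y' \<le> hi" for d x' y'
  proof -
    have L: "(\<lambda>\<omega>. e $ a *\<^sub>R (L y \<omega> $ a - L x \<omega> $ a)) \<in> L2 M" for a e x y
      by (intro L2_scaleR L2_increment_nth)
    have expand: "(\<lambda>\<omega>. e \<bullet> (L y \<omega> - L x \<omega>)) = (\<lambda>\<omega>. \<Sum>a\<in>UNIV. e $ a *\<^sub>R (L y \<omega> $ a - L x \<omega> $ a))" for e x y
      by (simp add: fun_eq_iff inner_vec_def)
    have "l2inner M (\<lambda>\<omega>. d $ a *\<^sub>R (L y' \<omega> $ a - L x' \<omega> $ a)) (\<lambda>\<omega>. \<Sum>b\<in>UNIV. c $ b *\<^sub>R (L y \<omega> $ b - L x \<omega> $ b)) = 0" for a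
    proof -
      have "l2inner M (\<lambda>\<omega>. \<Sum>b\<in>UNIV. c $ b *\<^sub>R (L y \<omega> $ b - L x \<omega> $ b)) (\<lambda>\<omega>. L y' \<omega> $ a - L x' \<omega> $ a)
          = (\<Sum>b\<in>UNIV. c $ b * l2inner M (\<lambda>\<omega>. L y \<omega> $ b - L x \<omega> $ b) (\<lambda>\<omega>. L y' \<omega> $ a - L x' \<omega> $ a))"
        using l2inner_sum_left[of UNIV "\<lambda>b \<omega>. c $ b *\<^sub>R (L y \<omega> $ b - L x \<omega> $ b)", OF L L2_increment_nth]
        by (simp only: l2inner_scaleR_left)
      also have "\<dots> = 0"
      proof (intro sum.neutral ballI)
        fix b
        have "l2inner M (\<lambda>\<omega>. L y \<omega> $ b - L x \<omega> $ b) (\<lambda>\<omega>. L y' \<omega> $ a - L x' \<omega> $ a)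
            = l2inner M (\<lambda>\<omega>. L y' \<omega> $ a - L x' \<omega> $ a) (\<lambda>\<omega>. L y \<omega> $ b - L x \<omega> $ b)"
          by (rule l2inner_commute)
        also have "\<dots> = 0" using that assms by (intro increment_orthogonal) auto
        finally show "c $ b * l2inner M (\<lambda>\<omega>. L y \<omega> $ b - L x \<omega> $ b) (\<lambda>\<omega>. L y' \<omega> $ a - L x' \<omega> $ a) = 0" by simp
      qed
      finally show ?thesis
        by (simp only: l2inner_scaleR_left l2inner_commute[of M "\<lambda>\<omega>. L y' \<omega> $ a - L x' \<omega> $ a"] mult_zero_right)
    qed
    then show ?thesis
      unfolding expand using L by (subst l2inner_sum_left) (auto intro: L2_sum)
  qed
  show ?thesis
    using assms(1)
  proof (induction xs)
    case Nil
    then show ?case by (simp add: l2inner_def)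
  next
    case (Cons z xs)
    obtain d x' y' where z: "z = (d, x', y')" by (cases z) auto
    have "lstep_int L (z # xs) = (\<lambda>\<omega>. d \<bullet> (L y' \<omega> - L x' \<omega>) + lstep_int L xs \<omega>)"
      by (simp add: fun_eq_iff z)
    then have "l2inner M (lstep_int L (z # xs)) (\<lambda>\<omega>. c \<bullet> (L y \<omega> - L x \<omega>))
       = l2inner M (\<lambda>\<omega>. d \<bullet> (L y' \<omega> - L x' \<omega>)) (\<lambda>\<omega>. c \<bullet> (L y \<omega> - L x \<omega>))
         + l2inner M (lstep_int L xs) (\<lambda>\<omega>. c \<bullet> (L y \<omega> - L x \<omega>))"
      using l2inner_add_left[OF inc L2_lstep_int inc] by simp
    also have "\<dots> = 0" using Cons single[of x' y' d] z by simp
    finally show ?case .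
  qed
qed

lemma lstep_int_orthogonal:
  assumes "lstep_within lo hi xs" "lstep_within lo' hi' ys" "hi \<le> lo'"
  shows "l2inner M (lstep_int L xs) (lstep_int L ys) = 0"
  using assms(2)
proof (induction ys)
  case Nil
  then show ?case by (simp add: l2inner_def)
next
  case (Cons z ys)
  obtain c x y where z: "z = (c, x, y)" by (cases z) auto
  have inc: "(\<lambda>\<omega>. c \<bullet> (L y \<omega> - L x \<omega>)) \<in> L2 M"
    by (rule L2_bounded_linear[OF bounded_linear_inner_right L2_increment])
  have "lstep_int L (z # ys) = (\<lambda>\<omega>. c \<bullet> (L y \<omega> - L x \<omega>) + lstep_int L ys \<omega>)"
    by (simp add: fun_eq_iff z)
  then have "l2inner M (lstep_int L (z # ys)) (lstep_int L xs)
     = l2inner M (\<lambda>\<omega>. c \<bullet> (L y \<omega> - L x \<omega>)) (lstep_int L xs) + l2inner M (lstep_int L ys) (lstep_int L xs)"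
    using l2inner_add_left[OF inc L2_lstep_int L2_lstep_int] by simp
  then have "l2inner M (lstep_int L xs) (lstep_int L (z # ys))
     = l2inner M (lstep_int L xs) (\<lambda>\<omega>. c \<bullet> (L y \<omega> - L x \<omega>)) + l2inner M (lstep_int L xs) (lstep_int L ys)"
    by (simp only: l2inner_commute)
  also have "\<dots> = 0"
    using Cons z assms lstep_int_increment_orthogonal[OF assms(1), of x y c] by simp
  finally show ?case .
qed

section \<open>Integrals of deterministic square-integrable rows\<close>

text \<open>\<open>levy_int lo hi G I\<close> says that \<open>I = \<integral> G dL\<close>, where the integrand \<open>G\<close> is a row vector supported
  in \<open>[lo, hi]\<close>.\<close>

definition levy_int :: "real \<Rightarrow> real \<Rightarrow> (real \<Rightarrow> real^'k) \<Rightarrow> ('w \<Rightarrow> real) \<Rightarrow> bool" where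
  "levy_int lo hi G I \<longleftrightarrow> G \<in> L2 lborel \<and> I \<in> L2 M \<and>
     (\<forall>e>0. \<exists>xs. lstep_within lo hi xs \<and> l2norm lborel (\<lambda>u. G u - lstep_fun xs u) < e \<and>
        l2norm M (\<lambda>\<omega>. I \<omega> - lstep_int L xs \<omega>) < e)"

lemma levy_int_mono: "levy_int lo hi G I \<Longrightarrow> lo' \<le> lo \<Longrightarrow> hi \<le> hi' \<Longrightarrow> levy_int lo' hi' G I"
proof -
  assume "lo' \<le> lo" "hi \<le> hi'"
  then have "lstep_within lo hi xs \<Longrightarrow> lstep_within lo' hi' xs" for xs :: "'k lstep"
    by (fastforce simp: lstep_within_def)
  then show "levy_int lo hi G I \<Longrightarrow> levy_int lo' hi' G I" unfolding levy_int_def by blast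
qed

lemma levy_int_0: "levy_int lo hi (\<lambda>_. 0) (\<lambda>_. 0)"
  unfolding levy_int_def by (auto intro!: exI[of _ "[]"])

lemma levy_int_add:
  assumes "levy_int lo hi G I" "levy_int lo hi G' I'"
  shows "levy_int lo hi (\<lambda>u. G u + G' u) (\<lambda>\<omega>. I \<omega> + I' \<omega>)"
  unfolding levy_int_def
proof (intro conjI allI impI)
  have L2: "G \<in> L2 lborel" "G' \<in> L2 lborel" "I \<in> L2 M" "I' \<in> L2 M"
    using assms by (auto simp: levy_int_def)
  show "(\<lambda>u. G u + G' u) \<in> L2 lborel" "(\<lambda>\<omega>. I \<omega> + I' \<omega>) \<in> L2 M"
    using L2 by (auto intro: L2_add)
  fix e :: real assume "e > 0"
  then have e: "e / 2 > 0" by simp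
  obtain xs where xs: "lstep_within lo hi xs" "l2norm lborel (\<lambda>u. G u - lstep_fun xs u) < e / 2" "l2norm M (\<lambda>\<omega>. I \<omega> - lstep_int L xs \<omega>) < e / 2"
    using assms(1) e unfolding levy_int_def by blast
  obtain ys where ys: "lstep_within lo hi ys" "l2norm lborel (\<lambda>u. G' u - lstep_fun ys u) < e / 2" "l2norm M (\<lambda>\<omega>. I' \<omega> - lstep_int L ys \<omega>) < e / 2"
    using assms(2) e unfolding levy_int_def by blast
  have "l2norm lborel (\<lambda>u. (G u + G' u) - lstep_fun (xs @ ys) u) < e"
    using l2norm_triangle[OF L2_diff[OF L2(1) L2_lstep_fun[of xs]] L2_diff[OF L2(2) L2_lstep_fun[of ys]]] xs ys
    by (simp add: lstep_append add_diff_add)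
  moreover have "l2norm M (\<lambda>\<omega>. (I \<omega> + I' \<omega>) - lstep_int L (xs @ ys) \<omega>) < e"
    using l2norm_triangle[OF L2_diff[OF L2(3) L2_lstep_int[of xs]] L2_diff[OF L2(4) L2_lstep_int[of ys]]] xs ys
    by (simp add: lstep_append add_diff_add)
  ultimately show "\<exists>xs. lstep_within lo hi xs \<and> l2norm lborel (\<lambda>u. G u + G' u - lstep_fun xs u) < e \<and>
        l2norm M (\<lambda>\<omega>. I \<omega> + I' \<omega> - lstep_int L xs \<omega>) < e"
    using xs ys by (intro exI[of _ "xs @ ys"]) (simp add: lstep_append)
qed

lemma levy_int_scale:
  assumes "levy_int lo hi G I"
  shows "levy_int lo hi (\<lambda>u. d *\<^sub>R G u) (\<lambda>\<omega>. d * I \<omega>)"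
  unfolding levy_int_def
proof (intro conjI allI impI)
  have L2: "G \<in> L2 lborel" "I \<in> L2 M"
    using assms by (auto simp: levy_int_def)
  show "(\<lambda>u. d *\<^sub>R G u) \<in> L2 lborel" "(\<lambda>\<omega>. d * I \<omega>) \<in> L2 M"
    using L2 by (auto intro: L2_scaleR L2_mult_left)
  fix e :: real assume "e > 0"
  then have e: "e / (\<bar>d\<bar> + 1) > 0" by (simp add: add_nonneg_pos)
  then obtain xs where xs: "lstep_within lo hi xs" "l2norm lborel (\<lambda>u. G u - lstep_fun xs u) < e / (\<bar>d\<bar> + 1)" "l2norm M (\<lambda>\<omega>. I \<omega> - lstep_int L xs \<omega>) < e / (\<bar>d\<bar> + 1)"
    using assms unfolding levy_int_def by blast
  have less: "\<bar>d\<bar> * z < e" if "z < e / (\<bar>d\<bar> + 1)" "0 \<le> z" for z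
  proof -
    have "\<bar>d\<bar> * z \<le> (\<bar>d\<bar> + 1) * z" using that by (simp add: mult_right_mono)
    also have "\<dots> < e" using that by (simp add: pos_less_divide_eq add_nonneg_pos mult.commute)
    finally show ?thesis .
  qed
  have "l2norm lborel (\<lambda>u. d *\<^sub>R G u - lstep_fun (lstep_scale d xs) u) < e"
    using less[OF xs(2)] l2norm_scaleR[of lborel d "\<lambda>u. G u - lstep_fun xs u"] by (simp add: lstep_scale scaleR_diff_right)
  moreover have "l2norm M (\<lambda>\<omega>. d * I \<omega> - lstep_int L (lstep_scale d xs) \<omega>) < e"
    using less[OF xs(3)] l2norm_scaleR[of M d "\<lambda>\<omega>. I \<omega> - lstep_int L xs \<omega>"] by (simp add: lstep_scale right_diff_distrib)
  ultimately show "\<exists>xs. lstep_within lo hi xs \<and> l2norm lborel (\<lambda>u. d *\<^sub>R G u - lstep_fun xs u) < e \<and>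
        l2norm M (\<lambda>\<omega>. d * I \<omega> - lstep_int L xs \<omega>) < e"
    using xs by (intro exI[of _ "lstep_scale d xs"]) (simp add: lstep_scale)
qed

lemma levy_int_sum:
  assumes "\<And>i. i \<in> J \<Longrightarrow> levy_int lo hi (G i) (I i)"
  shows "levy_int lo hi (\<lambda>u. \<Sum>i\<in>J. G i u) (\<lambda>\<omega>. \<Sum>i\<in>J. I i \<omega>)"
  using assms by (induction J rule: infinite_finite_induct) (simp_all add: levy_int_0 levy_int_add)

lemma levy_int_norm:
  assumes "levy_int lo hi G I"
  shows "l2norm M I \<le> sigma_sum * l2norm lborel G"
proof (rule field_le_epsilon)
  have L2: "G \<in> L2 lborel" "I \<in> L2 M"
    using assms by (auto simp: levy_int_def)
  fix e :: real assume e: "e > 0"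
  \<comment> \<open>Replacing the integrand and the integral by a step approximation costs e'
    (sigma_sum + 1) in total, which is e.\<close>
  define e' where "e' = e / (sigma_sum + 1)"
  have "e' > 0" using e sigma_sum_nonneg by (simp add: e'_def)
  then obtain xs where xs: "lstep_within lo hi xs" "l2norm lborel (\<lambda>u. G u - lstep_fun xs u) < e'" "l2norm M (\<lambda>\<omega>. I \<omega> - lstep_int L xs \<omega>) < e'"
    using assms unfolding levy_int_def by blast
  have "l2norm M I \<le> l2norm M (\<lambda>\<omega>. I \<omega> - lstep_int L xs \<omega>) + l2norm M (lstep_int L xs)"
    using l2norm_triangle[OF L2_diff[OF L2(2) L2_lstep_int[of xs]] L2_lstep_int[of xs]] by simp
  also have "\<dots> \<le> e' + sigma_sum * l2norm lborel (lstep_fun xs)"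
    using xs l2norm_lstep_int[OF xs(1)] by simp
  also have "l2norm lborel (lstep_fun xs) \<le> l2norm lborel G + e'"
  proof -
    have "l2norm lborel (lstep_fun xs) \<le> l2norm lborel G + l2norm lborel (\<lambda>u. G u - lstep_fun xs u)"
      using l2norm_diff[OF L2(1) L2_diff[OF L2(1) L2_lstep_fun[of xs]]] by simp
    then show ?thesis using xs by simp
  qed
  then have "e' + sigma_sum * l2norm lborel (lstep_fun xs) \<le> e' + sigma_sum * (l2norm lborel G + e')"
    using sigma_sum_nonneg by (simp add: mult_left_mono)
  also have "\<dots> = sigma_sum * l2norm lborel G + e"
  proof -
    have "e' * (sigma_sum + 1) = e" using sigma_sum_nonneg by (simp add: e'_def)
    then show ?thesis by (simp add: algebra_simps)
  qed
  finally show "l2norm M I \<le> sigma_sum * l2norm lborel G + e" by simp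
qed

lemma levy_int_orthogonal:
  assumes "levy_int lo hi G I" "levy_int lo' hi' G' I'" "hi \<le> lo'"
  shows "l2inner M I I' = 0"
proof -
  have L2: "I \<in> L2 M" "I' \<in> L2 M" using assms by (auto simp: levy_int_def)
  have "\<exists>xs. lstep_within lo hi xs \<and> l2norm M (\<lambda>\<omega>. I \<omega> - lstep_int L xs \<omega>) < inverse (real (Suc n))" for n
    using assms(1) unfolding levy_int_def by (meson inverse_positive_iff_positive of_nat_0_less_iff zero_less_Suc)
  then obtain xs where xs: "\<And>n. lstep_within lo hi (xs n)" "\<And>n. l2norm M (\<lambda>\<omega>. I \<omega> - lstep_int L (xs n) \<omega>) < inverse (real (Suc n))"
    by metis
  have "\<exists>ys. lstep_within lo' hi' ys \<and> l2norm M (\<lambda>\<omega>. I' \<omega> - lstep_int L ys \<omega>) < inverse (real (Suc n))" for n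
    using assms(2) unfolding levy_int_def by (meson inverse_positive_iff_positive of_nat_0_less_iff zero_less_Suc)
  then obtain ys where ys: "\<And>n. lstep_within lo' hi' (ys n)" "\<And>n. l2norm M (\<lambda>\<omega>. I' \<omega> - lstep_int L (ys n) \<omega>) < inverse (real (Suc n))"
    by metis
  have lim: "ms_lim M sequentially (\<lambda>n. lstep_int L (zs n)) J" if "J \<in> L2 M" "\<And>n. l2norm M (\<lambda>\<omega>. J \<omega> - lstep_int L (zs n) \<omega>) < inverse (real (Suc n))" for J zs
  proof -
    have "(\<lambda>n. l2norm M (\<lambda>\<omega>. lstep_int L (zs n) \<omega> - J \<omega>)) \<longlonglongrightarrow> 0"
    proof (rule tendsto_sandwich[OF _ _ tendsto_const LIMSEQ_inverse_real_of_nat])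
      show "\<forall>\<^sub>F n in sequentially. l2norm M (\<lambda>\<omega>. lstep_int L (zs n) \<omega> - J \<omega>) \<le> inverse (real (Suc n))"
        using less_imp_le[OF that(2)] by (simp add: l2norm_minus_commute)
    qed simp
    then show ?thesis using that(1) L2_lstep_int by (simp add: ms_lim_iff_l2norm)
  qed
  \<comment> \<open>The two limits are taken one after the other, so continuity of the inner product
    in one argument is enough.\<close>
  have "l2inner M (lstep_int L (ys m)) I = 0" for m
  proof -
    have "(\<lambda>n. l2inner M (lstep_int L (xs n)) (lstep_int L (ys m))) \<longlonglongrightarrow> l2inner M I (lstep_int L (ys m))"
      by (intro tendsto_l2inner lim L2 xs L2_lstep_int)
    then have "l2inner M I (lstep_int L (ys m)) = 0"
      using lstep_int_orthogonal[OF xs(1) ys(1) assms(3)] LIMSEQ_unique tendsto_const by (simp add: LIMSEQ_const_iff)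
    then show ?thesis by (simp add: l2inner_commute)
  qed
  moreover have "(\<lambda>n. l2inner M (lstep_int L (ys n)) I) \<longlonglongrightarrow> l2inner M I' I"
    by (intro tendsto_l2inner lim L2 ys)
  ultimately have "l2inner M I' I = 0" by (simp add: LIMSEQ_const_iff)
  then show ?thesis by (simp add: l2inner_commute)
qed

text \<open>Row \<open>b\<close> of the coefficients over a partition gives a list of intervals.
  Since these lie in [s, t], cutting off by the indicator of [s, t] leaves the step function
  unchanged and makes the integrand a function on the whole line.\<close>

lemma has_levy_integral_imp_levy_int:
  assumes "has_levy_integral M L G s t I"
  shows "levy_int s t (\<lambda>u. indicator {s..t} u *\<^sub>R (G u $ b)) (\<lambda>\<omega>. I \<omega> $ b)"
proof -
  obtain n x c where G_meas: "set_borel_measurable lborel {s..t} G"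
    and G_int: "set_integrable lborel {s..t} (\<lambda>u. (norm (G u))\<^sup>2)"
    and part: "\<And>m. x m 0 = s" "\<And>m. x m (n m) = t" "\<And>m i. i < n m \<Longrightarrow> x m i \<le> x m (Suc i)"
    and G_lim: "(\<lambda>m. LINT u:{s..t}|lborel. (norm (step_fun (n m) (x m) (c m) u - G u))\<^sup>2) \<longlonglongrightarrow> 0"
    and I_lim: "ms_lim M sequentially (\<lambda>m. step_integral L (n m) (x m) (c m)) I"
    using assms unfolding has_levy_integral_def by blast
  define G' where "G' u = indicator {s..t} u *\<^sub>R G u" for u
  define S where "S m u = indicator {s..t} u *\<^sub>R step_fun (n m) (x m) (c m) u" for m u
  define zs where "zs m = map (\<lambda>i. (c m i $ b, x m i, x m (Suc i))) [0..<n m]" for m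
  have mono: "x m i \<le> x m j" if "i \<le> j" "j \<le> n m" for m i j
    using that(1)
  proof (induction rule: inc_induct)
    case (step k)
    then show ?case using part(3)[of k m] that by (meson order.strict_trans2 order.trans)
  qed simp
  have range: "s \<le> x m i" "x m i \<le> t" if "i \<le> n m" for m i
    using mono[of 0 i m] mono[of i "n m" m] that part by auto
  have within: "lstep_within s t (zs m)" for m
    using range part(3) by (auto simp: zs_def lstep_within_def)
  have fun_zs: "lstep_fun (zs m) u = S m u $ b" for m u
  proof -
    have "lstep_fun (zs m) u = (\<Sum>i<n m. indicator {x m i<..x m (Suc i)} u *\<^sub>R (c m i $ b))"
      by (simp add: lstep_fun_def zs_def interv_sum_list_conv_sum_set_nat atLeast0LessThan comp_def)
    also have "\<dots> = (\<Sum>i<n m. indicator {s..t} u *\<^sub>R (indicator {x m i<..x m (Suc i)} u *\<^sub>R (c m i $ b)))"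
    proof (intro sum.cong refl)
      fix i assume "i \<in> {..<n m}"
      then have "u \<in> {x m i<..x m (Suc i)} \<Longrightarrow> u \<in> {s..t}"
        using range[of i m] range[of "Suc i" m] by auto
      then show "indicator {x m i<..x m (Suc i)} u *\<^sub>R (c m i $ b) = indicator {s..t} u *\<^sub>R (indicator {x m i<..x m (Suc i)} u *\<^sub>R (c m i $ b))"
        by (auto simp: indicator_def)
    qed
    also have "\<dots> = S m u $ b"
      by (simp only: S_def step_fun_def scaleR_sum_right sum_component vector_scaleR_component)
    finally show ?thesis .
  qed
  have int_zs: "lstep_int L (zs m) \<omega> = step_integral L (n m) (x m) (c m) \<omega> $ b" for m \<omega>
  proof -
    have "lstep_int L (zs m) \<omega> = (\<Sum>i<n m. (c m i $ b) \<bullet> (L (x m (Suc i)) \<omega> - L (x m i) \<omega>))"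
      by (simp add: lstep_int_def zs_def interv_sum_list_conv_sum_set_nat atLeast0LessThan comp_def)
    then show ?thesis by (simp add: step_integral_def matrix_vector_mul_component)
  qed
  have G'L2: "G' \<in> L2 lborel"
  proof -
    have "(\<lambda>u. (norm (G' u))\<^sup>2) = (\<lambda>u. indicator {s..t} u *\<^sub>R (norm (G u))\<^sup>2)"
      by (auto simp: fun_eq_iff G'_def indicator_def)
    then show ?thesis using G_meas G_int by (simp add: L2_def set_borel_measurable_def set_integrable_def G'_def[abs_def])
  qed
  have SL2: "S m \<in> L2 lborel" for m
  proof -
    have "S m = (\<lambda>u. \<Sum>i<n m. indicator {x m i<..x m (Suc i)} u *\<^sub>R c m i)"
    proof
      fix u
      have "u \<in> {x m i<..x m (Suc i)} \<Longrightarrow> u \<in> {s..t}" if "i < n m" for i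
        using range[of i m] range[of "Suc i" m] that by auto
      then show "S m u = (\<Sum>i<n m. indicator {x m i<..x m (Suc i)} u *\<^sub>R c m i)"
        unfolding S_def step_fun_def scaleR_sum_right by (intro sum.cong refl) (auto simp: indicator_def)
    qed
    then show ?thesis by (simp only:) (intro L2_sum L2_indicator_Ioc)
  qed
  have norm_lim: "(\<lambda>m. l2norm lborel (\<lambda>u. S m u - G' u)) \<longlonglongrightarrow> 0"
  proof -
    have "(LINT u:{s..t}|lborel. (norm (step_fun (n m) (x m) (c m) u - G u))\<^sup>2) = (l2norm lborel (\<lambda>u. S m u - G' u))\<^sup>2" for m
      unfolding l2norm_power2 set_lebesgue_integral_def
      by (intro Bochner_Integration.integral_cong refl) (auto simp: S_def G'_def indicator_def)
    with G_lim have "(\<lambda>m. sqrt ((l2norm lborel (\<lambda>u. S m u - G' u))\<^sup>2)) \<longlonglongrightarrow> sqrt 0"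
      by (intro tendsto_real_sqrt) simp
    then show ?thesis by simp
  qed
  note row = bounded_linear_vec_nth[of b]
  have I_row: "ms_lim M sequentially (\<lambda>m. lstep_int L (zs m)) (\<lambda>\<omega>. I \<omega> $ b)"
    using ms_lim_bounded_linear[OF row I_lim] by (simp add: int_zs[abs_def])
  show ?thesis
    unfolding levy_int_def
  proof (intro conjI allI impI)
    show 1: "(\<lambda>u. indicator {s..t} u *\<^sub>R (G u $ b)) \<in> L2 lborel"
      using L2_bounded_linear[OF row G'L2] by (simp add: G'_def)
    show 2: "(\<lambda>\<omega>. I \<omega> $ b) \<in> L2 M" using I_row by (simp add: ms_lim_iff_l2norm)
    fix e :: real assume e: "e > 0"
    have "\<forall>\<^sub>F m in sequentially. l2norm M (\<lambda>\<omega>. lstep_int L (zs m) \<omega> - I \<omega> $ b) < e"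
      using I_row e by (intro order_tendstoD(2)) (auto simp: ms_lim_iff_l2norm)
    moreover have "\<forall>\<^sub>F m in sequentially. l2norm lborel (\<lambda>u. S m u - G' u) < e"
      using norm_lim e by (rule order_tendstoD(2))
    ultimately obtain m where m: "l2norm M (\<lambda>\<omega>. lstep_int L (zs m) \<omega> - I \<omega> $ b) < e" "l2norm lborel (\<lambda>u. S m u - G' u) < e"
      using eventually_happens'[OF sequentially_bot eventually_conj] by blast
    have "l2norm lborel (\<lambda>u. indicator {s..t} u *\<^sub>R (G u $ b) - lstep_fun (zs m) u) \<le> l2norm lborel (\<lambda>u. S m u - G' u)"
    proof (rule l2norm_le_norm)
      fix u
      have "indicator {s..t} u *\<^sub>R (G u $ b) - lstep_fun (zs m) u = - ((S m u - G' u) $ b)"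
        by (simp add: fun_zs G'_def)
      then show "norm (indicator {s..t} u *\<^sub>R (G u $ b) - lstep_fun (zs m) u) \<le> norm (S m u - G' u)"
        using Finite_Cartesian_Product.norm_nth_le[of "S m u - G' u" b] by (simp add: norm_minus_commute[of "G' u $ b"])
    qed (auto intro: L2_diff 1 L2_lstep_fun SL2 G'L2)
    with m show "\<exists>xs. lstep_within s t xs \<and> l2norm lborel (\<lambda>u. indicator {s..t} u *\<^sub>R (G u $ b) - lstep_fun xs u) < e \<and>
        l2norm M (\<lambda>\<omega>. I \<omega> $ b - lstep_int L xs \<omega>) < e"
      using within by (intro exI[of _ "zs m"]) (simp add: l2norm_minus_commute)
  qed
qed

end

section \<open>Exponential tails\<close>

lemma nn_integral_exp_tail:
  fixes c s t :: real
  assumes "c > 0"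
  shows "(\<integral>\<^sup>+u. ennreal (exp (- c * (t - u))) * indicator {..s} u \<partial>lborel) = ennreal (exp (- c * (t - s)) / c)"
proof -
  have "(\<integral>\<^sup>+u. ennreal (exp (- c * (t - u))) * indicator {..s} u \<partial>lborel)
      = (\<integral>\<^sup>+x. ennreal (exp (- c * (t - s + x))) * indicator {0..} x \<partial>lborel)"
    by (subst nn_integral_real_affine[where c = "-1" and t = s])
      (auto intro!: nn_integral_cong simp: indicator_def algebra_simps)
  also have "\<dots> = ennreal (0 - (- exp (- c * (t - s + 0)) / c))"
  proof (rule nn_integral_FTC_atLeast)
    show "((\<lambda>x. - exp (- c * (t - s + x)) / c) has_real_derivative exp (- c * (t - s + x))) (at x)" for x
      using assms by (auto intro!: derivative_eq_intros)
    show "((\<lambda>x. - exp (- c * (t - s + x)) / c) \<longlongrightarrow> 0) at_top"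
      using assms by real_asymp
  qed auto
  finally show ?thesis by simp
qed

lemma integrable_exp_tail:
  fixes c s t :: real
  assumes "c > 0"
  shows "integrable lborel (\<lambda>u. exp (- c * (t - u)) * indicator {..s} u)"
    and "(LINT u|lborel. exp (- c * (t - u)) * indicator {..s} u) = exp (- c * (t - s)) / c"
proof -
  have "(\<integral>\<^sup>+u. ennreal (exp (- c * (t - u)) * indicator {..s} u) \<partial>lborel) = ennreal (exp (- c * (t - s)) / c)"
    using nn_integral_exp_tail[OF assms, of t s] by (simp add: ennreal_mult' ennreal_indicator)
  then have "has_bochner_integral lborel (\<lambda>u. exp (- c * (t - u)) * indicator {..s} u) (exp (- c * (t - s)) / c)"
    using assms by (intro has_bochner_integral_nn_integral) auto
  then show "integrable lborel (\<lambda>u. exp (- c * (t - u)) * indicator {..s} u)"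
    "(LINT u|lborel. exp (- c * (t - u)) * indicator {..s} u) = exp (- c * (t - s)) / c"
    by (auto simp: has_bochner_integral_iff)
qed

text \<open>No integrability is assumed: otherwise the Bochner integral has the default value
  0.\<close>

lemma ennreal_norm_integral_le: "ennreal (norm (integral\<^sup>L M f)) \<le> (\<integral>\<^sup>+x. ennreal (norm (f x)) \<partial>M)"
  for f :: "_ \<Rightarrow> 'b::{banach,second_countable_topology}"
  by (cases "integrable M f") (auto intro: integral_norm_bound_ennreal simp: not_integrable_integral_eq)

section \<open>Exponentially weighted time integrals\<close>

text \<open>A common frame for the time integrals up to \<open>t\<close> of the output against an
  entry of e^(\<Lambda>(t-u))\<Theta> or of the kernel in the theorem. The decay of \<open>k\<close>
  is asked for u \<le> t only, since such kernels may grow beyond \<open>t\<close>.\<close>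

locale weighted_process = prob_space M for M :: "'w measure" +
  fixes k :: "real \<Rightarrow> real" and z :: "real \<Rightarrow> 'w \<Rightarrow> real" and t K \<delta> B :: real
  assumes k_measurable [measurable]: "k \<in> borel_measurable borel"
    and k_le: "\<And>u. u \<le> t \<Longrightarrow> \<bar>k u\<bar> \<le> K * exp (- \<delta> * (t - u))"
    and \<delta>: "\<delta> > 0"
    and z_measurable [measurable]: "(\<lambda>(u, \<omega>). z u \<omega>) \<in> borel_measurable (borel \<Otimes>\<^sub>M M)"
    and z_L2: "\<And>u. z u \<in> L2 M" and z_le: "\<And>u. l2norm M (z u) \<le> B"
begin

lemma K_nonneg: "K \<ge> 0"
  using order.trans[OF abs_ge_zero k_le[of t]] by simp

lemma B_nonneg: "B \<ge> 0"
  using order.trans[OF l2norm_nonneg z_le[of t]] .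

lemma z_measurable_lborel [measurable]: "(\<lambda>(u, \<omega>). z u \<omega>) \<in> borel_measurable (lborel \<Otimes>\<^sub>M M)"
proof -
  have "borel_measurable (lborel \<Otimes>\<^sub>M M) = (borel_measurable (borel \<Otimes>\<^sub>M M) :: (real \<times> 'w \<Rightarrow> real) set)"
    by (intro measurable_cong_sets sets_pair_measure_cong) simp_all
  then show ?thesis using z_measurable by simp
qed

definition weight :: "real \<Rightarrow> real" where
  "weight u = K * exp (- \<delta> * (t - u))"

lemma weight_nonneg: "weight u \<ge> 0"
  by (simp add: weight_def K_nonneg)

lemma weight_measurable [measurable]: "weight \<in> borel_measurable borel"
  by (simp add: weight_def[abs_def])

lemma nn_integral_weight: "(\<integral>\<^sup>+u. ennreal (weight u) * indicator {..s} u \<partial>lborel) = ennreal (K * (exp (- \<delta> * (t - s)) / \<delta>))"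
proof -
  have "(\<integral>\<^sup>+u. ennreal (weight u) * indicator {..s} u \<partial>lborel)
      = (\<integral>\<^sup>+u. ennreal K * (ennreal (exp (- \<delta> * (t - u))) * indicator {..s} u) \<partial>lborel)"
    by (simp add: weight_def ennreal_mult' K_nonneg mult.assoc)
  also have "\<dots> = ennreal K * ennreal (exp (- \<delta> * (t - s)) / \<delta>)"
    by (subst nn_integral_cmult) (simp_all only: nn_integral_exp_tail[OF \<delta>], measurable)
  also have "\<dots> = ennreal (K * (exp (- \<delta> * (t - s)) / \<delta>))"
    by (rule ennreal_mult[symmetric]) (use K_nonneg \<delta> in auto)
  finally show ?thesis .
qed

text \<open>Cauchy-Schwarz in time with the weight split as sqrt(r) times sqrt(r)|z|: one factor is
  the mass of the weight on (-\<infinity>, s], the other has expectation at most B^2 times that mass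
  by Tonelli's theorem. Letting \<open>T\<close> and \<open>s\<close> vary gives square
  integrability and the decay of tails at once.\<close>

lemma nn_integral_square_le:
  assumes [measurable]: "T \<in> sets borel" and "T \<subseteq> {..s}" "s \<le> t"
  shows "(\<integral>\<^sup>+\<omega>. (\<integral>\<^sup>+u. ennreal \<bar>k u * z u \<omega>\<bar> * indicator T u \<partial>lborel)\<^sup>2 \<partial>M)
     \<le> ennreal ((B * (K * (exp (- \<delta> * (t - s)) / \<delta>)))\<^sup>2)"
proof -
  define W where "W = K * (exp (- \<delta> * (t - s)) / \<delta>)"
  have W: "W \<ge> 0" using K_nonneg \<delta> by (simp add: W_def)
  define r where "r u = weight u * indicator {..s} u" for u
  have r: "r u \<ge> 0" for u by (simp add: r_def weight_nonneg)
  have [measurable]: "r \<in> borel_measurable borel" by (simp add: r_def[abs_def])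
  have rW: "(\<integral>\<^sup>+u. ennreal (r u) \<partial>lborel) = ennreal W"
    using nn_integral_weight[of s] by (simp add: r_def W_def ennreal_mult'' ennreal_indicator)
  interpret pair_sigma_finite lborel M ..
  have "(\<integral>\<^sup>+u. ennreal \<bar>k u * z u \<omega>\<bar> * indicator T u \<partial>lborel)\<^sup>2 \<le> ennreal W * (\<integral>\<^sup>+u. ennreal (r u * (z u \<omega>)\<^sup>2) \<partial>lborel)"
    if [measurable]: "\<omega> \<in> space M" for \<omega>
  proof -
    have [measurable]: "(\<lambda>u. z u \<omega>) \<in> borel_measurable borel" by measurable
    have "(\<integral>\<^sup>+u. ennreal \<bar>k u * z u \<omega>\<bar> * indicator T u \<partial>lborel)
        \<le> (\<integral>\<^sup>+u. ennreal (sqrt (r u)) * ennreal (sqrt (r u) * \<bar>z u \<omega>\<bar>) \<partial>lborel)"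
    proof (rule nn_integral_mono)
      fix u
      show "ennreal \<bar>k u * z u \<omega>\<bar> * indicator T u \<le> ennreal (sqrt (r u)) * ennreal (sqrt (r u) * \<bar>z u \<omega>\<bar>)"
      proof (cases "u \<in> T")
        case True
        then have "u \<le> s" using assms by auto
        then have "\<bar>k u * z u \<omega>\<bar> \<le> r u * \<bar>z u \<omega>\<bar>"
          using k_le[of u] assms by (auto simp: abs_mult r_def weight_def intro!: mult_right_mono)
        also have "\<dots> = sqrt (r u) * (sqrt (r u) * \<bar>z u \<omega>\<bar>)" using r[of u] by simp
        finally have "ennreal \<bar>k u * z u \<omega>\<bar> \<le> ennreal (sqrt (r u) * (sqrt (r u) * \<bar>z u \<omega>\<bar>))" by (rule ennreal_leI)
        also have "\<dots> = ennreal (sqrt (r u)) * ennreal (sqrt (r u) * \<bar>z u \<omega>\<bar>)"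
          using r[of u] by (intro ennreal_mult) auto
        finally show ?thesis using True by simp
      qed simp
    qed
    then have "(\<integral>\<^sup>+u. ennreal \<bar>k u * z u \<omega>\<bar> * indicator T u \<partial>lborel)\<^sup>2
       \<le> (\<integral>\<^sup>+u. ennreal (sqrt (r u)) * ennreal (sqrt (r u) * \<bar>z u \<omega>\<bar>) \<partial>lborel)\<^sup>2"
      by (intro power_mono) auto
    also have "\<dots> \<le> (\<integral>\<^sup>+u. (ennreal (sqrt (r u)))\<^sup>2 \<partial>lborel) * (\<integral>\<^sup>+u. (ennreal (sqrt (r u) * \<bar>z u \<omega>\<bar>))\<^sup>2 \<partial>lborel)"
      by (rule Cauchy_Schwarz_nn_integral) measurable
    also have "(\<integral>\<^sup>+u. (ennreal (sqrt (r u)))\<^sup>2 \<partial>lborel) = ennreal W"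
      using r rW by (simp add: ennreal_power)
    also have "(\<integral>\<^sup>+u. (ennreal (sqrt (r u) * \<bar>z u \<omega>\<bar>))\<^sup>2 \<partial>lborel) = (\<integral>\<^sup>+u. ennreal (r u * (z u \<omega>)\<^sup>2) \<partial>lborel)"
      using r by (intro nn_integral_cong) (simp add: ennreal_power power_mult_distrib)
    finally show ?thesis .
  qed
  then have "(\<integral>\<^sup>+\<omega>. (\<integral>\<^sup>+u. ennreal \<bar>k u * z u \<omega>\<bar> * indicator T u \<partial>lborel)\<^sup>2 \<partial>M)
      \<le> (\<integral>\<^sup>+\<omega>. ennreal W * (\<integral>\<^sup>+u. ennreal (r u * (z u \<omega>)\<^sup>2) \<partial>lborel) \<partial>M)"
    by (rule nn_integral_mono)
  also have "\<dots> = ennreal W * (\<integral>\<^sup>+\<omega>. (\<integral>\<^sup>+u. ennreal (r u * (z u \<omega>)\<^sup>2) \<partial>lborel) \<partial>M)"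
    by (rule nn_integral_cmult) measurable
  also have "(\<integral>\<^sup>+\<omega>. (\<integral>\<^sup>+u. ennreal (r u * (z u \<omega>)\<^sup>2) \<partial>lborel) \<partial>M) = (\<integral>\<^sup>+u. (\<integral>\<^sup>+\<omega>. ennreal (r u * (z u \<omega>)\<^sup>2) \<partial>M) \<partial>lborel)"
    by (rule Fubini') measurable
  also have "\<dots> \<le> (\<integral>\<^sup>+u. ennreal (B\<^sup>2) * ennreal (r u) \<partial>lborel)"
  proof (rule nn_integral_mono)
    fix u
    have [measurable]: "z u \<in> borel_measurable M" using z_L2 by measurable
    have "(\<integral>\<^sup>+\<omega>. ennreal (r u * (z u \<omega>)\<^sup>2) \<partial>M) = ennreal (r u) * (\<integral>\<^sup>+\<omega>. ennreal ((norm (z u \<omega>))\<^sup>2) \<partial>M)"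
      using r[of u] by (subst nn_integral_cmult[symmetric]) (simp_all add: ennreal_mult')
    also have "\<dots> = ennreal (r u) * ennreal ((l2norm M (z u))\<^sup>2)"
      by (simp only: nn_integral_power2_l2norm[OF z_L2])
    also have "\<dots> \<le> ennreal (r u) * ennreal (B\<^sup>2)"
      by (intro mult_left_mono ennreal_leI power_mono z_le) auto
    finally show "(\<integral>\<^sup>+\<omega>. ennreal (r u * (z u \<omega>)\<^sup>2) \<partial>M) \<le> ennreal (B\<^sup>2) * ennreal (r u)"
      by (simp add: mult.commute)
  qed
  also have "\<dots> = ennreal (B\<^sup>2) * ennreal W"
    by (subst nn_integral_cmult) (simp_all add: rW)
  also have "ennreal W * (ennreal (B\<^sup>2) * ennreal W) = ennreal ((B * W)\<^sup>2)"
    using W B_nonneg by (simp add: power_mult_distrib power2_eq_square mult_ac flip: ennreal_mult)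
  finally show ?thesis by (simp add: W_def mult_left_mono)
qed

lemma AE_integrable: "AE \<omega> in M. set_integrable lborel {..t} (\<lambda>u. k u * z u \<omega>)"
proof -
  have "(\<integral>\<^sup>+\<omega>. (\<integral>\<^sup>+u. ennreal \<bar>k u * z u \<omega>\<bar> * indicator {..t} u \<partial>lborel)\<^sup>2 \<partial>M) \<noteq> \<infinity>"
    using nn_integral_square_le[of "{..t}" t] by (auto simp: top_unique)
  then have "AE \<omega> in M. (\<integral>\<^sup>+u. ennreal \<bar>k u * z u \<omega>\<bar> * indicator {..t} u \<partial>lborel)\<^sup>2 \<noteq> \<infinity>"
    by (intro nn_integral_PInf_AE) measurable
  then show ?thesis
    using AE_space
  proof eventually_elim
    case (elim \<omega>)
    have [measurable]: "(\<lambda>u. z u \<omega>) \<in> borel_measurable borel" using elim(2) by measurable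
    have "(\<integral>\<^sup>+u. ennreal \<bar>k u * z u \<omega>\<bar> * indicator {..t} u \<partial>lborel) < \<infinity>"
      using elim(1) by (auto simp: power2_eq_square ennreal_mult_eq_top_iff top.not_eq_extremum)
    then show ?case
      unfolding set_integrable_def
      by (intro integrableI_bounded) (auto simp: ennreal_mult' ennreal_indicator mult.commute abs_mult)
  qed
qed

lemma L2_partial:
  assumes [measurable]: "T \<in> sets borel" and "T \<subseteq> {..s}" "s \<le> t"
  shows "(\<lambda>\<omega>. LINT u:T|lborel. k u * z u \<omega>) \<in> L2 M"
    and "l2norm M (\<lambda>\<omega>. LINT u:T|lborel. k u * z u \<omega>) \<le> B * (K * (exp (- \<delta> * (t - s)) / \<delta>))"
proof -
  have meas: "(\<lambda>\<omega>. LINT u:T|lborel. k u * z u \<omega>) \<in> borel_measurable M"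
    unfolding set_lebesgue_integral_def by measurable
  have "(\<integral>\<^sup>+\<omega>. ennreal ((norm (LINT u:T|lborel. k u * z u \<omega>))\<^sup>2) \<partial>M)
     \<le> (\<integral>\<^sup>+\<omega>. (\<integral>\<^sup>+u. ennreal \<bar>k u * z u \<omega>\<bar> * indicator T u \<partial>lborel)\<^sup>2 \<partial>M)"
  proof (rule nn_integral_mono)
    fix \<omega>
    have "ennreal (norm (LINT u:T|lborel. k u * z u \<omega>)) \<le> (\<integral>\<^sup>+u. ennreal (norm (indicator T u *\<^sub>R (k u * z u \<omega>))) \<partial>lborel)"
      unfolding set_lebesgue_integral_def by (rule ennreal_norm_integral_le)
    also have "\<dots> = (\<integral>\<^sup>+u. ennreal \<bar>k u * z u \<omega>\<bar> * indicator T u \<partial>lborel)"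
      by (intro nn_integral_cong) (auto simp: indicator_def)
    finally have "(ennreal (norm (LINT u:T|lborel. k u * z u \<omega>)))\<^sup>2 \<le> (\<integral>\<^sup>+u. ennreal \<bar>k u * z u \<omega>\<bar> * indicator T u \<partial>lborel)\<^sup>2"
      by (intro power_mono) auto
    then show "ennreal ((norm (LINT u:T|lborel. k u * z u \<omega>))\<^sup>2) \<le> (\<integral>\<^sup>+u. ennreal \<bar>k u * z u \<omega>\<bar> * indicator T u \<partial>lborel)\<^sup>2"
      by (simp add: ennreal_power)
  qed
  also have "\<dots> \<le> ennreal ((B * (K * (exp (- \<delta> * (t - s)) / \<delta>)))\<^sup>2)"
    by (rule nn_integral_square_le[OF assms])
  finally have le: "(\<integral>\<^sup>+\<omega>. ennreal ((norm (LINT u:T|lborel. k u * z u \<omega>))\<^sup>2) \<partial>M) \<le> ennreal ((B * (K * (exp (- \<delta> * (t - s)) / \<delta>)))\<^sup>2)" .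
  show "(\<lambda>\<omega>. LINT u:T|lborel. k u * z u \<omega>) \<in> L2 M"
    using L2I_nn_integral(1)[OF meas le] .
  have "l2norm M (\<lambda>\<omega>. LINT u:T|lborel. k u * z u \<omega>) \<le> sqrt ((B * (K * (exp (- \<delta> * (t - s)) / \<delta>)))\<^sup>2)"
    using L2I_nn_integral(2)[OF meas le] by simp
  then show "l2norm M (\<lambda>\<omega>. LINT u:T|lborel. k u * z u \<omega>) \<le> B * (K * (exp (- \<delta> * (t - s)) / \<delta>))"
    using B_nonneg K_nonneg \<delta> by simp
qed

lemma AE_past_limit:
  "AE \<omega> in M. ((\<lambda>s. LINT u:{s..t}|lborel. k u * z u \<omega>) \<longlongrightarrow> (LINT u:{..t}|lborel. k u * z u \<omega>)) at_bot"
  using AE_integrable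
  by eventually_elim (intro tendsto_set_lebesgue_integral_at_bot, simp_all)

text \<open>The part cut off at \<open>s\<close> is the integral over times below \<open>s\<close>;
  the weighted estimate bounds its norm by a multiple of e^(-\<delta>(t-s)). Splitting the half-line
  is justified by almost sure integrability.\<close>

lemma ms_lim_past:
  "ms_lim M at_bot (\<lambda>s \<omega>. LINT u:{s..t}|lborel. k u * z u \<omega>) (\<lambda>\<omega>. LINT u:{..t}|lborel. k u * z u \<omega>)"
  unfolding ms_lim_iff_l2norm
proof (intro conjI)
  show I: "(\<lambda>\<omega>. LINT u:{..t}|lborel. k u * z u \<omega>) \<in> L2 M"
    by (rule L2_partial(1)[of _ t]) auto
  have P: "(\<lambda>\<omega>. LINT u:{s..t}|lborel. k u * z u \<omega>) \<in> L2 M" for s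
    by (rule L2_partial(1)[of _ t]) auto
  then show "\<forall>\<^sub>F s in at_bot. (\<lambda>\<omega>. LINT u:{s..t}|lborel. k u * z u \<omega>) \<in> L2 M" by simp
  have "l2norm M (\<lambda>\<omega>. (LINT u:{s..t}|lborel. k u * z u \<omega>) - (LINT u:{..t}|lborel. k u * z u \<omega>))
      \<le> B * (K * (exp (- \<delta> * (t - s)) / \<delta>))" if "s \<le> t" for s
  proof -
    have Q: "(\<lambda>\<omega>. LINT u:{..<s}|lborel. k u * z u \<omega>) \<in> L2 M"
      using that by (intro L2_partial(1)[of _ s]) auto
    have "AE \<omega> in M. (LINT u:{..t}|lborel. k u * z u \<omega>) - (LINT u:{s..t}|lborel. k u * z u \<omega>) = (LINT u:{..<s}|lborel. k u * z u \<omega>)"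
      using AE_integrable
    proof eventually_elim
      case (elim \<omega>)
      have "{..t} = {..<s} \<union> {s..t}" using that by auto
      then have "(LINT u:{..t}|lborel. k u * z u \<omega>) = (LINT u:{..<s}|lborel. k u * z u \<omega>) + (LINT u:{s..t}|lborel. k u * z u \<omega>)"
        using that set_integrable_subset[OF elim, of "{..<s}"] set_integrable_subset[OF elim, of "{s..t}"]
        by (simp only:) (subst set_integral_Un, auto)
      then show ?case by simp
    qed
    then have "l2norm M (\<lambda>\<omega>. (LINT u:{..t}|lborel. k u * z u \<omega>) - (LINT u:{s..t}|lborel. k u * z u \<omega>))
       = l2norm M (\<lambda>\<omega>. LINT u:{..<s}|lborel. k u * z u \<omega>)"
      using L2_measurable[OF L2_diff[OF I P]] L2_measurable[OF Q] by (intro l2norm_cong_AE) auto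
    also have "\<dots> \<le> B * (K * (exp (- \<delta> * (t - s)) / \<delta>))"
      using that by (intro L2_partial(2)) auto
    finally show ?thesis by (subst l2norm_minus_commute)
  qed
  then have "\<forall>\<^sub>F s in at_bot. norm (l2norm M (\<lambda>\<omega>. (LINT u:{s..t}|lborel. k u * z u \<omega>) - (LINT u:{..t}|lborel. k u * z u \<omega>)))
      \<le> B * (K * (exp (- \<delta> * (t - s)) / \<delta>))"
    unfolding eventually_at_bot_linorder by auto
  moreover have "((\<lambda>s. B * (K * (exp (- \<delta> * (t - s)) / \<delta>))) \<longlongrightarrow> 0) at_bot"
  proof -
    have "((\<lambda>s. exp (- \<delta> * (t - s))) \<longlongrightarrow> 0) at_bot"
      using \<delta> by real_asymp
    from tendsto_mult_left[OF tendsto_mult_left[OF tendsto_divide[OF this tendsto_const]]]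
    show ?thesis using \<delta> by force
  qed
  ultimately show "((\<lambda>s. l2norm M (\<lambda>\<omega>. (LINT u:{s..t}|lborel. k u * z u \<omega>) - (LINT u:{..t}|lborel. k u * z u \<omega>))) \<longlongrightarrow> 0) at_bot"
    by (rule Lim_null_comparison)
qed

lemma L2_past: "(\<lambda>\<omega>. LINT u:{..t}|lborel. k u * z u \<omega>) \<in> L2 M"
  by (rule L2_partial(1)[of _ t]) auto

text \<open>Fubini's theorem, applicable because the product of kernel, process and \<open>U\<close>
  has total mass at most B ||U|| times the mass of the weight. A random time integral is thereby
  tested through ordinary integrals of inner products.\<close>

lemma l2inner_past:
  assumes U: "U \<in> L2 M"
  shows "set_integrable lborel {..t} (\<lambda>u. k u * l2inner M (z u) U)"
    and "l2inner M (\<lambda>\<omega>. LINT u:{..t}|lborel. k u * z u \<omega>) U = (LINT u:{..t}|lborel. k u * l2inner M (z u) U)"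
proof -
  note nn_fst = nn_integral_fst
  interpret pair_sigma_finite lborel M ..
  have [measurable]: "U \<in> borel_measurable M" using U by measurable
  define F where "F u \<omega> = indicator {..t} u * k u * z u \<omega> * U \<omega>" for u \<omega>
  have F_meas [measurable]: "case_prod F \<in> borel_measurable (lborel \<Otimes>\<^sub>M M)"
    unfolding F_def by measurable
  have F_meas2 [measurable]: "F u \<in> borel_measurable M" for u
    unfolding F_def using z_L2[of u] by measurable
  have "integrable (lborel \<Otimes>\<^sub>M M) (case_prod F)"
  proof (rule integrableI_bounded)
    have "(\<integral>\<^sup>+x. ennreal (norm (case_prod F x)) \<partial>(lborel \<Otimes>\<^sub>M M)) = (\<integral>\<^sup>+u. \<integral>\<^sup>+\<omega>. ennreal (norm (F u \<omega>)) \<partial>M \<partial>lborel)"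
      by (subst nn_fst[symmetric]) simp_all
    also have "\<dots> \<le> (\<integral>\<^sup>+u. ennreal (B * l2norm M U) * (ennreal (weight u) * indicator {..t} u) \<partial>lborel)"
    proof (rule nn_integral_mono)
      fix u
      show "(\<integral>\<^sup>+\<omega>. ennreal (norm (F u \<omega>)) \<partial>M) \<le> ennreal (B * l2norm M U) * (ennreal (weight u) * indicator {..t} u)"
      proof (cases "u \<le> t")
        case True
        note zn = L2_norm[OF z_L2[of u]] and Un = L2_norm[OF U]
        have int: "integrable M (\<lambda>\<omega>. norm (z u \<omega>) * norm (U \<omega>))"
          using L2_inner_integrable[OF zn Un] by simp
        have "(\<integral>\<^sup>+\<omega>. ennreal (norm (F u \<omega>)) \<partial>M) \<le> (\<integral>\<^sup>+\<omega>. ennreal (weight u) * ennreal (norm (z u \<omega>) * norm (U \<omega>)) \<partial>M)"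
        proof (rule nn_integral_mono)
          fix \<omega>
          have "norm (F u \<omega>) \<le> weight u * (norm (z u \<omega>) * norm (U \<omega>))"
            using True mult_right_mono[OF k_le[OF True], of "\<bar>z u \<omega>\<bar> * \<bar>U \<omega>\<bar>"]
            by (simp add: F_def weight_def abs_mult mult.assoc)
          then show "ennreal (norm (F u \<omega>)) \<le> ennreal (weight u) * ennreal (norm (z u \<omega>) * norm (U \<omega>))"
            using weight_nonneg by (simp add: ennreal_leI flip: ennreal_mult')
        qed
        also have "\<dots> = ennreal (weight u) * ennreal (LINT \<omega>|M. norm (z u \<omega>) * norm (U \<omega>))"
          using int by (subst nn_integral_cmult) (auto simp: nn_integral_eq_integral)
        also have "\<dots> \<le> ennreal (weight u) * ennreal (B * l2norm M U)"
        proof (intro mult_left_mono ennreal_leI)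
          have "(LINT \<omega>|M. norm (z u \<omega>) * norm (U \<omega>)) \<le> l2norm M (z u) * l2norm M U"
            using l2inner_Cauchy_Schwarz[OF zn Un] by (simp add: l2inner_def l2norm_def)
          also have "\<dots> \<le> B * l2norm M U" using z_le by (simp add: mult_right_mono)
          finally show "(LINT \<omega>|M. norm (z u \<omega>) * norm (U \<omega>)) \<le> B * l2norm M U" .
        qed simp
        finally show ?thesis using True by (simp add: mult.commute)
      qed (simp add: F_def)
    qed
    also have "\<dots> = ennreal (B * l2norm M U) * ennreal (K * (exp (- \<delta> * (t - t)) / \<delta>))"
      by (subst nn_integral_cmult) (simp_all only: nn_integral_weight, measurable)
    also have "\<dots> < \<infinity>" by (simp add: ennreal_mult_less_top)
    finally show "(\<integral>\<^sup>+x. ennreal (norm (case_prod F x)) \<partial>(lborel \<Otimes>\<^sub>M M)) < \<infinity>" .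
  qed measurable
  note int = this
  have inner: "(LINT \<omega>|M. F u \<omega>) = indicator {..t} u *\<^sub>R (k u * l2inner M (z u) U)" for u
    by (simp add: F_def l2inner_def mult.assoc)
  show "set_integrable lborel {..t} (\<lambda>u. k u * l2inner M (z u) U)"
    using integrable_fst[OF int] by (simp add: inner set_integrable_def)
  have outer: "(LINT u|lborel. F u \<omega>) = (LINT u:{..t}|lborel. k u * z u \<omega>) * U \<omega>" for \<omega>
    unfolding F_def set_lebesgue_integral_def
    by (subst Bochner_Integration.integral_mult_left_zero[symmetric]) (simp add: mult.assoc)
  have "l2inner M (\<lambda>\<omega>. LINT u:{..t}|lborel. k u * z u \<omega>) U = (LINT \<omega>|M. LINT u|lborel. F u \<omega>)"
    by (simp add: l2inner_def outer)
  also have "\<dots> = (LINT u|lborel. LINT \<omega>|M. F u \<omega>)"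
    by (rule Fubini_integral[OF int])
  finally show "l2inner M (\<lambda>\<omega>. LINT u:{..t}|lborel. k u * z u \<omega>) U = (LINT u:{..t}|lborel. k u * l2inner M (z u) U)"
    by (simp add: inner set_lebesgue_integral_def)
qed

end

context square_levy
begin

lemma levy_int_diff:
  assumes "levy_int lo hi G I" "levy_int lo hi G' I'"
  shows "levy_int lo hi (\<lambda>u. G u - G' u) (\<lambda>\<omega>. I \<omega> - I' \<omega>)"
  using levy_int_add[OF assms(1) levy_int_scale[OF assms(2), of "-1"]] by simp

text \<open>The norm estimate, applied to the difference of the integrands.\<close>

lemma levy_int_AE_unique:
  assumes "levy_int lo hi G I" "levy_int lo hi G' I'" "AE u in lborel. G u = G' u"
  shows "AE \<omega> in M. I \<omega> = I' \<omega>"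
proof -
  note D = levy_int_diff[OF assms(1,2)]
  have L2: "G \<in> L2 lborel" "G' \<in> L2 lborel" "I \<in> L2 M" "I' \<in> L2 M"
    using assms by (auto simp: levy_int_def)
  have "AE u in lborel. G u - G' u = 0" using assms(3) by eventually_elim simp
  then have "l2norm lborel (\<lambda>u. G u - G' u) = l2norm lborel (\<lambda>u. G u - G u)"
    using L2_measurable[OF L2_diff[OF L2(1,2)]] by (intro l2norm_cong_AE) auto
  then have "l2norm lborel (\<lambda>u. G u - G' u) = 0" by simp
  with levy_int_norm[OF D] have "l2norm M (\<lambda>\<omega>. I \<omega> - I' \<omega>) = 0"
    using l2norm_nonneg[of M "\<lambda>\<omega>. I \<omega> - I' \<omega>"] by simp
  then show ?thesis using l2norm_eq_0[OF L2_diff[OF L2(3,4)]] by simp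
qed

end

lemma l2norm_window_le:
  fixes g :: "real \<Rightarrow> 'b::euclidean_space"
  assumes L2: "(\<lambda>u. indicator {s..t} u *\<^sub>R g u) \<in> L2 lborel" and "s \<le> t" "B \<ge> 0"
    and "\<And>u. u \<in> {s..t} \<Longrightarrow> norm (g u) \<le> B"
  shows "l2norm lborel (\<lambda>u. indicator {s..t} u *\<^sub>R g u) \<le> B * sqrt (t - s)"
proof -
  have "(l2norm lborel (\<lambda>u. indicator {s..t} u *\<^sub>R g u))\<^sup>2 \<le> (LINT u|lborel. indicator {s..t} u *\<^sub>R B\<^sup>2)"
    unfolding l2norm_power2
  proof (rule integral_mono[OF L2_integrable_power2[OF L2]])
    show "integrable lborel (\<lambda>u. indicator {s..t} u *\<^sub>R B\<^sup>2)"
      by (intro integrable_scaleR_left integrable_real_indicator) (use assms in auto)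
    show "(norm (indicator {s..t} u *\<^sub>R g u))\<^sup>2 \<le> indicator {s..t} u *\<^sub>R B\<^sup>2" for u
      using assms by (auto simp: indicator_def intro!: power_mono)
  qed
  also have "\<dots> = (B * sqrt (t - s))\<^sup>2"
    using assms by (simp add: power_mult_distrib)
  finally show ?thesis
    by (rule power2_le_imp_le) (use assms in simp)
qed

lemma l2norm_exp_window_le:
  fixes g :: "real \<Rightarrow> 'b::euclidean_space"
  assumes L2: "(\<lambda>u. indicator {s..t} u *\<^sub>R g u) \<in> L2 lborel" and "\<delta> > 0" "K \<ge> 0"
    and "\<And>u. u \<le> t \<Longrightarrow> norm (g u) \<le> K * exp (- \<delta> * (t - u))"
  shows "l2norm lborel (\<lambda>u. indicator {s..t} u *\<^sub>R g u) \<le> K * sqrt (1 / (2 * \<delta>))"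
proof -
  note tail = integrable_exp_tail[of "2 * \<delta>" t t]
  have "(l2norm lborel (\<lambda>u. indicator {s..t} u *\<^sub>R g u))\<^sup>2
     \<le> (LINT u|lborel. K\<^sup>2 * (exp (- (2 * \<delta>) * (t - u)) * indicator {..t} u))"
    unfolding l2norm_power2
  proof (rule integral_mono[OF L2_integrable_power2[OF L2]])
    show "integrable lborel (\<lambda>u. K\<^sup>2 * (exp (- (2 * \<delta>) * (t - u)) * indicator {..t} u))"
      using tail(1) assms(2) by simp
    show "(norm (indicator {s..t} u *\<^sub>R g u))\<^sup>2 \<le> K\<^sup>2 * (exp (- (2 * \<delta>) * (t - u)) * indicator {..t} u)" for u
    proof (cases "u \<in> {s..t}")
      case True
      then have "(norm (g u))\<^sup>2 \<le> (K * exp (- \<delta> * (t - u)))\<^sup>2"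
        using assms(4)[of u] by (intro power_mono) auto
      also have "\<dots> = K\<^sup>2 * exp (- (2 * \<delta>) * (t - u))"
        by (simp add: power_mult_distrib power2_eq_square[of "exp _"] flip: exp_add)
      finally show ?thesis using True by simp
    qed simp
  qed
  also have "\<dots> = (K * sqrt (1 / (2 * \<delta>)))\<^sup>2"
    using tail(2) assms(2) by (simp add: power_mult_distrib)
  finally show ?thesis
    by (rule power2_le_imp_le) (use assms in simp)
qed

lemma ms_lim_l2norm_le:
  fixes Z :: "'i \<Rightarrow> 'w \<Rightarrow> 'b::euclidean_space"
  assumes "ms_lim M F Z W" "\<forall>\<^sub>F h in F. l2norm M (Z h) \<le> B" "F \<noteq> bot"
  shows "l2norm M W \<le> B"
proof -
  have W: "W \<in> L2 M" and Z: "\<forall>\<^sub>F h in F. Z h \<in> L2 M" and lim: "((\<lambda>h. l2norm M (\<lambda>\<omega>. Z h \<omega> - W \<omega>)) \<longlongrightarrow> 0) F"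
    using assms by (auto simp: ms_lim_iff_l2norm)
  have "\<forall>\<^sub>F h in F. l2norm M W \<le> B + l2norm M (\<lambda>\<omega>. Z h \<omega> - W \<omega>)"
    using Z assms(2)
  proof eventually_elim
    case (elim h)
    from l2norm_diff[OF elim(1) L2_diff[OF elim(1) W]] elim(2) show ?case by simp
  qed
  moreover have "((\<lambda>h. B + l2norm M (\<lambda>\<omega>. Z h \<omega> - W \<omega>)) \<longlongrightarrow> B + 0) F"
    by (intro tendsto_add tendsto_const lim)
  ultimately show ?thesis using tendsto_lowerbound assms(3) by fastforce
qed

lemma matrix_mult_row: "((U :: real^'m::finite^'n) ** (W :: real^'k::finite^'m)) $ b = (\<Sum>a\<in>UNIV. U $ b $ a *\<^sub>R W $ a)"
  by (simp add: vec_eq_iff matrix_matrix_mult_def)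

section \<open>The input process\<close>

locale iccss = square_levy M L for M :: "'w measure" and L :: "real \<Rightarrow> 'w \<Rightarrow> real^'k::finite" +
  fixes p q :: nat and A C :: "nat \<Rightarrow> real^'k^'k" and X :: "real \<Rightarrow> nat \<Rightarrow> 'w \<Rightarrow> real^'k"
  assumes pq: "p > q" "q > 0"
    and rank_Cq: "rank (C q) = CARD('k)"
    and zeros_P: "\<And>z. det (P_poly p A z) = 0 \<Longrightarrow> Re z < 0"
    and zeros_Q: "\<And>z. det (Q_poly q C z) = 0 \<Longrightarrow> Re z < 0"
    and X: "input_process M L p A X"
begin

abbreviation EA :: "real \<Rightarrow> nat \<Rightarrow> nat \<Rightarrow> real^'k^'k" where
  "EA r j l \<equiv> bexpn p (matA p A) 0 r j l"

text \<open>\<open>matB\<close> selects the last block column of the exponential.\<close>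

lemma input_kernel_eq: "input_kernel p A j r = EA r j p"
  using pq by (simp add: input_kernel_def bmul_def bexp_bscale matB_def if_distrib[of "\<lambda>U. _ ** U"] matrix_mult_zero cong: if_cong)

lemma input_kernel_add:
  assumes "j \<in> {1..p}"
  shows "input_kernel p A j (r + s) = (\<Sum>l=1..p. EA r j l ** input_kernel p A l s)"
  unfolding input_kernel_eq using assms pq by (intro bexpn_add) auto

lemma input_kernel_decay:
  obtains K \<delta> where "\<delta> > 0" "K \<ge> 0"
    "\<And>j r b. j \<in> {1..p} \<Longrightarrow> r \<ge> 0 \<Longrightarrow> norm (input_kernel p A j r $ b) \<le> K * exp (- \<delta> * r)"
proof (rule companion_exp_decay[OF zeros_P])
  fix K \<delta>
  assume K: "\<delta> > 0" "K \<ge> 0" and bound: "\<And>i j r. i \<in> {1..p} \<Longrightarrow> j \<in> {1..p} \<Longrightarrow> r \<ge> 0 \<Longrightarrow> norm (EA r i j) \<le> K * exp (- \<delta> * r)"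
  show ?thesis
  proof (rule that[OF K])
    fix j r b assume "j \<in> {1..p}" "(r::real) \<ge> 0"
    then show "norm (input_kernel p A j r $ b) \<le> K * exp (- \<delta> * r)"
      unfolding input_kernel_eq using pq
      by (intro order.trans[OF Finite_Cartesian_Product.norm_nth_le bound]) auto
  qed
qed

lemma X_rep:
  assumes "j \<in> {1..p}"
  shows "\<exists>J. (\<forall>s\<le>t. has_levy_integral M L (\<lambda>u. input_kernel p A j (t - u)) s t (J s)) \<and> ms_lim M at_bot J (X t j)"
proof -
  have "has_past_levy_integral M L (\<lambda>u. input_kernel p A j (t - u)) t (X t j)"
    using X assms unfolding input_process_def by blast
  then show ?thesis unfolding has_past_levy_integral_def by (elim exE conjE) (intro exI conjI)
qed

text \<open>\<open>J s\<close> is the integral truncated to [s, t]. Properties of \<open>X\<close>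
  are proved for \<open>J s\<close>, where the integral calculus applies, and then passed to the
  limit as s tends to -\<infinity>.\<close>

definition X_approx :: "real \<Rightarrow> nat \<Rightarrow> (real \<Rightarrow> 'w \<Rightarrow> real^'k) \<Rightarrow> bool" where
  "X_approx t j J \<longleftrightarrow> ms_lim M at_bot J (X t j) \<and>
     (\<forall>s\<le>t. \<forall>b. levy_int s t (\<lambda>u. indicator {s..t} u *\<^sub>R (input_kernel p A j (t - u) $ b)) (\<lambda>\<omega>. J s \<omega> $ b))"

lemma X_approx_exists:
  assumes "j \<in> {1..p}"
  shows "\<exists>J. X_approx t j J"
proof -
  obtain J where J: "\<forall>s\<le>t. has_levy_integral M L (\<lambda>u. input_kernel p A j (t - u)) s t (J s)" "ms_lim M at_bot J (X t j)"
    using X_rep[OF assms, of t] by (elim exE conjE)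
  have "X_approx t j J"
    unfolding X_approx_def
  proof (intro conjI allI impI)
    fix s b assume "s \<le> t"
    then show "levy_int s t (\<lambda>u. indicator {s..t} u *\<^sub>R (input_kernel p A j (t - u) $ b)) (\<lambda>\<omega>. J s \<omega> $ b)"
      by (intro has_levy_integral_imp_levy_int J(1)[rule_format])
  qed (rule J(2))
  then show ?thesis by (rule exI[of _ J])
qed

lemma X_approxD:
  assumes "X_approx t j J"
  shows "ms_lim M at_bot J (X t j)"
    and "s \<le> t \<Longrightarrow> levy_int s t (\<lambda>u. indicator {s..t} u *\<^sub>R (input_kernel p A j (t - u) $ b)) (\<lambda>\<omega>. J s \<omega> $ b)"
  using assms unfolding X_approx_def by blast+

lemma X_L2:
  assumes "j \<in> {1..p}"
  shows "X t j \<in> L2 M"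
proof -
  obtain J where "X_approx t j J" using X_approx_exists[OF assms] ..
  then show ?thesis using X_approxD(1) by (auto simp: ms_lim_iff_l2norm)
qed

lemma X_nth_L2: "j \<in> {1..p} \<Longrightarrow> (\<lambda>\<omega>. X t j \<omega> $ b) \<in> L2 M"
  by (rule L2_bounded_linear[OF bounded_linear_vec_nth X_L2])

definition noise :: "nat \<Rightarrow> real \<Rightarrow> real \<Rightarrow> 'w \<Rightarrow> real^'k" where
  "noise j t h = levy_integral M L (\<lambda>u. input_kernel p A j (t + h - u)) t (t + h)"

text \<open>\<open>levy_integral\<close> is a choice, so an integral must exist for it to be
  meaningful: the truncation to [t, t + h] of the integral that defines the input at time t + h is
  one.\<close>

lemma noise_levy_int:
  assumes "j \<in> {1..p}" "h \<ge> 0"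
  shows "levy_int t (t + h) (\<lambda>u. indicator {t..t + h} u *\<^sub>R (input_kernel p A j (t + h - u) $ b)) (\<lambda>\<omega>. noise j t h \<omega> $ b)"
proof -
  obtain J where J: "\<forall>s\<le>t + h. has_levy_integral M L (\<lambda>u. input_kernel p A j (t + h - u)) s (t + h) (J s)"
    using X_rep[OF assms(1), of "t + h"] by (elim exE conjE)
  have "\<exists>I. has_levy_integral M L (\<lambda>u. input_kernel p A j (t + h - u)) t (t + h) I"
    using J assms(2) by (intro exI[of _ "J t"]) simp
  then have "has_levy_integral M L (\<lambda>u. input_kernel p A j (t + h - u)) t (t + h) (noise j t h)"
    unfolding noise_def levy_integral_def by (rule someI_ex)
  then show ?thesis by (rule has_levy_integral_imp_levy_int)
qed

lemma noise_L2: "j \<in> {1..p} \<Longrightarrow> h \<ge> 0 \<Longrightarrow> (\<lambda>\<omega>. noise j t h \<omega> $ b) \<in> L2 M"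
  using noise_levy_int by (auto simp: levy_int_def)

text \<open>For u \<le> t the semigroup property splits off the factor e^(Ah) from the kernel; the
  part of the integral after \<open>t\<close> is the noise. Both sides, truncated at
  \<open>s\<close>, have almost equal integrands and hence equal integrals, and the identity
  survives the limit in \<open>s\<close>.\<close>

lemma state_transition:
  assumes j: "j \<in> {1..p}" and h: "h \<ge> 0"
  shows "AE \<omega> in M. X (t + h) j \<omega> $ b = (\<Sum>l=1..p. \<Sum>a\<in>UNIV. EA h j l $ b $ a * X t l \<omega> $ a) + noise j t h \<omega> $ b"
proof -
  obtain J' where J'X: "X_approx (t + h) j J'"
    using X_approx_exists[OF j] by blast
  note J' = X_approxD(2)[OF J'X] X_approxD(1)[OF J'X]
  have "\<forall>l\<in>{1..p}. \<exists>J. X_approx t l J"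
    using X_approx_exists by blast
  then obtain J where JX: "\<forall>l\<in>{1..p}. X_approx t l (J l)"
    by (rule bchoice[THEN exE])
  note J = X_approxD(2)[OF JX[rule_format]] X_approxD(1)[OF JX[rule_format]]
  define R where "R s \<omega> = (\<Sum>l=1..p. \<Sum>a\<in>UNIV. EA h j l $ b $ a * J l s \<omega> $ a) + noise j t h \<omega> $ b" for s \<omega>
  have eq: "AE \<omega> in M. J' s \<omega> $ b = R s \<omega>" if s: "s \<le> t" for s
  proof (rule levy_int_AE_unique)
    show "levy_int s (t + h) (\<lambda>u. indicator {s..t + h} u *\<^sub>R (input_kernel p A j (t + h - u) $ b)) (\<lambda>\<omega>. J' s \<omega> $ b)"
      using s h by (intro J') simp
    show "levy_int s (t + h) (\<lambda>u. (\<Sum>l=1..p. \<Sum>a\<in>UNIV. EA h j l $ b $ a *\<^sub>R (indicator {s..t} u *\<^sub>R (input_kernel p A l (t - u) $ a)))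
        + indicator {t..t + h} u *\<^sub>R (input_kernel p A j (t + h - u) $ b)) (R s)"
      unfolding R_def using s h
      by (intro levy_int_add levy_int_sum levy_int_scale levy_int_mono[OF J(1)] levy_int_mono[OF noise_levy_int] j) auto
    \<comment> \<open>The windows [s, t] and [t, t + h] overlap in the point \<open>t\<close>, the
      only place where the integrands may differ.\<close>
    have "AE u in lborel. u \<noteq> t" by (rule AE_lborel_singleton)
    then show "AE u in lborel. indicator {s..t + h} u *\<^sub>R (input_kernel p A j (t + h - u) $ b)
       = (\<Sum>l=1..p. \<Sum>a\<in>UNIV. EA h j l $ b $ a *\<^sub>R (indicator {s..t} u *\<^sub>R (input_kernel p A l (t - u) $ a)))
        + indicator {t..t + h} u *\<^sub>R (input_kernel p A j (t + h - u) $ b)"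
    proof eventually_elim
      case (elim u)
      have "input_kernel p A j (t + h - u) $ b = (\<Sum>l=1..p. \<Sum>a\<in>UNIV. EA h j l $ b $ a *\<^sub>R (input_kernel p A l (t - u) $ a))"
        using input_kernel_add[OF j, of h "t - u"] by (simp add: matrix_mult_row algebra_simps)
      then show ?case using elim s h by (cases "u \<le> t") (auto simp: indicator_def)
    qed
  qed
  note nth = ms_lim_bounded_linear[OF bounded_linear_vec_nth]
  have lim1: "ms_lim M at_bot (\<lambda>s \<omega>. J' s \<omega> $ b) (\<lambda>\<omega>. X (t + h) j \<omega> $ b)"
    by (rule nth[OF J'(2)])
  have lim2: "ms_lim M at_bot R (\<lambda>\<omega>. (\<Sum>l=1..p. \<Sum>a\<in>UNIV. EA h j l $ b $ a * X t l \<omega> $ a) + noise j t h \<omega> $ b)"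
    unfolding R_def
    by (intro ms_lim_add ms_lim_sum ms_lim_const noise_L2 j h ms_lim_bounded_linear[OF bounded_linear_mult_right] nth[OF J(2)])
  have "ms_lim M at_bot R (\<lambda>\<omega>. X (t + h) j \<omega> $ b)"
  proof (rule ms_lim_cong_AE[OF lim1])
    show "\<forall>\<^sub>F s in at_bot. R s \<in> borel_measurable M \<and> (AE \<omega> in M. J' s \<omega> $ b = R s \<omega>)"
    proof (rule eventually_conj)
      show "\<forall>\<^sub>F s in at_bot. R s \<in> borel_measurable M"
        using lim2 by (auto simp: ms_lim_iff_l2norm elim: eventually_mono intro: L2_measurable)
      show "\<forall>\<^sub>F s in at_bot. AE \<omega> in M. J' s \<omega> $ b = R s \<omega>"
        using eq unfolding eventually_at_bot_linorder by blast
    qed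
  qed (auto intro: L2_measurable X_nth_L2 j)
  from ms_lim_unique[OF this lim2] show ?thesis by simp
qed

text \<open>The constant is \<open>sigma_sum\<close> times the L2 norm K sqrt(1/(2\<delta>)) of the
  exponential envelope of the kernel, so it depends neither on the time nor on the
  truncation.\<close>

lemma X_bound:
  obtains B where "B \<ge> 0" "\<And>j t b. j \<in> {1..p} \<Longrightarrow> l2norm M (\<lambda>\<omega>. X t j \<omega> $ b) \<le> B"
proof (rule input_kernel_decay)
  fix K \<delta>
  assume K: "\<delta> > 0" "K \<ge> 0" and bound: "\<And>j r b. j \<in> {1..p} \<Longrightarrow> r \<ge> 0 \<Longrightarrow> norm (input_kernel p A j r $ b) \<le> K * exp (- \<delta> * r)"
  show ?thesis
  proof (rule that[of "sigma_sum * (K * sqrt (1 / (2 * \<delta>)))"])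
    show "0 \<le> sigma_sum * (K * sqrt (1 / (2 * \<delta>)))"
      using K sigma_sum_nonneg by simp
    fix j t b assume j: "j \<in> {1..p}"
    obtain J where JX: "X_approx t j J" using X_approx_exists[OF j] by blast
    note J = X_approxD(2)[OF JX] X_approxD(1)[OF JX]
    show "l2norm M (\<lambda>\<omega>. X t j \<omega> $ b) \<le> sigma_sum * (K * sqrt (1 / (2 * \<delta>)))"
    proof (rule ms_lim_l2norm_le[OF ms_lim_bounded_linear[OF bounded_linear_vec_nth J(2)]])
      have "l2norm M (\<lambda>\<omega>. J s \<omega> $ b) \<le> sigma_sum * (K * sqrt (1 / (2 * \<delta>)))" if "s \<le> t" for s
      proof -
        note li = J(1)[OF that, of b]
        have "l2norm M (\<lambda>\<omega>. J s \<omega> $ b) \<le> sigma_sum * l2norm lborel (\<lambda>u. indicator {s..t} u *\<^sub>R (input_kernel p A j (t - u) $ b))"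
          by (rule levy_int_norm[OF li])
        also have "l2norm lborel (\<lambda>u. indicator {s..t} u *\<^sub>R (input_kernel p A j (t - u) $ b)) \<le> K * sqrt (1 / (2 * \<delta>))"
          using li K bound[OF j] by (intro l2norm_exp_window_le) (auto simp: levy_int_def)
        finally show ?thesis using sigma_sum_nonneg by (simp add: mult_left_mono)
      qed
      then show "\<forall>\<^sub>F s in at_bot. l2norm M (\<lambda>\<omega>. J s \<omega> $ b) \<le> sigma_sum * (K * sqrt (1 / (2 * \<delta>)))"
        unfolding eventually_at_bot_linorder by blast
    qed simp
  qed
qed

lemma noise_orthogonal_X:
  assumes j: "j \<in> {1..p}" "l \<in> {1..p}" and h: "h \<ge> 0" and s: "s \<le> t"
  shows "l2inner M (\<lambda>\<omega>. X s l \<omega> $ a) (\<lambda>\<omega>. noise j t h \<omega> $ b) = 0"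
proof -
  obtain J where JX: "X_approx s l J" using X_approx_exists[OF j(2)] by blast
  note J = X_approxD(2)[OF JX] X_approxD(1)[OF JX]
  have "((\<lambda>s'. l2inner M (\<lambda>\<omega>. J s' \<omega> $ a) (\<lambda>\<omega>. noise j t h \<omega> $ b)) \<longlongrightarrow> l2inner M (\<lambda>\<omega>. X s l \<omega> $ a) (\<lambda>\<omega>. noise j t h \<omega> $ b)) at_bot"
    by (intro tendsto_l2inner ms_lim_bounded_linear[OF bounded_linear_vec_nth J(2)] noise_L2 j h)
  moreover have "\<forall>\<^sub>F s' in at_bot. l2inner M (\<lambda>\<omega>. J s' \<omega> $ a) (\<lambda>\<omega>. noise j t h \<omega> $ b) = 0"
    unfolding eventually_at_bot_linorder
    using levy_int_orthogonal[OF J(1) noise_levy_int[OF j(1) h] s] by blast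
  then have "((\<lambda>s'. l2inner M (\<lambda>\<omega>. J s' \<omega> $ a) (\<lambda>\<omega>. noise j t h \<omega> $ b)) \<longlongrightarrow> 0) at_bot"
    by (rule tendsto_eventually)
  ultimately show ?thesis
    by (rule tendsto_unique[OF trivial_limit_at_bot_linorder])
qed

lemma EA_bounded:
  obtains K where "K \<ge> 0" "\<And>i j r. i \<in> {1..p} \<Longrightarrow> j \<in> {1..p} \<Longrightarrow> r \<ge> 0 \<Longrightarrow> norm (EA r i j) \<le> K"
proof (rule companion_exp_decay[OF zeros_P])
  fix K \<delta> :: real
  assume K: "\<delta> > 0" "K \<ge> 0" and bound: "\<And>i j r. i \<in> {1..p} \<Longrightarrow> j \<in> {1..p} \<Longrightarrow> r \<ge> 0 \<Longrightarrow> norm (EA r i j) \<le> K * exp (- \<delta> * r)"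
  show ?thesis
  proof (rule that[OF K(2)])
    fix i j r assume "i \<in> {1..p}" "j \<in> {1..p}" "(r::real) \<ge> 0"
    then have "norm (EA r i j) \<le> K * exp (- \<delta> * r)" by (rule bound)
    also have "\<dots> \<le> K * 1" using K \<open>r \<ge> 0\<close> by (intro mult_left_mono) auto
    finally show "norm (EA r i j) \<le> K" by simp
  qed
qed

text \<open>A bounded kernel on a window of length h gives the size h^(1/2). For j < p the kernel
  block vanishes at 0 and its derivative is the next, bounded block, so it is O(r); this gains the
  factor h that makes the noise negligible in the difference quotients of these blocks.\<close>

lemma noise_bound:
  obtains K where "K \<ge> 0"
    "\<And>j t h b. j \<in> {1..p} \<Longrightarrow> h \<ge> 0 \<Longrightarrow> l2norm M (\<lambda>\<omega>. noise j t h \<omega> $ b) \<le> K * sqrt h"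
    "\<And>j t h b. j \<in> {1..<p} \<Longrightarrow> h \<ge> 0 \<Longrightarrow> l2norm M (\<lambda>\<omega>. noise j t h \<omega> $ b) \<le> K * h * sqrt h"
proof (rule EA_bounded)
  fix K :: real
  assume K: "K \<ge> 0" and bound: "\<And>i j r. i \<in> {1..p} \<Longrightarrow> j \<in> {1..p} \<Longrightarrow> r \<ge> 0 \<Longrightarrow> norm (EA r i j) \<le> K"
  have p: "p \<in> {1..p}" using pq by auto
  have linear: "norm (EA r j p) \<le> K * r" if "j \<in> {1..<p}" "r \<ge> 0" for j r
  proof -
    have j: "j \<in> {1..p}" "Suc j \<in> {1..p}" using that by auto
    have "norm (EA r j p - EA 0 j p) \<le> K * r - K * 0"
    proof (cases "r = 0")
      case False
      show ?thesis
      proof (rule differentiable_bound_general[where f' = "\<lambda>r. bexpn p (matA p A) 1 r j p" and \<phi>' = "\<lambda>_. K"])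
        show "0 < r" using that False by simp
        show "continuous_on {0..r} (\<lambda>r. EA r j p)"
          by (rule continuous_on_vector_derivative) (rule has_vector_derivative_bexpn[OF j(1) p])
        show "((\<lambda>r. EA r j p) has_vector_derivative bexpn p (matA p A) 1 x j p) (at x)" for x
          using has_vector_derivative_bexpn[OF j(1) p, of "matA p A" 0 x UNIV] by simp
        show "((*) K has_vector_derivative K) (at x)" for x
          by (auto intro!: derivative_eq_intros simp flip: has_real_derivative_iff_has_vector_derivative)
        show "norm (bexpn p (matA p A) 1 x j p) \<le> K" if "0 < x" for x
          using bexpn_companion_shift[of j p p A 0 x] bound[OF j(2) p, of x] that \<open>j \<in> {1..<p}\<close> p by simp
      qed (auto intro!: continuous_intros)
    qed simp
    then show ?thesis using that by (simp add: bexpn_zero)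
  qed
  show ?thesis
  proof (rule that[of "sigma_sum * K"])
    show "0 \<le> sigma_sum * K" using K sigma_sum_nonneg by simp
  next
    fix j t h b assume j: "j \<in> {1..p}" and h: "(h::real) \<ge> 0"
    note li = noise_levy_int[OF this, of t b]
    have "l2norm lborel (\<lambda>u. indicator {t..t + h} u *\<^sub>R (input_kernel p A j (t + h - u) $ b)) \<le> K * sqrt (t + h - t)"
    proof (rule l2norm_window_le)
      show "norm (input_kernel p A j (t + h - u) $ b) \<le> K" if "u \<in> {t..t + h}" for u
        unfolding input_kernel_eq using that j p
        by (intro order.trans[OF Finite_Cartesian_Product.norm_nth_le bound]) auto
    qed (use li h K in \<open>auto simp: levy_int_def\<close>)
    from order.trans[OF levy_int_norm[OF li] mult_left_mono[OF this sigma_sum_nonneg]]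
    show "l2norm M (\<lambda>\<omega>. noise j t h \<omega> $ b) \<le> sigma_sum * K * sqrt h"
      by (simp add: mult.assoc)
  next
    fix j t h b assume j: "j \<in> {1..<p}" and h: "(h::real) \<ge> 0"
    then have j': "j \<in> {1..p}" by auto
    note li = noise_levy_int[OF this h, of t b]
    have "l2norm lborel (\<lambda>u. indicator {t..t + h} u *\<^sub>R (input_kernel p A j (t + h - u) $ b)) \<le> (K * h) * sqrt (t + h - t)"
    proof (rule l2norm_window_le)
      show "norm (input_kernel p A j (t + h - u) $ b) \<le> K * h" if "u \<in> {t..t + h}" for u
      proof -
        have "norm (input_kernel p A j (t + h - u) $ b) \<le> K * (t + h - u)"
          unfolding input_kernel_eq using that j
          by (intro order.trans[OF Finite_Cartesian_Product.norm_nth_le linear]) auto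
        also have "\<dots> \<le> K * h" using K that by (intro mult_left_mono) auto
        finally show ?thesis .
      qed
    qed (use li h K in \<open>auto simp: levy_int_def\<close>)
    from order.trans[OF levy_int_norm[OF li] mult_left_mono[OF this sigma_sum_nonneg]]
    show "l2norm M (\<lambda>\<omega>. noise j t h \<omega> $ b) \<le> sigma_sum * K * h * sqrt h"
      by (simp add: mult.assoc)
  qed
qed

end

lemma ms_lim_filter_mono: "ms_lim M F Z W \<Longrightarrow> F' \<le> F \<Longrightarrow> ms_lim M F' Z W"
  unfolding ms_lim_def by (blast intro: filter_leD tendsto_mono)

lemma has_vector_derivative_quotient_limit:
  assumes "(f has_vector_derivative f') (at (0::real))"
  shows "((\<lambda>k. norm ((f k - f 0) /\<^sub>R k - f')) \<longlongrightarrow> 0) (at_right 0)"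
proof -
  have "((\<lambda>h. norm (f (0 + h) - f 0 - h *\<^sub>R f') / norm h) \<longlongrightarrow> 0) (at 0)"
    using assms by (simp add: has_vector_derivative_def has_derivative_at)
  then have "((\<lambda>h. norm (f (0 + h) - f 0 - h *\<^sub>R f') / norm h) \<longlongrightarrow> 0) (at_right 0)"
    by (rule tendsto_mono[rotated]) (simp add: at_le)
  moreover have "\<forall>\<^sub>F h in at_right 0. norm (f (0 + h) - f 0 - h *\<^sub>R f') / norm h = norm ((f h - f 0) /\<^sub>R h - f')"
    unfolding eventually_at_right_field
  proof (intro exI[of _ 1] conjI allI impI)
    fix h :: real assume "h > 0"
    then have "(f h - f 0) /\<^sub>R h - f' = (f h - f 0 - h *\<^sub>R f') /\<^sub>R h"
      by (simp add: scaleR_diff_right)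
    then show "norm (f (0 + h) - f 0 - h *\<^sub>R f') / norm h = norm ((f h - f 0) /\<^sub>R h - f')"
      using \<open>h > 0\<close> by (simp add: divide_inverse mult.commute)
  qed simp
  ultimately show ?thesis by (rule Lim_transform_eventually)
qed

lemma matrix_entry_le: "\<bar>(U :: real^'n::finite^'m::finite) $ b $ a\<bar> \<le> norm U"
  using Finite_Cartesian_Product.norm_nth_le[of "U $ b" a] Finite_Cartesian_Product.norm_nth_le[of U b] by simp

section \<open>Mean-square continuity and derivatives of the input\<close>

context iccss
begin

lemma X_lincomb_bound:
  assumes B: "\<And>j t b. j \<in> {1..p} \<Longrightarrow> l2norm M (\<lambda>\<omega>. X t j \<omega> $ b) \<le> B" and "B \<ge> 0"
  shows "l2norm M (\<lambda>\<omega>. \<Sum>l=1..p. \<Sum>a\<in>UNIV. m l $ b $ a * X s l \<omega> $ a) \<le> real CARD('k) * B * (\<Sum>l=1..p. norm (m l))"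
proof -
  have "l2norm M (\<lambda>\<omega>. \<Sum>l=1..p. \<Sum>a\<in>UNIV. m l $ b $ a * X s l \<omega> $ a)
      \<le> (\<Sum>l=1..p. l2norm M (\<lambda>\<omega>. \<Sum>a\<in>UNIV. m l $ b $ a * X s l \<omega> $ a))"
    by (intro l2norm_sum L2_sum L2_mult_left X_nth_L2)
  also have "\<dots> \<le> (\<Sum>l=1..p. \<Sum>a\<in>UNIV. l2norm M (\<lambda>\<omega>. m l $ b $ a * X s l \<omega> $ a))"
    by (intro sum_mono l2norm_sum L2_mult_left X_nth_L2)
  also have "\<dots> \<le> (\<Sum>l=1..p. \<Sum>a\<in>(UNIV::'k set). norm (m l) * B)"
    using B \<open>B \<ge> 0\<close> by (intro sum_mono) (auto simp: l2norm_mult_left matrix_entry_le intro!: mult_mono)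
  also have "\<dots> = real CARD('k) * B * (\<Sum>l=1..p. norm (m l))"
    by (simp add: sum_distrib_left mult_ac)
  finally show ?thesis .
qed

lemma X_lincomb_L2: "(\<lambda>\<omega>. \<Sum>l=1..p. \<Sum>a\<in>UNIV. m l $ b $ a * X s l \<omega> $ a) \<in> L2 M"
  by (intro L2_sum L2_mult_left X_nth_L2)

lemma X_lincomb_unit:
  assumes "j \<in> {1..p}"
  shows "(\<Sum>l=1..p. \<Sum>a\<in>UNIV. (if l = j then mat 1 else 0 :: real^'k^'k) $ b $ a * X s l \<omega> $ a) = X s j \<omega> $ b"
proof -
  have "(\<Sum>a\<in>UNIV. (mat 1 :: real^'k^'k) $ b $ a * f a) = f b" for f :: "'k \<Rightarrow> real"
    by (simp add: mat_def if_distrib[of "\<lambda>x. x * _"] cong: if_cong)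
  then have "(\<Sum>l=1..p. \<Sum>a\<in>UNIV. (if l = j then mat 1 else 0 :: real^'k^'k) $ b $ a * X s l \<omega> $ a)
     = (\<Sum>l=1..p. if l = j then X s l \<omega> $ b else 0)"
    by (intro sum.cong refl) auto
  then show ?thesis using assms by simp
qed

text \<open>The transition formula runs forward in time, so only right increments are bounded
  directly. The bounds are uniform in the base point \<open>s\<close>, which lets left increments be
  treated as right increments from an earlier time.\<close>

lemma X_increment_bounds:
  obtains c w :: "real \<Rightarrow> real" where "(c \<longlongrightarrow> 0) (at_right 0)" "(w \<longlongrightarrow> 0) (at_right 0)"
    "\<And>j s k b. j \<in> {1..p} \<Longrightarrow> k > 0 \<Longrightarrow> l2norm M (\<lambda>\<omega>. X (s + k) j \<omega> $ b - X s j \<omega> $ b) \<le> c k"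
    "\<And>j s k b. j \<in> {1..<p} \<Longrightarrow> k > 0 \<Longrightarrow>
       l2norm M (\<lambda>\<omega>. (X (s + k) j \<omega> $ b - X s j \<omega> $ b) /\<^sub>R k - X s (Suc j) \<omega> $ b) \<le> w k"
proof -
  obtain B where B: "B \<ge> 0" "\<And>j t b. j \<in> {1..p} \<Longrightarrow> l2norm M (\<lambda>\<omega>. X t j \<omega> $ b) \<le> B"
    by (rule X_bound) blast
  obtain K where K: "K \<ge> 0"
    "\<And>j t h b. j \<in> {1..p} \<Longrightarrow> h \<ge> 0 \<Longrightarrow> l2norm M (\<lambda>\<omega>. noise j t h \<omega> $ b) \<le> K * sqrt h"
    "\<And>j t h b. j \<in> {1..<p} \<Longrightarrow> h \<ge> 0 \<Longrightarrow> l2norm M (\<lambda>\<omega>. noise j t h \<omega> $ b) \<le> K * h * sqrt h"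
    by (rule noise_bound) blast
  define E1 where "E1 j l = bexpn p (matA p A) 1 0 j l" for j l
  \<comment> \<open>Summing over all block rows makes one function serve every \<open>j\<close>; the
    last summand bounds the noise, in \<open>w\<close> after division by k.\<close>
  define c where "c k = (\<Sum>j=1..p. \<Sum>l=1..p. real CARD('k) * B * norm (EA k j l - EA 0 j l)) + K * sqrt k" for k
  define w where "w k = (\<Sum>j=1..p. \<Sum>l=1..p. real CARD('k) * B * norm ((EA k j l - EA 0 j l) /\<^sub>R k - E1 j l)) + K * sqrt k" for k
  have E0: "EA 0 j l = (if l = j then mat 1 else 0)" for j l by (simp add: bexpn_zero)
  have trans: "AE \<omega> in M. X (s + k) j \<omega> $ b - X s j \<omega> $ b
      = (\<Sum>l=1..p. \<Sum>a\<in>UNIV. (EA k j l - EA 0 j l) $ b $ a * X s l \<omega> $ a) + noise j s k \<omega> $ b"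
    if j: "j \<in> {1..p}" and "k > 0" for j k s b
    using state_transition[OF j less_imp_le[OF \<open>k > 0\<close>], of s b]
  proof eventually_elim
    case (elim \<omega>)
    then show ?case using X_lincomb_unit[OF j, of b s \<omega>]
      by (simp add: E0 left_diff_distrib sum_subtractf)
  qed
  have row_le: "real CARD('k) * B * (\<Sum>l=1..p. norm (m j l)) \<le> (\<Sum>j=1..p. \<Sum>l=1..p. real CARD('k) * B * norm (m j l))"
    if "j \<in> {1..p}" for m :: "nat \<Rightarrow> nat \<Rightarrow> real^'k^'k" and j
    using that B(1) member_le_sum[of j "{1..p}" "\<lambda>j. \<Sum>l=1..p. real CARD('k) * B * norm (m j l)"]
    by (simp add: sum_distrib_left sum_nonneg)
  show ?thesis
  proof (rule that)
    have EA_lim: "((\<lambda>k. norm (EA k j l - EA 0 j l)) \<longlongrightarrow> 0) (at_right 0)" if "j \<in> {1..p}" "l \<in> {1..p}" for j l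
    proof -
      have "isCont (\<lambda>k. EA k j l) 0"
        using has_vector_derivative_bexpn[OF that] by (rule has_vector_derivative_continuous)
      then have "((\<lambda>k. EA k j l) \<longlongrightarrow> EA 0 j l) (at_right 0)"
        unfolding isCont_def by (rule tendsto_mono[rotated]) (simp add: at_le)
      then show ?thesis by (simp add: LIM_zero tendsto_norm_zero)
    qed
    have sqrt_lim: "((\<lambda>k. K * sqrt k) \<longlongrightarrow> K * sqrt 0) (at_right 0)" by (intro tendsto_intros)
    have "(c \<longlongrightarrow> (\<Sum>j=1..p. \<Sum>l=1..p. real CARD('k) * B * 0) + K * sqrt 0) (at_right 0)"
      unfolding c_def by (intro tendsto_add tendsto_sum tendsto_mult_left EA_lim sqrt_lim)
    then show "(c \<longlongrightarrow> 0) (at_right 0)" by simp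
    have "(w \<longlongrightarrow> (\<Sum>j=1..p. \<Sum>l=1..p. real CARD('k) * B * 0) + K * sqrt 0) (at_right 0)"
      unfolding w_def E1_def
      by (intro tendsto_add tendsto_sum tendsto_mult_left sqrt_lim has_vector_derivative_quotient_limit)
        (use has_vector_derivative_bexpn[of _ p _ "matA p A" 0 0 UNIV] in simp)
    then show "(w \<longlongrightarrow> 0) (at_right 0)" by simp
  next
    fix j s k b assume j: "j \<in> {1..p}" and k: "(k::real) > 0"
    have "l2norm M (\<lambda>\<omega>. X (s + k) j \<omega> $ b - X s j \<omega> $ b)
       = l2norm M (\<lambda>\<omega>. (\<Sum>l=1..p. \<Sum>a\<in>UNIV. (EA k j l - EA 0 j l) $ b $ a * X s l \<omega> $ a) + noise j s k \<omega> $ b)"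
      using trans[OF j k] k
      by (intro l2norm_cong_AE L2_measurable[OF L2_diff] L2_measurable[OF L2_add] X_nth_L2 X_lincomb_L2 noise_L2 j) auto
    also have "\<dots> \<le> l2norm M (\<lambda>\<omega>. \<Sum>l=1..p. \<Sum>a\<in>UNIV. (EA k j l - EA 0 j l) $ b $ a * X s l \<omega> $ a) + l2norm M (\<lambda>\<omega>. noise j s k \<omega> $ b)"
      using k by (intro l2norm_triangle X_lincomb_L2 noise_L2 j) auto
    also have "\<dots> \<le> c k"
      unfolding c_def using k
      by (intro add_mono order.trans[OF X_lincomb_bound[OF B(2,1)] row_le] K(2) j) auto
    finally show "l2norm M (\<lambda>\<omega>. X (s + k) j \<omega> $ b - X s j \<omega> $ b) \<le> c k" .
  next
    fix j s k b assume j: "j \<in> {1..<p}" and k: "(k::real) > 0"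
    then have j': "j \<in> {1..p}" "Suc j \<in> {1..p}" by auto
    have E1: "E1 j l = (if l = Suc j then mat 1 else 0)" if "l \<in> {1..p}" for l
      using bexpn_companion_shift[OF j that, of A 0 0] unfolding E1_def by (simp add: bexpn_zero)
    have eq: "AE \<omega> in M. (X (s + k) j \<omega> $ b - X s j \<omega> $ b) /\<^sub>R k - X s (Suc j) \<omega> $ b
        = (\<Sum>l=1..p. \<Sum>a\<in>UNIV. ((EA k j l - EA 0 j l) /\<^sub>R k - E1 j l) $ b $ a * X s l \<omega> $ a) + (noise j s k \<omega> $ b) /\<^sub>R k"
      using trans[OF j'(1) k, of s b]
    proof eventually_elim
      case (elim \<omega>)
      have "X s (Suc j) \<omega> $ b = (\<Sum>l=1..p. \<Sum>a\<in>UNIV. (if l = Suc j then mat 1 else 0 :: real^'k^'k) $ b $ a * X s l \<omega> $ a)"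
        by (rule X_lincomb_unit[OF j'(2), symmetric])
      also have "\<dots> = (\<Sum>l=1..p. \<Sum>a\<in>UNIV. E1 j l $ b $ a * X s l \<omega> $ a)"
        by (intro sum.cong refl) (simp only: E1)
      finally have "X s (Suc j) \<omega> $ b = (\<Sum>l=1..p. \<Sum>a\<in>UNIV. E1 j l $ b $ a * X s l \<omega> $ a)" .
      then show ?case
        unfolding elim by (simp add: left_diff_distrib right_diff_distrib sum_subtractf sum_distrib_left distrib_left mult.assoc)
    qed
    have "l2norm M (\<lambda>\<omega>. (X (s + k) j \<omega> $ b - X s j \<omega> $ b) /\<^sub>R k - X s (Suc j) \<omega> $ b)
       = l2norm M (\<lambda>\<omega>. (\<Sum>l=1..p. \<Sum>a\<in>UNIV. ((EA k j l - EA 0 j l) /\<^sub>R k - E1 j l) $ b $ a * X s l \<omega> $ a) + (noise j s k \<omega> $ b) /\<^sub>R k)"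
      using eq k
      by (intro l2norm_cong_AE L2_measurable[OF L2_diff] L2_measurable[OF L2_add] L2_scaleR L2_diff X_nth_L2 X_lincomb_L2 noise_L2 j') auto
    also have "\<dots> \<le> l2norm M (\<lambda>\<omega>. \<Sum>l=1..p. \<Sum>a\<in>UNIV. ((EA k j l - EA 0 j l) /\<^sub>R k - E1 j l) $ b $ a * X s l \<omega> $ a)
        + l2norm M (\<lambda>\<omega>. (noise j s k \<omega> $ b) /\<^sub>R k)"
      using k by (intro l2norm_triangle X_lincomb_L2 L2_scaleR noise_L2 j') auto
    also have "\<dots> \<le> w k"
      unfolding w_def
    proof (intro add_mono order.trans[OF X_lincomb_bound[OF B(2,1)] row_le] j')
      have "l2norm M (\<lambda>\<omega>. (noise j s k \<omega> $ b) /\<^sub>R k) = inverse k * l2norm M (\<lambda>\<omega>. noise j s k \<omega> $ b)"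
        using k by (simp only: l2norm_scaleR) simp
      also have "\<dots> \<le> inverse k * (K * k * sqrt k)"
        using K(3)[OF j, of k s b] k by (intro mult_left_mono) auto
      also have "\<dots> = K * sqrt k" using k by simp
      finally show "l2norm M (\<lambda>\<omega>. (noise j s k \<omega> $ b) /\<^sub>R k) \<le> K * sqrt k" .
    qed
    finally show "l2norm M (\<lambda>\<omega>. (X (s + k) j \<omega> $ b - X s j \<omega> $ b) /\<^sub>R k - X s (Suc j) \<omega> $ b) \<le> w k" .
  qed
qed

lemma tendsto_abs_at_0:
  assumes "((c::real \<Rightarrow> real) \<longlongrightarrow> 0) (at_right 0)"
  shows "((\<lambda>h. c \<bar>h\<bar>) \<longlongrightarrow> 0) (at 0)"
proof (rule filterlim_compose[OF assms])
  have "((\<lambda>h::real. \<bar>h\<bar>) \<longlongrightarrow> \<bar>0\<bar>) (at 0)" by (intro tendsto_intros)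
  then show "filterlim (\<lambda>h::real. \<bar>h\<bar>) (at_right 0) (at 0)"
    unfolding filterlim_at by (auto simp: eventually_at_filter)
qed

lemma X_ms_continuous:
  assumes "j \<in> {1..p}"
  shows "ms_lim M (at 0) (\<lambda>h \<omega>. X (t + h) j \<omega> $ b) (\<lambda>\<omega>. X t j \<omega> $ b)"
proof (rule X_increment_bounds)
  fix c w :: "real \<Rightarrow> real"
  assume c: "(c \<longlongrightarrow> 0) (at_right 0)"
    and bound: "\<And>j s k b. j \<in> {1..p} \<Longrightarrow> k > 0 \<Longrightarrow> l2norm M (\<lambda>\<omega>. X (s + k) j \<omega> $ b - X s j \<omega> $ b) \<le> c k"
  have le: "l2norm M (\<lambda>\<omega>. X (t + h) j \<omega> $ b - X t j \<omega> $ b) \<le> c \<bar>h\<bar>" if "h \<noteq> 0" for h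
  proof (cases "h > 0")
    case True
    then show ?thesis using bound[OF assms True, of t b] by simp
  next
    case False
    then have "- h > 0" using that by simp
    from bound[OF assms this, of "t + h" b] show ?thesis
      using False by (simp add: l2norm_minus_commute[of M "\<lambda>\<omega>. X t j \<omega> $ b"])
  qed
  have "((\<lambda>h. l2norm M (\<lambda>\<omega>. X (t + h) j \<omega> $ b - X t j \<omega> $ b)) \<longlongrightarrow> 0) (at 0)"
  proof (rule Lim_null_comparison[OF _ tendsto_abs_at_0[OF c]])
    show "\<forall>\<^sub>F h in at 0. norm (l2norm M (\<lambda>\<omega>. X (t + h) j \<omega> $ b - X t j \<omega> $ b)) \<le> c \<bar>h\<bar>"
      using le by (auto simp: eventually_at_filter)
  qed
  then show ?thesis using X_nth_L2[OF assms] by (simp add: ms_lim_iff_l2norm)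
qed

lemma X_ms_deriv:
  assumes j: "j \<in> {1..<p}"
  shows "ms_lim M (at 0) (\<lambda>h \<omega>. (X (t + h) j \<omega> $ b - X t j \<omega> $ b) /\<^sub>R h) (\<lambda>\<omega>. X t (Suc j) \<omega> $ b)"
proof (rule X_increment_bounds)
  fix c w :: "real \<Rightarrow> real"
  assume c: "(c \<longlongrightarrow> 0) (at_right 0)" and w: "(w \<longlongrightarrow> 0) (at_right 0)"
    and bound_c: "\<And>j s k b. j \<in> {1..p} \<Longrightarrow> k > 0 \<Longrightarrow> l2norm M (\<lambda>\<omega>. X (s + k) j \<omega> $ b - X s j \<omega> $ b) \<le> c k"
    and bound_w: "\<And>j s k b. j \<in> {1..<p} \<Longrightarrow> k > 0 \<Longrightarrow>
       l2norm M (\<lambda>\<omega>. (X (s + k) j \<omega> $ b - X s j \<omega> $ b) /\<^sub>R k - X s (Suc j) \<omega> $ b) \<le> w k"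
  have j': "j \<in> {1..p}" "Suc j \<in> {1..p}" using j by auto
  have le: "l2norm M (\<lambda>\<omega>. (X (t + h) j \<omega> $ b - X t j \<omega> $ b) /\<^sub>R h - X t (Suc j) \<omega> $ b) \<le> w \<bar>h\<bar> + c \<bar>h\<bar>" if "h \<noteq> 0" for h
  proof (cases "h > 0")
    case True
    then show ?thesis
      using bound_w[OF j True, of t b] order.trans[OF l2norm_nonneg bound_c[OF j'(1) True, of t b]] by simp
  next
    case False
    then have h: "- h > 0" using that by simp
    \<comment> \<open>For h < 0 the quotient is the forward quotient based at t + h. It is compared
      with block j + 1 at t + h, and continuity of that block moves the comparison to
      \<open>t\<close> at the cost c(-h).\<close>
    have "l2norm M (\<lambda>\<omega>. (X (t + h) j \<omega> $ b - X t j \<omega> $ b) /\<^sub>R h - X t (Suc j) \<omega> $ b)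
       = l2norm M (\<lambda>\<omega>. ((X (t + h + - h) j \<omega> $ b - X (t + h) j \<omega> $ b) /\<^sub>R (- h) - X (t + h) (Suc j) \<omega> $ b)
           + (X (t + h) (Suc j) \<omega> $ b - X (t + h + - h) (Suc j) \<omega> $ b))"
      by (intro arg_cong[of _ _ "l2norm M"]) (simp add: fun_eq_iff algebra_simps)
    also have "\<dots> \<le> w (- h) + c (- h)"
    proof (intro order.trans[OF l2norm_triangle] add_mono)
      show "l2norm M (\<lambda>\<omega>. (X (t + h + - h) j \<omega> $ b - X (t + h) j \<omega> $ b) /\<^sub>R (- h) - X (t + h) (Suc j) \<omega> $ b) \<le> w (- h)"
        by (rule bound_w[OF j h])
      show "l2norm M (\<lambda>\<omega>. X (t + h) (Suc j) \<omega> $ b - X (t + h + - h) (Suc j) \<omega> $ b) \<le> c (- h)"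
        using bound_c[OF j'(2) h, of "t + h" b] by (subst l2norm_minus_commute)
      show "(\<lambda>\<omega>. (X (t + h + - h) j \<omega> $ b - X (t + h) j \<omega> $ b) /\<^sub>R (- h) - X (t + h) (Suc j) \<omega> $ b) \<in> L2 M"
        by (intro L2_diff L2_scaleR X_nth_L2 j')
      show "(\<lambda>\<omega>. X (t + h) (Suc j) \<omega> $ b - X (t + h + - h) (Suc j) \<omega> $ b) \<in> L2 M"
        by (intro L2_diff X_nth_L2 j')
    qed
    finally show ?thesis using False by simp
  qed
  have "((\<lambda>h. l2norm M (\<lambda>\<omega>. (X (t + h) j \<omega> $ b - X t j \<omega> $ b) /\<^sub>R h - X t (Suc j) \<omega> $ b)) \<longlongrightarrow> 0) (at 0)"
  proof (rule Lim_null_comparison)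
    show "\<forall>\<^sub>F h in at 0. norm (l2norm M (\<lambda>\<omega>. (X (t + h) j \<omega> $ b - X t j \<omega> $ b) /\<^sub>R h - X t (Suc j) \<omega> $ b)) \<le> w \<bar>h\<bar> + c \<bar>h\<bar>"
      using le by (auto simp: eventually_at_filter)
    show "((\<lambda>h. w \<bar>h\<bar> + c \<bar>h\<bar>) \<longlongrightarrow> 0) (at 0)"
      using tendsto_add[OF tendsto_abs_at_0[OF w] tendsto_abs_at_0[OF c]] by simp
  qed
  then show ?thesis
    unfolding ms_lim_iff_l2norm by (intro conjI always_eventually allI L2_scaleR L2_diff X_nth_L2 j')
qed

section \<open>Mean-square derivatives of the output process\<close>

text \<open>\<open>y m v\<close> is the \<open>m\<close>-th derivative of \<open>Y\<^sub>v\<close>, expressed through the state by \<open>X\<^sub>j' = X\<^sub>j\<^sub>+\<^sub>1\<close>.\<close>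

definition y :: "nat \<Rightarrow> 'k \<Rightarrow> real \<Rightarrow> 'w \<Rightarrow> real" where
  "y m v t \<omega> = (\<Sum>i=0..q. \<Sum>a\<in>UNIV. C i $ v $ a * X t (i + 1 + m) \<omega> $ a)"

lemma y_index: "m \<le> p - q - 1 \<Longrightarrow> i \<in> {0..q} \<Longrightarrow> i + 1 + m \<in> {1..p}"
  using pq by auto

lemma y_L2: "m \<le> p - q - 1 \<Longrightarrow> y m v t \<in> L2 M"
  unfolding y_def[abs_def] by (intro L2_sum L2_mult_left X_nth_L2 y_index)

lemma y_ms_deriv:
  assumes "Suc m \<le> p - q - 1"
  shows "ms_lim M (at 0) (\<lambda>h \<omega>. (y m v (t + h) \<omega> - y m v t \<omega>) /\<^sub>R h) (y (Suc m) v t)"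
proof -
  have "ms_lim M (at 0) (\<lambda>h \<omega>. \<Sum>i=0..q. \<Sum>a\<in>UNIV. C i $ v $ a * ((X (t + h) (i + 1 + m) \<omega> $ a - X t (i + 1 + m) \<omega> $ a) /\<^sub>R h))
    (\<lambda>\<omega>. \<Sum>i=0..q. \<Sum>a\<in>UNIV. C i $ v $ a * X t (Suc (i + 1 + m)) \<omega> $ a)"
    using assms pq by (intro ms_lim_sum ms_lim_bounded_linear[OF bounded_linear_mult_right] X_ms_deriv) auto
  moreover have "(\<lambda>h \<omega>. \<Sum>i=0..q. \<Sum>a\<in>UNIV. C i $ v $ a * ((X (t + h) (i + 1 + m) \<omega> $ a - X t (i + 1 + m) \<omega> $ a) /\<^sub>R h))
     = (\<lambda>h \<omega>. (y m v (t + h) \<omega> - y m v t \<omega>) /\<^sub>R h)"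
    by (simp add: y_def fun_eq_iff sum_subtractf[symmetric] sum_distrib_left right_diff_distrib mult.left_commute)
  moreover have "(\<lambda>\<omega>. \<Sum>i=0..q. \<Sum>a\<in>UNIV. C i $ v $ a * X t (Suc (i + 1 + m)) \<omega> $ a) = y (Suc m) v t"
    by (simp add: y_def fun_eq_iff)
  ultimately show ?thesis by simp
qed

lemma y_bound:
  obtains B where "B \<ge> 0" "\<And>v t. l2norm M (y 0 v t) \<le> B"
proof (rule X_bound)
  fix B assume B: "B \<ge> 0" "\<And>j t b. j \<in> {1..p} \<Longrightarrow> l2norm M (\<lambda>\<omega>. X t j \<omega> $ b) \<le> B"
  show ?thesis
  proof (rule that)
    show "0 \<le> (\<Sum>i=0..q. \<Sum>a\<in>(UNIV::'k set). norm (C i) * B)"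
      using B by (intro sum_nonneg) auto
    fix v t
    have "l2norm M (y 0 v t) \<le> (\<Sum>i=0..q. l2norm M (\<lambda>\<omega>. \<Sum>a\<in>UNIV. C i $ v $ a * X t (i + 1 + 0) \<omega> $ a))"
      unfolding y_def[abs_def] by (intro l2norm_sum L2_sum L2_mult_left X_nth_L2 y_index) auto
    also have "\<dots> \<le> (\<Sum>i=0..q. \<Sum>a\<in>UNIV. l2norm M (\<lambda>\<omega>. C i $ v $ a * X t (i + 1 + 0) \<omega> $ a))"
      by (intro sum_mono l2norm_sum L2_mult_left X_nth_L2 y_index) auto
    also have "\<dots> \<le> (\<Sum>i=0..q. \<Sum>a\<in>(UNIV::'k set). norm (C i) * B)"
      using B pq by (intro sum_mono) (auto simp: l2norm_mult_left matrix_entry_le intro!: mult_mono)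
    finally show "l2norm M (y 0 v t) \<le> (\<Sum>i=0..q. \<Sum>a\<in>(UNIV::'k set). norm (C i) * B)" .
  qed
qed

lemma y_measurable: "(\<lambda>(u, \<omega>). y 0 v u \<omega>) \<in> borel_measurable (borel \<Otimes>\<^sub>M M)"
proof -
  have "(\<lambda>x. X (fst x) (i + 1 + 0) (snd x) $ a) \<in> borel_measurable (borel \<Otimes>\<^sub>M M)" if "i \<in> {0..q}" for i a
  proof -
    have "(\<lambda>x. X (fst x) (i + 1 + 0) (snd x)) \<in> borel_measurable (borel \<Otimes>\<^sub>M M)"
      using X y_index[OF le0 that] unfolding input_process_def by (auto simp: case_prod_unfold)
    then show ?thesis
      by (rule measurable_compose) (intro borel_measurable_continuous_onI continuous_intros)
  qed
  then show ?thesis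
    unfolding y_def case_prod_unfold by (intro borel_measurable_sum borel_measurable_times borel_measurable_const)
qed

abbreviation Y :: "real \<Rightarrow> 'w \<Rightarrow> real^'k" where
  "Y \<equiv> output_process p q C X"

lemma Y_nth: "Y t \<omega> $ v = y 0 v t \<omega>"
proof -
  have "Y t \<omega> = (\<Sum>j\<in>{1..q + 1}. C (j - 1) *v X t j \<omega>)"
    unfolding output_process_def using pq
    by (intro sum.mono_neutral_cong_right) (auto simp: matC_def)
  also have "\<dots> = (\<Sum>i=0..q. C i *v X t (i + 1) \<omega>)"
    by (rule sum.reindex_bij_witness[of _ "\<lambda>i. i + 1" "\<lambda>j. j - 1"]) auto
  finally show ?thesis by (simp add: y_def matrix_vector_mult_def)
qed

lemma component_Y: "component Y v t = (\<lambda>\<omega>. complex_of_real (y 0 v t \<omega>))"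
  by (simp add: component_def fun_eq_iff Y_nth)

text \<open>At each order the previous derivative is known only up to a null set depending on the
  time, so the limit of the explicit quotients is first transferred to these versions. The limit so
  obtained is a witness for the choice in \<open>ms_deriv\<close>, and uniqueness of limits
  identifies the chosen version.\<close>

lemma msD_component:
  assumes "m \<le> p - q - 1"
  shows "msD M m (component Y v) t \<in> borel_measurable M \<and> (AE \<omega> in M. msD M m (component Y v) t \<omega> = complex_of_real (y m v t \<omega>))"
  using assms
proof (induction m arbitrary: t)
  case 0
  have "(\<lambda>\<omega>. complex_of_real (y 0 v t \<omega>)) \<in> L2 M" by (intro L2_of_real y_L2) simp
  then show ?case by (auto simp: msD_def component_Y intro: L2_measurable)
next
  case (Suc m)
  define Z where "Z = msD M m (component Y v)"
  have Z: "Z t \<in> borel_measurable M" "AE \<omega> in M. Z t \<omega> = complex_of_real (y m v t \<omega>)" for t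
    using Suc.IH[of t] Suc.prems by (simp_all add: Z_def)
  have msD_Suc: "msD M (Suc m) (component Y v) t = ms_deriv M Z t" by (simp add: msD_def Z_def)
  have "ms_lim M (at 0) (\<lambda>h \<omega>. complex_of_real ((y m v (t + h) \<omega> - y m v t \<omega>) /\<^sub>R h)) (\<lambda>\<omega>. complex_of_real (y (Suc m) v t \<omega>))"
    by (rule ms_lim_bounded_linear[OF bounded_linear_of_real y_ms_deriv[OF Suc.prems]])
  then have lim: "ms_lim M (at 0) (\<lambda>h \<omega>. (Z (t + h) \<omega> - Z t \<omega>) /\<^sub>R h) (\<lambda>\<omega>. complex_of_real (y (Suc m) v t \<omega>))"
  proof (rule ms_lim_cong_AE)
    show "\<forall>\<^sub>F h in at 0. (\<lambda>\<omega>. (Z (t + h) \<omega> - Z t \<omega>) /\<^sub>R h) \<in> borel_measurable M \<and>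
        (AE \<omega> in M. complex_of_real ((y m v (t + h) \<omega> - y m v t \<omega>) /\<^sub>R h) = (Z (t + h) \<omega> - Z t \<omega>) /\<^sub>R h)"
    proof (rule always_eventually, rule allI, rule conjI)
      fix h
      show "(\<lambda>\<omega>. (Z (t + h) \<omega> - Z t \<omega>) /\<^sub>R h) \<in> borel_measurable M"
        using Z(1)[of t] Z(1)[of "t + h"] by measurable
      show "AE \<omega> in M. complex_of_real ((y m v (t + h) \<omega> - y m v t \<omega>) /\<^sub>R h) = (Z (t + h) \<omega> - Z t \<omega>) /\<^sub>R h"
        using Z(2)[of t] Z(2)[of "t + h"] by eventually_elim (simp add: scaleR_conv_of_real)
    qed
  qed (use Suc.prems in \<open>auto intro!: L2_measurable[OF L2_of_real] y_L2\<close>)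
  then have lim': "ms_lim M (at 0) (\<lambda>h \<omega>. (Z (t + h) \<omega> - Z t \<omega>) /\<^sub>R h) (ms_deriv M Z t)"
    unfolding ms_deriv_def by (rule someI[of "ms_lim M (at 0) (\<lambda>h \<omega>. (Z (t + h) \<omega> - Z t \<omega>) /\<^sub>R h)"])
  have "AE \<omega> in M. ms_deriv M Z t \<omega> = complex_of_real (y (Suc m) v t \<omega>)"
    by (rule ms_lim_unique[OF lim' lim]) simp
  moreover have "ms_deriv M Z t \<in> borel_measurable M" using lim' by (auto simp: ms_lim_iff_l2norm intro: L2_measurable)
  ultimately show ?case by (simp add: msD_Suc)
qed

lemma msD_component_L2:
  assumes "m \<le> p - q - 1"
  shows "msD M m (component Y v) t \<in> L2 M"
proof (rule L2_cong_AE)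
  show "(\<lambda>\<omega>. complex_of_real (y m v t \<omega>)) \<in> L2 M" by (intro L2_of_real y_L2 assms)
  show "AE \<omega> in M. complex_of_real (y m v t \<omega>) = msD M m (component Y v) t \<omega>"
    using msD_component[OF assms, of v t] by auto
qed (use msD_component[OF assms] in blast)

text \<open>A two-sided derivative may be computed from the left, where the quotients involve times
  up to \<open>t\<close> only. Each derivative of component \<open>v\<close> is thus in the past of
  that component alone.\<close>

lemma y_in_past_space:
  assumes "m \<le> p - q - 1" "v \<in> S"
  shows "(\<lambda>\<omega>. complex_of_real (y m v t \<omega>)) \<in> past_space M Y S t"
  using assms(1)
proof (induction m arbitrary: t)
  case 0
  have "component Y v t \<in> L2 M" unfolding component_Y by (intro L2_of_real y_L2) simp
  from component_in_past_space[OF this assms(2) order.refl] show ?case by (simp add: component_Y)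
next
  case (Suc m)
  note sub = closed_subspace_past_space[of M Y S t]
  have in_t: "(\<lambda>\<omega>. complex_of_real (y m v r \<omega>)) \<in> past_space M Y S t" if "r \<le> t" for r
    using Suc past_space_mono[OF that order.refl, of M Y S] by auto
  have "ms_lim M (at_left 0) (\<lambda>h \<omega>. complex_of_real ((y m v (t + h) \<omega> - y m v t \<omega>) /\<^sub>R h)) (\<lambda>\<omega>. complex_of_real (y (Suc m) v t \<omega>))"
    by (rule ms_lim_filter_mono[OF ms_lim_bounded_linear[OF bounded_linear_of_real y_ms_deriv[OF Suc.prems]]])
      (simp add: at_le)
  then show ?case
  proof (rule closed_subspace_ms_lim[OF sub])
    show "\<forall>\<^sub>F h in at_left 0. (\<lambda>\<omega>. complex_of_real ((y m v (t + h) \<omega> - y m v t \<omega>) /\<^sub>R h)) \<in> past_space M Y S t"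
      unfolding eventually_at_left_field
    proof (intro exI[of _ "-1"] conjI allI impI)
      fix h :: real assume "h < 0"
      then have "(\<lambda>\<omega>. complex_of_real (inverse h) * (complex_of_real (y m v (t + h) \<omega>) - complex_of_real (y m v t \<omega>))) \<in> past_space M Y S t"
        by (intro closed_subspace_mult[OF sub] closed_subspace_diff[OF sub] in_t) auto
      then show "(\<lambda>\<omega>. complex_of_real ((y m v (t + h) \<omega> - y m v t \<omega>) /\<^sub>R h)) \<in> past_space M Y S t"
        by simp
    qed simp
  qed simp
qed

end

section \<open>The state as a functional of the past output\<close>

context iccss
begin

abbreviation EL :: "real \<Rightarrow> nat \<Rightarrow> nat \<Rightarrow> real^'k^'k" where
  "EL r i l \<equiv> bexpn q (matLambda q C) 0 r i l"

abbreviation Cinv :: "real^'k^'k" where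
  "Cinv \<equiv> matrix_inv (C q)"

lemma Cinv: "Cinv ** C q = mat 1"
  by (rule matrix_inv_full_rank[OF rank_Cq])

text \<open>Solving \<open>\<Sum>\<^sub>i C\<^sub>i f\<^sub>i\<^sub>+\<^sub>1 = y\<close> for \<open>f\<^sub>q\<^sub>+\<^sub>1\<close> gives the row \<open>(f\<^sub>2, \<dots>, f\<^sub>q\<^sub>+\<^sub>1) = \<Lambda> (f\<^sub>1, \<dots>, f\<^sub>q) + \<Theta> y\<close>.\<close>

lemma matLambda_step:
  fixes f :: "nat \<Rightarrow> real^'k"
  assumes "m \<in> {1..q}"
  shows "f (Suc m) = (\<Sum>l=1..q. matLambda q C m l *v f l)
     + matTheta q C m 1 *v (\<Sum>i=0..q. C i *v f (Suc i))"
proof (cases "m < q")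
  case True
  then have "(\<Sum>l=1..q. matLambda q C m l *v f l) = (\<Sum>l=1..q. if l = Suc m then f l else 0)"
    by (intro sum.cong refl) (auto simp: matLambda_def)
  then show ?thesis using True by (simp add: matTheta_def)
next
  case False
  then have m: "m = q" using assms by simp
  have "(\<Sum>l=1..q. matLambda q C q l *v f l) = (\<Sum>i=0..<q. - (Cinv *v (C i *v f (Suc i))))"
    by (rule sum.reindex_bij_witness[of _ Suc "\<lambda>l. l - 1"])
      (auto simp: matLambda_def matrix_vector_mul_assoc bounded_bilinear.minus_left[OF bounded_bilinear_matrix_vector_mult])
  moreover have "Cinv *v (\<Sum>i=0..q. C i *v f (Suc i)) = (\<Sum>i=0..<q. Cinv *v (C i *v f (Suc i))) + Cinv *v (C q *v f (Suc q))"
    by (simp add: matrix_vector_sum_right matrix_vector_right_distrib atLeast0AtMost atLeast0LessThan lessThan_Suc_atMost[symmetric])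
  moreover have "Cinv *v (C q *v f (Suc q)) = f (Suc q)"
    by (simp add: matrix_vector_mul_assoc Cinv)
  ultimately show ?thesis by (simp add: m matTheta_def sum_negf)
qed

text \<open>The algebra of the integrating factor: e^(\<Lambda>r), applied to the relation "shifted
  blocks = \<Lambda> blocks + \<Theta> output", turns the factor \<Lambda> into the derivative of
  the exponential.\<close>

lemma EL_step:
  fixes f :: "nat \<Rightarrow> real^'k"
  assumes i: "i \<in> {1..q}"
  shows "(\<Sum>l=1..q. EL r i l *v f (Suc l)) = (\<Sum>l=1..q. bexpn q (matLambda q C) 1 r i l *v f l)
    + (EL r i q ** Cinv) *v (\<Sum>i=0..q. C i *v f (Suc i))"
proof -
  let ?\<Psi> = "\<Sum>i=0..q. C i *v f (Suc i)"
  have "(\<Sum>l=1..q. EL r i l *v f (Suc l))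
     = (\<Sum>m=1..q. EL r i m *v (\<Sum>l=1..q. matLambda q C m l *v f l) + EL r i m *v (matTheta q C m 1 *v ?\<Psi>))"
    by (intro sum.cong refl) (simp only: matLambda_step matrix_vector_right_distrib)
  also have "\<dots> = (\<Sum>m=1..q. EL r i m *v (\<Sum>l=1..q. matLambda q C m l *v f l)) + (\<Sum>m=1..q. EL r i m *v (matTheta q C m 1 *v ?\<Psi>))"
    by (rule sum.distrib)
  also have "(\<Sum>m=1..q. EL r i m *v (\<Sum>l=1..q. matLambda q C m l *v f l)) = (\<Sum>m=1..q. \<Sum>l=1..q. (EL r i m ** matLambda q C m l) *v f l)"
    by (simp add: matrix_vector_sum_right matrix_vector_mul_assoc)
  also have "\<dots> = (\<Sum>l=1..q. (\<Sum>m=1..q. EL r i m ** matLambda q C m l) *v f l)"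
    by (subst sum.swap) (simp add: matrix_vector_sum_left)
  also have "\<dots> = (\<Sum>l=1..q. bexpn q (matLambda q C) 1 r i l *v f l)"
    using bexpn_right[OF i, of _ "matLambda q C" 0 r] by (intro sum.cong refl) simp
  also have "(\<Sum>m=1..q. EL r i m *v (matTheta q C m 1 *v ?\<Psi>)) = (\<Sum>m=1..q. if m = q then (EL r i q ** Cinv) *v ?\<Psi> else 0)"
    by (intro sum.cong refl) (auto simp: matTheta_def matrix_vector_mul_assoc)
  also have "\<dots> = (EL r i q ** Cinv) *v ?\<Psi>" using pq by simp
  finally show ?thesis .
qed

lemma EL_decay:
  obtains (bound) K \<delta> where "\<delta> > 0" "K \<ge> 0"
    "\<And>i j r. i \<in> {1..q} \<Longrightarrow> j \<in> {1..q} \<Longrightarrow> r \<ge> 0 \<Longrightarrow> norm (EL r i j) \<le> K * exp (- \<delta> * r)"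
proof (rule matLambda_exp_decay[of C q])
  show "rank (C q) = CARD('k)" by (rule rank_Cq)
  show "Re z < 0" if "det (Q_poly q C z) = 0" for z using that by (rule zeros_Q)
  show thesis if "\<delta> > 0" "K \<ge> 0"
    "\<And>i j r. i \<in> {1..q} \<Longrightarrow> j \<in> {1..q} \<Longrightarrow> r \<ge> 0 \<Longrightarrow> norm (EL r i j) \<le> K * exp (- \<delta> * r)" for K \<delta>
    using that by (rule bound)
qed

text \<open>The blocks of \<open>e\<^bsup>\<Lambda> r\<^esup> \<Theta>\<close>.\<close>

definition G :: "nat \<Rightarrow> real \<Rightarrow> real^'k^'k" where
  "G i r = EL r i q ** Cinv"

lemma isCont_G:
  assumes "i \<in> {1..q}"
  shows "isCont (\<lambda>u. G i (t - u) $ b $ v) x"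
proof -
  have "q \<in> {1..q}" using pq by simp
  then have "isCont (\<lambda>r. EL r i q) (t - x)"
    using has_vector_derivative_bexpn[OF assms] by (intro has_vector_derivative_continuous)
  then have "isCont (\<lambda>u. EL (t - u) i q) x"
    by (intro isCont_o2[where f = "\<lambda>u. t - u" and g = "\<lambda>r. EL r i q"]) simp_all
  then have "isCont (\<lambda>u. G i (t - u)) x"
    unfolding G_def by (rule bounded_bilinear.continuous[OF bounded_bilinear_matrix_mult]) simp
  then show ?thesis by (intro continuous_intros)
qed

lemma G_decay:
  obtains K \<delta> where "\<delta> > 0" "K \<ge> 0"
    "\<And>i r b v. i \<in> {1..q} \<Longrightarrow> r \<ge> 0 \<Longrightarrow> \<bar>G i r $ b $ v\<bar> \<le> K * exp (- \<delta> * r)"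
proof (rule EL_decay)
  fix K \<delta>
  assume K: "\<delta> > 0" "K \<ge> 0" and bound: "\<And>i j r. i \<in> {1..q} \<Longrightarrow> j \<in> {1..q} \<Longrightarrow> r \<ge> 0 \<Longrightarrow> norm (EL r i j) \<le> K * exp (- \<delta> * r)"
  obtain k where k: "k > 0" "\<And>U W. norm ((U::real^'k^'k) ** (W::real^'k^'k)) \<le> norm U * norm W * k"
    using bounded_bilinear.pos_bounded[OF bounded_bilinear_matrix_mult] by blast
  show ?thesis
  proof (rule that[OF K(1), of "K * (norm Cinv * k)"])
    show "0 \<le> K * (norm Cinv * k)" using K k by simp
    fix i r b v assume "i \<in> {1..q}" "(r::real) \<ge> 0"
    then have "norm (EL r i q) \<le> K * exp (- \<delta> * r)" using pq by (intro bound) auto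
    then have "norm (EL r i q) * (norm Cinv * k) \<le> K * exp (- \<delta> * r) * (norm Cinv * k)"
      using k by (intro mult_right_mono) auto
    moreover have "\<bar>G i r $ b $ v\<bar> \<le> norm (EL r i q) * norm Cinv * k"
      unfolding G_def by (rule order.trans[OF matrix_entry_le k(2)])
    ultimately show "\<bar>G i r $ b $ v\<bar> \<le> K * (norm Cinv * k) * exp (- \<delta> * r)"
      by (simp add: mult_ac)
  qed
qed

lemma weighted_process_y:
  assumes "\<And>u. isCont k u" "\<And>u. u \<le> t \<Longrightarrow> \<bar>k u\<bar> \<le> K * exp (- \<delta> * (t - u))" "\<delta> > 0"
  shows "\<exists>B. weighted_process M k (y 0 v) t K \<delta> B"
proof (rule y_bound)
  fix B assume B: "B \<ge> 0" "\<And>v t. l2norm M (y 0 v t) \<le> B"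
  have "k \<in> borel_measurable borel"
    using assms(1) by (intro borel_measurable_continuous_onI continuous_at_imp_continuous_on) auto
  then have "weighted_process M k (y 0 v) t K \<delta> B"
    using assms B y_measurable y_L2[of 0 v] by unfold_locales auto
  then show ?thesis by (rule exI)
qed

lemma l2inner_X_deriv:
  assumes U: "U \<in> L2 M" and j: "j \<in> {1..<p}"
  shows "((\<lambda>u. l2inner M (\<lambda>\<omega>. X u j \<omega> $ b) U) has_real_derivative l2inner M (\<lambda>\<omega>. X t (Suc j) \<omega> $ b) U) (at t)"
proof -
  have j': "j \<in> {1..p}" using j by auto
  have "l2inner M (\<lambda>\<omega>. (X (t + h) j \<omega> $ b - X t j \<omega> $ b) /\<^sub>R h) U
      = (l2inner M (\<lambda>\<omega>. X (t + h) j \<omega> $ b) U - l2inner M (\<lambda>\<omega>. X t j \<omega> $ b) U) / h" for h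
    by (simp only: l2inner_scaleR_left l2inner_diff_left[OF X_nth_L2[OF j'] X_nth_L2[OF j'] U]) (simp add: divide_inverse)
  then show ?thesis
    using tendsto_l2inner[OF X_ms_deriv[OF j, of t b] U] by (simp add: DERIV_def)
qed

lemma l2inner_X_continuous:
  assumes U: "U \<in> L2 M" and j: "j \<in> {1..p}"
  shows "isCont (\<lambda>u. l2inner M (\<lambda>\<omega>. X u j \<omega> $ b) U) t"
  using tendsto_l2inner[OF X_ms_continuous[OF j, of t b] U] by (simp add: isCont_iff)

lemma l2inner_y:
  assumes U: "U \<in> L2 M"
  shows "l2inner M (y 0 v u) U = (\<Sum>i=0..q. C i *v (\<chi> a. l2inner M (\<lambda>\<omega>. X u (Suc i) \<omega> $ a) U)) $ v"
proof -
  have idx: "Suc i \<in> {1..p}" if "i \<in> {0..q}" for i using that pq by auto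
  have "l2inner M (y 0 v u) U = (\<Sum>i=0..q. l2inner M (\<lambda>\<omega>. \<Sum>a\<in>UNIV. C i $ v $ a *\<^sub>R X u (Suc i) \<omega> $ a) U)"
    unfolding y_def[abs_def] using U idx by (subst l2inner_sum_left) (auto intro!: L2_sum L2_mult_left X_nth_L2)
  also have "\<dots> = (\<Sum>i=0..q. \<Sum>a\<in>UNIV. C i $ v $ a * l2inner M (\<lambda>\<omega>. X u (Suc i) \<omega> $ a) U)"
    using idx by (intro sum.cong refl) (simp only: l2inner_sum_left[OF L2_scaleR[OF X_nth_L2] U] l2inner_scaleR_left)
  finally show ?thesis by (simp add: matrix_vector_mult_def)
qed

text \<open>The derivative of \<open>u \<mapsto> E[(e\<^bsup>\<Lambda>(t-u)\<^esup> X(u))\<^sub>i U]\<close> is \<open>E[(e\<^bsup>\<Lambda>(t-u)\<^esup> \<Theta> Y(u))\<^sub>i U]\<close>, for every square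
  integrable \<open>U\<close>; only scalar calculus is needed to integrate this identity over \<open>(-\<infinity>, t]\<close>.\<close>

lemma l2inner_X_eq_integral:
  assumes i: "i \<in> {1..q}" and U: "U \<in> L2 M"
  shows "l2inner M (\<lambda>\<omega>. X t i \<omega> $ b) U = (\<Sum>v\<in>UNIV. LINT u:{..t}|lborel. G i (t - u) $ b $ v * l2inner M (y 0 v u) U)"
proof (rule EL_decay)
  fix K \<delta>
  assume K: "\<delta> > 0" "K \<ge> 0" and bound: "\<And>i j r. i \<in> {1..q} \<Longrightarrow> j \<in> {1..q} \<Longrightarrow> r \<ge> 0 \<Longrightarrow> norm (EL r i j) \<le> K * exp (- \<delta> * r)"
  define \<phi> where "\<phi> l a u = l2inner M (\<lambda>\<omega>. X u l \<omega> $ a) U" for l a u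
  define \<Phi> where "\<Phi> l u = (\<chi> a. \<phi> l a u)" for l u
  define \<psi> where "\<psi> v u = l2inner M (y 0 v u) U" for v u
  define H where "H u = (\<Sum>l=1..q. \<Sum>a\<in>UNIV. EL (t - u) i l $ b $ a * \<phi> l a u)" for u
  define D where "D u = (\<Sum>v\<in>UNIV. G i (t - u) $ b $ v * \<psi> v u)" for u
  have \<psi>: "\<psi> v u = (\<Sum>i=0..q. C i *v \<Phi> (Suc i) u) $ v" for v u
    unfolding \<psi>_def \<Phi>_def \<phi>_def by (rule l2inner_y[OF U])
  have H_deriv: "(H has_real_derivative D u) (at u)" for u
  proof -
    have "(H has_real_derivative (\<Sum>l=1..q. \<Sum>a\<in>UNIV. EL (t - u) i l $ b $ a * \<phi> (Suc l) a u
        + - (bexpn q (matLambda q C) 1 (t - u) i l $ b $ a) * \<phi> l a u)) (at u)"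
      unfolding H_def
    proof (intro DERIV_sum DERIV_mult')
      fix l a assume l: "l \<in> {1..q}"
      show "(\<phi> l a has_real_derivative \<phi> (Suc l) a u) (at u)"
        unfolding \<phi>_def[abs_def] using l pq by (intro l2inner_X_deriv[OF U]) auto
      have "((\<lambda>r. EL r i l $ b $ a) has_vector_derivative bexpn q (matLambda q C) 1 (t - u) i l $ b $ a) (at (t - u))"
        using has_vector_derivative_bexpn[OF i l, of "matLambda q C" 0]
        by (intro bounded_linear.has_vector_derivative[OF bounded_linear_vec_nth]) simp
      then have "((\<lambda>r. EL r i l $ b $ a) has_real_derivative bexpn q (matLambda q C) 1 (t - u) i l $ b $ a) (at (t - u))"
        by (simp add: has_real_derivative_iff_has_vector_derivative)
      moreover have "((\<lambda>u. t - u) has_real_derivative -1) (at u)"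
        by (auto intro!: derivative_eq_intros)
      ultimately have "((\<lambda>u. EL (t - u) i l $ b $ a) has_real_derivative bexpn q (matLambda q C) 1 (t - u) i l $ b $ a * -1) (at u)"
        by (rule DERIV_chain2)
      then show "((\<lambda>u. EL (t - u) i l $ b $ a) has_real_derivative - (bexpn q (matLambda q C) 1 (t - u) i l $ b $ a)) (at u)"
        by simp
    qed
    also have "(\<Sum>l=1..q. \<Sum>a\<in>UNIV. EL (t - u) i l $ b $ a * \<phi> (Suc l) a u
        + - (bexpn q (matLambda q C) 1 (t - u) i l $ b $ a) * \<phi> l a u)
       = ((\<Sum>l=1..q. EL (t - u) i l *v \<Phi> (Suc l) u) - (\<Sum>l=1..q. bexpn q (matLambda q C) 1 (t - u) i l *v \<Phi> l u)) $ b"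
      by (simp add: matrix_vector_mult_def \<Phi>_def sum.distrib sum_subtractf sum_negf)
    also have "\<dots> = ((EL (t - u) i q ** Cinv) *v (\<Sum>i=0..q. C i *v \<Phi> (Suc i) u)) $ b"
      using EL_step[OF i, of "t - u" "\<lambda>l. \<Phi> l u"] by simp
    also have "\<dots> = D u"
      unfolding D_def \<psi> by (simp add: G_def matrix_vector_mult_def)
    finally show ?thesis .
  qed
  \<comment> \<open>\<open>D\<close> involves the blocks up to q + 1, and q + 1 may equal p. The
    last block has no derivative at its disposal, but it is mean-square continuous.\<close>
  have D_cont: "isCont D u" for u
  proof -
    have "isCont (\<psi> v) u" for v
    proof -
      have "\<psi> v = (\<lambda>u. \<Sum>i=0..q. \<Sum>a\<in>UNIV. C i $ v $ a * \<phi> (Suc i) a u)"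
        by (simp add: fun_eq_iff \<psi> matrix_vector_mult_def \<Phi>_def)
      then show ?thesis
        unfolding \<phi>_def using pq by (auto intro!: continuous_intros l2inner_X_continuous[OF U])
    qed
    then show ?thesis unfolding D_def by (intro continuous_intros isCont_G i)
  qed
  have FTC: "(LINT u:{s..t}|lborel. D u) = H t - H s" if "s \<le> t" for s
    using integral_FTC_Icc_real[OF that, of H D] H_deriv D_cont
    by (simp add: set_lebesgue_integral_def mult.commute)
  have H_t: "H t = \<phi> i b t"
  proof -
    have "H t = (\<Sum>l=1..q. if l = i then (\<Sum>a\<in>UNIV. (mat 1 :: real^'k^'k) $ b $ a * \<phi> i a t) else 0)"
      unfolding H_def by (intro sum.cong refl) (auto simp: bexpn_zero)
    also have "\<dots> = (\<Sum>a\<in>UNIV. (mat 1 :: real^'k^'k) $ b $ a * \<phi> i a t)" using i by simp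
    also have "\<dots> = \<phi> i b t" by (simp add: mat_def if_distrib[of "\<lambda>x. x * _"] cong: if_cong)
    finally show ?thesis .
  qed
  obtain B where B: "B \<ge> 0" "\<And>j t b. j \<in> {1..p} \<Longrightarrow> l2norm M (\<lambda>\<omega>. X t j \<omega> $ b) \<le> B"
    by (rule X_bound) blast
  \<comment> \<open>The boundary term at -\<infinity>: the exponential decays while the blocks stay
    bounded in L2. Here the stability of \<Lambda> removes any initial value.\<close>
  have H_lim: "(H \<longlongrightarrow> 0) at_bot"
  proof (rule Lim_null_comparison)
    have "\<bar>H s\<bar> \<le> (\<Sum>l=1..q. \<Sum>a\<in>(UNIV::'k set). K * exp (- \<delta> * (t - s)) * (B * l2norm M U))" if "s \<le> t" for s
    proof -
      have "\<bar>H s\<bar> \<le> (\<Sum>l=1..q. \<Sum>a\<in>UNIV. \<bar>EL (t - s) i l $ b $ a * \<phi> l a s\<bar>)"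
        unfolding H_def by (intro order.trans[OF sum_abs] sum_mono sum_abs)
      also have "\<dots> \<le> (\<Sum>l=1..q. \<Sum>a\<in>(UNIV::'k set). K * exp (- \<delta> * (t - s)) * (B * l2norm M U))"
        unfolding abs_mult
      proof (intro sum_mono mult_mono)
        fix l a assume l: "l \<in> {1..q}"
        then have l': "l \<in> {1..p}" using pq by auto
        show "\<bar>EL (t - s) i l $ b $ a\<bar> \<le> K * exp (- \<delta> * (t - s))"
          using that by (intro order.trans[OF matrix_entry_le bound] i l) auto
        show "\<bar>\<phi> l a s\<bar> \<le> B * l2norm M U"
          unfolding \<phi>_def by (intro order.trans[OF l2inner_Cauchy_Schwarz[OF X_nth_L2[OF l'] U]] mult_right_mono B(2)[OF l']) simp
      qed (use K in auto)
      finally show ?thesis .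
    qed
    then show "\<forall>\<^sub>F s in at_bot. norm (H s) \<le> (\<Sum>l=1..q. \<Sum>a\<in>(UNIV::'k set). K * exp (- \<delta> * (t - s)) * (B * l2norm M U))"
      unfolding eventually_at_bot_linorder by auto
    have "((\<lambda>s. exp (- \<delta> * (t - s))) \<longlongrightarrow> 0) at_bot" using K(1) by real_asymp
    then have "((\<lambda>s. \<Sum>l=1..q. \<Sum>a\<in>(UNIV::'k set). K * exp (- \<delta> * (t - s)) * (B * l2norm M U)) \<longlongrightarrow>
       (\<Sum>l=1..q. \<Sum>a\<in>(UNIV::'k set). K * 0 * (B * l2norm M U))) at_bot"
      by (intro tendsto_sum tendsto_mult tendsto_const)
    then show "((\<lambda>s. \<Sum>l=1..q. \<Sum>a\<in>(UNIV::'k set). K * exp (- \<delta> * (t - s)) * (B * l2norm M U)) \<longlongrightarrow> 0) at_bot"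
      by simp
  qed
  have int: "set_integrable lborel {..t} (\<lambda>u. G i (t - u) $ b $ v * \<psi> v u)" for v
  proof (rule G_decay)
    fix K \<delta> assume "\<delta> > 0" and G: "\<And>i r b v. i \<in> {1..q} \<Longrightarrow> r \<ge> 0 \<Longrightarrow> \<bar>G i r $ b $ v\<bar> \<le> K * exp (- \<delta> * r)"
    then have "\<exists>B. weighted_process M (\<lambda>u. G i (t - u) $ b $ v) (y 0 v) t K \<delta> B"
      by (intro weighted_process_y isCont_G i G) auto
    then obtain B where "weighted_process M (\<lambda>u. G i (t - u) $ b $ v) (y 0 v) t K \<delta> B" ..
    from weighted_process.l2inner_past(1)[OF this U] show ?thesis by (simp add: \<psi>_def)
  qed
  have sum_int: "(LINT u:T|lborel. D u) = (\<Sum>v\<in>UNIV. LINT u:T|lborel. G i (t - u) $ b $ v * \<psi> v u)"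
    if "T \<in> sets borel" "T \<subseteq> {..t}" for T
    unfolding D_def set_lebesgue_integral_def scaleR_sum_right
  proof (rule Bochner_Integration.integral_sum)
    show "integrable lborel (\<lambda>u. indicator T u *\<^sub>R (G i (t - u) $ b $ v * \<psi> v u))" for v
      using set_integrable_subset[OF int, of T] that unfolding set_integrable_def by simp
  qed
  have "((\<lambda>s. LINT u:{s..t}|lborel. D u) \<longlongrightarrow> (LINT u:{..t}|lborel. D u)) at_bot"
  proof (rule tendsto_set_lebesgue_integral_at_bot)
    show "set_integrable lborel {..t} D"
      unfolding D_def set_integrable_def scaleR_sum_right
      using int[unfolded set_integrable_def] by (rule Bochner_Integration.integrable_sum)
  qed auto
  moreover have "\<forall>\<^sub>F s in at_bot. (LINT u:{s..t}|lborel. D u) = H t - H s"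
    unfolding eventually_at_bot_linorder using FTC by blast
  ultimately have "((\<lambda>s. H t - H s) \<longlongrightarrow> (LINT u:{..t}|lborel. D u)) at_bot"
    by (rule Lim_transform_eventually)
  moreover have "((\<lambda>s. H t - H s) \<longlongrightarrow> H t - 0) at_bot"
    by (intro tendsto_intros H_lim)
  ultimately have "(LINT u:{..t}|lborel. D u) = H t - 0"
    by (rule tendsto_unique[OF trivial_limit_at_bot_linorder])
  then show ?thesis
    using sum_int[of "{..t}"] by (simp add: H_t \<phi>_def \<psi>_def)
qed

text \<open>Both sides have the same inner product with every square-integrable \<open>U\<close>,
  the right one by Fubini's theorem, so they coincide almost surely.\<close>

lemma X_eq_integral:
  assumes i: "i \<in> {1..q}"
  shows "AE \<omega> in M. X t i \<omega> $ b = (\<Sum>v\<in>UNIV. LINT u:{..t}|lborel. G i (t - u) $ b $ v * y 0 v u \<omega>)"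
proof (rule G_decay)
  fix K \<delta> assume \<delta>: "\<delta> > 0" and G: "\<And>i r b v. i \<in> {1..q} \<Longrightarrow> r \<ge> 0 \<Longrightarrow> \<bar>G i r $ b $ v\<bar> \<le> K * exp (- \<delta> * r)"
  have wp: "\<exists>B. weighted_process M (\<lambda>u. G i (t - u) $ b $ v) (y 0 v) t K \<delta> B" for v
    by (intro weighted_process_y isCont_G i G \<delta>) auto
  have I: "(\<lambda>\<omega>. LINT u:{..t}|lborel. G i (t - u) $ b $ v * y 0 v u \<omega>) \<in> L2 M" for v
  proof -
    obtain B where "weighted_process M (\<lambda>u. G i (t - u) $ b $ v) (y 0 v) t K \<delta> B" using wp ..
    then show ?thesis by (rule weighted_process.L2_past)
  qed
  have X: "(\<lambda>\<omega>. X t i \<omega> $ b) \<in> L2 M" using i pq by (intro X_nth_L2) auto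
  show ?thesis
  proof (rule AE_eq_if_l2inner_eq[OF X L2_sum[OF I]])
    fix U :: "'w \<Rightarrow> real" assume U: "U \<in> L2 M"
    have *: "l2inner M (\<lambda>\<omega>. LINT u:{..t}|lborel. G i (t - u) $ b $ v * y 0 v u \<omega>) U
        = (LINT u:{..t}|lborel. G i (t - u) $ b $ v * l2inner M (y 0 v u) U)" for v
    proof -
      obtain B where "weighted_process M (\<lambda>u. G i (t - u) $ b $ v) (y 0 v) t K \<delta> B" using wp ..
      from weighted_process.l2inner_past(2)[OF this U] show ?thesis .
    qed
    have "l2inner M (\<lambda>\<omega>. \<Sum>v\<in>UNIV. LINT u:{..t}|lborel. G i (t - u) $ b $ v * y 0 v u \<omega>) U
        = (\<Sum>v\<in>UNIV. l2inner M (\<lambda>\<omega>. LINT u:{..t}|lborel. G i (t - u) $ b $ v * y 0 v u \<omega>) U)"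
      by (rule l2inner_sum_left[OF I U])
    also have "\<dots> = (\<Sum>v\<in>UNIV. LINT u:{..t}|lborel. G i (t - u) $ b $ v * l2inner M (y 0 v u) U)"
      by (intro sum.cong refl *)
    also have "\<dots> = l2inner M (\<lambda>\<omega>. X t i \<omega> $ b) U"
      by (rule l2inner_X_eq_integral[OF i U, symmetric])
    finally show "l2inner M (\<lambda>\<omega>. X t i \<omega> $ b) U = l2inner M (\<lambda>\<omega>. \<Sum>v\<in>UNIV. LINT u:{..t}|lborel. G i (t - u) $ b $ v * y 0 v u \<omega>) U"
      by (rule sym)
  qed
qed

end

text \<open>A time integral lies in the closed subspace: its component orthogonal to the subspace is
  orthogonal to every \<open>z u\<close>, hence by Fubini to the integral itself.\<close>

lemma weighted_process_past_in_subspace: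
  assumes wp: "weighted_process M k z t K \<delta> B" and L: "closed_subspace M \<L>"
    and z: "\<And>u. u \<le> t \<Longrightarrow> (\<lambda>\<omega>. complex_of_real (z u \<omega>)) \<in> \<L>"
  shows "(\<lambda>\<omega>. complex_of_real (LINT u:{..t}|lborel. k u * z u \<omega>)) \<in> \<L>"
proof -
  interpret weighted_process M k z t K \<delta> B by (rule wp)
  define I where "I \<omega> = (LINT u:{..t}|lborel. k u * z u \<omega>)" for \<omega>
  have I: "I \<in> L2 M" unfolding I_def by (rule L2_past)
  have IC: "(\<lambda>\<omega>. complex_of_real (I \<omega>)) \<in> L2 M" by (rule L2_of_real[OF I])
  obtain W where W: "W \<in> \<L>" "\<forall>V\<in>\<L>. l2inner M (\<lambda>\<omega>. complex_of_real (I \<omega>) - W \<omega>) V = 0"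
    using orth_proj_exists[OF L IC] ..
  note W = W(1) W(2)[rule_format]
  define D where "D \<omega> = complex_of_real (I \<omega>) - W \<omega>" for \<omega>
  have WL: "W \<in> L2 M" by (rule closed_subspace_L2[OF L W(1)])
  have D: "D \<in> L2 M" unfolding D_def by (intro L2_diff IC WL)
  have Re: "(\<lambda>\<omega>. Re (D \<omega>)) \<in> L2 M" by (rule L2_bounded_linear[OF bounded_linear_Re D])
  \<comment> \<open>\<open>z\<close> and the integral are real, so only the real part of
    \<open>D\<close> is seen when they are tested against it.\<close>
  have inner_Re: "l2inner M (\<lambda>\<omega>. complex_of_real (f \<omega>)) D = l2inner M f (\<lambda>\<omega>. Re (D \<omega>))" for f
    by (simp add: l2inner_def inner_complex_def)
  have "l2inner M (z u) (\<lambda>\<omega>. Re (D \<omega>)) = 0" if "u \<le> t" for u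
  proof -
    have "l2inner M D (\<lambda>\<omega>. complex_of_real (z u \<omega>)) = 0"
      using W(2)[OF z[OF that]] by (simp add: D_def[abs_def])
    then show ?thesis by (simp only: l2inner_commute[of M D "\<lambda>\<omega>. complex_of_real (z u \<omega>)"] inner_Re)
  qed
  then have "(LINT u:{..t}|lborel. k u * l2inner M (z u) (\<lambda>\<omega>. Re (D \<omega>))) = 0"
    unfolding set_lebesgue_integral_def
    by (intro integral_eq_zero_AE AE_I2) (auto simp: indicator_def)
  then have "l2inner M I (\<lambda>\<omega>. Re (D \<omega>)) = 0"
    unfolding I_def l2inner_past(2)[OF Re] .
  then have "l2inner M D (\<lambda>\<omega>. complex_of_real (I \<omega>)) = 0"
    by (simp only: l2inner_commute[of M D "\<lambda>\<omega>. complex_of_real (I \<omega>)"] inner_Re)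
  moreover have "l2inner M D W = 0" using W(2)[OF W(1)] by (simp add: D_def[abs_def])
  moreover have "l2inner M D D = l2inner M (\<lambda>\<omega>. complex_of_real (I \<omega>)) D - l2inner M W D"
    using l2inner_diff_left[OF IC WL D] by (simp add: D_def[abs_def])
  ultimately have "(l2norm M D)\<^sup>2 = 0"
    unfolding l2norm_eq_inner
    by (simp add: l2inner_commute[of M "\<lambda>\<omega>. complex_of_real (I \<omega>)" D] l2inner_commute[of M W D])
  then have "AE \<omega> in M. D \<omega> = 0" using l2norm_eq_0[OF D] by simp
  then have "AE \<omega> in M. W \<omega> = complex_of_real (I \<omega>)" by eventually_elim (simp add: D_def)
  from closed_subspace_cong_AE[OF L W(1) L2_measurable[OF IC] this] show ?thesis by (simp add: I_def)
qed

section \<open>Prediction from the past\<close>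

text \<open>Against a real random variable a complex coefficient enters only through its real part,
  so orthogonality to the real components extends to complex combinations and then, by
  Cauchy-Schwarz, to their closure.\<close>

lemma l2inner_past_space_zero:
  fixes z :: "'w \<Rightarrow> real"
  assumes z: "z \<in> L2 M"
    and L2: "\<And>s r. s \<in> S \<Longrightarrow> r \<le> t \<Longrightarrow> (\<lambda>\<omega>. Y r \<omega> $ s) \<in> L2 M"
    and orth: "\<And>s r. s \<in> S \<Longrightarrow> r \<le> t \<Longrightarrow> l2inner M (\<lambda>\<omega>. Y r \<omega> $ s) z = 0"
    and U: "U \<in> past_space M Y S t"
  shows "l2inner M U (\<lambda>\<omega>. complex_of_real (z \<omega>)) = 0"
proof -
  have zC: "(\<lambda>\<omega>. complex_of_real (z \<omega>)) \<in> L2 M" by (rule L2_of_real[OF z])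
  have lin: "l2inner M W (\<lambda>\<omega>. complex_of_real (z \<omega>)) = 0" if W: "W \<in> past_lin Y S t" for W
  proof -
    obtain F c where W: "W = (\<lambda>\<omega>. \<Sum>(s, r)\<in>F. c s r * component Y s r \<omega>)" "finite F" "F \<subseteq> S \<times> {..t}"
      using W unfolding past_lin_def by blast
    have "l2inner M W (\<lambda>\<omega>. complex_of_real (z \<omega>)) = (\<Sum>x\<in>F. l2inner M (\<lambda>\<omega>. c (fst x) (snd x) * component Y (fst x) (snd x) \<omega>) (\<lambda>\<omega>. complex_of_real (z \<omega>)))"
      unfolding W(1) case_prod_unfold
      using W(3) by (intro l2inner_sum_left zC L2_mult_left) (auto simp: component_def[abs_def] intro!: L2_of_real L2)
    also have "\<dots> = 0"
    proof (intro sum.neutral ballI)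
      fix x assume "x \<in> F"
      then have x: "fst x \<in> S" "snd x \<le> t" using W(3) by auto
      have "l2inner M (\<lambda>\<omega>. c (fst x) (snd x) * component Y (fst x) (snd x) \<omega>) (\<lambda>\<omega>. complex_of_real (z \<omega>))
          = Re (c (fst x) (snd x)) * l2inner M (\<lambda>\<omega>. Y (snd x) \<omega> $ fst x) z"
        by (simp add: l2inner_def inner_complex_def component_def mult.assoc)
      then show "l2inner M (\<lambda>\<omega>. c (fst x) (snd x) * component Y (fst x) (snd x) \<omega>) (\<lambda>\<omega>. complex_of_real (z \<omega>)) = 0"
        using orth[OF x] by simp
    qed
    finally show ?thesis .
  qed
  have UL: "U \<in> L2 M" using U by (simp add: past_space_iff)
  have "\<bar>l2inner M U (\<lambda>\<omega>. complex_of_real (z \<omega>))\<bar> \<le> 0 + e" if "e > 0" for e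
  proof -
    \<comment> \<open>The approximation error is multiplied by the norm of \<open>z\<close>; the
      summand 1 covers the case of norm 0.\<close>
    define e' where "e' = e / (l2norm M z + 1)"
    have n: "l2norm M z + 1 > 0" using l2norm_nonneg[of M z] by linarith
    have e': "e' > 0" using that n by (simp add: e'_def)
    obtain W where W: "W \<in> past_lin Y S t" "W \<in> L2 M" "l2norm M (\<lambda>\<omega>. U \<omega> - W \<omega>) < e'"
      using U e' unfolding past_space_iff by blast
    have "l2inner M U (\<lambda>\<omega>. complex_of_real (z \<omega>)) = l2inner M (\<lambda>\<omega>. U \<omega> - W \<omega>) (\<lambda>\<omega>. complex_of_real (z \<omega>))"
      using l2inner_diff_left[OF UL W(2) zC] lin[OF W(1)] by simp
    then have "\<bar>l2inner M U (\<lambda>\<omega>. complex_of_real (z \<omega>))\<bar> \<le> l2norm M (\<lambda>\<omega>. U \<omega> - W \<omega>) * l2norm M z"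
      using l2inner_Cauchy_Schwarz[OF L2_diff[OF UL W(2)] zC] by simp
    also have "\<dots> \<le> e' * (l2norm M z + 1)" using W(3) e' by (intro mult_mono) auto
    also have "\<dots> = e" using n by (simp add: e'_def)
    finally show ?thesis by simp
  qed
  then have "\<bar>l2inner M U (\<lambda>\<omega>. complex_of_real (z \<omega>))\<bar> \<le> 0" by (rule field_le_epsilon)
  then show ?thesis by simp
qed

lemma (in weighted_process) has_past_integral_complex:
  "has_past_integral M (\<lambda>u \<omega>. complex_of_real (k u) * complex_of_real (z u \<omega>)) t
     (\<lambda>\<omega>. complex_of_real (LINT u:{..t}|lborel. k u * z u \<omega>))"
proof -
  have int_eq: "(LINT u:T|lborel. complex_of_real (k u) * complex_of_real (z u \<omega>)) = complex_of_real (LINT u:T|lborel. k u * z u \<omega>)" for T \<omega>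
    using set_integral_complex_of_real[of lborel T "\<lambda>u. k u * z u \<omega>"] by simp
  show ?thesis
    unfolding has_past_integral_def int_eq
  proof (intro conjI)
    show "AE \<omega> in M. \<forall>s. set_integrable lborel {s..t} (\<lambda>u. complex_of_real (k u) * complex_of_real (z u \<omega>))"
      using AE_integrable
    proof eventually_elim
      case (elim \<omega>)
      show ?case
      proof
        fix s
        have "set_integrable lborel {s..t} (\<lambda>u. k u * z u \<omega>)"
          by (rule set_integrable_subset[OF elim]) auto
        then have "integrable lborel (\<lambda>u. complex_of_real (indicator {s..t} u *\<^sub>R (k u * z u \<omega>)))"
          unfolding set_integrable_def by (rule integrable_of_real)
        then show "set_integrable lborel {s..t} (\<lambda>u. complex_of_real (k u) * complex_of_real (z u \<omega>))"
          unfolding set_integrable_def by (simp add: scaleR_conv_of_real)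
      qed
    qed
    show "AE \<omega> in M. ((\<lambda>s. complex_of_real (LINT u:{s..t}|lborel. k u * z u \<omega>)) \<longlongrightarrow> complex_of_real (LINT u:{..t}|lborel. k u * z u \<omega>)) at_bot"
      using AE_past_limit by eventually_elim (rule tendsto_of_real)
    show "ms_lim M at_bot (\<lambda>s \<omega>. complex_of_real (LINT u:{s..t}|lborel. k u * z u \<omega>)) (\<lambda>\<omega>. complex_of_real (LINT u:{..t}|lborel. k u * z u \<omega>))"
      by (rule ms_lim_bounded_linear[OF bounded_linear_of_real ms_lim_past])
  qed
qed

lemma past_integral_AE_eq:
  fixes F :: "real \<Rightarrow> 'w \<Rightarrow> 'b::euclidean_space"
  assumes "has_past_integral M F t I"
  shows "past_integral M F t \<in> L2 M" "AE \<omega> in M. past_integral M F t \<omega> = I \<omega>"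
proof -
  have "has_past_integral M F t (past_integral M F t)"
    unfolding past_integral_def by (rule someI[of "has_past_integral M F t", OF assms])
  then have lim: "ms_lim M at_bot (\<lambda>s \<omega>. LINT u:{s..t}|lborel. F u \<omega>) (past_integral M F t)"
    by (simp add: has_past_integral_def)
  then show "past_integral M F t \<in> L2 M" by (simp add: ms_lim_iff_l2norm)
  have lim': "ms_lim M at_bot (\<lambda>s \<omega>. LINT u:{s..t}|lborel. F u \<omega>) I"
    using assms by (simp add: has_past_integral_def)
  show "AE \<omega> in M. past_integral M F t \<omega> = I \<omega>"
    by (rule ms_lim_unique[OF lim lim' trivial_limit_at_bot_linorder])
qed

lemma bpow_one: "i \<in> {1..n} \<Longrightarrow> j \<in> {1..n} \<Longrightarrow> bpow n X 1 i j = X i j"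
  using bmul_one_right[of j n X X i] by simp

text \<open>Only the exponential depends on \<open>h\<close>, and its derivative at 0 is
  \<open>X\<close>. The formula serves both M'(0) and M_m'(0), which differ in the constant factor
  \<open>R\<close>.\<close>

lemma bderiv0_bmul_bexp:
  "bderiv0 (\<lambda>h. bmul p (bmul p U (bexp p (bscale h X))) R) i j = (\<Sum>l=1..p. (\<Sum>m=1..p. U i m ** X m l) ** R l j)"
proof -
  have "((\<lambda>h. \<Sum>l=1..p. (\<Sum>m=1..p. U i m ** bexpn p X 0 h m l) ** R l j)
      has_vector_derivative (\<Sum>l=1..p. (\<Sum>m=1..p. U i m ** X m l) ** R l j)) (at 0)"
  proof (intro has_vector_derivative_sum
      bounded_linear.has_vector_derivative[OF bounded_bilinear.bounded_linear_left[OF bounded_bilinear_matrix_mult]]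
      bounded_linear.has_vector_derivative[OF bounded_bilinear.bounded_linear_right[OF bounded_bilinear_matrix_mult]])
    fix l m assume lm: "l \<in> {1..p}" "m \<in> {1..p}"
    show "((\<lambda>h. bexpn p X 0 h m l) has_vector_derivative X m l) (at 0)"
      using has_vector_derivative_bexpn[OF lm(2,1), of X 0 0 UNIV] bpow_one[OF lm(2,1), of X]
      by (simp add: bexpn_zero del: bpow.simps)
  qed
  then show ?thesis
    unfolding bderiv0_def bmul_def bexp_bscale by (rule vector_derivative_at)
qed

section \<open>Reconstruction of the state and the coefficients of the limit\<close>

context iccss
begin

text \<open>Iteration of the relation "shifted blocks = \<Lambda> blocks + \<Theta> output". For
  blocks f = X(t) the vectors summed against \<open>C c\<close> are the derivatives of Y of order m.
  The statement is pure algebra for an arbitrary family \<open>f\<close>.\<close>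

lemma matLambda_iterate:
  fixes f :: "nat \<Rightarrow> real^'k"
  assumes "i \<in> {1..q}"
  shows "f (i + j) = (\<Sum>l=1..q. bpow q (matLambda q C) j i l *v f l)
     + (\<Sum>m<j. bmul q (bpow q (matLambda q C) (j - 1 - m)) (matTheta q C) i 1 *v (\<Sum>c=0..q. C c *v f (Suc (c + m))))"
  using assms
proof (induction j arbitrary: i)
  case 0
  have "(\<Sum>l=1..q. bpow q (matLambda q C) 0 i l *v f l) = (\<Sum>l=1..q. if l = i then f l else 0)"
    by (intro sum.cong refl) auto
  then show ?case using 0 by simp
next
  case (Suc j)
  let ?\<Lambda> = "matLambda q C" and ?\<Theta> = "matTheta q C"
  define \<eta> where "\<eta> m = (\<Sum>c=0..q. C c *v f (Suc (c + m)))" for m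
  have "f (i + Suc j) = (\<Sum>l=1..q. ?\<Lambda> i l *v f (l + j)) + ?\<Theta> i 1 *v \<eta> j"
    using matLambda_step[OF Suc.prems, of "\<lambda>l. f (l + j)"] by (simp add: \<eta>_def)
  also have "(\<Sum>l=1..q. ?\<Lambda> i l *v f (l + j))
     = (\<Sum>l=1..q. ?\<Lambda> i l *v ((\<Sum>r=1..q. bpow q ?\<Lambda> j l r *v f r) + (\<Sum>m<j. bmul q (bpow q ?\<Lambda> (j - 1 - m)) ?\<Theta> l 1 *v \<eta> m)))"
    unfolding \<eta>_def by (intro sum.cong refl arg_cong[of _ _ "\<lambda>x. _ *v x"] Suc.IH)
  also have "\<dots> = (\<Sum>l=1..q. \<Sum>r=1..q. (?\<Lambda> i l ** bpow q ?\<Lambda> j l r) *v f r)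
      + (\<Sum>l=1..q. \<Sum>m<j. (?\<Lambda> i l ** bmul q (bpow q ?\<Lambda> (j - 1 - m)) ?\<Theta> l 1) *v \<eta> m)"
    by (simp add: matrix_vector_right_distrib matrix_vector_sum_right matrix_vector_mul_assoc sum.distrib)
  also have "(\<Sum>l=1..q. \<Sum>r=1..q. (?\<Lambda> i l ** bpow q ?\<Lambda> j l r) *v f r) = (\<Sum>r=1..q. bpow q ?\<Lambda> (Suc j) i r *v f r)"
    by (subst sum.swap) (simp only: bpow.simps(2) bmul_def matrix_vector_sum_left)
  also have "(\<Sum>l=1..q. \<Sum>m<j. (?\<Lambda> i l ** bmul q (bpow q ?\<Lambda> (j - 1 - m)) ?\<Theta> l 1) *v \<eta> m)
      = (\<Sum>m<j. bmul q ?\<Lambda> (bmul q (bpow q ?\<Lambda> (j - 1 - m)) ?\<Theta>) i 1 *v \<eta> m)"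
    by (subst sum.swap) (simp only: bmul_def[of q ?\<Lambda> "bmul q _ _"] matrix_vector_sum_left)
  also have "(\<Sum>m<j. bmul q ?\<Lambda> (bmul q (bpow q ?\<Lambda> (j - 1 - m)) ?\<Theta>) i 1 *v \<eta> m)
     = (\<Sum>m<j. bmul q (bpow q ?\<Lambda> (Suc j - 1 - m)) ?\<Theta> i 1 *v \<eta> m)"
  proof (intro sum.cong refl)
    fix m assume "m \<in> {..<j}"
    then have "Suc j - 1 - m = Suc (j - 1 - m)" by auto
    then show "bmul q ?\<Lambda> (bmul q (bpow q ?\<Lambda> (j - 1 - m)) ?\<Theta>) i 1 *v \<eta> m = bmul q (bpow q ?\<Lambda> (Suc j - 1 - m)) ?\<Theta> i 1 *v \<eta> m"
      by (simp add: bmul_assoc)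
  qed
  also have "?\<Theta> i 1 = bmul q (bpow q ?\<Lambda> (Suc j - 1 - j)) ?\<Theta> i 1"
    using bmul_one_left[OF Suc.prems, of ?\<Lambda> ?\<Theta> 1] by simp
  finally show ?case by (simp add: \<eta>_def del: bpow.simps)
qed

text \<open>The \<open>h\<close>-independent factors of \<open>M(h)\<close> and \<open>M\<^sub>m(h)\<close>: they reconstruct the state from its first \<open>q\<close>
  blocks and from the derivatives of \<open>Y\<close>.\<close>

abbreviation selM :: "nat \<Rightarrow> nat \<Rightarrow> real^'k^'k" where
  "selM \<equiv> badd (matE q)
         (bsum (\<lambda>j. bmul q (bmul 1 (matEj (q + j)) (sfET q)) (bpow q (matLambda q C) j)) {1..p - q})"

abbreviation selMm :: "nat \<Rightarrow> nat \<Rightarrow> nat \<Rightarrow> real^'k^'k" where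
  "selMm m \<equiv> bsum (\<lambda>j. bmul q (bmul 1 (matEj (q + j)) (sfET q)) (bpow q (matLambda q C) (j - 1 - m))) {m + 1..p - q}"

text \<open>The factor in front of \<open>Z\<close> moves its q-th block row to row \<open>r\<close>
  and clears all other rows.\<close>

lemma bmul_matEj_sfET: "bmul q (bmul 1 (matEj r) (sfET q)) Z l i = (if l = r then Z q i else 0)"
proof -
  have "bmul q (bmul 1 (matEj r) (sfET q)) Z l i = (\<Sum>c=1..q. if c = q then (if l = r then Z q i else 0) else 0)"
    unfolding bmul_def by (intro sum.cong refl) (auto simp: matEj_def sfET_def zero_matrix_mult matrix_mult_zero)
  then show ?thesis using pq by simp
qed

text \<open>Rows up to q are copied. A row q + j0 is met by the single summand j = j0 of each
  selector, and what remains is the iterated relation at i = q, whose derivative terms stop at m <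
  j0.\<close>

lemma state_from_output:
  fixes f :: "nat \<Rightarrow> real^'k"
  assumes l: "l \<in> {1..p}"
  shows "f l = (\<Sum>i=1..q. selM l i *v f i)
     + (\<Sum>m=0..p - q - 1. bmul q (selMm m) (matTheta q C) l 1 *v (\<Sum>c=0..q. C c *v f (Suc (c + m))))"
proof -
  define \<eta> where "\<eta> m = (\<Sum>c=0..q. C c *v f (Suc (c + m)))" for m
  have M: "selM l i = (if l = i \<and> l \<le> q then mat 1 else 0) + (\<Sum>j=1..p - q. if l = q + j then bpow q (matLambda q C) j q i else 0)" for i
    by (simp add: badd_def bsum_def matE_def bmul_matEj_sfET del: One_nat_def)
  have Mm: "bmul q (selMm m) (matTheta q C) l 1 = (\<Sum>j=m + 1..p - q. if l = q + j then bmul q (bpow q (matLambda q C) (j - 1 - m)) (matTheta q C) q 1 else 0)" for m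
  proof -
    have "bmul q (selMm m) (matTheta q C) l 1
        = (\<Sum>i=1..q. \<Sum>j=m + 1..p - q. (if l = q + j then bpow q (matLambda q C) (j - 1 - m) q i else 0) ** matTheta q C i 1)"
      unfolding bmul_def[of q "selMm m"] by (simp only: bsum_def bmul_matEj_sfET matrix_mult_sum_left)
    also have "\<dots> = (\<Sum>j=m + 1..p - q. \<Sum>i=1..q. (if l = q + j then bpow q (matLambda q C) (j - 1 - m) q i else 0) ** matTheta q C i 1)"
      by (rule sum.swap)
    also have "\<dots> = (\<Sum>j=m + 1..p - q. if l = q + j then bmul q (bpow q (matLambda q C) (j - 1 - m)) (matTheta q C) q 1 else 0)"
      by (intro sum.cong refl) (auto simp: bmul_def zero_matrix_mult)
    finally show ?thesis .
  qed
  show ?thesis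
  proof (cases "l \<le> q")
    case True
    then have 1: "selM l i = (if i = l then mat 1 else 0)" for i unfolding M by auto
    have 2: "bmul q (selMm m) (matTheta q C) l 1 = 0" for m unfolding Mm using True by (intro sum.neutral) auto
    have "(\<Sum>i=1..q. selM l i *v f i) = (\<Sum>i=1..q. if i = l then f i else 0)"
      unfolding 1 by (intro sum.cong refl) auto
    then show ?thesis using True l by (simp only: 2) simp
  next
    case False
    define j0 where "j0 = l - q"
    have j0: "l = q + j0" "j0 \<in> {1..p - q}" using False l by (auto simp: j0_def)
    have q: "q \<in> {1..q}" using pq by auto
    have 1: "selM l i = bpow q (matLambda q C) j0 q i" for i
    proof -
      have "(\<Sum>j=1..p - q. if l = q + j then bpow q (matLambda q C) j q i else 0) = (\<Sum>j=1..p - q. if j = j0 then bpow q (matLambda q C) j q i else 0)"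
        by (intro sum.cong refl) (auto simp: j0)
      then show ?thesis unfolding M using False j0 by simp
    qed
    have 2: "bmul q (selMm m) (matTheta q C) l 1 = (if m < j0 then bmul q (bpow q (matLambda q C) (j0 - 1 - m)) (matTheta q C) q 1 else 0)" for m
    proof -
      have "bmul q (selMm m) (matTheta q C) l 1 = (\<Sum>j=m + 1..p - q. if j = j0 then bmul q (bpow q (matLambda q C) (j - 1 - m)) (matTheta q C) q 1 else 0)"
        unfolding Mm by (intro sum.cong refl) (auto simp: j0)
      then show ?thesis using j0 by auto
    qed
    have "(\<Sum>m=0..p - q - 1. bmul q (selMm m) (matTheta q C) l 1 *v \<eta> m)
        = (\<Sum>m<j0. bmul q (bpow q (matLambda q C) (j0 - 1 - m)) (matTheta q C) q 1 *v \<eta> m)"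
      unfolding 2 using j0 by (intro sum.mono_neutral_cong_right) auto
    then show ?thesis
      using matLambda_iterate[OF q, of f j0] unfolding 1 \<eta>_def[symmetric] j0(1)[symmetric] by simp
  qed
qed

text \<open>The blocks of \<open>\<C> \<A>\<close>.\<close>

definition rowA :: "nat \<Rightarrow> real^'k^'k" where
  "rowA l = (\<Sum>m=1..p. sfC p q C 1 m ** matA p A m l)"

text \<open>The reconstruction of the state is multiplied by the row \<open>rowA\<close>. Since A is
  the derivative of e^(Ah) at 0, the products with the selectors are exactly the derivatives at 0
  that occur in the theorem.\<close>

lemma rowA_expansion:
  fixes f :: "nat \<Rightarrow> real^'k"
  shows "(\<Sum>l=1..p. rowA l *v f l) = (\<Sum>i=1..q. bderiv0 (sfM p q A C) 1 i *v f i)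
     + (\<Sum>m=0..p - q - 1. deriv_coeff p q A C m *v (\<Sum>c=0..q. C c *v f (Suc (c + m))))"
proof -
  define \<eta> where "\<eta> m = (\<Sum>c=0..q. C c *v f (Suc (c + m)))" for m
  have M: "bderiv0 (sfM p q A C) 1 i = (\<Sum>l=1..p. rowA l ** selM l i)" for i
    unfolding sfM_def[abs_def] rowA_def by (rule bderiv0_bmul_bexp)
  have D: "bderiv0 (sfMm p q A C m) 1 i = (\<Sum>l=1..p. rowA l ** selMm m l i)" for m i
    unfolding sfMm_def[abs_def] rowA_def by (rule bderiv0_bmul_bexp)
  have Mm: "deriv_coeff p q A C m = (\<Sum>l=1..p. rowA l ** bmul q (selMm m) (matTheta q C) l 1)" for m
    unfolding deriv_coeff_def bmul_def[of q "bderiv0 _"] bmul_def[of q "selMm m"]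
    by (simp only: D matrix_mult_sum_left matrix_mult_sum_right matrix_mul_assoc) (rule sum.swap)
  have "(\<Sum>l=1..p. rowA l *v f l)
     = (\<Sum>l=1..p. rowA l *v ((\<Sum>i=1..q. selM l i *v f i) + (\<Sum>m=0..p - q - 1. bmul q (selMm m) (matTheta q C) l 1 *v \<eta> m)))"
    unfolding \<eta>_def by (intro sum.cong refl arg_cong[of _ _ "\<lambda>x. _ *v x"] state_from_output)
  also have "\<dots> = (\<Sum>l=1..p. \<Sum>i=1..q. (rowA l ** selM l i) *v f i) + (\<Sum>l=1..p. \<Sum>m=0..p - q - 1. (rowA l ** bmul q (selMm m) (matTheta q C) l 1) *v \<eta> m)"
    by (simp only: matrix_vector_right_distrib matrix_vector_sum_right matrix_vector_mul_assoc sum.distrib)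
  also have "(\<Sum>l=1..p. \<Sum>i=1..q. (rowA l ** selM l i) *v f i) = (\<Sum>i=1..q. bderiv0 (sfM p q A C) 1 i *v f i)"
    by (subst sum.swap) (simp only: M matrix_vector_sum_left)
  also have "(\<Sum>l=1..p. \<Sum>m=0..p - q - 1. (rowA l ** bmul q (selMm m) (matTheta q C) l 1) *v \<eta> m) = (\<Sum>m=0..p - q - 1. deriv_coeff p q A C m *v \<eta> m)"
    by (subst sum.swap) (simp only: Mm matrix_vector_sum_left)
  finally show ?thesis by (simp only: \<eta>_def)
qed

lemma kernel_coeff_eq: "kernel_coeff p q A C r = (\<Sum>i=1..q. bderiv0 (sfM p q A C) 1 i ** G i r)"
proof -
  have "kernel_coeff p q A C r = bmul q (bderiv0 (sfM p q A C)) (bmul q (bexpn q (matLambda q C) 0 r) (matTheta q C)) 1 1"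
    by (simp only: kernel_coeff_def bmul_assoc bexp_bscale)
  also have "\<dots> = (\<Sum>i=1..q. bderiv0 (sfM p q A C) 1 i ** G i r)"
    unfolding bmul_def[of q "bderiv0 _"]
  proof (intro sum.cong refl arg_cong[of _ _ "\<lambda>U. _ ** U"])
    fix i assume "i \<in> {1..q}"
    have "bmul q (bexpn q (matLambda q C) 0 r) (matTheta q C) i 1 = (\<Sum>l=1..q. if l = q then G i r else 0)"
      unfolding bmul_def G_def by (intro sum.cong refl) (auto simp: matTheta_def matrix_mult_zero)
    then show "bmul q (bexpn q (matLambda q C) 0 r) (matTheta q C) i 1 = G i r" using pq by simp
  qed
  finally show ?thesis .
qed

lemma weighted_process_kernel:
  "\<exists>K \<delta> B. weighted_process M (\<lambda>u. kernel_coeff p q A C (t - u) $ a $ v) (y 0 v) t K \<delta> B"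
proof (rule G_decay)
  fix K \<delta> assume \<delta>: "\<delta> > 0" "K \<ge> 0" and G: "\<And>i r b v. i \<in> {1..q} \<Longrightarrow> r \<ge> 0 \<Longrightarrow> \<bar>G i r $ b $ v\<bar> \<le> K * exp (- \<delta> * r)"
  define N where "N = (\<Sum>i=1..q. \<Sum>b\<in>UNIV. \<bar>bderiv0 (sfM p q A C) 1 i $ a $ b\<bar>)"
  have eq: "kernel_coeff p q A C r $ a $ v = (\<Sum>i=1..q. \<Sum>b\<in>UNIV. bderiv0 (sfM p q A C) 1 i $ a $ b * G i r $ b $ v)" for r
    by (simp add: kernel_coeff_eq matrix_matrix_mult_def)
  have "\<exists>B. weighted_process M (\<lambda>u. kernel_coeff p q A C (t - u) $ a $ v) (y 0 v) t (N * K) \<delta> B"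
  proof (rule weighted_process_y)
    show "isCont (\<lambda>u. kernel_coeff p q A C (t - u) $ a $ v) u" for u
      unfolding eq by (intro isCont_sum ballI continuous_mult continuous_const isCont_G)
    show "\<bar>kernel_coeff p q A C (t - u) $ a $ v\<bar> \<le> N * K * exp (- \<delta> * (t - u))" if "u \<le> t" for u
    proof -
      have "\<bar>kernel_coeff p q A C (t - u) $ a $ v\<bar> \<le> (\<Sum>i=1..q. \<Sum>b\<in>UNIV. \<bar>bderiv0 (sfM p q A C) 1 i $ a $ b * G i (t - u) $ b $ v\<bar>)"
        unfolding eq by (intro order.trans[OF sum_abs] sum_mono sum_abs)
      also have "\<dots> \<le> (\<Sum>i=1..q. \<Sum>b\<in>UNIV. \<bar>bderiv0 (sfM p q A C) 1 i $ a $ b\<bar> * (K * exp (- \<delta> * (t - u))))"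
        unfolding abs_mult using that by (intro sum_mono mult_left_mono G) auto
      also have "\<dots> = N * K * exp (- \<delta> * (t - u))"
        by (simp add: N_def sum_distrib_right mult.assoc)
      finally show ?thesis .
    qed
  qed (rule \<delta>(1))
  then show ?thesis by blast
qed

definition kernel_int :: "'k \<Rightarrow> 'k \<Rightarrow> real \<Rightarrow> 'w \<Rightarrow> real" where
  "kernel_int a v t \<omega> = (LINT u:{..t}|lborel. kernel_coeff p q A C (t - u) $ a $ v * y 0 v u \<omega>)"

lemma past_integral_kernel:
  shows "past_integral M (\<lambda>u \<omega>. complex_of_real (kernel_coeff p q A C (t - u) $ a $ v) * component Y v u \<omega>) t \<in> L2 M"
    and "AE \<omega> in M. past_integral M (\<lambda>u \<omega>. complex_of_real (kernel_coeff p q A C (t - u) $ a $ v) * component Y v u \<omega>) t \<omega>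
      = complex_of_real (kernel_int a v t \<omega>)"
proof -
  obtain K \<delta> B where wp: "weighted_process M (\<lambda>u. kernel_coeff p q A C (t - u) $ a $ v) (y 0 v) t K \<delta> B"
    using weighted_process_kernel by blast
  note has = weighted_process.has_past_integral_complex[OF wp]
  show "past_integral M (\<lambda>u \<omega>. complex_of_real (kernel_coeff p q A C (t - u) $ a $ v) * component Y v u \<omega>) t \<in> L2 M"
    unfolding component_Y by (rule past_integral_AE_eq(1)[OF has])
  show "AE \<omega> in M. past_integral M (\<lambda>u \<omega>. complex_of_real (kernel_coeff p q A C (t - u) $ a $ v) * component Y v u \<omega>) t \<omega>
      = complex_of_real (kernel_int a v t \<omega>)"
    unfolding component_Y kernel_int_def by (rule past_integral_AE_eq(2)[OF has])
qed

lemma kernel_int_in_past_space: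
  assumes "v \<in> S"
  shows "(\<lambda>\<omega>. complex_of_real (kernel_int a v t \<omega>)) \<in> past_space M Y S t"
proof -
  obtain K \<delta> B where wp: "weighted_process M (\<lambda>u. kernel_coeff p q A C (t - u) $ a $ v) (y 0 v) t K \<delta> B"
    using weighted_process_kernel by blast
  show ?thesis
    unfolding kernel_int_def
  proof (rule weighted_process_past_in_subspace[OF wp closed_subspace_past_space])
    show "(\<lambda>\<omega>. complex_of_real (y 0 v u \<omega>)) \<in> past_space M Y S t" if "u \<le> t" for u
      using y_in_past_space[of 0 v S u] past_space_mono[OF that order.refl, of M Y S] assms by auto
  qed
qed

lemma G_weighted_process:
  assumes i: "i \<in> {1..q}"
  shows "\<exists>K \<delta> B. weighted_process M (\<lambda>u. G i (t - u) $ b $ v) (y 0 v) t K \<delta> B"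
proof (rule G_decay)
  fix K \<delta> assume \<delta>: "\<delta> > 0" and G: "\<And>i r b v. i \<in> {1..q} \<Longrightarrow> r \<ge> 0 \<Longrightarrow> \<bar>G i r $ b $ v\<bar> \<le> K * exp (- \<delta> * r)"
  have "\<exists>B. weighted_process M (\<lambda>u. G i (t - u) $ b $ v) (y 0 v) t K \<delta> B"
    by (intro weighted_process_y isCont_G i G \<delta>) auto
  then show ?thesis by blast
qed

text \<open>The kernel of the theorem is a finite combination of the entries of
  e^(\<Lambda>r)\<Theta>. Exchanging the finite sums with the time integral requires each summand to
  be integrable along the path, which is the second almost sure event used.\<close>

lemma kernel_int_sum:
  "AE \<omega> in M. (\<Sum>i=1..q. bderiv0 (sfM p q A C) 1 i *v X t i \<omega>) $ a = (\<Sum>v\<in>UNIV. kernel_int a v t \<omega>)"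
proof -
  have 1: "AE \<omega> in M. \<forall>i\<in>{1..q}. \<forall>b\<in>UNIV. X t i \<omega> $ b = (\<Sum>v\<in>UNIV. LINT u:{..t}|lborel. G i (t - u) $ b $ v * y 0 v u \<omega>)"
    by (intro AE_finite_allI X_eq_integral) auto
  have "AE \<omega> in M. set_integrable lborel {..t} (\<lambda>u. G i (t - u) $ b $ v * y 0 v u \<omega>)" if i: "i \<in> {1..q}" for i b v
  proof -
    obtain K \<delta> B where "weighted_process M (\<lambda>u. G i (t - u) $ b $ v) (y 0 v) t K \<delta> B"
      using G_weighted_process[OF i] by blast
    then show ?thesis by (rule weighted_process.AE_integrable)
  qed
  then have 2: "AE \<omega> in M. \<forall>i\<in>{1..q}. \<forall>b\<in>UNIV. \<forall>v\<in>UNIV. set_integrable lborel {..t} (\<lambda>u. G i (t - u) $ b $ v * y 0 v u \<omega>)"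
    by (intro AE_finite_allI) auto
  show ?thesis
    using 1 2
  proof eventually_elim
    case (elim \<omega>)
    define J where "J i b v = (LINT u:{..t}|lborel. G i (t - u) $ b $ v * y 0 v u \<omega>)" for i b v
    have K: "kernel_int a v t \<omega> = (\<Sum>i=1..q. \<Sum>b\<in>UNIV. bderiv0 (sfM p q A C) 1 i $ a $ b * J i b v)" for v
    proof -
      have "kernel_int a v t \<omega> = (LINT u|lborel. (\<Sum>i=1..q. \<Sum>b\<in>UNIV. bderiv0 (sfM p q A C) 1 i $ a $ b *\<^sub>R (indicator {..t} u *\<^sub>R (G i (t - u) $ b $ v * y 0 v u \<omega>))))"
        unfolding kernel_int_def set_lebesgue_integral_def
        by (intro Bochner_Integration.integral_cong refl)
          (simp only: kernel_coeff_eq matrix_matrix_mult_def sum_component vec_lambda_beta sum_distrib_left sum_distrib_right real_scaleR_def mult_ac)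
      also have "\<dots> = (\<Sum>i=1..q. \<Sum>b\<in>UNIV. bderiv0 (sfM p q A C) 1 i $ a $ b *\<^sub>R J i b v)"
        using elim(2) unfolding J_def set_lebesgue_integral_def set_integrable_def
        by (subst Bochner_Integration.integral_sum Bochner_Integration.integral_scaleR_right; intro Bochner_Integration.integrable_sum integrable_scaleR_right sum.cong refl; simp)+
      finally show ?thesis by simp
    qed
    have "(\<Sum>i=1..q. bderiv0 (sfM p q A C) 1 i *v X t i \<omega>) $ a = (\<Sum>i=1..q. \<Sum>b\<in>UNIV. bderiv0 (sfM p q A C) 1 i $ a $ b * (\<Sum>v\<in>UNIV. J i b v))"
      using elim(1) by (simp add: matrix_vector_mult_def J_def)
    also have "\<dots> = (\<Sum>i=1..q. \<Sum>v\<in>UNIV. \<Sum>b\<in>UNIV. bderiv0 (sfM p q A C) 1 i $ a $ b * J i b v)"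
      by (rule sum.cong[OF refl]) (simp only: sum_distrib_left, rule sum.swap)
    also have "\<dots> = (\<Sum>v\<in>UNIV. \<Sum>i=1..q. \<Sum>b\<in>UNIV. bderiv0 (sfM p q A C) 1 i $ a $ b * J i b v)"
      by (rule sum.swap)
    finally show ?case by (simp only: K)
  qed
qed

lemma y_vec: "(\<chi> v. y m v t \<omega>) = (\<Sum>c=0..q. C c *v X t (Suc (c + m)) \<omega>)"
  by (simp add: vec_eq_iff y_def matrix_vector_mult_def)

lemma rowA_X_expansion:
  "AE \<omega> in M. (\<Sum>l=1..p. rowA l *v X t l \<omega>) $ a
     = (\<Sum>v\<in>UNIV. kernel_int a v t \<omega>) + (\<Sum>v\<in>UNIV. \<Sum>m=0..p - q - 1. deriv_coeff p q A C m $ a $ v * y m v t \<omega>)"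
  using kernel_int_sum[of t a]
proof eventually_elim
  case (elim \<omega>)
  have "(\<Sum>m=0..p - q - 1. deriv_coeff p q A C m *v (\<chi> v. y m v t \<omega>)) $ a
      = (\<Sum>v\<in>UNIV. \<Sum>m=0..p - q - 1. deriv_coeff p q A C m $ a $ v * y m v t \<omega>)"
    by (simp add: matrix_vector_mult_def) (rule sum.swap)
  then show ?case
    using rowA_expansion[of "\<lambda>l. X t l \<omega>"] elim by (simp only: y_vec vector_add_component)
qed

lemma X_in_past_space_low:
  assumes i: "i \<in> {1..q}"
  shows "(\<lambda>\<omega>. complex_of_real (X t i \<omega> $ b)) \<in> past_space M Y UNIV t"
proof -
  note sub = closed_subspace_past_space[of M Y UNIV t]
  have "(\<lambda>\<omega>. complex_of_real (LINT u:{..t}|lborel. G i (t - u) $ b $ v * y 0 v u \<omega>)) \<in> past_space M Y UNIV t" for v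
  proof -
    obtain K \<delta> B where wp: "weighted_process M (\<lambda>u. G i (t - u) $ b $ v) (y 0 v) t K \<delta> B"
      using G_weighted_process[OF i] by blast
    show ?thesis
    proof (rule weighted_process_past_in_subspace[OF wp sub])
      show "(\<lambda>\<omega>. complex_of_real (y 0 v u \<omega>)) \<in> past_space M Y UNIV t" if "u \<le> t" for u
        using y_in_past_space[of 0 v UNIV u] past_space_mono[OF that order.refl, of M Y UNIV] by auto
    qed
  qed
  then have "(\<lambda>\<omega>. \<Sum>v\<in>UNIV. complex_of_real (LINT u:{..t}|lborel. G i (t - u) $ b $ v * y 0 v u \<omega>)) \<in> past_space M Y UNIV t"
    by (rule closed_subspace_sum[OF sub])
  then show ?thesis
  proof (rule closed_subspace_cong_AE[OF sub])
    show "(\<lambda>\<omega>. complex_of_real (X t i \<omega> $ b)) \<in> borel_measurable M"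
      using i pq by (intro L2_measurable[OF L2_of_real[OF X_nth_L2]]) auto
    show "AE \<omega> in M. (\<Sum>v\<in>UNIV. complex_of_real (LINT u:{..t}|lborel. G i (t - u) $ b $ v * y 0 v u \<omega>)) = complex_of_real (X t i \<omega> $ b)"
      using X_eq_integral[OF i, of t b] by eventually_elim simp
  qed
qed

text \<open>All blocks are combinations of the first q, which are past integrals of Y, and of left
  derivatives of Y.\<close>

lemma X_in_past_space:
  assumes l: "l \<in> {1..p}"
  shows "(\<lambda>\<omega>. complex_of_real (X t l \<omega> $ b)) \<in> past_space M Y UNIV t"
proof -
  note sub = closed_subspace_past_space[of M Y UNIV t]
  have "X t l \<omega> $ b = (\<Sum>i=1..q. \<Sum>c\<in>UNIV. selM l i $ b $ c * X t i \<omega> $ c)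
      + (\<Sum>m=0..p - q - 1. \<Sum>v\<in>UNIV. bmul q (selMm m) (matTheta q C) l 1 $ b $ v * y m v t \<omega>)" for \<omega>
  proof -
    have "X t l \<omega> $ b = ((\<Sum>i=1..q. selM l i *v X t i \<omega>) + (\<Sum>m=0..p - q - 1. bmul q (selMm m) (matTheta q C) l 1 *v (\<chi> v. y m v t \<omega>))) $ b"
      unfolding y_vec using state_from_output[OF l, of "\<lambda>l. X t l \<omega>"] by (rule arg_cong)
    then show ?thesis by (simp only: vector_add_component sum_component matrix_vector_mult_def vec_lambda_beta)
  qed
  then have "(\<lambda>\<omega>. complex_of_real (X t l \<omega> $ b)) = (\<lambda>\<omega>. (\<Sum>i=1..q. \<Sum>c\<in>UNIV. complex_of_real (selM l i $ b $ c) * complex_of_real (X t i \<omega> $ c))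
      + (\<Sum>m=0..p - q - 1. \<Sum>v\<in>UNIV. complex_of_real (bmul q (selMm m) (matTheta q C) l 1 $ b $ v) * complex_of_real (y m v t \<omega>)))"
    by (simp only: of_real_add of_real_sum of_real_mult)
  also have "\<dots> \<in> past_space M Y UNIV t"
    by (intro closed_subspace_add[OF sub] closed_subspace_sum[OF sub] closed_subspace_mult[OF sub] X_in_past_space_low y_in_past_space) auto
  finally show ?thesis .
qed

text \<open>The blocks of \<open>\<C> e\<^bsup>\<A> h\<^esup>\<close>.\<close>

definition rowE :: "real \<Rightarrow> nat \<Rightarrow> real^'k^'k" where
  "rowE h l = (\<Sum>j=1..p. sfC p q C 1 j ** EA h j l)"

lemma y_top: "(\<chi> v. y (p - q - 1) v t \<omega>) = (\<Sum>j=1..p. sfC p q C 1 j *v X t j \<omega>)"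
proof -
  have "(\<Sum>j=1..p. sfC p q C 1 j *v X t j \<omega>) = (\<Sum>j\<in>{p - q..p}. C (j - (p - q)) *v X t j \<omega>)"
    using pq by (intro sum.mono_neutral_cong_right) (auto simp: sfC_def)
  also have "\<dots> = (\<Sum>c=0..q. C c *v X t (Suc (c + (p - q - 1))) \<omega>)"
    using pq by (intro sum.reindex_bij_witness[of _ "\<lambda>c. c + (p - q)" "\<lambda>j. j - (p - q)"]) auto
  finally show ?thesis by (simp add: y_vec)
qed

lemma eta_eq_noise: "eta M L p q A C t h \<omega> = (\<Sum>j=1..p. sfC p q C 1 j *v noise j t h \<omega>)"
  by (simp add: eta_def noise_def)

lemma eta_nth: "eta M L p q A C t h \<omega> $ a = (\<Sum>j=1..p. \<Sum>b\<in>UNIV. sfC p q C 1 j $ a $ b * noise j t h \<omega> $ b)"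
  by (simp add: eta_eq_noise matrix_vector_mult_def)

lemma eta_L2: "h \<ge> 0 \<Longrightarrow> (\<lambda>\<omega>. eta M L p q A C t h \<omega> $ a) \<in> L2 M"
  unfolding eta_nth by (intro L2_sum L2_mult_left noise_L2)

lemma y_top_transition:
  assumes h: "h \<ge> 0"
  shows "AE \<omega> in M. y (p - q - 1) a (t + h) \<omega> = (\<Sum>l=1..p. \<Sum>b\<in>UNIV. rowE h l $ a $ b * X t l \<omega> $ b) + eta M L p q A C t h \<omega> $ a"
proof -
  have "AE \<omega> in M. \<forall>j\<in>{1..p}. \<forall>b\<in>UNIV. X (t + h) j \<omega> $ b = (\<Sum>l=1..p. \<Sum>a\<in>UNIV. EA h j l $ b $ a * X t l \<omega> $ a) + noise j t h \<omega> $ b"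
    using h by (intro AE_finite_allI state_transition) auto
  then show ?thesis
  proof eventually_elim
    case (elim \<omega>)
    then have X: "X (t + h) j \<omega> = (\<Sum>l=1..p. EA h j l *v X t l \<omega>) + noise j t h \<omega>" if "j \<in> {1..p}" for j
      using that by (simp add: vec_eq_iff matrix_vector_mult_def)
    have "(\<Sum>j=1..p. sfC p q C 1 j *v X (t + h) j \<omega>) = (\<Sum>j=1..p. sfC p q C 1 j *v ((\<Sum>l=1..p. EA h j l *v X t l \<omega>) + noise j t h \<omega>))"
      by (intro sum.cong refl) (simp only: X)
    also have "\<dots> = (\<Sum>j=1..p. \<Sum>l=1..p. (sfC p q C 1 j ** EA h j l) *v X t l \<omega>) + eta M L p q A C t h \<omega>"
      by (simp only: eta_eq_noise matrix_vector_right_distrib matrix_vector_sum_right matrix_vector_mul_assoc sum.distrib)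
    also have "(\<Sum>j=1..p. \<Sum>l=1..p. (sfC p q C 1 j ** EA h j l) *v X t l \<omega>) = (\<Sum>l=1..p. rowE h l *v X t l \<omega>)"
      by (subst sum.swap) (simp only: rowE_def matrix_vector_sum_left)
    finally have "(\<chi> v. y (p - q - 1) v (t + h) \<omega>) $ a = ((\<Sum>l=1..p. rowE h l *v X t l \<omega>) + eta M L p q A C t h \<omega>) $ a"
      by (simp only: y_top)
    then show ?case by (simp add: matrix_vector_mult_def)
  qed
qed

lemma eta_orthogonal:
  assumes h: "h \<ge> 0" and U: "U \<in> past_space M Y UNIV t"
  shows "l2inner M U (\<lambda>\<omega>. complex_of_real (eta M L p q A C t h \<omega> $ a)) = 0"
proof (rule l2inner_past_space_zero[OF eta_L2[OF h] _ _ U])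
  fix v r assume r: "r \<le> t"
  have Yv: "(\<lambda>\<omega>. Y r \<omega> $ v) = y 0 v r" by (simp add: fun_eq_iff Y_nth)
  show "(\<lambda>\<omega>. Y r \<omega> $ v) \<in> L2 M" unfolding Yv by (rule y_L2) simp
  have noise: "l2inner M (\<lambda>\<omega>. noise j t h \<omega> $ b) (y 0 v r) = 0" if j: "j \<in> {1..p}" for j b
  proof -
    have "l2inner M (y 0 v r) (\<lambda>\<omega>. noise j t h \<omega> $ b) = (\<Sum>i=0..q. C i *v (\<chi> a. l2inner M (\<lambda>\<omega>. X r (Suc i) \<omega> $ a) (\<lambda>\<omega>. noise j t h \<omega> $ b))) $ v"
      by (rule l2inner_y[OF noise_L2[OF j h]])
    also have "\<dots> = 0"
    proof -
      have "(\<chi> a. l2inner M (\<lambda>\<omega>. X r (Suc i) \<omega> $ a) (\<lambda>\<omega>. noise j t h \<omega> $ b)) = 0" if "i \<in> {0..q}" for i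
        using that pq by (simp add: vec_eq_iff noise_orthogonal_X[OF j _ h r])
      then show ?thesis by simp
    qed
    finally show ?thesis by (simp only: l2inner_commute)
  qed
  have "l2inner M (\<lambda>\<omega>. eta M L p q A C t h \<omega> $ a) (y 0 v r)
      = (\<Sum>j=1..p. l2inner M (\<lambda>\<omega>. \<Sum>b\<in>UNIV. sfC p q C 1 j $ a $ b *\<^sub>R noise j t h \<omega> $ b) (y 0 v r))"
    unfolding eta_nth using h by (subst l2inner_sum_left) (auto intro!: L2_sum L2_mult_left noise_L2 y_L2)
  also have "\<dots> = (\<Sum>j=1..p. \<Sum>b\<in>UNIV. sfC p q C 1 j $ a $ b * l2inner M (\<lambda>\<omega>. noise j t h \<omega> $ b) (y 0 v r))"
    using h by (intro sum.cong refl) (simp only: l2inner_sum_left[OF L2_scaleR[OF noise_L2] y_L2] l2inner_scaleR_left le0)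
  also have "\<dots> = 0" by (intro sum.neutral ballI) (simp only: noise mult_zero_right)
  finally show "l2inner M (\<lambda>\<omega>. Y r \<omega> $ v) (\<lambda>\<omega>. eta M L p q A C t h \<omega> $ a) = 0"
    unfolding Yv by (simp only: l2inner_commute)
qed

lemma rowE_zero: "(\<Sum>l=1..p. \<Sum>b\<in>UNIV. rowE 0 l $ a $ b * X t l \<omega> $ b) = y (p - q - 1) a t \<omega>"
proof -
  have rowE: "rowE 0 l = sfC p q C 1 l" if "l \<in> {1..p}" for l
  proof -
    have "rowE 0 l = (\<Sum>j=1..p. if j = l then sfC p q C 1 l else 0)"
      unfolding rowE_def by (intro sum.cong refl) (auto simp: bexpn_zero matrix_mult_zero)
    then show ?thesis using that by simp
  qed
  have "y (p - q - 1) a t \<omega> = (\<Sum>l=1..p. sfC p q C 1 l *v X t l \<omega>) $ a"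
    unfolding y_top[symmetric] by simp
  also have "\<dots> = (\<Sum>l=1..p. (rowE 0 l *v X t l \<omega>) $ a)"
    by (simp add: rowE del: One_nat_def)
  finally show ?thesis by (simp add: matrix_vector_mult_def)
qed

lemma rowE_has_vector_derivative:
  assumes "l \<in> {1..p}"
  shows "((\<lambda>h. rowE h l) has_vector_derivative rowA l) (at 0)"
  unfolding rowE_def rowA_def
proof (intro has_vector_derivative_sum
    bounded_linear.has_vector_derivative[OF bounded_bilinear.bounded_linear_right[OF bounded_bilinear_matrix_mult]])
  fix j assume j: "j \<in> {1..p}"
  show "((\<lambda>h. EA h j l) has_vector_derivative matA p A j l) (at 0)"
    using has_vector_derivative_bexpn[OF j assms, of "matA p A" 0 0 UNIV] bpow_one[OF j assms, of "matA p A"]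
    by (simp add: bexpn_zero del: bpow.simps)
qed

section \<open>The projected difference quotient and the prediction error\<close>

abbreviation msD_quotient :: "'k \<Rightarrow> real \<Rightarrow> real \<Rightarrow> 'w \<Rightarrow> complex" where
  "msD_quotient a t h \<equiv> \<lambda>\<omega>. (msD M (p - q - 1) (component Y a) (t + h) \<omega>
      - msD M (p - q - 1) (component Y a) t \<omega>) / complex_of_real h"

text \<open>The \<open>a\<close>-th component of the row (0, ..., 0, C_0, ..., C_q) times A X(t):
  the slope of the part of the increment that is determined by the state at time
  \<open>t\<close>.\<close>

definition drift :: "'k \<Rightarrow> real \<Rightarrow> 'w \<Rightarrow> real" where
  "drift a t \<omega> = (\<Sum>l=1..p. \<Sum>b\<in>UNIV. rowA l $ a $ b * X t l \<omega> $ b)"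

lemma drift_L2: "drift a t \<in> L2 M"
  unfolding drift_def[abs_def] by (rule X_lincomb_L2)

lemma msD_quotient_L2: "msD_quotient a t h \<in> L2 M"
proof -
  have "(\<lambda>\<omega>. (1 / complex_of_real h) * (msD M (p - q - 1) (component Y a) (t + h) \<omega> - msD M (p - q - 1) (component Y a) t \<omega>)) \<in> L2 M"
    by (intro L2_mult_left L2_diff msD_component_L2) auto
  then show ?thesis by simp
qed

lemma msD_quotient_eq:
  assumes h: "h > 0"
  shows "AE \<omega> in M. msD_quotient a t h \<omega> = complex_of_real (drift a t \<omega>)
    + complex_of_real (\<Sum>l=1..p. \<Sum>b\<in>UNIV. ((rowE h l - rowE 0 l) /\<^sub>R h - rowA l) $ a $ b * X t l \<omega> $ b)
    + complex_of_real ((1 / h) * eta M L p q A C t h \<omega> $ a)"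
proof -
  have "AE \<omega> in M. msD M (p - q - 1) (component Y a) (t + h) \<omega> = complex_of_real (y (p - q - 1) a (t + h) \<omega>)"
    "AE \<omega> in M. msD M (p - q - 1) (component Y a) t \<omega> = complex_of_real (y (p - q - 1) a t \<omega>)"
    using msD_component[of "p - q - 1" a] by auto
  then show ?thesis
    using y_top_transition[of h a t, OF less_imp_le[OF h]]
  proof eventually_elim
    case (elim \<omega>)
    have "drift a t \<omega> + (\<Sum>l=1..p. \<Sum>b\<in>UNIV. ((rowE h l - rowE 0 l) /\<^sub>R h - rowA l) $ a $ b * X t l \<omega> $ b)
        = (\<Sum>l=1..p. \<Sum>b\<in>UNIV. (1 / h) * (rowE h l $ a $ b * X t l \<omega> $ b) - (1 / h) * (rowE 0 l $ a $ b * X t l \<omega> $ b))"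
      unfolding drift_def sum.distrib[symmetric]
      by (intro sum.cong refl) (simp add: algebra_simps divide_inverse)
    also have "\<dots> = (1 / h) * (\<Sum>l=1..p. \<Sum>b\<in>UNIV. rowE h l $ a $ b * X t l \<omega> $ b) - (1 / h) * y (p - q - 1) a t \<omega>"
      by (simp only: sum_subtractf sum_distrib_left[symmetric] rowE_zero)
    finally have "drift a t \<omega> + (\<Sum>l=1..p. \<Sum>b\<in>UNIV. ((rowE h l - rowE 0 l) /\<^sub>R h - rowA l) $ a $ b * X t l \<omega> $ b)
        + (1 / h) * eta M L p q A C t h \<omega> $ a = (y (p - q - 1) a (t + h) \<omega> - y (p - q - 1) a t \<omega>) / h"
      unfolding elim(3) by (simp add: diff_divide_distrib add_divide_distrib)
    then show ?case
      unfolding elim(1,2) of_real_add[symmetric] by (simp only: of_real_diff of_real_divide)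
  qed
qed

text \<open>The quotient and the drift are compared through inner products with the past only. There
  the noise divided by h contributes nothing, so the contraction bound involves just the remainder
  of the differentiation of \<open>rowE\<close> at 0, which tends to 0.\<close>

lemma orth_proj_msD_quotient_limit:
  "ms_lim M (at_right 0) (\<lambda>h. orth_proj M (past_space M Y S t) (msD_quotient a t h))
     (orth_proj M (past_space M Y S t) (\<lambda>\<omega>. complex_of_real (drift a t \<omega>)))"
proof -
  note sub = closed_subspace_past_space[of M Y S t]
  have L2d: "(\<lambda>\<omega>. complex_of_real (drift a t \<omega>)) \<in> L2 M" by (rule L2_of_real[OF drift_L2])
  define w where "w h \<omega> = (\<Sum>l=1..p. \<Sum>b\<in>UNIV. ((rowE h l - rowE 0 l) /\<^sub>R h - rowA l) $ a $ b * X t l \<omega> $ b)" for h \<omega>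
  have w_L2: "w h \<in> L2 M" for h unfolding w_def[abs_def] by (rule X_lincomb_L2)
  obtain B where B: "B \<ge> 0" "\<And>j t b. j \<in> {1..p} \<Longrightarrow> l2norm M (\<lambda>\<omega>. X t j \<omega> $ b) \<le> B"
    using X_bound by blast
  have bound: "l2norm M (\<lambda>\<omega>. orth_proj M (past_space M Y S t) (msD_quotient a t h) \<omega>
      - orth_proj M (past_space M Y S t) (\<lambda>\<omega>. complex_of_real (drift a t \<omega>)) \<omega>)
      \<le> real CARD('k) * B * (\<Sum>l=1..p. norm ((rowE h l - rowE 0 l) /\<^sub>R h - rowA l))" if h: "h > 0" for h
  proof -
    have wC: "(\<lambda>\<omega>. complex_of_real (w h \<omega>)) \<in> L2 M" by (rule L2_of_real[OF w_L2])
    have eC: "(\<lambda>\<omega>. complex_of_real ((1 / h) * eta M L p q A C t h \<omega> $ a)) \<in> L2 M"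
      using h by (intro L2_of_real L2_mult_left eta_L2) auto
    have "l2norm M (\<lambda>\<omega>. orth_proj M (past_space M Y S t) (msD_quotient a t h) \<omega>
        - orth_proj M (past_space M Y S t) (\<lambda>\<omega>. complex_of_real (drift a t \<omega>)) \<omega>) \<le> l2norm M (\<lambda>\<omega>. complex_of_real (w h \<omega>))"
    proof (rule orth_proj_contraction[OF sub msD_quotient_L2 L2d wC])
      fix U assume U: "U \<in> past_space M Y S t"
      then have UL: "U \<in> L2 M" by (rule closed_subspace_L2[OF sub])
      \<comment> \<open>The noise is orthogonal to the past of all components, which contains the
        past of those in \<open>S\<close>.\<close>
      have "U \<in> past_space M Y UNIV t" using U past_space_mono[of t t S UNIV M Y] by auto
      then have "l2inner M U (\<lambda>\<omega>. complex_of_real (eta M L p q A C t h \<omega> $ a)) = 0"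
        using h by (intro eta_orthogonal) auto
      then have e0: "l2inner M (\<lambda>\<omega>. complex_of_real ((1 / h) * eta M L p q A C t h \<omega> $ a)) U = 0"
        using l2inner_scaleR_left[of M "1 / h" "\<lambda>\<omega>. complex_of_real (eta M L p q A C t h \<omega> $ a)" U]
          l2inner_commute[of M U "\<lambda>\<omega>. complex_of_real (eta M L p q A C t h \<omega> $ a)"]
        by (simp add: scaleR_conv_of_real)
      have "l2inner M (\<lambda>\<omega>. msD_quotient a t h \<omega> - complex_of_real (drift a t \<omega>)) U
          = l2inner M (\<lambda>\<omega>. complex_of_real (w h \<omega>) + complex_of_real ((1 / h) * eta M L p q A C t h \<omega> $ a)) U"
      proof (rule l2inner_cong_AE)
        show "AE \<omega> in M. msD_quotient a t h \<omega> - complex_of_real (drift a t \<omega>)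
            = complex_of_real (w h \<omega>) + complex_of_real ((1 / h) * eta M L p q A C t h \<omega> $ a)"
          using msD_quotient_eq[OF h, of a t] by eventually_elim (simp only: w_def add.assoc add_diff_cancel_left')
      qed (intro L2_measurable L2_diff[OF msD_quotient_L2 L2d] L2_add[OF wC eC] UL)+
      then show "l2inner M (\<lambda>\<omega>. msD_quotient a t h \<omega> - complex_of_real (drift a t \<omega>)) U = l2inner M (\<lambda>\<omega>. complex_of_real (w h \<omega>)) U"
        using l2inner_add_left[OF wC eC UL] e0 by simp
    qed
    also have "\<dots> \<le> real CARD('k) * B * (\<Sum>l=1..p. norm ((rowE h l - rowE 0 l) /\<^sub>R h - rowA l))"
      unfolding l2norm_of_real w_def[abs_def] by (rule X_lincomb_bound[OF B(2,1)])
    finally show ?thesis .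
  qed
  have "((\<lambda>h. real CARD('k) * B * (\<Sum>l=1..p. norm ((rowE h l - rowE 0 l) /\<^sub>R h - rowA l))) \<longlongrightarrow> real CARD('k) * B * (\<Sum>l=1..p. 0)) (at_right 0)"
    by (intro tendsto_intros has_vector_derivative_quotient_limit rowE_has_vector_derivative)
  then have lim: "((\<lambda>h. real CARD('k) * B * (\<Sum>l=1..p. norm ((rowE h l - rowE 0 l) /\<^sub>R h - rowA l))) \<longlongrightarrow> 0) (at_right 0)"
    by simp
  have "((\<lambda>h. l2norm M (\<lambda>\<omega>. orth_proj M (past_space M Y S t) (msD_quotient a t h) \<omega>
      - orth_proj M (past_space M Y S t) (\<lambda>\<omega>. complex_of_real (drift a t \<omega>)) \<omega>)) \<longlongrightarrow> 0) (at_right 0)"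
    by (rule tendsto_sandwich[OF always_eventually eventually_mono[OF eventually_at_right_less bound] tendsto_const lim]) simp
  then show ?thesis
    unfolding ms_lim_iff_l2norm
    by (intro conjI always_eventually allI closed_subspace_L2[OF sub] orth_proj_in[OF sub] msD_quotient_L2 L2d)
qed

abbreviation kernel_integral :: "'k \<Rightarrow> 'k \<Rightarrow> real \<Rightarrow> 'w \<Rightarrow> complex" where
  "kernel_integral a v t \<equiv> past_integral M (\<lambda>u \<omega>. complex_of_real (kernel_coeff p q A C (t - u) $ a $ v) * component Y v u \<omega>) t"

text \<open>\<open>orth_proj\<close> is a choice, hence additive at most up to null sets. The
  right-hand side is therefore treated as one candidate: it lies in the past space and has the inner
  products of the drift, so uniqueness of projections applies.\<close>

lemma orth_proj_drift:
  "AE \<omega> in M. orth_proj M (past_space M Y S t) (\<lambda>\<omega>. complex_of_real (drift a t \<omega>)) \<omega>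
     = (\<Sum>v\<in>S. kernel_integral a v t \<omega>)
     + (\<Sum>v\<in>S. \<Sum>m=0..p - q - 1. complex_of_real (deriv_coeff p q A C m $ a $ v) * msD M m (component Y v) t \<omega>)
     + orth_proj M (past_space M Y S t) (\<lambda>\<omega>. \<Sum>v\<in>UNIV - S. kernel_integral a v t \<omega>) \<omega>
     + orth_proj M (past_space M Y S t)
         (\<lambda>\<omega>. \<Sum>v\<in>UNIV - S. \<Sum>m=0..p - q - 1. complex_of_real (deriv_coeff p q A C m $ a $ v) * msD M m (component Y v) t \<omega>) \<omega>"
proof -
  note sub = closed_subspace_past_space[of M Y S t]
  define K where "K T \<omega> = (\<Sum>v\<in>T. kernel_integral a v t \<omega>)" for T \<omega>
  define D where "D T \<omega> = (\<Sum>v\<in>T. \<Sum>m=0..p - q - 1. complex_of_real (deriv_coeff p q A C m $ a $ v) * msD M m (component Y v) t \<omega>)" for T \<omega>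
  have K_L2: "K T \<in> L2 M" for T
    unfolding K_def[abs_def] by (intro L2_sum past_integral_kernel(1))
  have D_L2: "D T \<in> L2 M" for T
    unfolding D_def[abs_def] by (intro L2_sum L2_mult_left msD_component_L2) auto
  have K_in: "K S \<in> past_space M Y S t"
    unfolding K_def[abs_def]
  proof (rule closed_subspace_sum[OF sub])
    fix v assume v: "v \<in> S"
    have "AE \<omega> in M. complex_of_real (kernel_int a v t \<omega>) = kernel_integral a v t \<omega>"
      using past_integral_kernel(2)[of t a v] by eventually_elim simp
    then show "kernel_integral a v t \<in> past_space M Y S t"
      by (rule closed_subspace_cong_AE[OF sub kernel_int_in_past_space[OF v] L2_measurable[OF past_integral_kernel(1)]])
  qed
  have D_in: "D S \<in> past_space M Y S t"
    unfolding D_def[abs_def]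
  proof (intro closed_subspace_sum[OF sub] closed_subspace_mult[OF sub])
    fix v m assume v: "v \<in> S" and "m \<in> {0..p - q - 1}"
    then have m: "m \<le> p - q - 1" by simp
    have "AE \<omega> in M. complex_of_real (y m v t \<omega>) = msD M m (component Y v) t \<omega>"
      using conjunct2[OF msD_component[OF m, of v t]] by eventually_elim simp
    then show "msD M m (component Y v) t \<in> past_space M Y S t"
      by (rule closed_subspace_cong_AE[OF sub y_in_past_space[OF m v] L2_measurable[OF msD_component_L2[OF m]]])
  qed
  have "AE \<omega> in M. \<forall>v\<in>UNIV. kernel_integral a v t \<omega> = complex_of_real (kernel_int a v t \<omega>)"
    by (intro AE_finite_allI past_integral_kernel(2)) auto
  moreover have "AE \<omega> in M. \<forall>v\<in>UNIV. \<forall>m\<in>{0..p - q - 1}. msD M m (component Y v) t \<omega> = complex_of_real (y m v t \<omega>)"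
    using msD_component by (intro AE_finite_allI) auto
  ultimately have decomp: "AE \<omega> in M. complex_of_real (drift a t \<omega>) = K S \<omega> + D S \<omega> + K (UNIV - S) \<omega> + D (UNIV - S) \<omega>"
    using rowA_X_expansion[of t a]
  proof eventually_elim
    case (elim \<omega>)
    have drift: "drift a t \<omega> = (\<Sum>l=1..p. rowA l *v X t l \<omega>) $ a"
      by (simp add: drift_def matrix_vector_mult_def)
    have "complex_of_real (drift a t \<omega>) = K UNIV \<omega> + D UNIV \<omega>"
      unfolding drift elim(3) using elim(1,2) by (simp add: K_def D_def)
    moreover have "K UNIV \<omega> = K (UNIV - S) \<omega> + K S \<omega>" "D UNIV \<omega> = D (UNIV - S) \<omega> + D S \<omega>"
      unfolding K_def D_def by (intro sum.subset_diff; simp)+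
    ultimately show ?case by simp
  qed
  let ?P = "orth_proj M (past_space M Y S t)"
  have "AE \<omega> in M. ?P (\<lambda>\<omega>. complex_of_real (drift a t \<omega>)) \<omega> = K S \<omega> + D S \<omega> + ?P (K (UNIV - S)) \<omega> + ?P (D (UNIV - S)) \<omega>"
  proof (rule orth_proj_unique[OF sub L2_of_real[OF drift_L2]])
    show "(\<lambda>\<omega>. K S \<omega> + D S \<omega> + ?P (K (UNIV - S)) \<omega> + ?P (D (UNIV - S)) \<omega>) \<in> past_space M Y S t"
      by (intro closed_subspace_add[OF sub] K_in D_in orth_proj_in[OF sub] K_L2 D_L2)
    fix U assume U: "U \<in> past_space M Y S t"
    then have UL: "U \<in> L2 M" by (rule closed_subspace_L2[OF sub])
    have P_L2: "?P (K (UNIV - S)) \<in> L2 M" "?P (D (UNIV - S)) \<in> L2 M"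
      by (intro closed_subspace_L2[OF sub] orth_proj_in[OF sub] K_L2 D_L2)+
    have PK: "l2inner M (?P (K (UNIV - S))) U = l2inner M (K (UNIV - S)) U"
      using orth_proj_orthogonal[OF sub K_L2 U, of "UNIV - S"] l2inner_diff_left[OF K_L2 P_L2(1) UL] by simp
    have PD: "l2inner M (?P (D (UNIV - S))) U = l2inner M (D (UNIV - S)) U"
      using orth_proj_orthogonal[OF sub D_L2 U, of "UNIV - S"] l2inner_diff_left[OF D_L2 P_L2(2) UL] by simp
    have "l2inner M (\<lambda>\<omega>. complex_of_real (drift a t \<omega>)) U = l2inner M (\<lambda>\<omega>. K S \<omega> + D S \<omega> + K (UNIV - S) \<omega> + D (UNIV - S) \<omega>) U"
      by (intro l2inner_cong_AE L2_measurable L2_add K_L2 D_L2 UL L2_of_real drift_L2 decomp)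
    also have "\<dots> = l2inner M (\<lambda>\<omega>. K S \<omega> + D S \<omega> + ?P (K (UNIV - S)) \<omega> + ?P (D (UNIV - S)) \<omega>) U"
      by (simp only: l2inner_add_left L2_add K_L2 D_L2 UL P_L2 PK PD)
    finally show "l2inner M (\<lambda>\<omega>. complex_of_real (drift a t \<omega>)) U = l2inner M (\<lambda>\<omega>. K S \<omega> + D S \<omega> + ?P (K (UNIV - S)) \<omega> + ?P (D (UNIV - S)) \<omega>) U" .
  qed
  then show ?thesis unfolding K_def[abs_def] D_def[abs_def] .
qed

text \<open>The transition formula already splits the derivative at t + h into an element
  \<open>W\<close> of the past space and a noise orthogonal to it; such a splitting determines the
  projection.\<close>

lemma msD_prediction_error:
  assumes h: "h \<ge> 0"
  shows "AE \<omega> in M. msD M (p - q - 1) (component Y a) (t + h) \<omega>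
      - orth_proj M (past_space M Y UNIV t) (msD M (p - q - 1) (component Y a) (t + h)) \<omega>
    = complex_of_real (eta M L p q A C t h \<omega> $ a)"
proof -
  note sub = closed_subspace_past_space[of M Y UNIV t]
  let ?Z = "msD M (p - q - 1) (component Y a) (t + h)"
  define W where "W \<omega> = (\<Sum>l=1..p. \<Sum>b\<in>UNIV. complex_of_real (rowE h l $ a $ b) * complex_of_real (X t l \<omega> $ b))" for \<omega>
  define \<eta> where "\<eta> \<omega> = complex_of_real (eta M L p q A C t h \<omega> $ a)" for \<omega>
  have Z_L2: "?Z \<in> L2 M" by (rule msD_component_L2) simp
  have W_in: "W \<in> past_space M Y UNIV t"
    unfolding W_def[abs_def] by (intro closed_subspace_sum[OF sub] closed_subspace_mult[OF sub] X_in_past_space)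
  then have W_L2: "W \<in> L2 M" by (rule closed_subspace_L2[OF sub])
  have \<eta>_L2: "\<eta> \<in> L2 M" unfolding \<eta>_def[abs_def] by (rule L2_of_real[OF eta_L2[OF h]])
  have "AE \<omega> in M. ?Z \<omega> = complex_of_real (y (p - q - 1) a (t + h) \<omega>)"
    using msD_component[of "p - q - 1" a "t + h"] by simp
  then have Z: "AE \<omega> in M. ?Z \<omega> = W \<omega> + \<eta> \<omega>"
    using y_top_transition[OF h, of a t] by eventually_elim (simp add: W_def \<eta>_def)
  have "AE \<omega> in M. orth_proj M (past_space M Y UNIV t) ?Z \<omega> = W \<omega>"
  proof (rule orth_proj_unique[OF sub Z_L2 W_in])
    fix U assume U: "U \<in> past_space M Y UNIV t"
    then have UL: "U \<in> L2 M" by (rule closed_subspace_L2[OF sub])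
    have "l2inner M ?Z U = l2inner M (\<lambda>\<omega>. W \<omega> + \<eta> \<omega>) U"
      by (intro l2inner_cong_AE L2_measurable L2_add W_L2 \<eta>_L2 UL Z_L2 Z)
    also have "\<dots> = l2inner M W U + l2inner M U \<eta>"
      by (simp only: l2inner_add_left[OF W_L2 \<eta>_L2 UL] l2inner_commute[of M \<eta> U])
    finally show "l2inner M ?Z U = l2inner M W U"
      using eta_orthogonal[OF h U, of a] by (simp add: \<eta>_def[abs_def])
  qed
  with Z show ?thesis by eventually_elim (simp add: \<eta>_def)
qed

end

theorem theorem3p10:
  fixes M :: "'w measure"
    and L :: "real \<Rightarrow> 'w \<Rightarrow> real^'k"
    and p q :: nat
    and A C :: "nat \<Rightarrow> real^'k^'k"
    and X :: "real \<Rightarrow> nat \<Rightarrow> 'w \<Rightarrow> real^'k"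
    and Y :: "real \<Rightarrow> 'w \<Rightarrow> real^'k"
    and S :: "'k set" and a :: 'k and t :: real
  assumes pq: "p > q" "q > 0"
    and levy: "two_sided_levy M L"
    and L1_square: "integrable M (\<lambda>\<omega>. (norm (L 1 \<omega>))\<^sup>2)"
    and L1_mean: "(LINT \<omega>|M. L 1 \<omega>) = 0"
    and coprime: "right_coprime (P_poly p A) (Q_poly q C)"
    and rank_Cq: "rank (C q) = CARD('k)"
    and zeros_P: "\<And>z. det (P_poly p A z) = 0 \<Longrightarrow> Re z < 0"
    and zeros_Q: "\<And>z. det (Q_poly q C z) = 0 \<Longrightarrow> Re z < 0"
    and X: "input_process M L p A X"
    and Y: "Y = output_process p q C X"
  shows
    "ms_lim M (at_right 0)
       (\<lambda>h. orth_proj M (past_space M Y S t)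
          (\<lambda>\<omega>. (msD M (p - q - 1) (component Y a) (t + h) \<omega>
                  - msD M (p - q - 1) (component Y a) t \<omega>) / complex_of_real h))
       (\<lambda>\<omega>.
          (\<Sum>v\<in>S. past_integral M
             (\<lambda>u \<omega>. complex_of_real (kernel_coeff p q A C (t - u) $ a $ v) * component Y v u \<omega>) t \<omega>)
        + (\<Sum>v\<in>S. \<Sum>m=0..p - q - 1.
             complex_of_real (deriv_coeff p q A C m $ a $ v) * msD M m (component Y v) t \<omega>)
        + orth_proj M (past_space M Y S t)
            (\<lambda>\<omega>. \<Sum>v\<in>UNIV - S. past_integral M
               (\<lambda>u \<omega>. complex_of_real (kernel_coeff p q A C (t - u) $ a $ v) * component Y v u \<omega>) t \<omega>) \<omega>
        + orth_proj M (past_space M Y S t)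
            (\<lambda>\<omega>. \<Sum>v\<in>UNIV - S. \<Sum>m=0..p - q - 1.
               complex_of_real (deriv_coeff p q A C m $ a $ v) * msD M m (component Y v) t \<omega>) \<omega>)
     \<and> (\<forall>h\<ge>0. AE \<omega> in M.
          msD M (p - q - 1) (component Y a) (t + h) \<omega>
            - orth_proj M (past_space M Y UNIV t) (msD M (p - q - 1) (component Y a) (t + h)) \<omega>
          = complex_of_real (eta M L p q A C t h \<omega> $ a))"
proof -
  interpret prob_space M using levy by (simp add: two_sided_levy_def)
  interpret iccss M L p q A C X
    by unfold_locales fact+
  note in_L2 = closed_subspace_L2[OF closed_subspace_past_space orth_proj_in[OF closed_subspace_past_space]]
  show ?thesis
    unfolding Y
  proof (intro conjI allI impI msD_prediction_error)
    show "ms_lim M (at_right 0)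
       (\<lambda>h. orth_proj M (past_space M (output_process p q C X) S t) (msD_quotient a t h))
       (\<lambda>\<omega>. (\<Sum>v\<in>S. kernel_integral a v t \<omega>)
        + (\<Sum>v\<in>S. \<Sum>m=0..p - q - 1.
             complex_of_real (deriv_coeff p q A C m $ a $ v) * msD M m (component (output_process p q C X) v) t \<omega>)
        + orth_proj M (past_space M (output_process p q C X) S t)
            (\<lambda>\<omega>. \<Sum>v\<in>UNIV - S. kernel_integral a v t \<omega>) \<omega>
        + orth_proj M (past_space M (output_process p q C X) S t)
            (\<lambda>\<omega>. \<Sum>v\<in>UNIV - S. \<Sum>m=0..p - q - 1.
               complex_of_real (deriv_coeff p q A C m $ a $ v) * msD M m (component (output_process p q C X) v) t \<omega>) \<omega>)"
    \<comment> \<open>The limit is first obtained as the projection of the drift; the stated sum is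
      an almost surely equal version of it.\<close>
    proof (rule ms_lim_cong_AE[OF orth_proj_msD_quotient_limit _ _ orth_proj_drift])
      let ?S = "past_space M (output_process p q C X) S t"
      show "\<forall>\<^sub>F h in at_right 0. orth_proj M ?S (msD_quotient a t h) \<in> borel_measurable M
          \<and> (AE \<omega> in M. orth_proj M ?S (msD_quotient a t h) \<omega> = orth_proj M ?S (msD_quotient a t h) \<omega>)"
        by (intro always_eventually allI conjI L2_measurable in_L2 msD_quotient_L2) simp
    qed (intro L2_measurable L2_add L2_sum L2_mult_left in_L2 past_integral_kernel(1) msD_component_L2; simp)
  qed
qed

end
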